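(* Let $k$ be a field of characteristic zero, let $q$ be a nondegenerate quadratic form over $k$ of rank $n\geq 2$, and let $G=\mathrm{O}(q)$ be the orthogonal group of $q$. Let $V$ be a finite-dimensional $k$-vector space with an almost free linear $G$-action. Then the field $k(V)^G$ is stably pure over $k$.
   Context: Let $\bar k$ be an algebraic closure of $k$. For a linear algebraic $k$-group $G$ acting on a geometrically integral $k$-variety $X$, $k(X)^G$ denotes the subfield of $\bar k(X)^{G(\bar k)}$ fixed by $\mathrm{Gal}(\bar k/k)$. The action is almost free if there is a non-empty open set $U\subset X$ such that for every $x\in U(\bar k)$ the stabilizer $G_x\subset G(\bar k)$ is trivial. A field $K/k$ is stably pure over $k$ if $K(x_1,\dots,x_r)$ is purely transcendental over $k$ for some independent variables $x_1,\dots,x_r$. *)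

theory Defs
  imports
    "HOL-Algebra.Algebraic_Closure_Type"
    "HOL-Algebra.Generated_Fields"
    "HOL-Algebra.Group_Action"
    "HOL-Library.Poly_Mapping"
    "Jordan_Normal_Form.Determinant"
begin

section \<open>Polynomials and rational functions\<close>

text \<open>
  A polynomial in variables of type \<open>'v\<close> is a finitely supported map from monomials
  \<open>'v \<Rightarrow>\<^sub>0 nat\<close> to coefficients.
\<close>

type_synonym ('v, 'a) mpol = "('v \<Rightarrow>\<^sub>0 nat) \<Rightarrow>\<^sub>0 'a"

definition mpol_const :: "'a::zero \<Rightarrow> ('v, 'a) mpol" where
  "mpol_const c = Poly_Mapping.single 0 c"

definition mpol_var :: "'v \<Rightarrow> ('v, 'a::zero_neq_one) mpol" where
  "mpol_var v = Poly_Mapping.single (Poly_Mapping.single v 1) 1"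

definition mpol_vars :: "('v, 'a::zero) mpol \<Rightarrow> 'v set" where
  "mpol_vars p = (\<Union>t\<in>Poly_Mapping.keys p. Poly_Mapping.keys t)"

text \<open>Evaluation at \<open>x\<close>, with the coefficients transported along \<open>h\<close>.\<close>

definition mpol_eval :: "('a::zero \<Rightarrow> 'b::comm_semiring_1) \<Rightarrow> ('v \<Rightarrow> 'b) \<Rightarrow> ('v, 'a) mpol \<Rightarrow> 'b" where
  "mpol_eval h x p =
     (\<Sum>t\<in>Poly_Mapping.keys p. h (Poly_Mapping.lookup p t) *
        (\<Prod>v\<in>Poly_Mapping.keys t. x v ^ Poly_Mapping.lookup t v))"

text \<open>
  Rational functions in the variables \<open>x\<^sub>0, x\<^sub>1, \<dots>\<close>; fields of rational functions in finitely
  many variables are subfields of this field.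
\<close>

type_synonym 'a ratfun = "(nat, 'a) mpol fract"

definition rf_const :: "'a::field \<Rightarrow> 'a ratfun" where
  "rf_const c = Fraction_Field.Fract (mpol_const c) 1"

definition rf_var :: "nat \<Rightarrow> 'a::field ratfun" where
  "rf_var i = Fraction_Field.Fract (mpol_var i) 1"

text \<open>
  The map on fractions induced by an injective ring endomorphism \<open>\<phi>\<close>. The description determines
  a unique value for such \<open>\<phi>\<close>, by the lemma below.
\<close>

definition fract_map :: "('a::idom \<Rightarrow> 'a) \<Rightarrow> 'a fract \<Rightarrow> 'a fract" where
  "fract_map \<phi> f =
     (THE h. \<forall>a b. b \<noteq> 0 \<longrightarrow> f = Fraction_Field.Fract a b \<longrightarrow>
        h = Fraction_Field.Fract (\<phi> a) (\<phi> b))"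

lemma fract_map_Fract:
  assumes mult: "\<And>a b. \<phi> (a * b) = \<phi> a * \<phi> b"
    and inj: "\<And>a. \<phi> a = 0 \<Longrightarrow> a = 0"
    and b: "b \<noteq> 0"
  shows "fract_map \<phi> (Fraction_Field.Fract a b) = Fraction_Field.Fract (\<phi> a) (\<phi> b)"
  unfolding fract_map_def
proof (rule the_equality)
  show "\<forall>a' b'. b' \<noteq> 0 \<longrightarrow> Fraction_Field.Fract a b = Fraction_Field.Fract a' b' \<longrightarrow>
    Fraction_Field.Fract (\<phi> a) (\<phi> b) = Fraction_Field.Fract (\<phi> a') (\<phi> b')"
  proof (intro allI impI)
    fix a' b'
    assume b': "b' \<noteq> 0" and "Fraction_Field.Fract a b = Fraction_Field.Fract a' b'"
    hence "a * b' = a' * b" using b by (simp add: Fraction_Field.eq_fract)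
    hence "\<phi> a * \<phi> b' = \<phi> a' * \<phi> b" by (metis mult)
    moreover have "\<phi> b \<noteq> 0" "\<phi> b' \<noteq> 0" using inj b b' by blast+
    ultimately show "Fraction_Field.Fract (\<phi> a) (\<phi> b) = Fraction_Field.Fract (\<phi> a') (\<phi> b')"
      by (simp add: Fraction_Field.eq_fract)
  qed
qed (use b in blast)

section \<open>Stably pure extensions\<close>

definition gen_subfield :: "'a::field set \<Rightarrow> 'a set" where
  "gen_subfield S = generate_field ring_of_type_algebra S"

text \<open>Algebraic independence of the elements of \<open>B\<close>: the elements themselves name the variables.\<close>

definition alg_independent :: "'a::field set \<Rightarrow> 'a set \<Rightarrow> bool" where
  "alg_independent k B \<longleftrightarrow>
     (\<forall>p :: ('a, 'a) mpol. Poly_Mapping.range p \<subseteq> k \<longrightarrow> mpol_vars p \<subseteq> B \<longrightarrow>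
        mpol_eval (\<lambda>c. c) (\<lambda>b. b) p = 0 \<longrightarrow> p = 0)"

definition purely_transcendental :: "'a::field set \<Rightarrow> 'a set \<Rightarrow> bool" where
  "purely_transcendental k E \<longleftrightarrow> (\<exists>B. alg_independent k B \<and> E = gen_subfield (k \<union> B))"

text \<open>
  For subfields \<open>k \<subseteq> K\<close> of \<open>'a\<close>, the field \<open>K(x\<^sub>0, \<dots>, x\<^sub>r\<^sub>-\<^sub>1)\<close> is formed inside \<open>'a(x\<^sub>0, x\<^sub>1, \<dots>)\<close>.
\<close>

definition stably_pure :: "'a::field set \<Rightarrow> 'a set \<Rightarrow> bool" where
  "stably_pure k K \<longleftrightarrow>
     (\<exists>r. purely_transcendental (rf_const ` k) (gen_subfield (rf_const ` K \<union> rf_var ` {..<r})))"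

section \<open>Quadratic forms and orthogonal groups\<close>

definition polar_form :: "('a::field vec \<Rightarrow> 'a) \<Rightarrow> 'a vec \<Rightarrow> 'a vec \<Rightarrow> 'a" where
  "polar_form q v w = q (v + w) - q v - q w"

definition quadratic_form :: "nat \<Rightarrow> ('a::field vec \<Rightarrow> 'a) \<Rightarrow> bool" where
  "quadratic_form n q \<longleftrightarrow>
     (\<forall>c. \<forall>v\<in>carrier_vec n. q (c \<cdot>\<^sub>v v) = c\<^sup>2 * q v) \<and>
     (\<forall>u\<in>carrier_vec n. \<forall>v\<in>carrier_vec n. \<forall>w\<in>carrier_vec n.
        polar_form q (u + v) w = polar_form q u w + polar_form q v w) \<and>
     (\<forall>c. \<forall>v\<in>carrier_vec n. \<forall>w\<in>carrier_vec n.
        polar_form q (c \<cdot>\<^sub>v v) w = c * polar_form q v w)"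

definition nondegenerate_form :: "nat \<Rightarrow> ('a::field vec \<Rightarrow> 'a) \<Rightarrow> bool" where
  "nondegenerate_form n q \<longleftrightarrow>
     (\<forall>v\<in>carrier_vec n. (\<forall>w\<in>carrier_vec n. polar_form q v w = 0) \<longrightarrow> v = 0\<^sub>v n)"

text \<open>
  The extension of a quadratic form on \<open>k\<^sup>n\<close> to the algebraic closure of \<open>k\<close>, obtained by writing
  the form as a homogeneous polynomial of degree 2 in the coordinates.
\<close>

definition form_closure :: "nat \<Rightarrow> ('k::field vec \<Rightarrow> 'k) \<Rightarrow> 'k alg_closure vec \<Rightarrow> 'k alg_closure" where
  "form_closure n q v =
     (\<Sum>i<n. to_ac (q (unit_vec n i)) * (v $ i)\<^sup>2) +
     (\<Sum>j<n. \<Sum>i<j. to_ac (polar_form q (unit_vec n i) (unit_vec n j)) * v $ i * v $ j)"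

text \<open>
  In characteristic 0 algebraic groups are smooth, and a linear algebraic \<open>k\<close>-group is handled
  through its group of points over the algebraic closure of \<open>k\<close>, a closed subgroup of some
  \<open>GL\<^sub>n\<close> defined over \<open>k\<close>.
\<close>

definition GL :: "nat \<Rightarrow> 'a::comm_ring_1 mat monoid" where
  "GL n = units_of (ring_mat TYPE('a) n ())"

definition orthogonal_group :: "nat \<Rightarrow> ('k::field vec \<Rightarrow> 'k) \<Rightarrow> 'k alg_closure mat monoid" where
  "orthogonal_group n q =
     (GL n)\<lparr>carrier := {A \<in> carrier (GL n).
        \<forall>v\<in>carrier_vec n. form_closure n q (A *\<^sub>v v) = form_closure n q v}\<rparr>"

section \<open>Linear actions\<close>

text \<open>
  A linear action over \<open>k\<close> of \<open>G \<subseteq> GL\<^sub>n\<close> on \<open>V = k\<^sup>m\<close> is a homomorphism of algebraic groups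
  \<open>G \<rightarrow> GL\<^sub>m\<close> defined over \<open>k\<close>. The regular functions over \<open>k\<close> on a closed subgroup of \<open>GL\<^sub>n\<close> are
  the restrictions of elements of \<open>k[x\<^sub>i\<^sub>j, 1/det]\<close>.
\<close>

definition regular_on :: "'k::field alg_closure mat monoid \<Rightarrow> nat \<Rightarrow> ('k alg_closure mat \<Rightarrow> 'k alg_closure) \<Rightarrow> bool" where
  "regular_on G n \<phi> \<longleftrightarrow>
     (\<exists>(p :: (nat \<times> nat, 'k) mpol) N. mpol_vars p \<subseteq> {..<n} \<times> {..<n} \<and>
        (\<forall>g\<in>carrier G. \<phi> g = mpol_eval to_ac (\<lambda>ij. g $$ ij) p / det g ^ N))"

definition linear_action ::
    "'k::field alg_closure mat monoid \<Rightarrow> nat \<Rightarrow> nat \<Rightarrow> ('k alg_closure mat \<Rightarrow> 'k alg_closure mat) \<Rightarrow> bool" where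
  "linear_action G n m \<rho> \<longleftrightarrow>
     \<rho> \<in> hom G (GL m) \<and> (\<forall>i<m. \<forall>j<m. regular_on G n (\<lambda>g. \<rho> g $$ (i, j)))"

text \<open>The points over the algebraic closure of an open \<open>k\<close>-subvariety of \<open>k\<^sup>m\<close>.\<close>

definition k_open :: "nat \<Rightarrow> 'k::field alg_closure vec set \<Rightarrow> bool" where
  "k_open m U \<longleftrightarrow>
     (\<exists>S :: (nat, 'k) mpol set. (\<forall>p\<in>S. mpol_vars p \<subseteq> {..<m}) \<and>
        U = {x \<in> carrier_vec m. \<exists>p\<in>S. mpol_eval to_ac (\<lambda>i. x $ i) p \<noteq> 0})"

definition almost_free ::
    "'k::field alg_closure mat monoid \<Rightarrow> nat \<Rightarrow> ('k alg_closure mat \<Rightarrow> 'k alg_closure mat) \<Rightarrow> bool" where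
  "almost_free G m \<rho> \<longleftrightarrow>
     (\<exists>U. k_open m U \<and> U \<noteq> {} \<and> (\<forall>x\<in>U. stabilizer G (\<lambda>g v. \<rho> g *\<^sub>v v) x = {\<one>\<^bsub>G\<^esub>}))"

section \<open>Fields of invariants\<close>

definition function_field :: "nat \<Rightarrow> 'a::field ratfun set" where
  "function_field m = gen_subfield (range rf_const \<union> rf_var ` {..<m})"

text \<open>
  Substitution \<open>p(x) \<mapsto> p(A x)\<close> in the first \<open>m\<close> variables. The remaining variables, which do not
  occur in elements of the function field of \<open>k\<^sup>m\<close>, are fixed, so that the substitution is injective
  on all polynomials when \<open>A\<close> is invertible.
\<close>

definition mpol_linear_subst :: "nat \<Rightarrow> 'a::comm_ring_1 mat \<Rightarrow> (nat, 'a) mpol \<Rightarrow> (nat, 'a) mpol" where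
  "mpol_linear_subst m A =
     mpol_eval mpol_const
       (\<lambda>i. if i < m then \<Sum>j<m. mpol_const (A $$ (i, j)) * mpol_var j else mpol_var i)"

text \<open>The action \<open>(g \<cdot> f)(x) = f(g\<^sup>-\<^sup>1 x)\<close> on rational functions.\<close>

definition ratfun_act ::
    "'a::field mat monoid \<Rightarrow> nat \<Rightarrow> ('a mat \<Rightarrow> 'a mat) \<Rightarrow> 'a mat \<Rightarrow> 'a ratfun \<Rightarrow> 'a ratfun" where
  "ratfun_act G m \<rho> g = fract_map (mpol_linear_subst m (\<rho> (inv\<^bsub>G\<^esub> g)))"

definition absolute_galois :: "('k::field alg_closure \<Rightarrow> 'k alg_closure) set" where
  "absolute_galois =
     {\<sigma>. bij \<sigma> \<and> (\<forall>x y. \<sigma> (x + y) = \<sigma> x + \<sigma> y) \<and> (\<forall>x y. \<sigma> (x * y) = \<sigma> x * \<sigma> y) \<and>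
         (\<forall>c. \<sigma> (to_ac c) = to_ac c)}"

definition galois_act :: "('a::field \<Rightarrow> 'a) \<Rightarrow> 'a ratfun \<Rightarrow> 'a ratfun" where
  "galois_act \<sigma> = fract_map (Poly_Mapping.map \<sigma>)"

definition geom_invariant_field ::
    "'a::field mat monoid \<Rightarrow> nat \<Rightarrow> ('a mat \<Rightarrow> 'a mat) \<Rightarrow> 'a ratfun set" where
  "geom_invariant_field G m \<rho> =
     {f \<in> function_field m. \<forall>g\<in>carrier G. ratfun_act G m \<rho> g f = f}"

definition invariant_field ::
    "'k::field alg_closure mat monoid \<Rightarrow> nat \<Rightarrow> ('k alg_closure mat \<Rightarrow> 'k alg_closure mat) \<Rightarrow>
     'k alg_closure ratfun set" where
  "invariant_field G m \<rho> =
     {f \<in> geom_invariant_field G m \<rho>. \<forall>\<sigma>\<in>absolute_galois. galois_act \<sigma> f = f}"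

text \<open>The copy of \<open>k\<close> inside the field of rational functions over its algebraic closure.\<close>

definition base_field :: "'k::field alg_closure ratfun set" where
  "base_field = range (\<lambda>c. rf_const (to_ac c))"

end

theory Submission
  imports
    Defs
    "Jordan_Normal_Form.Char_Poly"
begin

text \<open>
  The theorem is a double application of the no-name lemma to the \<open>G\<close>-variety \<open>V \<times> M\<^sub>n\<close>, where
  \<open>G = O(q)\<close> acts on the \<open>n \<times> n\<close> matrices by left multiplication. Write \<open>x\<close> for the generic vector
  of \<open>V\<close>, \<open>w\<close> for the generic matrix, and \<open>Q\<close> for the Gram matrix of \<open>q\<close>.

  Over \<open>M\<^sub>n\<close>: two invertible matrices have the same Gram matrix \<open>s = w\<^sup>T Q w\<close> precisely if they lie
  in one orbit, so \<open>k(M\<^sub>n)\<^sup>G = k(s)\<close>, and \<open>V \<times> M\<^sub>n\<close> is an equivariant vector bundle over \<open>M\<^sub>n\<close>.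
  It is trivialized by \<open>m\<close> invariants \<open>z\<^sub>1, \<dots>, z\<^sub>m\<close> that are linear in \<open>x\<close>, and therefore
  \<open>k(V \<times> M\<^sub>n)\<^sup>G = k(s, z)\<close>, with the entries \<open>s\<^sub>i\<^sub>j\<close>, \<open>i \<le> j\<close>, and the \<open>z\<^sub>r\<close> algebraically
  independent. The forms \<open>z\<^sub>r\<close> are written down without Galois cohomology. The Gram-Schmidt process
  turns \<open>w\<close> into a matrix \<open>u\<close> with orthogonal columns, and if \<open>\<tau>\<^sub>j\<close> is a square root of a
  suitable scalar, then rescaling the columns of \<open>u\<close> by the \<open>\<tau>\<^sub>j\<close>, followed by a change of basis
  over \<open>k\<close>, gives an element \<open>g\<close> of \<open>G\<close>
  that depends equivariantly on \<open>w\<close>. The rows of \<open>\<rho>(g\<^sup>-\<^sup>1)\<close> would trivialize the bundle,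
  but they contain square roots. Sorting their entries by the sign character of \<open>{\<plusminus>1}\<^sup>n\<close> acting on
  \<open>\<tau>\<close> removes the roots and keeps the equivariance; this is \<open>equivariant_rows\<close>.

  Over \<open>V\<close>: as the action on \<open>V\<close> is almost free, \<open>w\<close> is rational over \<open>k\<^sup>a(V)\<close> and the invariants,
  where \<open>k\<^sup>a\<close> is the algebraic closure of \<open>k\<close>
  (\<open>frame_generated\<close>). Clearing denominators by a fixed element (\<open>common_fixed_denominator\<close>)
  produces an invertible matrix \<open>F\<close> over \<open>k\<^sup>a(V)\<close> that is fixed by Galois and
  satisfies \<open>F(g x) = g F(x)\<close> for \<open>g\<close> in \<open>G\<close> (\<open>equivariant_frame\<close>). Hence
  \<open>y = F\<^sup>-\<^sup>1 w\<close> consists of \<open>n\<^sup>2\<close> invariants, and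
  \<open>k(V \<times> M\<^sub>n)\<^sup>G = k(V)\<^sup>G(y)\<close>. Comparison of the two descriptions shows that \<open>k(V)\<^sup>G\<close> becomes purely
  transcendental after \<open>n\<^sup>2\<close> variables are adjoined.

  Two general tools replace geometry. Statements about generic points and orbits become statements
  about specializations, that is, homomorphisms from a finitely generated subring to the algebraic
  closure: in characteristic zero an element outside the field generated by some
  functions takes two values at points where those functions agree (\<open>separating_specializations\<close>).
  The passage from the algebraic closure to \<open>k\<close> is Artin's argument with a shortest linear
  combination, applied to Galois and \<open>G\<close> at the same time (\<open>fixed_field_descent\<close>).
\<close>

section \<open>Subrings of a field and their homomorphisms\<close>

definition subring_set :: "'a::comm_ring_1 set \<Rightarrow> bool" where
  "subring_set A \<longleftrightarrow> 1 \<in> A \<and> (\<forall>x\<in>A. \<forall>y\<in>A. x - y \<in> A \<and> x * y \<in> A)"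

lemma subring_setD:
  assumes "subring_set A"
  shows subring_one: "1 \<in> A" and subring_zero: "0 \<in> A"
    and subring_minus: "x \<in> A \<Longrightarrow> - x \<in> A"
    and subring_diff: "x \<in> A \<Longrightarrow> y \<in> A \<Longrightarrow> x - y \<in> A"
    and subring_add: "x \<in> A \<Longrightarrow> y \<in> A \<Longrightarrow> x + y \<in> A"
    and subring_mult: "x \<in> A \<Longrightarrow> y \<in> A \<Longrightarrow> x * y \<in> A"
proof -
  have d: "x - y \<in> A" if "x \<in> A" "y \<in> A" for x y
    using assms that by (auto simp: subring_set_def)
  show o: "1 \<in> A" using assms by (auto simp: subring_set_def)
  show z: "0 \<in> A" using d[OF o o] by simp
  have m: "- x \<in> A" if "x \<in> A" for x using d[OF z that] by simp
  show "x \<in> A \<Longrightarrow> - x \<in> A" by (rule m)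
  show "x \<in> A \<Longrightarrow> y \<in> A \<Longrightarrow> x - y \<in> A" by (rule d)
  show "x \<in> A \<Longrightarrow> y \<in> A \<Longrightarrow> x + y \<in> A" using d[of x "- y"] m[of y] by simp
  show "x \<in> A \<Longrightarrow> y \<in> A \<Longrightarrow> x * y \<in> A" using assms by (auto simp: subring_set_def)
qed

lemma subring_sum:
  assumes "subring_set A" "\<And>i. i \<in> I \<Longrightarrow> f i \<in> A" shows "sum f I \<in> A"
  using assms(2) by (induction I rule: infinite_finite_induct)
    (auto intro: subring_add[OF assms(1)] subring_zero[OF assms(1)])

lemma subring_prod:
  assumes "subring_set A" "\<And>i. i \<in> I \<Longrightarrow> f i \<in> A" shows "prod f I \<in> A"
  using assms(2) by (induction I rule: infinite_finite_induct)
    (auto intro: subring_mult[OF assms(1)] subring_one[OF assms(1)])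

lemma subring_power: "subring_set A \<Longrightarrow> x \<in> A \<Longrightarrow> x ^ k \<in> A"
  by (induction k) (auto intro: subring_mult subring_one)

text \<open>
  Specializations are defined only on subrings. They are total functions whose
  values outside \<open>A\<close> are irrelevant, so that restriction needs no change of function.
\<close>

definition hom_on :: "'a::comm_ring_1 set \<Rightarrow> ('a \<Rightarrow> 'b::comm_ring_1) \<Rightarrow> bool" where
  "hom_on A f \<longleftrightarrow> subring_set A \<and> f 1 = 1 \<and>
     (\<forall>x\<in>A. \<forall>y\<in>A. f (x + y) = f x + f y \<and> f (x * y) = f x * f y)"

lemma hom_on_subring: "hom_on A f \<Longrightarrow> subring_set A"
  by (simp add: hom_on_def)

lemma hom_onD:
  assumes "hom_on A f"
  shows hom_on_one: "f 1 = 1" and hom_on_zero: "f 0 = 0"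
    and hom_on_add: "x \<in> A \<Longrightarrow> y \<in> A \<Longrightarrow> f (x + y) = f x + f y"
    and hom_on_mult: "x \<in> A \<Longrightarrow> y \<in> A \<Longrightarrow> f (x * y) = f x * f y"
    and hom_on_minus: "x \<in> A \<Longrightarrow> f (- x) = - f x"
    and hom_on_diff: "x \<in> A \<Longrightarrow> y \<in> A \<Longrightarrow> f (x - y) = f x - f y"
proof -
  note s = hom_on_subring[OF assms]
  have a: "f (x + y) = f x + f y" if "x \<in> A" "y \<in> A" for x y
    using assms that by (simp add: hom_on_def)
  show "f 1 = 1" using assms by (simp add: hom_on_def)
  show z: "f 0 = 0" using a[OF subring_zero[OF s] subring_zero[OF s]] by simp
  have m: "f (- x) = - f x" if "x \<in> A" for x
    using a[OF that subring_minus[OF s that]] z by (simp add: eq_neg_iff_add_eq_0 add.commute)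
  show "x \<in> A \<Longrightarrow> y \<in> A \<Longrightarrow> f (x + y) = f x + f y" by (rule a)
  show "x \<in> A \<Longrightarrow> y \<in> A \<Longrightarrow> f (x * y) = f x * f y" using assms by (simp add: hom_on_def)
  show "x \<in> A \<Longrightarrow> f (- x) = - f x" by (rule m)
  show "x \<in> A \<Longrightarrow> y \<in> A \<Longrightarrow> f (x - y) = f x - f y"
    using a[of x "- y"] m[of y] subring_minus[OF s] by simp
qed

lemma hom_on_sum:
  assumes "hom_on A f" "\<And>i. i \<in> I \<Longrightarrow> g i \<in> A" shows "f (sum g I) = (\<Sum>i\<in>I. f (g i))"
  using assms(2)
  by (induction I rule: infinite_finite_induct)
    (auto simp: hom_on_zero[OF assms(1)] hom_on_add[OF assms(1)] subring_sum[OF hom_on_subring[OF assms(1)]])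

lemma hom_on_prod:
  assumes "hom_on A f" "\<And>i. i \<in> I \<Longrightarrow> g i \<in> A" shows "f (prod g I) = (\<Prod>i\<in>I. f (g i))"
  using assms(2)
  by (induction I rule: infinite_finite_induct)
    (auto simp: hom_on_one[OF assms(1)] hom_on_mult[OF assms(1)] subring_prod[OF hom_on_subring[OF assms(1)]])

lemma hom_on_power: "hom_on A f \<Longrightarrow> x \<in> A \<Longrightarrow> f (x ^ k) = f x ^ k"
  by (induction k) (auto simp: hom_on_one hom_on_mult subring_power hom_on_subring)

lemma hom_on_subset: "hom_on A f \<Longrightarrow> subring_set B \<Longrightarrow> B \<subseteq> A \<Longrightarrow> hom_on B f"
  unfolding hom_on_def by blast

lemma hom_on_comp:
  assumes "hom_on A f" "hom_on B g" "f ` A \<subseteq> B" shows "hom_on A (g \<circ> f)"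
  using assms unfolding hom_on_def by (auto simp: image_subset_iff)

lemma subring_UNIV: "subring_set UNIV"
  by (simp add: subring_set_def)

lemma hom_UNIV_inverse:
  fixes f :: "'a::field \<Rightarrow> 'b::field"
  assumes "hom_on UNIV f" shows "f (inverse x) = inverse (f x)"
proof (cases "x = 0")
  case False
  then have "f x * f (inverse x) = 1"
    using hom_on_mult[OF assms, of x "inverse x"] hom_on_one[OF assms] by simp
  then show ?thesis by (metis inverse_unique)
qed (simp add: hom_on_zero[OF assms])

lemma hom_UNIV_inj:
  fixes f :: "'a::field \<Rightarrow> 'b::field"
  assumes "hom_on UNIV f" shows "inj f"
proof (rule injI)
  fix x y assume e: "f x = f y"
  show "x = y"
  proof (rule ccontr)
    assume "x \<noteq> y"
    then have "f ((x - y) * inverse (x - y)) = 1" using hom_on_one[OF assms] by simp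
    moreover have "f ((x - y) * inverse (x - y)) = 0"
      using e hom_on_mult[OF assms, of "x - y" "inverse (x - y)"] hom_on_diff[OF assms, of x y] by simp
    ultimately show False by simp
  qed
qed

lemma hom_UNIV_eq_0:
  fixes f :: "'a::field \<Rightarrow> 'b::field"
  assumes "hom_on UNIV f" shows "f x = 0 \<longleftrightarrow> x = 0"
  using hom_UNIV_inj[OF assms] hom_on_zero[OF assms] by (metis injD)

inductive_set gen_ring :: "'a::comm_ring_1 set \<Rightarrow> 'a set" for S where
  gen_ring_one: "1 \<in> gen_ring S"
| gen_ring_incl: "x \<in> S \<Longrightarrow> x \<in> gen_ring S"
| gen_ring_diff: "x \<in> gen_ring S \<Longrightarrow> y \<in> gen_ring S \<Longrightarrow> x - y \<in> gen_ring S"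
| gen_ring_mult: "x \<in> gen_ring S \<Longrightarrow> y \<in> gen_ring S \<Longrightarrow> x * y \<in> gen_ring S"

lemma subring_gen_ring: "subring_set (gen_ring S)"
  by (auto simp: subring_set_def intro: gen_ring.intros)

lemma gen_ring_least:
  assumes "subring_set A" "S \<subseteq> A" shows "gen_ring S \<subseteq> A"
proof
  fix x assume "x \<in> gen_ring S" then show "x \<in> A"
    by induction (use assms in \<open>auto intro: subring_setD\<close>)
qed

lemma gen_ring_mono: "S \<subseteq> T \<Longrightarrow> gen_ring S \<subseteq> gen_ring T"
  by (rule gen_ring_least[OF subring_gen_ring]) (auto intro: gen_ring_incl)

lemma gen_ring_cong_hom:
  assumes f: "hom_on (gen_ring S) f" and g: "hom_on (gen_ring S) g"
    and e: "\<And>x. x \<in> S \<Longrightarrow> f x = g x" and "x \<in> gen_ring S"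
  shows "f x = g x"
  using assms(4)
  by induction (simp_all add: e hom_on_one[OF f] hom_on_one[OF g] hom_on_diff[OF f] hom_on_diff[OF g]
      hom_on_mult[OF f] hom_on_mult[OF g])

lemma gen_ring_image:
  assumes f: "hom_on (gen_ring S) f" and B: "subring_set B" and e: "\<And>x. x \<in> S \<Longrightarrow> f x \<in> B"
    and "x \<in> gen_ring S"
  shows "f x \<in> B"
  using assms(4)
  by induction (simp_all add: e hom_on_one[OF f] hom_on_diff[OF f]
      hom_on_mult[OF f] subring_one[OF B] subring_diff[OF B] subring_mult[OF B])

subsection \<open>Polynomials over a subring\<close>

lemma subring_of_nat: "subring_set A \<Longrightarrow> of_nat k \<in> A"
  by (induction k) (auto intro: subring_setD)

definition poly_over :: "'a::comm_ring_1 set \<Rightarrow> 'a poly \<Rightarrow> bool" where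
  "poly_over A p \<longleftrightarrow> (\<forall>i. Polynomial.coeff p i \<in> A)"

lemma poly_over_intros:
  assumes A: "subring_set A"
  shows poly_over_0: "poly_over A 0" and poly_over_1: "poly_over A 1"
    and poly_over_diff: "poly_over A p \<Longrightarrow> poly_over A q \<Longrightarrow> poly_over A (p - q)"
    and poly_over_add: "poly_over A p \<Longrightarrow> poly_over A q \<Longrightarrow> poly_over A (p + q)"
    and poly_over_mult: "poly_over A p \<Longrightarrow> poly_over A q \<Longrightarrow> poly_over A (p * q)"
    and poly_over_smult: "c \<in> A \<Longrightarrow> poly_over A p \<Longrightarrow> poly_over A (Polynomial.smult c p)"
    and poly_over_monom: "c \<in> A \<Longrightarrow> poly_over A (Polynomial.monom c k)"
    and poly_over_const: "c \<in> A \<Longrightarrow> poly_over A [:c:]"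
proof -
  note z = subring_zero[OF A] and o = subring_one[OF A]
  show c: "poly_over A [:c:]" if "c \<in> A" for c
    using that z by (simp add: poly_over_def Polynomial.coeff_pCons split: nat.split)
  show "poly_over A 0" using z by (simp add: poly_over_def)
  show "poly_over A 1" using c[OF o] by (simp add: one_pCons)
  show "poly_over A p \<Longrightarrow> poly_over A q \<Longrightarrow> poly_over A (p - q)"
    by (simp add: poly_over_def subring_diff[OF A])
  show "poly_over A p \<Longrightarrow> poly_over A q \<Longrightarrow> poly_over A (p + q)"
    by (simp add: poly_over_def subring_add[OF A])
  show "poly_over A p \<Longrightarrow> poly_over A q \<Longrightarrow> poly_over A (p * q)"
    by (simp add: poly_over_def coeff_mult subring_sum[OF A] subring_mult[OF A])
  show "c \<in> A \<Longrightarrow> poly_over A p \<Longrightarrow> poly_over A (Polynomial.smult c p)"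
    by (simp add: poly_over_def subring_mult[OF A])
  show "c \<in> A \<Longrightarrow> poly_over A (Polynomial.monom c k)"
    using z by (simp add: poly_over_def Polynomial.coeff_monom)
qed

lemma poly_over_pderiv:
  fixes p :: "'a::idom poly"
  assumes A: "subring_set A" and p: "poly_over A p" shows "poly_over A (pderiv p)"
  unfolding poly_over_def coeff_pderiv
  using p by (intro allI subring_mult[OF A] subring_of_nat[OF A]) (auto simp: poly_over_def)

lemma poly_over_sub: "poly_over A p \<Longrightarrow> A \<subseteq> B \<Longrightarrow> poly_over B p"
  by (auto simp: poly_over_def)

lemma poly_in_subring: "subring_set A \<Longrightarrow> poly_over A p \<Longrightarrow> x \<in> A \<Longrightarrow> poly p x \<in> A"
  unfolding poly_altdef by (intro subring_sum subring_mult subring_power) (auto simp: poly_over_def)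

definition adjoin :: "'a::comm_ring_1 set \<Rightarrow> 'a \<Rightarrow> 'a set" where
  "adjoin A y = {poly p y |p. poly_over A p}"

lemma adjoinI: "poly_over A p \<Longrightarrow> poly p y \<in> adjoin A y"
  by (auto simp: adjoin_def)

lemma adjoin_base: assumes "subring_set A" "a \<in> A" shows "a \<in> adjoin A y"
  using adjoinI[OF poly_over_const[OF assms], of y] by simp

lemma adjoin_gen: assumes "subring_set A" shows "y \<in> adjoin A y"
  using adjoinI[OF poly_over_monom[OF assms subring_one[OF assms], of 1], of y] by (simp add: poly_monom)

lemma subring_adjoin: assumes A: "subring_set A" shows "subring_set (adjoin A y)"
  unfolding subring_set_def
proof (intro conjI ballI)
  show "1 \<in> adjoin A y" by (rule adjoin_base[OF A subring_one[OF A]])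
  fix u v assume "u \<in> adjoin A y" "v \<in> adjoin A y"
  then obtain p q where p: "u = poly p y" "poly_over A p" and q: "v = poly q y" "poly_over A q"
    by (auto simp: adjoin_def)
  show "u - v \<in> adjoin A y" using adjoinI[OF poly_over_diff[OF A p(2) q(2)], of y] p q by simp
  show "u * v \<in> adjoin A y" using adjoinI[OF poly_over_mult[OF A p(2) q(2)], of y] p q by simp
qed

lemma gen_ring_insert: "gen_ring (insert y S) = adjoin (gen_ring S) y"
proof
  note A = subring_gen_ring[of S]
  show "gen_ring (insert y S) \<subseteq> adjoin (gen_ring S) y"
    by (rule gen_ring_least[OF subring_adjoin[OF A]])
      (auto intro: adjoin_gen[OF A] adjoin_base[OF A] gen_ring_incl)
  have "gen_ring S \<subseteq> gen_ring (insert y S)" by (rule gen_ring_mono) auto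
  then show "adjoin (gen_ring S) y \<subseteq> gen_ring (insert y S)"
    unfolding adjoin_def
    using poly_in_subring[OF subring_gen_ring _ gen_ring_incl[of y "insert y S"]] poly_over_sub by blast
qed

lemma map_poly_hom:
  assumes f: "hom_on A f" and p: "poly_over A p" and q: "poly_over A q"
  shows map_poly_hom_add: "map_poly f (p + q) = map_poly f p + map_poly f q"
    and map_poly_hom_mult: "map_poly f (p * q) = map_poly f p * map_poly f q"
proof -
  note A = hom_on_subring[OF f] and c = coeff_map_poly[of f, OF hom_on_zero[OF f]]
  have i: "Polynomial.coeff p i \<in> A" "Polynomial.coeff q i \<in> A" for i
    using p q by (auto simp: poly_over_def)
  show "map_poly f (p + q) = map_poly f p + map_poly f q"
    by (rule poly_eqI) (simp add: c hom_on_add[OF f] i)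
  show "map_poly f (p * q) = map_poly f p * map_poly f q"
    by (rule poly_eqI)
      (simp add: c coeff_mult hom_on_sum[OF f] hom_on_mult[OF f] i subring_mult[OF A])
qed

lemma map_poly_hom_pderiv:
  fixes f :: "'a::idom \<Rightarrow> 'b::idom"
  assumes f: "hom_on A f" and p: "poly_over A p"
  shows "map_poly f (pderiv p) = pderiv (map_poly f p)"
proof -
  note A = hom_on_subring[OF f] and c = coeff_map_poly[of f, OF hom_on_zero[OF f]]
  have i: "Polynomial.coeff p i \<in> A" for i using p by (auto simp: poly_over_def)
  have nat: "f (of_nat k) = of_nat k" for k
    by (induction k) (simp_all add: hom_on_one[OF f] hom_on_zero[OF f] hom_on_add[OF f]
        subring_of_nat[OF A] subring_one[OF A])
  show "map_poly f (pderiv p) = pderiv (map_poly f p)"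
  proof (rule poly_eqI)
    fix k
    have "f (of_nat (Suc k) * Polynomial.coeff p (Suc k)) = of_nat (Suc k) * f (Polynomial.coeff p (Suc k))"
      using hom_on_mult[OF f subring_of_nat[OF A, of "Suc k"] i[of "Suc k"]] nat[of "Suc k"] by simp
    then show "Polynomial.coeff (map_poly f (pderiv p)) k = Polynomial.coeff (pderiv (map_poly f p)) k"
      by (simp add: c coeff_pderiv)
  qed
qed

lemma poly_map_poly_hom:
  assumes f: "hom_on A f" and p: "poly_over A p" and x: "x \<in> A"
  shows "poly (map_poly f p) (f x) = f (poly p x)"
  using p
proof (induction p)
  case 0
  then show ?case by (simp add: hom_on_zero[OF f])
next
  case (pCons a p)
  note A = hom_on_subring[OF f]
  have a: "a \<in> A" and p: "poly_over A p"
    using pCons.prems by (auto simp: poly_over_def Polynomial.coeff_pCons split: nat.splits)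
  show ?case
    using pCons.IH[OF p] a p x
    by (simp add: Polynomial.map_poly_pCons[of f, OF hom_on_zero[OF f]] hom_on_add[OF f] hom_on_mult[OF f] poly_in_subring[OF A]
        subring_mult[OF A])
qed

text \<open>
  Long division over a subring: multiplying by the leading coefficient of the divisor at each step
  avoids division in \<open>A\<close>.
\<close>

lemma pseudo_division:
  fixes p q :: "'a::idom poly"
  assumes A: "subring_set A" and q: "poly_over A q" "q \<noteq> 0" and p: "poly_over A p"
  shows "\<exists>N h r. poly_over A h \<and> poly_over A r \<and>
    Polynomial.smult (Polynomial.lead_coeff q ^ N) p = q * h + r \<and>
    (r = 0 \<or> Polynomial.degree r < Polynomial.degree q)"
  using p
proof (induction "if p = 0 then 0 else Suc (Polynomial.degree p)" arbitrary: p rule: less_induct)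
  case (less p)
  let ?d = Polynomial.degree and ?c = "Polynomial.lead_coeff q"
  show ?case
  proof (cases "p = 0 \<or> ?d p < ?d q")
    case True
    then show ?thesis using less.prems poly_over_0[OF A]
      by (intro exI[of _ 0] exI[of _ p] conjI) auto
  next
    case False
    define t where "t = Polynomial.monom (Polynomial.lead_coeff p) (?d p - ?d q)"
    define p1 where "p1 = Polynomial.smult ?c p - t * q"
    have c: "?c \<in> A" "Polynomial.lead_coeff p \<in> A" using q less.prems by (auto simp: poly_over_def)
    have t: "poly_over A t" unfolding t_def by (rule poly_over_monom[OF A c(2)])
    have p1: "poly_over A p1" unfolding p1_def
      by (intro poly_over_intros[OF A] c q t less.prems)
    have "?d p1 \<le> ?d p" unfolding p1_def
    proof (rule degree_diff_le)
      show "?d (Polynomial.smult ?c p) \<le> ?d p" by simp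
      have "?d (t * q) \<le> ?d t + ?d q" by (rule degree_mult_le)
      also have "?d t \<le> ?d p - ?d q" unfolding t_def by (rule degree_monom_le)
      finally show "?d (t * q) \<le> ?d p" using False by simp
    qed
    moreover have "Polynomial.coeff p1 (?d p) = 0"
    proof -
      have "Polynomial.coeff (t * q) (?d p) = Polynomial.lead_coeff p * ?c"
        unfolding t_def using False by (simp add: coeff_monom_mult)
      then show ?thesis unfolding p1_def by simp
    qed
    ultimately have "p1 = 0 \<or> ?d p1 < ?d p"
      by (metis leading_coeff_0_iff le_neq_implies_less)
    then have "(if p1 = 0 then 0 else Suc (?d p1)) < (if p = 0 then 0 else Suc (?d p))"
      using False by auto
    from less.hyps[OF this p1] obtain N h r where
      h: "poly_over A h" "poly_over A r" and e: "Polynomial.smult (?c ^ N) p1 = q * h + r"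
      and r: "r = 0 \<or> ?d r < ?d q" by blast
    have "Polynomial.smult (?c ^ Suc N) p = q * (Polynomial.smult (?c ^ N) t + h) + r"
    proof -
      have "Polynomial.smult (?c ^ Suc N) p = Polynomial.smult (?c ^ N) (p1 + t * q)"
        by (simp add: p1_def mult.commute)
      then show ?thesis using e by (simp add: smult_add_right algebra_simps)
    qed
    moreover have "poly_over A (Polynomial.smult (?c ^ N) t + h)"
      by (intro poly_over_intros[OF A] subring_power[OF A] c t h)
    ultimately show ?thesis using h r by blast
  qed
qed

subsection \<open>Extending homomorphisms\<close>

text \<open>
  A polynomial of least degree. Over a subring it cannot in general be made monic, and its
  leading coefficient has to be inverted whenever one divides by it.
\<close>

definition min_poly :: "'a::comm_ring_1 set \<Rightarrow> 'a \<Rightarrow> 'a poly \<Rightarrow> bool" where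
  "min_poly A y P \<longleftrightarrow> poly_over A P \<and> P \<noteq> 0 \<and> poly P y = 0 \<and>
     (\<forall>Q. poly_over A Q \<longrightarrow> Q \<noteq> 0 \<longrightarrow> poly Q y = 0 \<longrightarrow> Polynomial.degree P \<le> Polynomial.degree Q)"

lemma min_poly_exists:
  assumes "poly_over A Q" "Q \<noteq> 0" "poly Q y = 0"
  obtains P where "min_poly A y P"
  using ex_has_least_nat[of "\<lambda>Q. poly_over A Q \<and> Q \<noteq> 0 \<and> poly Q y = 0" Q Polynomial.degree] assms
  by (auto simp: min_poly_def)

lemma min_poly_degree_pos:
  fixes P :: "'a::idom poly"
  assumes "min_poly A y P" shows "Polynomial.degree P > 0"
  using assms by (auto simp: min_poly_def intro!: Nat.gr0I elim!: degree_eq_zeroE)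

text \<open>
  An element of \<open>adjoin A y\<close> has many expressions as a polynomial in \<open>y\<close>. The hypothesis is
  exactly what makes the evaluation at \<open>x\<close> independent of the choice.
\<close>

lemma hom_extend:
  assumes f: "hom_on A f"
    and z: "\<And>Q. poly_over A Q \<Longrightarrow> poly Q y = 0 \<Longrightarrow> poly (map_poly f Q) x = 0"
  obtains g where "hom_on (adjoin A y) g" "\<And>a. a \<in> A \<Longrightarrow> g a = f a" "g y = x"
proof -
  note A = hom_on_subring[OF f]
  define g where "g = (\<lambda>u. poly (map_poly f (SOME p. poly_over A p \<and> poly p y = u)) x)"
  have g: "g (poly p y) = poly (map_poly f p) x" if p: "poly_over A p" for p
  proof -
    define q where "q = (SOME q. poly_over A q \<and> poly q y = poly p y)"
    have q: "poly_over A q \<and> poly q y = poly p y"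
      unfolding q_def by (rule someI[of _ p]) (use p in auto)
    have "poly (map_poly f (q - p)) x = 0"
      by (rule z) (use q p in \<open>auto intro: poly_over_diff[OF A]\<close>)
    moreover have "map_poly f q = map_poly f (q - p) + map_poly f p"
      using map_poly_hom_add[OF f poly_over_diff[OF A conjunct1[OF q] p] p] by simp
    ultimately show ?thesis by (simp add: g_def q_def)
  qed
  have a: "g a = f a" if "a \<in> A" for a
    using g[OF poly_over_const[OF A that]] by (simp add: Polynomial.map_poly_pCons[of f, OF hom_on_zero[OF f]])
  have "g y = x"
    using g[OF poly_over_monom[OF A subring_one[OF A], of 1]]
    by (simp add: poly_monom map_poly_monom[of f, OF hom_on_zero[OF f]] hom_on_one[OF f])
  moreover have "hom_on (adjoin A y) g" unfolding hom_on_def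
  proof (intro conjI ballI)
    show "subring_set (adjoin A y)" by (rule subring_adjoin[OF A])
    show "g 1 = 1" using a[OF subring_one[OF A]] hom_on_one[OF f] by simp
    fix u v assume "u \<in> adjoin A y" "v \<in> adjoin A y"
    then obtain p q where p: "u = poly p y" "poly_over A p" and q: "v = poly q y" "poly_over A q"
      by (auto simp: adjoin_def)
    show "g (u + v) = g u + g v"
      using g[OF poly_over_add[OF A p(2) q(2)]] g[OF p(2)] g[OF q(2)] p q
        map_poly_hom_add[OF f p(2) q(2)] by simp
    show "g (u * v) = g u * g v"
      using g[OF poly_over_mult[OF A p(2) q(2)]] g[OF p(2)] g[OF q(2)] p q
        map_poly_hom_mult[OF f p(2) q(2)] by simp
  qed
  ultimately show ?thesis using a that by blast
qed

text \<open>
  Every relation of \<open>y\<close> over \<open>A\<close> is a multiple of the minimal polynomial up to a power of its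
  leading coefficient. Once that coefficient survives under \<open>f\<close>, roots of the image of \<open>P\<close> are the
  possible values of \<open>y\<close>.
\<close>

lemma hom_extend_root:
  fixes f :: "'a::idom \<Rightarrow> 'b::idom"
  assumes f: "hom_on A f" and P: "min_poly A y P" and lc: "f (Polynomial.lead_coeff P) \<noteq> 0"
    and x: "poly (map_poly f P) x = 0"
  obtains g where "hom_on (adjoin A y) g" "\<And>a. a \<in> A \<Longrightarrow> g a = f a" "g y = x"
proof (rule hom_extend[OF f])
  note A = hom_on_subring[OF f]
  have Po: "poly_over A P" "P \<noteq> 0" "poly P y = 0" using P by (auto simp: min_poly_def)
  have lA: "Polynomial.lead_coeff P \<in> A" using Po by (auto simp: poly_over_def)
  fix Q assume Q: "poly_over A Q" "poly Q y = 0"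
  let ?c = "Polynomial.lead_coeff P"
  obtain N h r where h: "poly_over A h" "poly_over A r" and e: "Polynomial.smult (?c ^ N) Q = P * h + r"
    and r: "r = 0 \<or> Polynomial.degree r < Polynomial.degree P"
    using pseudo_division[OF A Po(1,2) Q(1)] by blast
  have "poly r y = 0" using arg_cong[OF e, of "\<lambda>p. poly p y"] Q Po by simp
  with r h P have "r = 0" by (auto simp: min_poly_def not_less[symmetric])
  then have e': "[:?c ^ N:] * Q = P * h" using e by simp
  have cN: "?c ^ N \<in> A" by (rule subring_power[OF A lA])
  have "map_poly f ([:?c ^ N:]) * map_poly f Q = map_poly f P * map_poly f h"
    using map_poly_hom_mult[OF f poly_over_const[OF A cN] Q(1)] map_poly_hom_mult[OF f Po(1) h(1)] e' by simp
  from arg_cong[OF this, of "\<lambda>p. poly p x"] have "f (?c ^ N) * poly (map_poly f Q) x = 0"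
    using x by (simp add: Polynomial.map_poly_pCons[of f, OF hom_on_zero[OF f]])
  then show "poly (map_poly f Q) x = 0" using lc hom_on_power[OF f lA, of N] by simp
qed (use that in blast)

text \<open>
  The norm of \<open>a\<close> without field theory: among the multiples of \<open>a\<close>, one represented by a polynomial
  of least degree is constant. Indeed, pseudo-division of the minimal polynomial by this polynomial has
  a remainder that represents a multiple of \<open>a\<close> in smaller degree, hence is zero, and the minimal
  polynomial would otherwise factor. Consequently \<open>a\<close> does not vanish under an extension of a homomorphism
  that does not kill \<open>a * e\<close>.
\<close>

lemma norm_multiple:
  fixes a :: "'a::idom"
  assumes A: "subring_set A" and P: "min_poly A y P" and a: "a \<in> adjoin A y" "a \<noteq> 0"
  obtains e where "e \<in> adjoin A y" "a * e \<in> A" "a * e \<noteq> 0"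
proof -
  let ?d = Polynomial.degree
  note S = subring_adjoin[OF A, of y]
  define good where "good = (\<lambda>Q. poly_over A Q \<and> poly Q y \<noteq> 0 \<and> (\<exists>e\<in>adjoin A y. poly Q y = a * e))"
  obtain Q0 where "poly_over A Q0" "poly Q0 y = a" using a by (auto simp: adjoin_def)
  then have "good Q0" unfolding good_def using a subring_one[OF S] by (intro conjI bexI[of _ 1]) auto
  then obtain Q where Q: "good Q" and least: "\<And>R. good R \<Longrightarrow> ?d Q \<le> ?d R"
    using ex_has_least_nat[of good Q0 ?d] by blast
  obtain e where e: "e \<in> adjoin A y" "poly Q y = a * e" and Qo: "poly_over A Q" "poly Q y \<noteq> 0"
    using Q by (auto simp: good_def)
  have Po: "poly_over A P" "P \<noteq> 0" "poly P y = 0"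
    and Pl: "\<And>Q. poly_over A Q \<Longrightarrow> Q \<noteq> 0 \<Longrightarrow> poly Q y = 0 \<Longrightarrow> ?d P \<le> ?d Q"
    using P by (auto simp: min_poly_def)
  \<comment> \<open>The remainder modulo \<open>P\<close> represents a multiple of \<open>a\<close> as well.\<close>
  have QP: "?d Q < ?d P"
  proof -
    obtain N h r where h: "poly_over A h" "poly_over A r"
      and er: "Polynomial.smult (Polynomial.lead_coeff P ^ N) Q = P * h + r"
      and r: "r = 0 \<or> ?d r < ?d P"
      using pseudo_division[OF A Po(1,2) Qo(1)] by blast
    have ry: "poly r y = Polynomial.lead_coeff P ^ N * poly Q y"
      using arg_cong[OF er, of "\<lambda>p. poly p y"] Po by simp
    have "poly r y \<noteq> 0" using ry Qo Po by simp
    moreover have "poly r y = a * (Polynomial.lead_coeff P ^ N * e)" using ry e by simp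
    moreover have "Polynomial.lead_coeff P ^ N * e \<in> adjoin A y"
      using Po by (intro subring_mult[OF S] subring_power[OF S] adjoin_base[OF A] e) (auto simp: poly_over_def)
    ultimately have "good r" using h by (auto simp: good_def)
    with least[of r] r Qo \<open>poly r y \<noteq> 0\<close> show ?thesis by auto
  qed
  have Q0: "Q \<noteq> 0" using Qo by auto
  obtain N h r where h: "poly_over A h" "poly_over A r"
    and er: "Polynomial.smult (Polynomial.lead_coeff Q ^ N) P = Q * h + r"
    and r: "r = 0 \<or> ?d r < ?d Q"
    using pseudo_division[OF A Qo(1) Q0 Po(1)] by blast
  have ry: "poly r y = - (poly Q y * poly h y)"
    using arg_cong[OF er, of "\<lambda>p. poly p y"] Po by (simp add: eq_neg_iff_add_eq_0 add.commute)
  \<comment> \<open>Otherwise \<open>r\<close> would contradict the minimality of \<open>Q\<close>.\<close>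
  have "poly r y = 0"
  proof (rule ccontr)
    assume n: "poly r y \<noteq> 0"
    have "poly r y = a * (- (e * poly h y))" using ry e by simp
    moreover have "- (e * poly h y) \<in> adjoin A y"
      by (intro subring_minus[OF S] subring_mult[OF S] e adjoinI h)
    ultimately have "good r" using n h unfolding good_def by metis
    with least[of r] r n show False by auto
  qed
  then have "r = 0" using Pl[OF h(2)] r QP by (meson less_trans not_less)
  have hy: "poly h y = 0" using ry \<open>poly r y = 0\<close> Qo by simp
  have eq: "Polynomial.smult (Polynomial.lead_coeff Q ^ N) P = Q * h" using er \<open>r = 0\<close> by simp
  have nz: "Polynomial.smult (Polynomial.lead_coeff Q ^ N) P \<noteq> 0" using Po Q0 by simp
  then have h0: "h \<noteq> 0" using eq by auto
  \<comment> \<open>The cofactor \<open>h\<close> kills \<open>y\<close>, so by minimality of \<open>P\<close> the factor \<open>Q\<close> is constant.\<close>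
  have "?d P = ?d Q + ?d h"
    using arg_cong[OF eq, of ?d] Q0 h0 by (simp add: Polynomial.degree_mult_eq)
  with Pl[OF h(1) h0 hy] have "?d Q = 0" by simp
  then obtain c where c: "Q = [:c:]" by (rule degree_eq_zeroE)
  then have "c \<in> A" using Qo(1) by (auto simp: poly_over_def dest: spec[of _ 0])
  with c e Qo that show ?thesis by auto
qed

lemma poly_nonroots_infinite:
  fixes p :: "'a::field_char_0 poly"
  assumes "p \<noteq> 0" "finite E" obtains x where "poly p x \<noteq> 0" "x \<notin> E"
proof -
  let ?F = "{x. poly p x = 0} \<union> E"
  have "finite ?F" using poly_roots_finite[OF assms(1)] assms(2) by simp
  moreover have "\<not> finite (UNIV :: 'a set)" by (rule infinite_UNIV_char_0)
  ultimately have "?F \<noteq> UNIV" by metis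
  then show ?thesis using that by blast
qed

lemma hom_extend_transcendental:
  fixes f :: "'a::idom \<Rightarrow> 'b::idom"
  assumes f: "hom_on A f" and t: "\<And>Q. poly_over A Q \<Longrightarrow> poly Q y = 0 \<Longrightarrow> Q = 0"
  obtains g where "hom_on (adjoin A y) g" "\<And>a. a \<in> A \<Longrightarrow> g a = f a" "g y = x"
  by (rule hom_extend[OF f, of y x]) (auto dest: t)

lemma hom_adjoin_poly:
  assumes A: "hom_on A f" and g: "hom_on (adjoin A y) g" "\<And>a. a \<in> A \<Longrightarrow> g a = f a" and p: "poly_over A p"
  shows "g (poly p y) = poly (map_poly f p) (g y)"
proof -
  have "map_poly f p = map_poly g p"
    by (rule poly_eqI) (use p g in \<open>auto simp: coeff_map_poly hom_on_zero[OF g(1)] hom_on_zero[OF A] poly_over_def\<close>)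
  moreover have "poly_over (adjoin A y) p"
    using p by (rule poly_over_sub) (auto intro: adjoin_base[OF hom_on_subring[OF A]])
  ultimately show ?thesis
    using poly_map_poly_hom[OF g(1) _ adjoin_gen[OF hom_on_subring[OF A]]] by simp
qed

text \<open>
  One step of Chevalley's extension theorem. For transcendental \<open>y\<close> the obstruction \<open>b\<close> is a leading
  coefficient, since a nonzero polynomial over an infinite field has a nonroot; for algebraic \<open>y\<close> it is
  the leading coefficient of the minimal polynomial times a norm of \<open>a\<close>.
\<close>

lemma generic_extension_one:
  fixes a y :: "'a::field"
  assumes A: "subring_set A" and a: "a \<in> adjoin A y" "a \<noteq> 0"
  obtains b where "b \<in> A" "b \<noteq> 0"
    "\<And>f :: 'a \<Rightarrow> 'b::{alg_closed_field,field_char_0}. hom_on A f \<Longrightarrow> f b \<noteq> 0 \<Longrightarrow>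
       \<exists>g. hom_on (adjoin A y) g \<and> (\<forall>x\<in>A. g x = f x) \<and> g a \<noteq> 0"
proof (cases "\<exists>Q. poly_over A Q \<and> Q \<noteq> 0 \<and> poly Q y = 0")
  case False
  then have t: "\<And>Q. poly_over A Q \<Longrightarrow> poly Q y = 0 \<Longrightarrow> Q = 0" by blast
  obtain p where p: "poly_over A p" "a = poly p y" using a by (auto simp: adjoin_def)
  have "p \<noteq> 0" using p a by auto
  show ?thesis
  proof (rule that[of "Polynomial.lead_coeff p"])
    show "Polynomial.lead_coeff p \<in> A" "Polynomial.lead_coeff p \<noteq> 0"
      using p \<open>p \<noteq> 0\<close> by (auto simp: poly_over_def)
    fix f :: "'a \<Rightarrow> 'b" assume f: "hom_on A f" and fb: "f (Polynomial.lead_coeff p) \<noteq> 0"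
    have "map_poly f p \<noteq> 0"
      using fb by (metis Polynomial.coeff_0 coeff_map_poly hom_on_zero[OF f])
    then obtain x where x: "poly (map_poly f p) x \<noteq> 0"
      using poly_nonroots_infinite[of "map_poly f p" "{}"] by blast
    obtain g where g: "hom_on (adjoin A y) g" "\<And>a. a \<in> A \<Longrightarrow> g a = f a" "g y = x"
      using hom_extend_transcendental[OF f t] by blast
    moreover have "g a \<noteq> 0" using hom_adjoin_poly[OF f g(1,2) p(1)] x g(3) p by simp
    ultimately show "\<exists>g. hom_on (adjoin A y) g \<and> (\<forall>x\<in>A. g x = f x) \<and> g a \<noteq> 0" by blast
  qed
next
  case True
  then obtain P where P: "min_poly A y P" using min_poly_exists by metis
  obtain e where e: "e \<in> adjoin A y" "a * e \<in> A" "a * e \<noteq> 0" using norm_multiple[OF A P a] by blast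
  have Po: "poly_over A P" "P \<noteq> 0" using P by (auto simp: min_poly_def)
  let ?c = "Polynomial.lead_coeff P"
  have c: "?c \<in> A" "?c \<noteq> 0" using Po by (auto simp: poly_over_def)
  show ?thesis
  proof (rule that[of "?c * (a * e)"])
    show "?c * (a * e) \<in> A" by (rule subring_mult[OF A c(1) e(2)])
    show "?c * (a * e) \<noteq> 0" using c e by simp
    fix f :: "'a \<Rightarrow> 'b" assume f: "hom_on A f" and fb: "f (?c * (a * e)) \<noteq> 0"
    have fc: "f ?c \<noteq> 0" "f (a * e) \<noteq> 0" using fb hom_on_mult[OF f c(1) e(2)] by auto
    have "Polynomial.coeff (map_poly f P) (Polynomial.degree P) \<noteq> 0"
      using fc by (simp add: coeff_map_poly hom_on_zero[OF f])
    then have "Polynomial.degree P \<le> Polynomial.degree (map_poly f P)" by (rule le_degree)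
    with min_poly_degree_pos[OF P] obtain x where x: "poly (map_poly f P) x = 0"
      using alg_closed_imp_poly_has_root[of "map_poly f P"] by auto
    obtain g where g: "hom_on (adjoin A y) g" "\<And>a. a \<in> A \<Longrightarrow> g a = f a" "g y = x"
      using hom_extend_root[OF f P fc(1) x] by blast
    have "g a * g e = f (a * e)" using hom_on_mult[OF g(1) a(1) e(1)] g(2)[OF e(2)] by simp
    then have "g a \<noteq> 0" using fc by auto
    with g show "\<exists>g. hom_on (adjoin A y) g \<and> (\<forall>x\<in>A. g x = f x) \<and> g a \<noteq> 0" by blast
  qed
qed

lemma generic_extension:
  fixes a :: "'a::field"
  assumes "finite S" and "a \<in> gen_ring (T \<union> S)" "a \<noteq> 0"
  obtains b where "b \<in> gen_ring T" "b \<noteq> 0"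
    "\<And>f :: 'a \<Rightarrow> 'b::{alg_closed_field,field_char_0}. hom_on (gen_ring T) f \<Longrightarrow> f b \<noteq> 0 \<Longrightarrow>
       \<exists>g. hom_on (gen_ring (T \<union> S)) g \<and> (\<forall>x\<in>gen_ring T. g x = f x) \<and> g a \<noteq> 0"
  using assms
proof (induction S arbitrary: a thesis rule: finite_induct)
  case empty
  show ?case by (rule empty(1)[of a]) (use empty in auto)
next
  case (insert y S)
  note R = subring_gen_ring[of "T \<union> S"]
  have eq: "gen_ring (T \<union> insert y S) = adjoin (gen_ring (T \<union> S)) y"
    using gen_ring_insert[of y "T \<union> S"] by simp
  obtain b1 where b1: "b1 \<in> gen_ring (T \<union> S)" "b1 \<noteq> 0"
    and ext1: "\<And>f :: 'a \<Rightarrow> 'b. hom_on (gen_ring (T \<union> S)) f \<Longrightarrow> f b1 \<noteq> 0 \<Longrightarrow>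
       \<exists>g. hom_on (adjoin (gen_ring (T \<union> S)) y) g \<and> (\<forall>x\<in>gen_ring (T \<union> S). g x = f x) \<and> g a \<noteq> 0"
    using generic_extension_one[OF R insert.prems(2)[unfolded eq] insert.prems(3)] by blast
  obtain b where b: "b \<in> gen_ring T" "b \<noteq> 0"
    and ext: "\<And>f :: 'a \<Rightarrow> 'b. hom_on (gen_ring T) f \<Longrightarrow> f b \<noteq> 0 \<Longrightarrow>
       \<exists>g. hom_on (gen_ring (T \<union> S)) g \<and> (\<forall>x\<in>gen_ring T. g x = f x) \<and> g b1 \<noteq> 0"
    using insert.IH[OF _ b1] by blast
  have sub: "gen_ring T \<subseteq> gen_ring (T \<union> S)" by (rule gen_ring_mono) auto
  show ?case
  proof (rule insert.prems(1)[OF b])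
    fix f :: "'a \<Rightarrow> 'b" assume "hom_on (gen_ring T) f" "f b \<noteq> 0"
    from ext[OF this] obtain g where g: "hom_on (gen_ring (T \<union> S)) g" "\<forall>x\<in>gen_ring T. g x = f x" "g b1 \<noteq> 0"
      by blast
    from ext1[OF g(1,3)] obtain h where "hom_on (adjoin (gen_ring (T \<union> S)) y) h"
      "\<forall>x\<in>gen_ring (T \<union> S). h x = g x" "h a \<noteq> 0" by blast
    with g sub show "\<exists>g. hom_on (gen_ring (T \<union> insert y S)) g \<and> (\<forall>x\<in>gen_ring T. g x = f x) \<and> g a \<noteq> 0"
      unfolding eq by (intro exI[of _ h]) auto
  qed
qed

subsection \<open>Generated subfields\<close>

definition subfield_set :: "'a::field set \<Rightarrow> bool" where
  "subfield_set F \<longleftrightarrow> subring_set F \<and> (\<forall>x\<in>F. inverse x \<in> F)"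

lemma subfield_subring: "subfield_set F \<Longrightarrow> subring_set F"
  by (simp add: subfield_set_def)

lemma subfield_inverse: "subfield_set F \<Longrightarrow> x \<in> F \<Longrightarrow> inverse x \<in> F"
  by (simp add: subfield_set_def)

lemma subfield_divide: "subfield_set F \<Longrightarrow> x \<in> F \<Longrightarrow> y \<in> F \<Longrightarrow> x / y \<in> F"
  by (simp add: divide_inverse subfield_inverse subring_mult subfield_subring)

text \<open>
  The subfields of the statement are generated in the ring structure of a type; the following facts
  translate them to closure under the operations of the type class.
\<close>

lemma ring_of_type_algebra_simps:
  "carrier ring_of_type_algebra = UNIV"
  "x \<otimes>\<^bsub>ring_of_type_algebra\<^esub> y = x * y" "x \<oplus>\<^bsub>ring_of_type_algebra\<^esub> y = x + y"
  "\<one>\<^bsub>ring_of_type_algebra\<^esub> = 1" "\<zero>\<^bsub>ring_of_type_algebra\<^esub> = 0"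
  by (simp_all add: ring_of_type_algebra_def)

lemma ring_of_type_algebra_inv:
  fixes x :: "'a::field"
  shows "\<ominus>\<^bsub>ring_of_type_algebra\<^esub> x = - x"
    and "x \<noteq> 0 \<Longrightarrow> inv\<^bsub>ring_of_type_algebra\<^esub> x = inverse x"
proof -
  interpret R: Ring.field "ring_of_type_algebra :: 'a ring" by (rule field_from_type_algebra)
  show "\<ominus>\<^bsub>ring_of_type_algebra\<^esub> x = - x"
    by (rule R.minus_equality) (simp_all add: ring_of_type_algebra_simps)
  show "inv\<^bsub>ring_of_type_algebra\<^esub> x = inverse x" if "x \<noteq> 0"
    by (rule R.inv_char) (use that in \<open>simp_all add: ring_of_type_algebra_simps\<close>)
qed

lemma gen_subfield_incl: "S \<subseteq> gen_subfield S"
  by (auto simp: gen_subfield_def intro: generate_field.incl)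

lemma subfield_gen_subfield: "subfield_set (gen_subfield (S :: 'a::field set))"
proof -
  let ?R = "ring_of_type_algebra :: 'a ring"
  have add: "x + y \<in> gen_subfield S" if "x \<in> gen_subfield S" "y \<in> gen_subfield S" for x y
    using generate_field.eng_add[of x ?R S y] that
    by (simp add: gen_subfield_def ring_of_type_algebra_simps)
  have neg: "- x \<in> gen_subfield S" if "x \<in> gen_subfield S" for x
    using generate_field.a_inv[of x ?R S] that
    by (simp add: gen_subfield_def ring_of_type_algebra_inv)
  have mult: "x * y \<in> gen_subfield S" if "x \<in> gen_subfield S" "y \<in> gen_subfield S" for x y
    using generate_field.eng_mult[of x ?R S y] that
    by (simp add: gen_subfield_def ring_of_type_algebra_simps)
  have inv: "inverse x \<in> gen_subfield S" if "x \<in> gen_subfield S" for x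
  proof (cases "x = 0")
    case False
    then show ?thesis
      using generate_field.m_inv[of x ?R S] that
      by (simp add: gen_subfield_def ring_of_type_algebra_simps ring_of_type_algebra_inv)
  qed (use that in simp)
  have "1 \<in> gen_subfield S"
    using generate_field.one[of ?R S] by (simp add: gen_subfield_def ring_of_type_algebra_simps)
  moreover have "x - y \<in> gen_subfield S" if "x \<in> gen_subfield S" "y \<in> gen_subfield S" for x y
    using add[OF that(1) neg[OF that(2)]] by simp
  ultimately show ?thesis using mult inv by (simp add: subfield_set_def subring_set_def)
qed

lemma gen_subfield_least:
  assumes F: "subfield_set F" and S: "S \<subseteq> F" shows "gen_subfield S \<subseteq> F"
proof
  note R = subfield_subring[OF F]
  fix x assume "x \<in> gen_subfield S"
  then have "x \<in> generate_field ring_of_type_algebra S" by (simp add: gen_subfield_def)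
  then show "x \<in> F"
    by induction
      (use S in \<open>auto simp: ring_of_type_algebra_simps ring_of_type_algebra_inv
         intro: subring_setD[OF R] subfield_inverse[OF F]\<close>)
qed

lemma gen_subfield_mono: "S \<subseteq> T \<Longrightarrow> gen_subfield S \<subseteq> gen_subfield T"
  by (rule gen_subfield_least[OF subfield_gen_subfield]) (use gen_subfield_incl in blast)

lemma gen_ring_subset_gen_subfield: "gen_ring S \<subseteq> gen_subfield S"
  by (rule gen_ring_least[OF subfield_subring[OF subfield_gen_subfield] gen_subfield_incl])

lemma gen_subfield_quotient:
  assumes "x \<in> gen_subfield S"
  obtains a b where "a \<in> gen_ring S" "b \<in> gen_ring S" "b \<noteq> 0" "x = a / b"
proof -
  let ?F = "{a / b |a b. a \<in> gen_ring S \<and> b \<in> gen_ring S \<and> b \<noteq> 0}"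
  note R = subring_gen_ring[of S]
  have "subfield_set ?F" unfolding subfield_set_def subring_set_def
  proof (intro conjI ballI)
    show "1 \<in> ?F" using subring_one[OF R] by (intro CollectI exI[of _ 1]) auto
    fix x assume "x \<in> ?F"
    then obtain a b where x: "x = a / b" "a \<in> gen_ring S" "b \<in> gen_ring S" "b \<noteq> 0" by blast
    show "inverse x \<in> ?F"
    proof (cases "a = 0")
      case True
      then show ?thesis using x by auto
    next
      case False
      then show ?thesis using x by (intro CollectI exI[of _ b] exI[of _ a]) auto
    qed
    fix y assume "y \<in> ?F"
    then obtain d e where y: "y = d / e" "d \<in> gen_ring S" "e \<in> gen_ring S" "e \<noteq> 0" by blast
    show "x - y \<in> ?F"
      using x y by (intro CollectI exI[of _ "a * e - d * b"] exI[of _ "b * e"])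
        (auto simp: diff_frac_eq intro!: gen_ring.intros(3,4))
    show "x * y \<in> ?F"
      using x y by (intro CollectI exI[of _ "a * d"] exI[of _ "b * e"])
        (auto intro!: gen_ring.intros(4))
  qed
  moreover have "S \<subseteq> ?F"
  proof
    fix x assume "x \<in> S"
    then show "x \<in> ?F"
      by (intro CollectI exI[of _ x] exI[of _ 1]) (auto intro: gen_ring.intros)
  qed
  ultimately have "gen_subfield S \<subseteq> ?F" by (rule gen_subfield_least)
  with assms that show ?thesis by blast
qed

lemma hom_gen_subfield_cong:
  fixes f g :: "'a::field \<Rightarrow> 'b::field"
  assumes f: "hom_on UNIV f" and g: "hom_on UNIV g" and e: "\<And>x. x \<in> S \<Longrightarrow> f x = g x"
    and x: "x \<in> gen_subfield S"
  shows "f x = g x"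
proof -
  have "subfield_set {x. f x = g x}"
    by (auto simp: subfield_set_def subring_set_def hom_onD[OF f] hom_onD[OF g]
        hom_UNIV_inverse[OF f] hom_UNIV_inverse[OF g])
  from gen_subfield_least[OF this, of S] e x show ?thesis by blast
qed

lemma hom_image_gen_subfield:
  fixes f :: "'a::field \<Rightarrow> 'b::field"
  assumes f: "hom_on UNIV f"
  shows "f ` gen_subfield S = gen_subfield (f ` S)"
proof
  note F = subfield_gen_subfield[of S]
  have "subfield_set {x. f x \<in> gen_subfield (f ` S)}"
    using subfield_gen_subfield[of "f ` S"]
    by (auto simp: subfield_set_def subring_set_def hom_onD[OF f] hom_UNIV_inverse[OF f])
  from gen_subfield_least[OF this, of S] gen_subfield_incl[of "f ` S"]
  show "f ` gen_subfield S \<subseteq> gen_subfield (f ` S)" by blast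
  have "subfield_set (f ` gen_subfield S)" unfolding subfield_set_def subring_set_def
  proof (intro conjI ballI)
    show "1 \<in> f ` gen_subfield S"
      using subring_one[OF subfield_subring[OF F]] hom_on_one[OF f] by (metis image_eqI)
    fix x assume "x \<in> f ` gen_subfield S"
    then obtain a where a: "x = f a" "a \<in> gen_subfield S" by blast
    show "inverse x \<in> f ` gen_subfield S"
      using a hom_UNIV_inverse[OF f, of a] subfield_inverse[OF F] by (metis image_eqI)
    fix y assume "y \<in> f ` gen_subfield S"
    then obtain b where b: "y = f b" "b \<in> gen_subfield S" by blast
    show "x - y \<in> f ` gen_subfield S"
      using a b hom_on_diff[OF f, of a b] subring_diff[OF subfield_subring[OF F], of a b] by (metis UNIV_I image_eqI)
    show "x * y \<in> f ` gen_subfield S"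
      using a b hom_on_mult[OF f, of a b] subring_mult[OF subfield_subring[OF F], of a b] by (metis UNIV_I image_eqI)
  qed
  then show "gen_subfield (f ` S) \<subseteq> f ` gen_subfield S"
    by (rule gen_subfield_least) (use gen_subfield_incl in blast)
qed

subsection \<open>Separating specializations\<close>

lemma hom_inverse_const:
  fixes c :: "'c::field \<Rightarrow> 'b::field"
  assumes c: "hom_on UNIV c"
  shows "gen_ring (range c) = range c" and "hom_on (range c) (inv_into UNIV c)"
proof -
  have s: "subring_set (range c)"
    using subring_UNIV hom_on_one[OF c] hom_on_diff[OF c] hom_on_mult[OF c]
    by (auto simp: subring_set_def image_iff) (metis UNIV_I)+
  show "gen_ring (range c) = range c"
    using gen_ring_least[OF s] by (auto intro: gen_ring_incl)
  have i: "inv_into UNIV c (c x) = x" for x by (rule inv_f_f[OF hom_UNIV_inj[OF c]])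
  show "hom_on (range c) (inv_into UNIV c)" unfolding hom_on_def
  proof (intro conjI ballI s)
    show "inv_into UNIV c 1 = 1" using i[of 1] hom_on_one[OF c] by simp
    fix x y assume "x \<in> range c" "y \<in> range c"
    then obtain u v where uv: "x = c u" "y = c v" by blast
    show "inv_into UNIV c (x + y) = inv_into UNIV c x + inv_into UNIV c y"
      using i[of "u + v"] hom_on_add[OF c, of u v] uv i by simp
    show "inv_into UNIV c (x * y) = inv_into UNIV c x * inv_into UNIV c y"
      using i[of "u * v"] hom_on_mult[OF c, of u v] uv i by simp
  qed
qed

text \<open>
  The weak Nullstellensatz: the extension theorem applied to the inverse of the
  embedding of the constants.
\<close>

lemma specialization:
  fixes c :: "'c::{alg_closed_field,field_char_0} \<Rightarrow> 'b::field"
  assumes c: "hom_on UNIV c" and S: "finite S" and a: "a \<in> gen_ring (range c \<union> S)" "a \<noteq> 0"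
  obtains f where "hom_on (gen_ring (range c \<union> S)) f" "\<And>x. f (c x) = x" "f a \<noteq> 0"
proof -
  note R = hom_inverse_const[OF c]
  obtain b where b: "b \<in> range c" "b \<noteq> 0"
    and ext: "\<And>f :: 'b \<Rightarrow> 'c. hom_on (range c) f \<Longrightarrow> f b \<noteq> 0 \<Longrightarrow>
       \<exists>g. hom_on (gen_ring (range c \<union> S)) g \<and> (\<forall>x\<in>range c. g x = f x) \<and> g a \<noteq> 0"
    using generic_extension[OF S a] unfolding R(1) by blast
  have i: "inv_into UNIV c (c x) = x" for x by (rule inv_f_f[OF hom_UNIV_inj[OF c]])
  have "inv_into UNIV c b \<noteq> 0" using b i by (auto simp: hom_on_zero[OF c])
  from ext[OF R(2) this] obtain g where "hom_on (gen_ring (range c \<union> S)) g"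
    "\<forall>x\<in>range c. g x = inv_into UNIV c x" "g a \<noteq> 0" by blast
  with i that show ?thesis by auto
qed

text \<open>
  A linear factor that is split off at a root \<open>x\<close> leaves a nonconstant cofactor. A root of the cofactor
  is different from \<open>x\<close> because the derivative at \<open>x\<close> is the value of the cofactor.
\<close>

lemma distinct_roots:
  fixes p :: "'a::alg_closed_field poly"
  assumes "Polynomial.degree p \<ge> 2" and s: "\<And>x. poly p x = 0 \<Longrightarrow> poly (pderiv p) x \<noteq> 0"
  obtains x y where "poly p x = 0" "poly p y = 0" "x \<noteq> y"
proof -
  obtain x where x: "poly p x = 0" using alg_closed_imp_poly_has_root[of p] assms(1) by auto
  then obtain r where r: "p = [:- x, 1:] * r" by (metis dvdE poly_eq_0_iff_dvd)
  have "p \<noteq> 0" using assms(1) by auto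
  then have "r \<noteq> 0" using r by auto
  then have "Polynomial.degree p = 1 + Polynomial.degree r"
    using r Polynomial.degree_mult_eq[of "[:- x, 1:]" r] by simp
  with assms(1) obtain y where y: "poly r y = 0" using alg_closed_imp_poly_has_root[of r] by auto
  have "poly (pderiv p) x = poly r x"
    unfolding r by (simp add: pderiv_diff pderiv_pCons pderiv_smult algebra_simps)
  with s[OF x] y have "x \<noteq> y" by auto
  moreover have "poly p y = 0" using y r by simp
  ultimately show ?thesis using that x by blast
qed

lemma simple_root_min_poly:
  fixes y :: "'a::field"
  assumes A: "subring_set A" and P: "min_poly A y P" and char0: "\<And>k. k > 0 \<Longrightarrow> (of_nat k :: 'a) \<noteq> 0"
  shows "poly (pderiv P) y \<noteq> 0"
proof
  assume z: "poly (pderiv P) y = 0"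
  have Po: "poly_over A P" "P \<noteq> 0" using P by (auto simp: min_poly_def)
  note d = min_poly_degree_pos[OF P]
  have "Polynomial.coeff (pderiv P) (Polynomial.degree P - 1) = of_nat (Polynomial.degree P) * Polynomial.lead_coeff P"
    using d by (simp add: coeff_pderiv)
  then have "pderiv P \<noteq> 0" using char0[OF d] Po by auto
  then have "Polynomial.degree P \<le> Polynomial.degree (pderiv P)"
    using P poly_over_pderiv[OF A Po(1)] z by (auto simp: min_poly_def)
  moreover have "Polynomial.degree (pderiv P) \<le> Polynomial.degree P - 1"
    by (rule degree_le) (auto simp: coeff_pderiv coeff_eq_0)
  ultimately show False using d by simp
qed

text \<open>
  If \<open>y\<close> is not a fraction of elements of \<open>A\<close>, then its value under a generic extension of \<open>f\<close> is not
  determined. A transcendental \<open>y\<close> takes almost all values. The minimal polynomial of an algebraic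
  \<open>y\<close> has degree at least two and, in characteristic zero, does not share a root with its derivative; if
  a norm of the value of the derivative survives under \<open>f\<close>, then the image of the polynomial has only
  simple roots, hence two different ones.
\<close>

lemma two_extensions:
  fixes y :: "'a::field"
  assumes A: "subring_set A" and y: "\<And>p q. p \<in> A \<Longrightarrow> q \<in> A \<Longrightarrow> q \<noteq> 0 \<Longrightarrow> y * q \<noteq> p"
    and char0: "\<And>k. k > 0 \<Longrightarrow> (of_nat k :: 'a) \<noteq> 0"
    and b: "b \<in> adjoin A y" "b \<noteq> 0"
  obtains a where "a \<in> A" "a \<noteq> 0"
    "\<And>f :: 'a \<Rightarrow> 'b::{alg_closed_field,field_char_0}. hom_on A f \<Longrightarrow> f a \<noteq> 0 \<Longrightarrow>
       \<exists>g h. hom_on (adjoin A y) g \<and> hom_on (adjoin A y) h \<and> (\<forall>x\<in>A. g x = f x \<and> h x = f x) \<and>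
         g b \<noteq> 0 \<and> h b \<noteq> 0 \<and> g y \<noteq> h y"
proof (cases "\<exists>Q. poly_over A Q \<and> Q \<noteq> 0 \<and> poly Q y = 0")
  case False
  then have t: "\<And>Q. poly_over A Q \<Longrightarrow> poly Q y = 0 \<Longrightarrow> Q = 0" by blast
  obtain p where p: "poly_over A p" "b = poly p y" using b by (auto simp: adjoin_def)
  have "p \<noteq> 0" using p b by auto
  show ?thesis
  proof (rule that[of "Polynomial.lead_coeff p"])
    show "Polynomial.lead_coeff p \<in> A" "Polynomial.lead_coeff p \<noteq> 0"
      using p \<open>p \<noteq> 0\<close> by (auto simp: poly_over_def)
    fix f :: "'a \<Rightarrow> 'b" assume f: "hom_on A f" and fb: "f (Polynomial.lead_coeff p) \<noteq> 0"
    have nz: "map_poly f p \<noteq> 0"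
      using fb by (metis Polynomial.coeff_0 coeff_map_poly hom_on_zero[OF f])
    obtain x where x: "poly (map_poly f p) x \<noteq> 0"
      using poly_nonroots_infinite[OF nz, of "{}"] by blast
    obtain x' where x': "poly (map_poly f p) x' \<noteq> 0" "x' \<noteq> x"
      using poly_nonroots_infinite[OF nz, of "{x}"] by blast
    obtain g where g: "hom_on (adjoin A y) g" "\<And>a. a \<in> A \<Longrightarrow> g a = f a" "g y = x"
      using hom_extend_transcendental[OF f t] by blast
    obtain h where h: "hom_on (adjoin A y) h" "\<And>a. a \<in> A \<Longrightarrow> h a = f a" "h y = x'"
      using hom_extend_transcendental[OF f t] by blast
    have "g b \<noteq> 0" using hom_adjoin_poly[OF f g(1,2) p(1)] x g(3) p by simp
    moreover have "h b \<noteq> 0" using hom_adjoin_poly[OF f h(1,2) p(1)] x' h(3) p by simp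
    ultimately show "\<exists>g h. hom_on (adjoin A y) g \<and> hom_on (adjoin A y) h \<and>
         (\<forall>x\<in>A. g x = f x \<and> h x = f x) \<and> g b \<noteq> 0 \<and> h b \<noteq> 0 \<and> g y \<noteq> h y"
      using g h x' by (intro exI[of _ g] exI[of _ h]) auto
  qed
next
  case True
  then obtain P where P: "min_poly A y P" using min_poly_exists by metis
  have Po: "poly_over A P" "P \<noteq> 0" "poly P y = 0" using P by (auto simp: min_poly_def)
  let ?c = "Polynomial.lead_coeff P"
  have c: "?c \<in> A" "?c \<noteq> 0" using Po by (auto simp: poly_over_def)
  have deg: "Polynomial.degree P \<ge> 2"
  proof (rule ccontr)
    assume "\<not> Polynomial.degree P \<ge> 2"
    then have "Polynomial.degree P = 1" using min_poly_degree_pos[OF P] by simp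
    moreover obtain u R where R: "P = pCons u R" by (cases P)
    ultimately have "Polynomial.degree R = 0" "R \<noteq> 0" by (auto split: if_splits)
    then obtain v where uv: "P = [:u, v:]" "v \<noteq> 0" using R by (metis degree_eq_zeroE pCons_0_0)
    then have "u \<in> A" "v \<in> A" using Po(1)
      by (auto simp: poly_over_def dest: spec[of _ 0] spec[of _ 1])
    moreover have "y * v = - u" using Po(3) uv by (simp add: eq_neg_iff_add_eq_0 add.commute)
    ultimately show False using y[of "- u" v] uv subring_minus[OF A] by auto
  qed
  define D where "D = poly (pderiv P) y"
  have D: "D \<in> adjoin A y" "D \<noteq> 0"
    using simple_root_min_poly[OF A P char0] adjoinI[OF poly_over_pderiv[OF A Po(1)]] by (auto simp: D_def)
  obtain e where e: "e \<in> adjoin A y" "b * e \<in> A" "b * e \<noteq> 0" using norm_multiple[OF A P b] by blast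
  obtain e' where e': "e' \<in> adjoin A y" "D * e' \<in> A" "D * e' \<noteq> 0" using norm_multiple[OF A P D] by blast
  show ?thesis
  \<comment> \<open>The factors keep, in this order, the degree of \<open>P\<close>, the element \<open>b\<close>, and the derivative of \<open>P\<close> at \<open>y\<close>
    away from zero.\<close>
  proof (rule that[of "?c * (b * e) * (D * e')"])
    show "?c * (b * e) * (D * e') \<in> A" by (intro subring_mult[OF A] c e e')
    show "?c * (b * e) * (D * e') \<noteq> 0" using c e e' by simp
    fix f :: "'a \<Rightarrow> 'b" assume f: "hom_on A f" and fb: "f (?c * (b * e) * (D * e')) \<noteq> 0"
    have fc: "f ?c \<noteq> 0" "f (b * e) \<noteq> 0" "f (D * e') \<noteq> 0"
      using fb hom_on_mult[OF f c(1) e(2)] hom_on_mult[OF f subring_mult[OF A c(1) e(2)] e'(2)] by auto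
    have "Polynomial.coeff (map_poly f P) (Polynomial.degree P) \<noteq> 0"
      using fc by (simp add: coeff_map_poly hom_on_zero[OF f])
    then have "Polynomial.degree P \<le> Polynomial.degree (map_poly f P)" by (rule le_degree)
    then have deg': "Polynomial.degree (map_poly f P) \<ge> 2" using deg by simp
    have ext: "\<exists>g. hom_on (adjoin A y) g \<and> (\<forall>a\<in>A. g a = f a) \<and> g y = x \<and> g b \<noteq> 0 \<and> g D \<noteq> 0"
      if x: "poly (map_poly f P) x = 0" for x
    proof -
      obtain g where g: "hom_on (adjoin A y) g" "\<And>a. a \<in> A \<Longrightarrow> g a = f a" "g y = x"
        using hom_extend_root[OF f P fc(1) x] by blast
      have "g b * g e = f (b * e)" using hom_on_mult[OF g(1) b(1) e(1)] g(2)[OF e(2)] by simp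
      then have "g b \<noteq> 0" using fc by auto
      moreover have "g D * g e' = f (D * e')" using hom_on_mult[OF g(1) D(1) e'(1)] g(2)[OF e'(2)] by simp
      then have "g D \<noteq> 0" using fc by auto
      ultimately show ?thesis using g by blast
    qed
    have simple: "poly (pderiv (map_poly f P)) x \<noteq> 0" if x: "poly (map_poly f P) x = 0" for x
    proof -
      obtain g where g: "hom_on (adjoin A y) g" "\<And>a. a \<in> A \<Longrightarrow> g a = f a" "g y = x" "g D \<noteq> 0"
        using ext[OF x] by blast
      show ?thesis
        using g(4) hom_adjoin_poly[OF f g(1,2) poly_over_pderiv[OF A Po(1)]] map_poly_hom_pderiv[OF f Po(1)] g(3)
        by (simp add: D_def)
    qed
    obtain x x' where x: "poly (map_poly f P) x = 0" "poly (map_poly f P) x' = 0" "x \<noteq> x'"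
      using distinct_roots[OF deg' simple] by blast
    from ext[OF x(1)] ext[OF x(2)] x(3)
    show "\<exists>g h. hom_on (adjoin A y) g \<and> hom_on (adjoin A y) h \<and>
         (\<forall>x\<in>A. g x = f x \<and> h x = f x) \<and> g b \<noteq> 0 \<and> h b \<noteq> 0 \<and> g y \<noteq> h y" by fastforce
  qed
qed

text \<open>
  A function that is constant on the fibres of the map given by \<open>S0\<close> is a rational function of the
  elements of \<open>S0\<close>. A generic specialization of the ring generated by \<open>S0\<close> has two extensions to \<open>y\<close>
  by \<open>two_extensions\<close>, and both extend further to the remaining generators.
\<close>

theorem separating_specializations:
  fixes c :: "'c::{alg_closed_field,field_char_0} \<Rightarrow> 'b::field"
  assumes c: "hom_on UNIV c" and S: "finite S" "S0 \<subseteq> S" and y: "y \<in> S"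
    "y \<notin> gen_subfield (range c \<union> S0)"
  obtains f g where "hom_on (gen_ring (range c \<union> S)) f" "hom_on (gen_ring (range c \<union> S)) g"
    "\<And>x. f (c x) = x" "\<And>x. g (c x) = x" "\<And>x. x \<in> S0 \<Longrightarrow> f x = g x" "f y \<noteq> g y"
proof -
  define A where "A = gen_ring (range c \<union> S0)"
  have A: "subring_set A" unfolding A_def by (rule subring_gen_ring)
  have adj: "adjoin A y = gen_ring (insert y (range c \<union> S0))" unfolding A_def by (rule gen_ring_insert[symmetric])
  have uni: "insert y (range c \<union> S0) \<union> S = range c \<union> S" using S y by auto
  have one: "1 \<in> gen_ring (insert y (range c \<union> S0) \<union> S)" by (rule gen_ring_one)
  \<comment> \<open>The element \<open>b\<close> guards the last step, from \<open>adjoin A y\<close> to the whole ring.\<close>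
  obtain b where b: "b \<in> adjoin A y" "b \<noteq> 0"
    and ext: "\<And>f :: 'b \<Rightarrow> 'c. hom_on (adjoin A y) f \<Longrightarrow> f b \<noteq> 0 \<Longrightarrow>
       \<exists>g. hom_on (gen_ring (range c \<union> S)) g \<and> (\<forall>x\<in>adjoin A y. g x = f x)"
    using generic_extension[OF S(1) one, where 'b='c] unfolding adj uni by (metis zero_neq_one)
  have ynot: "y * q \<noteq> p" if "p \<in> A" "q \<in> A" "q \<noteq> 0" for p q
  proof
    assume "y * q = p"
    then have "y = p / q" using that by (simp add: field_simps)
    moreover have "p / q \<in> gen_subfield (range c \<union> S0)"
      using that gen_ring_subset_gen_subfield[of "range c \<union> S0"] unfolding A_def
      by (intro subfield_divide[OF subfield_gen_subfield]) auto
    ultimately show False using y by simp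
  qed
  have char0: "(of_nat k :: 'b) \<noteq> 0" if "k > 0" for k
  proof -
    have "c (of_nat k) = of_nat k"
      by (induction k) (simp_all add: hom_onD[OF c])
    then show ?thesis using hom_UNIV_eq_0[OF c, of "of_nat k"] that by simp
  qed
  obtain a where a: "a \<in> A" "a \<noteq> 0"
    and two: "\<And>f :: 'b \<Rightarrow> 'c. hom_on A f \<Longrightarrow> f a \<noteq> 0 \<Longrightarrow>
       \<exists>g h. hom_on (adjoin A y) g \<and> hom_on (adjoin A y) h \<and> (\<forall>x\<in>A. g x = f x \<and> h x = f x) \<and>
         g b \<noteq> 0 \<and> h b \<noteq> 0 \<and> g y \<noteq> h y"
    using two_extensions[OF A ynot char0 b, where 'b='c] by blast
  obtain f where f: "hom_on A f" "\<And>x. f (c x) = x" "f a \<noteq> 0"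
    using specialization[OF c finite_subset[OF S(2,1)] a[unfolded A_def]] unfolding A_def by blast
  obtain g h where gh: "hom_on (adjoin A y) g" "hom_on (adjoin A y) h"
    "\<forall>x\<in>A. g x = f x \<and> h x = f x" "g b \<noteq> 0" "h b \<noteq> 0" "g y \<noteq> h y" using two[OF f(1,3)] by blast
  obtain g' where g': "hom_on (gen_ring (range c \<union> S)) g'" "\<forall>x\<in>adjoin A y. g' x = g x"
    using ext[OF gh(1,4)] by blast
  obtain h' where h': "hom_on (gen_ring (range c \<union> S)) h'" "\<forall>x\<in>adjoin A y. h' x = h x"
    using ext[OF gh(2,5)] by blast
  have cA: "c x \<in> A" for x unfolding A_def by (rule gen_ring_incl) simp
  have sA: "x \<in> A" if "x \<in> S0" for x unfolding A_def by (rule gen_ring_incl) (use that in simp)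
  show ?thesis
  proof (rule that[OF g'(1) h'(1)])
    show "g' (c x) = x" "h' (c x) = x" for x
      using g' h' gh f(2) adjoin_base[OF A cA, of x y] cA by auto
    show "g' x = h' x" if "x \<in> S0" for x
      using g' h' gh adjoin_base[OF A sA[OF that], of y] sA[OF that] by auto
    show "g' y \<noteq> h' y" using g' h' gh adjoin_gen[OF A] by auto
  qed
qed

section \<open>Evaluation of polynomials\<close>

definition monom_eval :: "('v \<Rightarrow> 'b::comm_semiring_1) \<Rightarrow> ('v \<Rightarrow>\<^sub>0 nat) \<Rightarrow> 'b" where
  "monom_eval x t = (\<Prod>v\<in>Poly_Mapping.keys t. x v ^ Poly_Mapping.lookup t v)"

lemma monom_eval_superset:
  assumes "finite V" "Poly_Mapping.keys t \<subseteq> V"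
  shows "monom_eval x t = (\<Prod>v\<in>V. x v ^ Poly_Mapping.lookup t v)"
  unfolding monom_eval_def
  by (rule prod.mono_neutral_left) (use assms in \<open>auto simp: in_keys_iff\<close>)

lemma monom_eval_add: "monom_eval x (s + t) = monom_eval x s * monom_eval x t"
proof -
  let ?V = "Poly_Mapping.keys s \<union> Poly_Mapping.keys t"
  have "Poly_Mapping.keys (s + t) \<subseteq> ?V" by (rule keys_add)
  then show ?thesis
    using monom_eval_superset[of ?V "s + t" x] monom_eval_superset[of ?V s x] monom_eval_superset[of ?V t x]
    by (simp add: lookup_add power_add prod.distrib)
qed

lemma monom_eval_0 [simp]: "monom_eval x 0 = 1"
  by (simp add: monom_eval_def)

lemma monom_eval_single [simp]: "monom_eval x (Poly_Mapping.single v k) = x v ^ k"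
  by (cases "k = 0") (auto simp: monom_eval_def)

lemma mpol_eval_superset:
  assumes "h 0 = 0" "finite T" "Poly_Mapping.keys p \<subseteq> T"
  shows "mpol_eval h x p = (\<Sum>t\<in>T. h (Poly_Mapping.lookup p t) * monom_eval x t)"
  unfolding mpol_eval_def monom_eval_def[symmetric]
  by (rule sum.mono_neutral_left) (use assms in \<open>auto simp: in_keys_iff\<close>)

lemma mpol_eval_single:
  assumes "h 0 = 0" shows "mpol_eval h x (Poly_Mapping.single t a) = h a * monom_eval x t"
  using mpol_eval_superset[of h "{t}", OF assms] by simp

lemma sum_singles: "(\<Sum>t\<in>Poly_Mapping.keys p. Poly_Mapping.single t (Poly_Mapping.lookup p t)) = p"
  by (rule poly_mapping_eqI)
    (simp add: lookup_sum lookup_single when_def in_keys_iff)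

lemma hom_mpol_eval:
  fixes h :: "'a::comm_ring_1 \<Rightarrow> 'b::comm_ring_1"
  assumes h: "hom_on UNIV h" shows "hom_on UNIV (mpol_eval h x)"
proof -
  note h0 = hom_on_zero[OF h]
  have add: "mpol_eval h x (p + q) = mpol_eval h x p + mpol_eval h x q" for p q
  proof -
    let ?T = "Poly_Mapping.keys p \<union> Poly_Mapping.keys q"
    have "Poly_Mapping.keys (p + q) \<subseteq> ?T" by (rule keys_add)
    then show ?thesis
      using mpol_eval_superset[of h ?T "p + q" x, OF h0] mpol_eval_superset[of h ?T p x, OF h0]
        mpol_eval_superset[of h ?T q x, OF h0]
      by (simp add: lookup_add hom_on_add[OF h] algebra_simps sum.distrib)
  qed
  have zero: "mpol_eval h x 0 = 0" by (simp add: mpol_eval_def)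
  have sum: "mpol_eval h x (sum f I) = (\<Sum>i\<in>I. mpol_eval h x (f i))" for f :: "'i \<Rightarrow> _" and I
    by (induction I rule: infinite_finite_induct) (simp_all add: add zero)
  have single: "mpol_eval h x (Poly_Mapping.single s a * Poly_Mapping.single t b) =
      mpol_eval h x (Poly_Mapping.single s a) * mpol_eval h x (Poly_Mapping.single t b)" for s t a b
    by (simp add: mult_single mpol_eval_single[where h=h, OF h0] monom_eval_add hom_on_mult[OF h])
  have mult: "mpol_eval h x (p * q) = mpol_eval h x p * mpol_eval h x q" for p q
  proof -
    let ?s = "\<lambda>p t. Poly_Mapping.single t (Poly_Mapping.lookup p t)"
    have "mpol_eval h x (p * q) =
        mpol_eval h x ((\<Sum>t\<in>Poly_Mapping.keys p. ?s p t) * (\<Sum>t\<in>Poly_Mapping.keys q. ?s q t))"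
      by (simp only: sum_singles)
    also have "\<dots> = (\<Sum>t\<in>Poly_Mapping.keys p. mpol_eval h x (?s p t)) *
        (\<Sum>t\<in>Poly_Mapping.keys q. mpol_eval h x (?s q t))"
      by (simp only: sum_product sum single)
    also have "\<dots> = mpol_eval h x p * mpol_eval h x q"
      by (simp only: sum[symmetric] sum_singles)
    finally show ?thesis .
  qed
  have "mpol_eval h x 1 = 1"
    using mpol_eval_single[where h=h and x=x and t=0 and a=1, OF h0] by (simp add: hom_on_one[OF h])
  then show ?thesis using add mult by (simp add: hom_on_def subring_UNIV)
qed

lemma mpol_eval_const: "h 0 = 0 \<Longrightarrow> mpol_eval h x (mpol_const a) = h a"
  by (simp add: mpol_const_def mpol_eval_single)

lemma mpol_eval_var: "hom_on UNIV h \<Longrightarrow> mpol_eval h x (mpol_var v) = x v"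
  using mpol_eval_single[where h=h and x=x and t="Poly_Mapping.single v 1" and a=1]
  by (simp add: mpol_var_def hom_onD)

lemma hom_mpol_const: "hom_on UNIV (mpol_const :: 'a::comm_ring_1 \<Rightarrow> ('v,'a) mpol)"
  by (simp add: hom_on_def subring_UNIV mpol_const_def single_add mult_single)

lemma mpol_eval_cong:
  assumes "\<And>a. a \<in> Poly_Mapping.range p \<Longrightarrow> h a = h' a" "\<And>v. v \<in> mpol_vars p \<Longrightarrow> x v = x' v"
  shows "mpol_eval h x p = mpol_eval h' x' p"
  unfolding mpol_eval_def
  by (intro sum.cong prod.cong refl arg_cong2[where f="(*)"] assms arg_cong[where f="\<lambda>u. u ^ _"])
    (use assms in \<open>auto simp: mpol_vars_def\<close>)

lemma hom_on_mpol_eval: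
  assumes f: "hom_on A f"
    and h: "\<And>a. a \<in> Poly_Mapping.range p \<Longrightarrow> h a \<in> A" and x: "\<And>v. v \<in> mpol_vars p \<Longrightarrow> x v \<in> A"
  shows "f (mpol_eval h x p) = mpol_eval (\<lambda>a. f (h a)) (\<lambda>v. f (x v)) p"
    and "mpol_eval h x p \<in> A"
proof -
  note A = hom_on_subring[OF f]
  have xA: "x v \<in> A" if "v \<in> Poly_Mapping.keys t" "t \<in> Poly_Mapping.keys p" for v t
    using x that by (auto simp: mpol_vars_def)
  have m: "(\<Prod>v\<in>Poly_Mapping.keys t. x v ^ Poly_Mapping.lookup t v) \<in> A" if "t \<in> Poly_Mapping.keys p" for t
    by (intro subring_prod[OF A] subring_power[OF A] xA[OF _ that])
  have fm: "f (\<Prod>v\<in>Poly_Mapping.keys t. x v ^ Poly_Mapping.lookup t v) =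
      (\<Prod>v\<in>Poly_Mapping.keys t. f (x v) ^ Poly_Mapping.lookup t v)" if "t \<in> Poly_Mapping.keys p" for t
    using xA[OF _ that] by (simp add: hom_on_prod[OF f] hom_on_power[OF f] subring_power[OF A] cong: prod.cong)
  show "f (mpol_eval h x p) = mpol_eval (\<lambda>a. f (h a)) (\<lambda>v. f (x v)) p"
    unfolding mpol_eval_def using m fm h
    by (simp add: hom_on_sum[OF f] hom_on_mult[OF f] subring_mult[OF A] cong: sum.cong)
  show "mpol_eval h x p \<in> A"
    unfolding mpol_eval_def using m h by (auto intro!: subring_sum[OF A] subring_mult[OF A])
qed

lemma mpol_eval_mem:
  assumes A: "subring_set A"
    and "\<And>a. a \<in> Poly_Mapping.range p \<Longrightarrow> h a \<in> A" "\<And>v. v \<in> mpol_vars p \<Longrightarrow> x v \<in> A"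
  shows "mpol_eval h x p \<in> A"
proof -
  have "hom_on A id" using A by (simp add: hom_on_def)
  from hom_on_mpol_eval(2)[OF this, of p h x] assms show ?thesis by simp
qed

lemma mpol_eval_self:
  fixes p :: "('v, 'a::comm_ring_1) mpol"
  shows "mpol_eval mpol_const mpol_var p = p"
proof -
  have v: "monom_eval mpol_var t = (Poly_Mapping.single t 1 :: ('v, 'a) mpol)" for t :: "'v \<Rightarrow>\<^sub>0 nat"
  proof -
    have pw: "mpol_var v ^ k = (Poly_Mapping.single (Poly_Mapping.single v k) 1 :: ('v, 'a) mpol)" for v :: 'v and k
      by (induction k) (simp_all add: mpol_var_def mult_single single_add[symmetric] single_one)
    have "(\<Prod>v\<in>V. mpol_var v ^ e v) =
        (Poly_Mapping.single (\<Sum>v\<in>V. Poly_Mapping.single v (e v)) 1 :: ('v, 'a) mpol)" if "finite V" for V and e :: "'v \<Rightarrow> nat"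
      using that by induction (simp_all add: pw mult_single)
    then show ?thesis by (simp add: monom_eval_def sum_singles)
  qed
  have "mpol_eval mpol_const mpol_var p =
      (\<Sum>t\<in>Poly_Mapping.keys p. mpol_const (Poly_Mapping.lookup p t) * monom_eval mpol_var t)"
    by (simp add: mpol_eval_def monom_eval_def)
  also have "\<dots> = (\<Sum>t\<in>Poly_Mapping.keys p. Poly_Mapping.single t (Poly_Mapping.lookup p t))"
    by (simp add: v mpol_const_def mult_single)
  finally show ?thesis by (simp add: sum_singles)
qed

lemma mpol_eval_comp:
  fixes h :: "'a::comm_ring_1 \<Rightarrow> ('w, 'b::comm_ring_1) mpol" and k :: "'b \<Rightarrow> 'c::comm_ring_1"
  assumes k: "hom_on UNIV k"
  shows "mpol_eval k y (mpol_eval h x p) = mpol_eval (\<lambda>a. mpol_eval k y (h a)) (\<lambda>v. mpol_eval k y (x v)) p"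
  by (rule hom_on_mpol_eval[OF hom_mpol_eval[OF k]]) auto

lemma poly_vanishing_sum:
  fixes q :: "nat \<Rightarrow> 'a::field_char_0"
  assumes "finite E" and "\<And>a. (\<Sum>e\<in>E. q e * a ^ e) = 0" and "e \<in> E" shows "q e = 0"
proof -
  define p where "p = (\<Sum>e\<in>E. Polynomial.monom (q e) e)"
  have "poly p a = 0" for a unfolding p_def using assms(2)[of a] by (simp add: poly_sum poly_monom)
  then have "p = 0" by (metis poly_all_0_iff_0)
  then have "Polynomial.coeff p e = 0" by simp
  then show ?thesis using assms(1,3) by (simp add: p_def coeff_sum Polynomial.coeff_monom)
qed

text \<open>
  Induction on the number of variables: after the other variables are specialized so that the
  coefficient of one power of the last variable is nonzero, a nonzero polynomial in one variable remains.
\<close>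

lemma monomials_nonvanishing:
  fixes c :: "('v \<Rightarrow> nat) \<Rightarrow> 'a::field_char_0"
  assumes "finite V" "finite T" "\<And>s t. s \<in> T \<Longrightarrow> t \<in> T \<Longrightarrow> (\<forall>v\<in>V. s v = t v) \<Longrightarrow> s = t"
    and "s \<in> T" "c s \<noteq> 0"
  shows "\<exists>a. (\<Sum>t\<in>T. c t * (\<Prod>v\<in>V. a v ^ t v)) \<noteq> 0"
  using assms
proof (induction V arbitrary: T s rule: finite_induct)
  case empty
  then have "T = {s}" by auto
  with empty show ?case by simp
next
  case (insert w V)
  define Te where "Te = (\<lambda>e. {t \<in> T. t w = e})"
  have "\<exists>a. (\<Sum>t\<in>Te (s w). c t * (\<Prod>v\<in>V. a v ^ t v)) \<noteq> 0"
  proof (rule insert.IH[where s=s])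
    show "finite (Te (s w))" using insert by (simp add: Te_def)
    show "s \<in> Te (s w)" "c s \<noteq> 0" using insert by (auto simp: Te_def)
    fix u t assume "u \<in> Te (s w)" "t \<in> Te (s w)" "\<forall>v\<in>V. u v = t v"
    then show "u = t" using insert.prems(2)[of u t] by (auto simp: Te_def)
  qed
  then obtain a where a: "(\<Sum>t\<in>Te (s w). c t * (\<Prod>v\<in>V. a v ^ t v)) \<noteq> 0" by blast
  define q where "q = (\<lambda>e. \<Sum>t\<in>Te e. c t * (\<Prod>v\<in>V. a v ^ t v))"
  define E where "E = (\<lambda>t. t w) ` T"
  have fE: "finite E" using insert by (simp add: E_def)
  show ?case
  proof (rule ccontr)
    assume n: "\<not> ?case"
    have "(\<Sum>e\<in>E. q e * b ^ e) = 0" for b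
    proof -
      have pr: "(\<Prod>v\<in>insert w V. (a(w := b)) v ^ t v) = b ^ t w * (\<Prod>v\<in>V. a v ^ t v)" for t
      proof -
        have "(\<Prod>v\<in>V. (a(w := b)) v ^ t v) = (\<Prod>v\<in>V. a v ^ t v)"
          by (rule prod.cong) (use insert in auto)
        then show ?thesis using insert by simp
      qed
      have "(\<Sum>e\<in>E. q e * b ^ e) = (\<Sum>e\<in>E. \<Sum>t\<in>{t \<in> T. t w = e}. c t * (\<Prod>v\<in>insert w V. (a(w := b)) v ^ t v))"
        unfolding q_def Te_def pr
        by (intro sum.cong refl) (simp add: sum_distrib_right sum_distrib_left mult_ac)
      also have "\<dots> = (\<Sum>t\<in>T. c t * (\<Prod>v\<in>insert w V. (a(w := b)) v ^ t v))"
        unfolding E_def by (rule sum.image_gen[symmetric]) (use insert in simp)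
      finally show ?thesis using n by auto
    qed
    from poly_vanishing_sum[OF fE this, of "s w"] have "q (s w) = 0" using insert by (auto simp: E_def)
    with a show False by (simp add: q_def)
  qed
qed

lemma mpol_nonvanishing:
  fixes p :: "('v, 'a::zero) mpol" and h :: "'a \<Rightarrow> 'b::field_char_0"
  assumes "p \<noteq> 0" and h: "\<And>a. a \<in> Poly_Mapping.range p \<Longrightarrow> h a \<noteq> 0"
  obtains a where "mpol_eval h a p \<noteq> 0"
proof -
  let ?V = "mpol_vars p" and ?T = "Poly_Mapping.lookup ` Poly_Mapping.keys p"
  define g :: "('v \<Rightarrow> nat) \<Rightarrow> ('v \<Rightarrow>\<^sub>0 nat)" where "g = inv_into (Poly_Mapping.keys p) Poly_Mapping.lookup"
  have inj: "inj_on Poly_Mapping.lookup (Poly_Mapping.keys p)"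
    by (auto simp: inj_on_def lookup_inject)
  have g: "g (Poly_Mapping.lookup t) = t" if "t \<in> Poly_Mapping.keys p" for t
    unfolding g_def using inv_into_f_f[OF inj that] .
  have fV: "finite ?V" by (auto simp: mpol_vars_def)
  obtain t where t: "t \<in> Poly_Mapping.keys p" using assms(1) by (metis ex_in_conv keys_eq_empty)
  have "\<exists>a. (\<Sum>t\<in>?T. h (Poly_Mapping.lookup p (g t)) * (\<Prod>v\<in>?V. a v ^ t v)) \<noteq> 0"
  proof (rule monomials_nonvanishing[OF fV])
    show "finite ?T" by simp
    show "Poly_Mapping.lookup t \<in> ?T" using t by simp
    show "h (Poly_Mapping.lookup p (g (Poly_Mapping.lookup t))) \<noteq> 0" using t g h by simp
    fix s u assume "s \<in> ?T" "u \<in> ?T" and e: "\<forall>v\<in>?V. s v = u v"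
    then obtain s' u' where su: "s = Poly_Mapping.lookup s'" "u = Poly_Mapping.lookup u'"
      "s' \<in> Poly_Mapping.keys p" "u' \<in> Poly_Mapping.keys p" by blast
    show "s = u"
    proof
      fix v show "s v = u v"
      proof (cases "v \<in> ?V")
        case False
        then have "v \<notin> Poly_Mapping.keys s'" "v \<notin> Poly_Mapping.keys u'" using su by (auto simp: mpol_vars_def)
        then show ?thesis using su by (simp add: in_keys_iff)
      qed (use e in auto)
    qed
  qed
  then obtain a where a: "(\<Sum>t\<in>?T. h (Poly_Mapping.lookup p (g t)) * (\<Prod>v\<in>?V. a v ^ t v)) \<noteq> 0" by blast
  have "(\<Sum>t\<in>?T. h (Poly_Mapping.lookup p (g t)) * (\<Prod>v\<in>?V. a v ^ t v)) =
      (\<Sum>t\<in>Poly_Mapping.keys p. h (Poly_Mapping.lookup p t) * (\<Prod>v\<in>?V. a v ^ Poly_Mapping.lookup t v))"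
    unfolding sum.reindex[OF inj] by (rule sum.cong) (simp_all add: g)
  also have "\<dots> = mpol_eval h a p"
    unfolding mpol_eval_def monom_eval_def[symmetric]
    by (intro sum.cong refl arg_cong2[where f="(*)"] monom_eval_superset[symmetric] fV)
      (auto simp: mpol_vars_def)
  finally show ?thesis using a that by simp
qed

section \<open>Homomorphisms of rational function fields\<close>

lemma hom_Fract: "hom_on UNIV (\<lambda>p :: 'a::idom. Fraction_Field.Fract p 1)"
  by (simp add: hom_on_def subring_UNIV One_fract_def)

lemma rf_const_eq: "rf_const = (\<lambda>a. Fraction_Field.Fract (mpol_const a) 1)"
  by (rule ext) (simp add: rf_const_def)

lemma hom_rf_const: "hom_on UNIV rf_const"
  unfolding rf_const_eq using hom_on_comp[OF hom_mpol_const hom_Fract] by (simp add: comp_def)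

lemma mpol_eval_rf: "mpol_eval rf_const rf_var p = Fraction_Field.Fract p 1"
proof -
  have "Fraction_Field.Fract (mpol_eval mpol_const mpol_var p) 1 =
      mpol_eval (\<lambda>a. Fraction_Field.Fract (mpol_const a) 1) (\<lambda>v. Fraction_Field.Fract (mpol_var v) 1) p"
    by (rule hom_on_mpol_eval[OF hom_Fract]) auto
  then show ?thesis by (simp add: mpol_eval_self rf_const_eq rf_var_def[abs_def])
qed

text \<open>
  A fraction is evaluated at an arbitrarily chosen representation; for injective \<open>\<phi>\<close> the choice
  does not matter.
\<close>

definition fract_lift :: "('a::idom \<Rightarrow> 'b::field) \<Rightarrow> 'a fract \<Rightarrow> 'b" where
  "fract_lift \<phi> f = (let ab = (SOME ab. snd ab \<noteq> 0 \<and> f = Fraction_Field.Fract (fst ab) (snd ab)) in \<phi> (fst ab) / \<phi> (snd ab))"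

lemma fract_lift_Fract:
  assumes f: "hom_on UNIV f" and inj: "\<And>a. f a = 0 \<Longrightarrow> a = 0" and b: "b \<noteq> 0"
  shows "fract_lift f (Fraction_Field.Fract a b) = f a / f b"
proof -
  define ab where "ab = (SOME ab. snd ab \<noteq> 0 \<and> Fraction_Field.Fract a b = Fraction_Field.Fract (fst ab) (snd ab))"
  have ab: "snd ab \<noteq> 0 \<and> Fraction_Field.Fract a b = Fraction_Field.Fract (fst ab) (snd ab)"
    unfolding ab_def by (rule someI[of _ "(a, b)"]) (use b in simp)
  then have "a * snd ab = fst ab * b" using b Fraction_Field.eq_fract(1)[of b "snd ab" a "fst ab"] by simp
  then have "f a * f (snd ab) = f (fst ab) * f b" using hom_on_mult[OF f] by (metis UNIV_I)
  moreover have "f b \<noteq> 0" "f (snd ab) \<noteq> 0" using inj b ab by blast+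
  ultimately show ?thesis unfolding fract_lift_def ab_def[symmetric] Let_def by (simp add: frac_eq_eq)
qed

lemma hom_fract_lift:
  assumes f: "hom_on UNIV f" and inj: "\<And>a. f a = 0 \<Longrightarrow> a = 0"
  shows "hom_on UNIV (fract_lift f)"
proof -
  note l = fract_lift_Fract[OF f inj]
  have "fract_lift f 1 = 1" using l[of 1 1] by (simp add: One_fract_def hom_on_one[OF f])
  moreover have "fract_lift f (x + y) = fract_lift f x + fract_lift f y \<and>
      fract_lift f (x * y) = fract_lift f x * fract_lift f y" for x y
  proof -
    obtain a b where x: "x = Fraction_Field.Fract a b" "b \<noteq> 0" by (cases x) auto
    obtain c d where y: "y = Fraction_Field.Fract c d" "d \<noteq> 0" by (cases y) auto
    have nz: "f b \<noteq> 0" "f d \<noteq> 0" using inj x y by blast+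
    show ?thesis using x y nz
      by (simp add: l hom_on_add[OF f] hom_on_mult[OF f] add_frac_eq)
  qed
  ultimately show ?thesis by (simp add: hom_on_def subring_UNIV)
qed

definition rf_hom :: "('a::field \<Rightarrow> 'b::field) \<Rightarrow> (nat \<Rightarrow> 'b) \<Rightarrow> 'a ratfun \<Rightarrow> 'b" where
  "rf_hom c x = fract_lift (mpol_eval c x)"

text \<open>
  A substitution of rational functions is injective as soon as no polynomial relation holds between the
  substituted elements, and then extends to all rational functions.
\<close>

lemma rf_hom:
  assumes c: "hom_on UNIV c" and inj: "\<And>p. mpol_eval c x p = 0 \<Longrightarrow> p = 0"
  shows rf_hom_hom: "hom_on UNIV (rf_hom c x)"
    and rf_hom_const: "rf_hom c x (rf_const a) = c a"
    and rf_hom_var: "rf_hom c x (rf_var i) = x i"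
proof -
  note e = hom_mpol_eval[OF c, of x]
  show "hom_on UNIV (rf_hom c x)" unfolding rf_hom_def by (rule hom_fract_lift[OF e inj])
  have F: "rf_hom c x (Fraction_Field.Fract p 1) = mpol_eval c x p" for p
    unfolding rf_hom_def using fract_lift_Fract[OF e inj, of 1 p] by (simp add: hom_on_one[OF e])
  show "rf_hom c x (rf_const a) = c a"
    by (simp add: rf_const_def F mpol_eval_const[of c, OF hom_on_zero[OF c]])
  show "rf_hom c x (rf_var i) = x i"
    by (simp add: rf_var_def F mpol_eval_var[OF c])
qed

text \<open>
  Algebraic independence of polynomials \<open>P i\<close> can be tested at points: if every nonzero polynomial
  takes a nonzero value at some tuple of values of the \<open>P i\<close>, then the \<open>P i\<close> satisfy no relation.
\<close>

lemma mpol_eval_inj: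
  fixes c :: "'a::field \<Rightarrow> 'b::field"
  assumes c: "hom_on UNIV c" and x: "\<And>i. x i = Fraction_Field.Fract (P i) 1"
    and y: "\<And>p. p \<noteq> 0 \<Longrightarrow> \<exists>y. mpol_eval c (\<lambda>i. mpol_eval (\<lambda>b. b) y (P i)) p \<noteq> 0"
    and z: "mpol_eval (\<lambda>a. rf_const (c a)) x p = 0"
  shows "p = 0"
proof (rule ccontr)
  assume "p \<noteq> 0"
  have "mpol_eval (\<lambda>a. rf_const (c a)) x p = Fraction_Field.Fract (mpol_eval (\<lambda>a. mpol_const (c a)) P p) 1"
    using hom_on_mpol_eval(1)[OF hom_Fract, of p "\<lambda>a. mpol_const (c a)" P] by (simp add: rf_const_def x[abs_def])
  with z have z': "mpol_eval (\<lambda>a. mpol_const (c a)) P p = 0"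
    by (simp add: Zero_fract_def Fraction_Field.eq_fract)
  obtain b where b: "mpol_eval c (\<lambda>i. mpol_eval (\<lambda>b. b) b (P i)) p \<noteq> 0" using y[OF \<open>p \<noteq> 0\<close>] by blast
  have id: "hom_on UNIV (\<lambda>b::'b. b)" by (simp add: hom_on_def subring_UNIV)
  have "mpol_eval (\<lambda>b. b) b (mpol_eval (\<lambda>a. mpol_const (c a)) P p) = mpol_eval c (\<lambda>i. mpol_eval (\<lambda>b. b) b (P i)) p"
    by (subst mpol_eval_comp[OF id]) (simp add: mpol_eval_const)
  with z' b show False by (simp add: mpol_eval_def)
qed

lemma range_nonzero: "a \<in> Poly_Mapping.range p \<Longrightarrow> a \<noteq> 0"
  by (transfer) auto

text \<open>
  In particular, polynomials that define a surjective map on points are algebraically independent. This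
  is the form used for invertible linear substitutions and for translations.
\<close>

lemma mpol_eval_inj_points:
  fixes c :: "'a::field \<Rightarrow> 'b::field_char_0"
  assumes c: "hom_on UNIV c" and x: "\<And>i. x i = Fraction_Field.Fract (P i) 1"
    and y: "\<And>a :: nat \<Rightarrow> 'b. \<exists>y. \<forall>i. mpol_eval (\<lambda>b. b) y (P i) = a i"
    and z: "mpol_eval (\<lambda>a. rf_const (c a)) x p = 0"
  shows "p = 0"
proof (rule mpol_eval_inj[OF c x _ z])
  fix p :: "(nat, 'a) mpol" assume "p \<noteq> 0"
  then obtain a where a: "mpol_eval c a p \<noteq> 0"
    using mpol_nonvanishing[of p c] hom_UNIV_eq_0[OF c] range_nonzero by metis
  obtain b where "\<forall>i. mpol_eval (\<lambda>b. b) b (P i) = a i" using y by blast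
  with a show "\<exists>y. mpol_eval c (\<lambda>i. mpol_eval (\<lambda>b. b) y (P i)) p \<noteq> 0" by (intro exI[of _ b]) simp
qed

lemma fract_map_eq_lift:
  fixes f :: "'a::idom \<Rightarrow> 'a"
  assumes f: "hom_on UNIV f" and inj: "\<And>a. f a = 0 \<Longrightarrow> a = 0"
  shows "fract_map f = fract_lift (\<lambda>a. Fraction_Field.Fract (f a) 1)"
proof
  fix x :: "'a fract"
  obtain a b where x: "x = Fraction_Field.Fract a b" "b \<noteq> 0" by (cases x) auto
  have nz: "f b \<noteq> 0" using inj x by blast
  have h: "hom_on UNIV (\<lambda>a. Fraction_Field.Fract (f a) 1)"
    using hom_on_comp[OF f hom_Fract] by (simp add: comp_def)
  have i: "Fraction_Field.Fract (f a) 1 = 0 \<Longrightarrow> a = 0" for a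
    using inj by (auto simp: Zero_fract_def Fraction_Field.eq_fract)
  show "fract_map f x = fract_lift (\<lambda>a. Fraction_Field.Fract (f a) 1) x"
    using x nz fract_map_Fract[of f b a] inj hom_on_mult[OF f] fract_lift_Fract[OF h i x(2), of a]
    by simp
qed

lemma mpol_map_eq:
  assumes "hom_on UNIV \<sigma>" shows "Poly_Mapping.map \<sigma> p = mpol_eval (\<lambda>a. mpol_const (\<sigma> a)) mpol_var p"
proof -
  have s0: "\<sigma> 0 = 0" by (rule hom_on_zero[OF assms])
  have k: "Poly_Mapping.keys (Poly_Mapping.map \<sigma> p) \<subseteq> Poly_Mapping.keys p"
    by (auto simp: in_keys_iff Poly_Mapping.map.rep_eq when_def split: if_splits)
  have l: "Poly_Mapping.lookup (Poly_Mapping.map \<sigma> p) t = \<sigma> (Poly_Mapping.lookup p t)" for t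
    by (simp add: Poly_Mapping.map.rep_eq when_def s0)
  have c0: "mpol_const 0 = 0" by (simp add: mpol_const_def)
  have "Poly_Mapping.map \<sigma> p = mpol_eval mpol_const mpol_var (Poly_Mapping.map \<sigma> p)"
    by (simp add: mpol_eval_self)
  also have "\<dots> = mpol_eval (\<lambda>a. mpol_const (\<sigma> a)) mpol_var p"
    using mpol_eval_superset[of mpol_const "Poly_Mapping.keys p" "Poly_Mapping.map \<sigma> p" mpol_var, OF c0 _ k]
      mpol_eval_superset[of "\<lambda>a. mpol_const (\<sigma> a)" "Poly_Mapping.keys p" p mpol_var] by (simp add: l s0 c0)
  finally show ?thesis .
qed

lemma galois_act_hom:
  fixes \<sigma> :: "'a::field \<Rightarrow> 'a"
  assumes s: "hom_on UNIV \<sigma>"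
  shows "hom_on UNIV (galois_act \<sigma>)"
    and "galois_act \<sigma> (rf_const a) = rf_const (\<sigma> a)" and "galois_act \<sigma> (rf_var i) = rf_var i"
proof -
  let ?f = "Poly_Mapping.map \<sigma> :: (nat, 'a) mpol \<Rightarrow> (nat, 'a) mpol"
  have c: "hom_on UNIV (\<lambda>a. mpol_const (\<sigma> a))"
    using hom_on_comp[OF s hom_mpol_const] by (simp add: comp_def)
  have f: "hom_on UNIV ?f"
    using hom_mpol_eval[OF c, of mpol_var] by (simp add: mpol_map_eq[OF s, abs_def])
  have inj: "?f p = 0 \<Longrightarrow> p = 0" for p
    by (auto simp: map_eq_zero_iff hom_UNIV_eq_0[OF s] in_keys_iff intro: poly_mapping_eqI)
  have h: "hom_on UNIV (\<lambda>a. Fraction_Field.Fract (?f a) 1)"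
    using hom_on_comp[OF f hom_Fract] by (simp add: comp_def)
  have i: "Fraction_Field.Fract (?f a) 1 = 0 \<Longrightarrow> a = 0" for a
    using inj by (auto simp: Zero_fract_def Fraction_Field.eq_fract)
  have g: "galois_act \<sigma> = fract_lift (\<lambda>a. Fraction_Field.Fract (?f a) 1)"
    unfolding galois_act_def by (rule fract_map_eq_lift[OF f inj])
  show "hom_on UNIV (galois_act \<sigma>)" unfolding g by (rule hom_fract_lift[OF h i])
  have one: "?f 1 = 1" by (rule hom_on_one[OF f])
  show "galois_act \<sigma> (rf_const a) = rf_const (\<sigma> a)" "galois_act \<sigma> (rf_var i) = rf_var i"
    unfolding g rf_const_def rf_var_def using fract_lift_Fract[OF h i, of 1] one
    by (simp_all add: mpol_const_def mpol_var_def map_single hom_on_zero[OF s] hom_on_one[OF s] One_fract_def[symmetric])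
qed

section \<open>Linear algebra\<close>

lemma index_mult_mat_sum:
  assumes "A \<in> carrier_mat a b" "B \<in> carrier_mat b c" "i < a" "j < c"
  shows "(A * B) $$ (i, j) = (\<Sum>l<b. A $$ (i, l) * B $$ (l, j))"
  using assms by (simp add: scalar_prod_def atLeast0LessThan)

lemma mult_mat_vec_index_sum:
  assumes "A \<in> carrier_mat a b" "v \<in> carrier_vec b" "i < a"
  shows "(A *\<^sub>v v) $ i = (\<Sum>l<b. A $$ (i, l) * v $ l)"
  using assms by (simp add: scalar_prod_def atLeast0LessThan)

lemma mat_inverse_exists:
  fixes A :: "'a::field mat"
  assumes A: "A \<in> carrier_mat n n" and d: "det A \<noteq> 0"
  obtains Ai where "Ai \<in> carrier_mat n n" "A * Ai = 1\<^sub>m n" "Ai * A = 1\<^sub>m n"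
proof -
  have "A \<in> Units (ring_mat TYPE('a) n ())" by (rule det_non_zero_imp_unit[OF A d])
  then show ?thesis using that by (auto simp: Units_def ring_mat_def)
qed

lemma mat_kernel_trivial:
  fixes A :: "'a::field mat"
  assumes A: "A \<in> carrier_mat n n" and k: "\<And>v. v \<in> carrier_vec n \<Longrightarrow> A *\<^sub>v v = 0\<^sub>v n \<Longrightarrow> v = 0\<^sub>v n"
  shows "det A \<noteq> 0"
  using det_0_iff_vec_prod_zero_field[OF A] k by blast

lemma det_in_subring:
  assumes R: "subring_set R" and A: "A \<in> carrier_mat n n" and e: "\<And>i j. i < n \<Longrightarrow> j < n \<Longrightarrow> A $$ (i, j) \<in> R"
  shows "det A \<in> R"
proof -
  have "signof p \<in> R" for p :: "nat \<Rightarrow> nat"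
    using subring_one[OF R] subring_minus[OF R subring_one[OF R]] by (simp add: sign_def)
  moreover have "A $$ (i, p i) \<in> R" if "p permutes {0..<n}" "i \<in> {0..<n}" for p i
  proof -
    have "p i \<in> {0..<n}" using permutes_in_image[OF that(1), of i] that(2) by blast
    then show ?thesis using e that(2) by simp
  qed
  ultimately show ?thesis
    unfolding det_def'[OF A] by (intro subring_sum[OF R] subring_mult[OF R] subring_prod[OF R]) auto
qed

text \<open>
  The inverse is the adjugate matrix divided by the determinant, and both are polynomial in the entries.
\<close>

lemma inverse_in_subfield:
  fixes A :: "'a::field mat"
  assumes F: "subfield_set F" and A: "A \<in> carrier_mat n n" and e: "\<And>i j. i < n \<Longrightarrow> j < n \<Longrightarrow> A $$ (i, j) \<in> F"
    and B: "B \<in> carrier_mat n n" "B * A = 1\<^sub>m n" and ij: "i < n" "j < n"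
  shows "B $$ (i, j) \<in> F"
proof -
  note R = subfield_subring[OF F] and adj = adj_mat[OF A]
  have "det B * det A = 1" using det_mult[OF B(1) A] B(2) by simp
  then have d: "det A \<noteq> 0" by auto
  have "B * (A * adj_mat A) = adj_mat A"
    using assoc_mult_mat[OF B(1) A adj(1)] B(2) adj(1) by simp
  then have "B * (det A \<cdot>\<^sub>m 1\<^sub>m n) = adj_mat A" using adj(2) by simp
  moreover have "B * (det A \<cdot>\<^sub>m 1\<^sub>m n) = det A \<cdot>\<^sub>m B"
    using mult_smult_distrib[OF B(1), of "1\<^sub>m n" n "det A"] B(1) by simp
  ultimately have "det A * B $$ (i, j) = adj_mat A $$ (i, j)" using B(1) ij by (metis carrier_matD index_smult_mat(1))
  also have "adj_mat A $$ (i, j) = cofactor A j i" using A ij by (simp add: adj_mat_def)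
  finally have "B $$ (i, j) = cofactor A j i / det A" using d by (simp add: field_simps)
  moreover have "cofactor A j i \<in> F"
  proof -
    have "mat_delete A j i \<in> carrier_mat (n - 1) (n - 1)" using A by (simp add: mat_delete_def)
    moreover have "mat_delete A j i $$ (u, v) \<in> F" if "u < n - 1" "v < n - 1" for u v
      using that A e by (auto simp: mat_delete_def)
    ultimately have "det (mat_delete A j i) \<in> F" by (rule det_in_subring[OF R])
    then show ?thesis unfolding cofactor_def
      by (intro subring_mult[OF R] subring_power[OF R] subring_minus[OF R] subring_one[OF R])
  qed
  moreover have "det A \<in> F" by (rule det_in_subring[OF R A e])
  ultimately show ?thesis using subfield_divide[OF F] by simp
qed

text \<open>
  A family of rows with trivial common kernel contains a basis. The index set \<open>E\<close> is arbitrary, so the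
  basis is found by exchange: the rows of the identity matrix are replaced one at a time.
\<close>

lemma select_rows:
  fixes R :: "'x \<Rightarrow> nat \<Rightarrow> 'b::field"
  assumes k: "\<And>c. (\<And>x. x \<in> E \<Longrightarrow> (\<Sum>i<m. R x i * c i) = 0) \<Longrightarrow> \<forall>i<m. c i = 0"
  obtains f where "\<And>r. r < m \<Longrightarrow> f r \<in> E" "det (mat m m (\<lambda>(r, i). R (f r) i)) \<noteq> 0"
proof -
  have "\<exists>M f. M \<in> carrier_mat m m \<and> det M \<noteq> 0 \<and> (\<forall>r<k. f r \<in> E \<and> (\<forall>i<m. M $$ (r, i) = R (f r) i))" if "k \<le> m" for k
    using that
  proof (induction k)
    case 0
    show ?case by (rule exI[of _ "1\<^sub>m m"]) auto
  next
    case (Suc k)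
    then obtain M f where M: "M \<in> carrier_mat m m" "det M \<noteq> 0"
      and f: "\<forall>r<k. f r \<in> E \<and> (\<forall>i<m. M $$ (r, i) = R (f r) i)" by auto
    obtain Mi where Mi: "Mi \<in> carrier_mat m m" "M * Mi = 1\<^sub>m m" "Mi * M = 1\<^sub>m m"
      using mat_inverse_exists[OF M] by blast
    \<comment> \<open>The vector \<open>c\<close> spans the kernel of all rows except row \<open>k\<close>. A row that does not kill \<open>c\<close> can take
      the place of row \<open>k\<close>.\<close>
    define c where "c = Mi *\<^sub>v unit_vec m k"
    have c: "c \<in> carrier_vec m" unfolding c_def using Mi(1) by simp
    have Mc: "M *\<^sub>v c = unit_vec m k"
      unfolding c_def using assoc_mult_mat_vec[OF M(1) Mi(1), of "unit_vec m k"] Mi(2) by simp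
    have "\<exists>x\<in>E. (\<Sum>i<m. R x i * c $ i) \<noteq> 0"
    proof (rule ccontr)
      assume "\<not> ?thesis"
      then have "\<forall>i<m. c $ i = 0" using k[of "\<lambda>i. c $ i"] by blast
      then have "c = 0\<^sub>v m" using c by (intro eq_vecI) auto
      moreover have "M *\<^sub>v 0\<^sub>v m = 0\<^sub>v m" using M(1) by (intro eq_vecI) auto
      ultimately have "unit_vec m k = (0\<^sub>v m :: 'b vec)" using Mc by simp
      then have "unit_vec m k $ k = (0\<^sub>v m :: 'b vec) $ k" by simp
      then show False using Suc.prems by simp
    qed
    then obtain x where x: "x \<in> E" "(\<Sum>i<m. R x i * c $ i) \<noteq> 0" by blast
    define M' where "M' = mat m m (\<lambda>(r, i). if r = k then R x i else M $$ (r, i))"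
    have M': "M' \<in> carrier_mat m m" by (simp add: M'_def)
    have "det M' \<noteq> 0"
    proof (rule mat_kernel_trivial[OF M'])
      fix v :: "'b vec" assume v: "v \<in> carrier_vec m" and z: "M' *\<^sub>v v = 0\<^sub>v m"
      define t where "t = (M *\<^sub>v v) $ k"
      have "(M *\<^sub>v v) $ r = (t \<cdot>\<^sub>v unit_vec m k) $ r" if r: "r < m" for r
      proof (cases "r = k")
        case False
        have "(M *\<^sub>v v) $ r = (M' *\<^sub>v v) $ r"
          unfolding mult_mat_vec_index_sum[OF M(1) v r] mult_mat_vec_index_sum[OF M' v r]
          using False r by (intro sum.cong) (auto simp: M'_def)
        then show ?thesis using z r False Suc.prems by simp
      qed (use r in \<open>simp add: t_def\<close>)
      then have "M *\<^sub>v v = t \<cdot>\<^sub>v unit_vec m k" using M(1) by (intro eq_vecI) auto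
      then have "Mi *\<^sub>v (M *\<^sub>v v) = t \<cdot>\<^sub>v c"
        unfolding c_def using mult_mat_vec[OF Mi(1), of "unit_vec m k" t] by simp
      then have vt: "v = t \<cdot>\<^sub>v c" using assoc_mult_mat_vec[OF Mi(1) M(1) v] Mi(3) v by simp
      have "0 = (M' *\<^sub>v v) $ k" using z Suc.prems by simp
      also have "\<dots> = (\<Sum>i<m. R x i * v $ i)"
        using mult_mat_vec_index_sum[OF M' v, of k] Suc.prems by (simp add: M'_def)
      also have "\<dots> = t * (\<Sum>i<m. R x i * c $ i)"
        unfolding vt sum_distrib_left using c by (intro sum.cong) (auto simp: mult_ac)
      finally have "t = 0" using x by simp
      then show "v = 0\<^sub>v m" using vt c by auto
    qed
    moreover have "\<forall>r<Suc k. (f(k := x)) r \<in> E \<and> (\<forall>i<m. M' $$ (r, i) = R ((f(k := x)) r) i)"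
      using f x Suc.prems by (auto simp: M'_def less_Suc_eq)
    ultimately show ?case using M' by blast
  qed
  from this[of m] obtain M f where M: "M \<in> carrier_mat m m" "det M \<noteq> 0"
    "\<forall>r<m. f r \<in> E \<and> (\<forall>i<m. M $$ (r, i) = R (f r) i)" by blast
  have "mat m m (\<lambda>(r, i). R (f r) i) = M" using M by (intro eq_matI) auto
  with M that show ?thesis by metis
qed

definition diag_mat_of :: "nat \<Rightarrow> (nat \<Rightarrow> 'a::zero) \<Rightarrow> 'a mat" where
  "diag_mat_of n d = mat n n (\<lambda>(i, j). if i = j then d i else 0)"

lemma diag_mat_of_carrier [simp]: "diag_mat_of n d \<in> carrier_mat n n"
  by (simp add: diag_mat_of_def)

lemma diag_mat_of_index: "i < n \<Longrightarrow> j < n \<Longrightarrow> diag_mat_of n d $$ (i, j) = (if i = j then d i else 0)"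
  by (simp add: diag_mat_of_def)

lemma diag_mat_of_mult: "diag_mat_of n d * diag_mat_of n e = diag_mat_of n (\<lambda>i. d i * e i :: 'a::comm_ring_1)"
proof (rule eq_matI)
  fix i j assume "i < dim_row (diag_mat_of n (\<lambda>i. d i * e i))" "j < dim_col (diag_mat_of n (\<lambda>i. d i * e i))"
  then have ij: "i < n" "j < n" by (auto simp: diag_mat_of_def)
  show "(diag_mat_of n d * diag_mat_of n e) $$ (i, j) = diag_mat_of n (\<lambda>i. d i * e i) $$ (i, j)"
    unfolding index_mult_mat_sum[OF diag_mat_of_carrier diag_mat_of_carrier ij] using ij
    by (auto simp: diag_mat_of_index if_distrib[of "\<lambda>x. x * _"] if_distrib[of "\<lambda>x. _ * x"] sum.If_cases cong: if_cong)
qed (auto simp: diag_mat_of_def)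

lemma diag_mat_of_transpose: "transpose_mat (diag_mat_of n d) = diag_mat_of n d"
  by (rule eq_matI) (auto simp: diag_mat_of_def)

lemma diag_mat_of_1: "(\<And>i. i < n \<Longrightarrow> d i = 1) \<Longrightarrow> diag_mat_of n d = 1\<^sub>m n"
  by (rule eq_matI) (auto simp: diag_mat_of_def)

lemma det_diag_nonzero:
  fixes d :: "nat \<Rightarrow> 'a::field"
  assumes "\<And>i. i < n \<Longrightarrow> d i \<noteq> 0" shows "det (diag_mat_of n d) \<noteq> 0"
proof -
  have "diag_mat_of n d * diag_mat_of n (\<lambda>i. 1 / d i) = 1\<^sub>m n"
    unfolding diag_mat_of_mult by (rule diag_mat_of_1) (use assms in simp)
  then have "det (diag_mat_of n d) * det (diag_mat_of n (\<lambda>i. 1 / d i)) = 1"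
    using det_mult[OF diag_mat_of_carrier diag_mat_of_carrier] by (metis det_one)
  then show ?thesis by auto
qed

lemma sum_delta_mult: "j < (n::nat) \<Longrightarrow> (\<Sum>i<n. f i * (if i = j then 1 else 0)) = (f j :: 'a::comm_ring_1)"
  by (simp add: if_distrib cong: if_cong)

text \<open>
  Gram-Schmidt over a subfield \<open>F\<close>. The matrix is only known to have entries in \<open>F\<close>; the point is that
  the orthogonal basis has coordinates in \<open>F\<close>, too. An orthogonal family of anisotropic vectors is
  enlarged by an anisotropic vector of its orthogonal complement. If there were none, polarization would
  make the form vanish on the complement; by nondegeneracy the complement would then be zero, and the
  family would already span.
\<close>

lemma diagonalize_symmetric:
  fixes S :: "'b::field mat"
  assumes F: "subfield_set F" and two: "(2::'b) \<noteq> 0" and S: "S \<in> carrier_mat n n"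
    and SF: "\<And>i j. i < n \<Longrightarrow> j < n \<Longrightarrow> S $$ (i, j) \<in> F"
    and sym: "\<And>i j. i < n \<Longrightarrow> j < n \<Longrightarrow> S $$ (i, j) = S $$ (j, i)" and det: "det S \<noteq> 0"
  obtains B d where "B \<in> carrier_mat n n" "\<And>i j. i < n \<Longrightarrow> j < n \<Longrightarrow> B $$ (i, j) \<in> F" "det B \<noteq> 0"
    "\<And>i. i < n \<Longrightarrow> d i \<in> F \<and> d i \<noteq> 0" "transpose_mat B * S * B = diag_mat_of n d"
proof -
  note R = subfield_subring[OF F]
  define bf where "bf = (\<lambda>x y :: nat \<Rightarrow> 'b. \<Sum>i<n. \<Sum>j<n. x i * S $$ (i, j) * y j)"
  have bf_sym: "bf x y = bf y x" for x y
    unfolding bf_def by (subst sum.swap) (auto intro!: sum.cong simp: sym mult_ac)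
  have bf_addr: "bf x (\<lambda>i. y i + z i) = bf x y + bf x z" for x y z
    unfolding bf_def by (simp add: algebra_simps sum.distrib)
  have bf_smultr: "bf x (\<lambda>i. c * y i) = c * bf x y" for x y c
    unfolding bf_def by (simp add: sum_distrib_left mult_ac)
  have bf_sumr: "bf x (\<lambda>i. \<Sum>k<r. c k * y k i) = (\<Sum>k<r. c k * bf x (y k))" for x c y and r :: nat
  proof (induction r)
    case 0 show ?case by (simp add: bf_def)
  next
    case (Suc r)
    have "bf x (\<lambda>i. \<Sum>k<Suc r. c k * y k i) = bf x (\<lambda>i. (\<Sum>k<r. c k * y k i) + c r * y r i)" by simp
    also have "\<dots> = bf x (\<lambda>i. \<Sum>k<r. c k * y k i) + bf x (\<lambda>i. c r * y r i)" by (rule bf_addr)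
    finally show ?case using Suc by (simp add: bf_smultr)
  qed
  have bfF: "bf x y \<in> F" if "\<And>i. i < n \<Longrightarrow> x i \<in> F" "\<And>i. i < n \<Longrightarrow> y i \<in> F" for x y
    unfolding bf_def using that SF by (intro subring_sum[OF R] subring_mult[OF R]) auto
  have "\<exists>b :: nat \<Rightarrow> nat \<Rightarrow> 'b. (\<forall>i<r. \<forall>j<n. b i j \<in> F) \<and> (\<forall>i<r. \<forall>j<r. i \<noteq> j \<longrightarrow> bf (b i) (b j) = 0)
      \<and> (\<forall>i<r. bf (b i) (b i) \<noteq> 0)" if "r \<le> n" for r
    using that
  proof (induction r)
    case 0 show ?case by simp
  next
    case (Suc r)
    then obtain b :: "nat \<Rightarrow> nat \<Rightarrow> 'b" where b: "\<forall>i<r. \<forall>j<n. b i j \<in> F"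
      "\<forall>i<r. \<forall>j<r. i \<noteq> j \<longrightarrow> bf (b i) (b j) = 0" "\<forall>i<r. bf (b i) (b i) \<noteq> 0" by auto
    have bF: "\<And>i j. i < r \<Longrightarrow> j < n \<Longrightarrow> b i j \<in> F"
      and orth: "\<And>i j. i < r \<Longrightarrow> j < r \<Longrightarrow> i \<noteq> j \<Longrightarrow> bf (b i) (b j) = 0"
      and nz: "\<And>i. i < r \<Longrightarrow> bf (b i) (b i) \<noteq> 0" using b by auto
    define e :: "nat \<Rightarrow> nat \<Rightarrow> 'b" where "e = (\<lambda>j i. if i = j then 1 else 0)"
    define co where "co = (\<lambda>j k. - bf (b k) (e j) / bf (b k) (b k))"
    \<comment> \<open>The projection of the unit vector \<open>e j\<close> to the orthogonal complement of the vectors \<open>b k\<close>.\<close>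
    define pr where "pr = (\<lambda>j i. e j i + (\<Sum>k<r. co j k * b k i))"
    have bpr: "bf (b k) (pr j) = 0" if k: "k < r" for k j
    proof -
      have "(\<Sum>l<r. co j l * bf (b k) (b l)) = (\<Sum>l<r. if l = k then co j k * bf (b k) (b k) else 0)"
        by (intro sum.cong) (use orth k in auto)
      then have "bf (b k) (pr j) = bf (b k) (e j) + co j k * bf (b k) (b k)"
        unfolding pr_def bf_addr bf_sumr using k by simp
      then show ?thesis using nz[OF k] by (simp add: co_def)
    qed
    have prb: "bf (pr j) (b k) = 0" if "k < r" for j k using bpr[OF that] bf_sym by simp
    have eF: "e j i \<in> F" for i j using subring_one[OF R] subring_zero[OF R] by (simp add: e_def)
    have coF: "co j k \<in> F" if "k < r" for j k unfolding co_def
      using that by (intro subfield_divide[OF F] subring_minus[OF R] bfF bF eF) auto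
    have prF: "pr j i \<in> F" if "i < n" for i j unfolding pr_def
      using that by (intro subring_add[OF R] eF subring_sum[OF R] subring_mult[OF R] coF bF) auto
    have "\<exists>x. (\<forall>i<n. x i \<in> F) \<and> (\<forall>k<r. bf (b k) x = 0) \<and> bf x x \<noteq> 0"
    proof (rule ccontr)
      assume no: "\<not> ?thesis"
      have iso: "bf (pr j) (pr j) = 0" for j using no bpr prF by blast
      have pp: "bf (pr i) (pr j) = 0" for i j
      proof -
        let ?x = "\<lambda>l. pr i l + pr j l"
        have "(\<forall>l<n. ?x l \<in> F) \<and> (\<forall>k<r. bf (b k) ?x = 0)"
          using prF bpr by (auto simp: bf_addr intro: subring_add[OF R])
        then have "bf ?x ?x \<noteq> 0 \<Longrightarrow> \<exists>x. (\<forall>i<n. x i \<in> F) \<and> (\<forall>k<r. bf (b k) x = 0) \<and> bf x x \<noteq> 0"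
          by (intro exI[of _ ?x]) simp
        with no have "bf ?x ?x = 0" by argo
        moreover have "bf ?x ?x = bf (pr i) (pr i) + 2 * bf (pr i) (pr j) + bf (pr j) (pr j)"
          using bf_addr[of ?x "pr i" "pr j"] bf_sym[of ?x "pr i"] bf_sym[of ?x "pr j"]
            bf_addr[of "pr i" "pr i" "pr j"] bf_addr[of "pr j" "pr i" "pr j"] bf_sym[of "pr j" "pr i"] by simp
        ultimately show ?thesis using iso two by simp
      qed
      have ep: "bf (e i) (pr j) = 0" for i j
      proof -
        have "bf (pr j) (\<lambda>l. e i l + (\<Sum>k<r. co i k * b k l)) =
            bf (pr j) (e i) + (\<Sum>k<r. co i k * bf (pr j) (b k))"
          by (simp only: bf_addr bf_sumr)
        moreover have "(\<lambda>l. e i l + (\<Sum>k<r. co i k * b k l)) = pr i" by (simp add: pr_def)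
        ultimately have "bf (pr j) (pr i) = bf (pr j) (e i) + (\<Sum>k<r. co i k * bf (pr j) (b k))" by simp
        then show ?thesis using pp prb bf_sym[of "e i" "pr j"] by simp
      qed
      have pr0: "pr j i = 0" if "i < n" for i j
      proof -
        define v where "v = vec n (pr j)"
        have v: "v \<in> carrier_vec n" by (simp add: v_def)
        have "S *\<^sub>v v = 0\<^sub>v n"
        proof (rule eq_vecI)
          fix i assume "i < dim_vec (0\<^sub>v n :: 'b vec)"
          then have i: "i < n" by simp
          have "bf (e i) (pr j) = (\<Sum>l<n. S $$ (i, l) * pr j l)"
          proof -
            have "bf (e i) (pr j) = (\<Sum>k<n. if k = i then (\<Sum>l<n. S $$ (i, l) * pr j l) else 0)"
              unfolding bf_def by (intro sum.cong refl) (simp add: e_def)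
            then show ?thesis using i by simp
          qed
          then show "(S *\<^sub>v v) $ i = 0\<^sub>v n $ i"
            using ep i unfolding mult_mat_vec_index_sum[OF S v i] by (simp add: v_def)
        qed (use S in simp)
        then have "v = 0\<^sub>v n" using det det_0_iff_vec_prod_zero_field[OF S] v by blast
        then have "v $ i = 0\<^sub>v n $ i" by simp
        then show ?thesis using that by (simp add: v_def)
      qed
      \<comment> \<open>All projections vanish, so the \<open>r\<close> vectors \<open>b k\<close> generate all unit vectors: \<open>M * N = 1\<close>, although
        column \<open>r\<close> of \<open>M\<close> is zero.\<close>
      define M where "M = mat n n (\<lambda>(l, k). if k < r then b k l else 0)"
      define N where "N = mat n n (\<lambda>(k, j). - co j k)"
      have MN: "M \<in> carrier_mat n n" "N \<in> carrier_mat n n" by (auto simp: M_def N_def)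
      have "M * N = 1\<^sub>m n"
      proof (rule eq_matI)
        fix i j assume "i < dim_row (1\<^sub>m n :: 'b mat)" "j < dim_col (1\<^sub>m n :: 'b mat)"
        then have ij: "i < n" "j < n" by auto
        have "(M * N) $$ (i, j) = (\<Sum>k<n. if k < r then - (co j k * b k i) else 0)"
          unfolding index_mult_mat_sum[OF MN ij] using ij by (intro sum.cong) (auto simp: M_def N_def)
        also have "\<dots> = (\<Sum>k<r. - (co j k * b k i))"
          by (rule sum.mono_neutral_cong_right) (use Suc.prems in auto)
        also have "\<dots> = e j i" using pr0[OF ij(1), of j] by (simp add: pr_def sum_negf add_eq_0_iff2)
        finally show "(M * N) $$ (i, j) = 1\<^sub>m n $$ (i, j)" using ij by (simp add: e_def)
      qed (auto simp: M_def N_def)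
      then have "det M * det N = 1" using det_mult[OF MN] by simp
      moreover have "det M = 0"
      proof -
        have rn: "r < n" using Suc.prems by simp
        have "M *\<^sub>v unit_vec n r = 0\<^sub>v n"
        proof (rule eq_vecI)
          fix i assume "i < dim_vec (0\<^sub>v n :: 'b vec)"
          then have i: "i < n" by simp
          show "(M *\<^sub>v unit_vec n r) $ i = 0\<^sub>v n $ i"
            unfolding mult_mat_vec_index_sum[OF MN(1) unit_vec_carrier i] using i rn
            by (auto simp: M_def unit_vec_def intro!: sum.neutral)
        qed (use MN in simp)
        moreover have "unit_vec n r \<noteq> (0\<^sub>v n :: 'b vec)"
        proof
          assume "unit_vec n r = (0\<^sub>v n :: 'b vec)"
          then have "unit_vec n r $ r = (0\<^sub>v n :: 'b vec) $ r" by simp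
          then show False using rn by simp
        qed
        ultimately show ?thesis
          using det_0_iff_vec_prod_zero_field[OF MN(1)] unit_vec_carrier by blast
      qed
      ultimately show False by simp
    qed
    then obtain x where x: "\<forall>i<n. x i \<in> F" "\<forall>k<r. bf (b k) x = 0" "bf x x \<noteq> 0" by blast
    have x2: "\<forall>k<r. bf x (b k) = 0" using x(2) bf_sym by simp
    let ?b = "b(r := x)"
    have "?b i j \<in> F" if "i < Suc r" "j < n" for i j using that x(1) bF by (cases "i = r") auto
    moreover have "bf (?b i) (?b j) = 0" if "i < Suc r" "j < Suc r" "i \<noteq> j" for i j
      using that x(2) x2 orth by (cases "i = r"; cases "j = r") auto
    moreover have "bf (?b i) (?b i) \<noteq> 0" if "i < Suc r" for i
      using that x(3) nz by (cases "i = r") auto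
    ultimately show ?case by blast
  qed
  from this[of n] obtain b :: "nat \<Rightarrow> nat \<Rightarrow> 'b" where b: "\<forall>i<n. \<forall>j<n. b i j \<in> F"
    "\<forall>i<n. \<forall>j<n. i \<noteq> j \<longrightarrow> bf (b i) (b j) = 0" "\<forall>i<n. bf (b i) (b i) \<noteq> 0" by auto
  have bF: "\<And>i j. i < n \<Longrightarrow> j < n \<Longrightarrow> b i j \<in> F"
    and orth: "\<And>i j. i < n \<Longrightarrow> j < n \<Longrightarrow> i \<noteq> j \<Longrightarrow> bf (b i) (b j) = 0"
    and nz: "\<And>i. i < n \<Longrightarrow> bf (b i) (b i) \<noteq> 0" using b by auto
  define B where "B = mat n n (\<lambda>(l, i). b i l)"
  define d where "d = (\<lambda>i. bf (b i) (b i))"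
  have B: "B \<in> carrier_mat n n" "transpose_mat B \<in> carrier_mat n n" by (auto simp: B_def)
  have TS: "transpose_mat B * S \<in> carrier_mat n n" using B S by simp
  have eq: "transpose_mat B * S * B = diag_mat_of n d"
  proof (rule eq_matI)
    fix i j assume "i < dim_row (diag_mat_of n d)" "j < dim_col (diag_mat_of n d)"
    then have ij: "i < n" "j < n" by (auto simp: diag_mat_of_def)
    have "(transpose_mat B * S * B) $$ (i, j) = (\<Sum>l<n. (\<Sum>k<n. b i k * S $$ (k, l)) * b j l)"
      unfolding index_mult_mat_sum[OF TS B(1) ij]
    proof (intro sum.cong refl)
      fix l assume "l \<in> {..<n}"
      then have l: "l < n" by simp
      show "(transpose_mat B * S) $$ (i, l) * B $$ (l, j) = (\<Sum>k<n. b i k * S $$ (k, l)) * b j l"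
        unfolding index_mult_mat_sum[OF B(2) S ij(1) l] using ij l by (simp add: B_def)
    qed
    also have "\<dots> = bf (b i) (b j)" unfolding bf_def sum_distrib_right by (rule sum.swap)
    finally show "(transpose_mat B * S * B) $$ (i, j) = diag_mat_of n d $$ (i, j)"
      using ij orth by (auto simp: diag_mat_of_index d_def)
  qed (use B S in \<open>auto simp: diag_mat_of_def\<close>)
  have "det (transpose_mat B * S * B) = det (transpose_mat B * S) * det B"
    by (rule det_mult[OF TS B(1)])
  moreover have "det (diag_mat_of n d) \<noteq> 0" by (rule det_diag_nonzero) (simp add: d_def nz)
  ultimately have "det B \<noteq> 0" using eq by auto
  moreover have "d i \<in> F \<and> d i \<noteq> 0" if "i < n" for i
    unfolding d_def using nz that by (auto intro: bfF bF)
  moreover have "B $$ (i, j) \<in> F" if "i < n" "j < n" for i j using that bF by (simp add: B_def)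
  ultimately show ?thesis using that B(1) eq by blast
qed

text \<open>
  Over an algebraically closed field the diagonal form has square roots.
\<close>

lemma symmetric_square:
  fixes S :: "'b::{alg_closed_field,field_char_0} mat"
  assumes S: "S \<in> carrier_mat n n" and sym: "\<And>i j. i < n \<Longrightarrow> j < n \<Longrightarrow> S $$ (i, j) = S $$ (j, i)"
    and det: "det S \<noteq> 0"
  obtains W where "W \<in> carrier_mat n n" "S = transpose_mat W * W"
proof -
  have U: "subfield_set (UNIV :: 'b set)" by (simp add: subfield_set_def subring_UNIV)
  obtain B d where B: "B \<in> carrier_mat n n" "det B \<noteq> 0" and eq: "transpose_mat B * S * B = diag_mat_of n d"
    by (rule diagonalize_symmetric[OF U _ S _ sym det]) auto
  obtain Bi where Bi: "Bi \<in> carrier_mat n n" "B * Bi = 1\<^sub>m n" "Bi * B = 1\<^sub>m n"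
    using mat_inverse_exists[OF B] by blast
  have "\<forall>i. \<exists>r. r ^ 2 = d i" using nth_root_exists[of 2] by auto
  then obtain r where r: "\<And>i. r i ^ 2 = d i" by metis
  let ?E = "diag_mat_of n r" and ?T = "transpose_mat"
  have T: "?T Bi \<in> carrier_mat n n" "?T B \<in> carrier_mat n n" using B Bi by auto
  have tb: "?T Bi * ?T B = 1\<^sub>m n"
    using transpose_mult[OF B(1) Bi(1)] Bi(2) by simp
  have "?T (?E * Bi) * (?E * Bi) = ?T Bi * ?T ?E * (?E * Bi)"
    using transpose_mult[OF diag_mat_of_carrier Bi(1)] by simp
  also have "\<dots> = ?T Bi * (?E * ?E) * Bi"
    using assoc_mult_mat[OF T(1) diag_mat_of_carrier[of n r] diag_mat_of_carrier[of n r]] T(1)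
      assoc_mult_mat[OF mult_carrier_mat[OF T(1) diag_mat_of_carrier[of n r]] diag_mat_of_carrier[of n r] Bi(1)]
    by (simp add: diag_mat_of_transpose)
  also have "?E * ?E = ?T B * S * B"
    unfolding eq diag_mat_of_mult using r by (simp add: power2_eq_square)
  also have "?T Bi * (?T B * S * B) * Bi = (?T Bi * ?T B) * S * (B * Bi)"
    using T B Bi S by (simp add: assoc_mult_mat[of _ n n _ n _ n])
  also have "\<dots> = S" using tb Bi S by simp
  finally have "S = ?T (?E * Bi) * (?E * Bi)" by (rule HOL.sym)
  then show ?thesis by (rule that[OF mult_carrier_mat[OF diag_mat_of_carrier Bi(1)]])
qed

text \<open>
  Linear independence of the characters of the group \<open>{\<plusminus>1}\<^sup>S\<close>, by adding and subtracting the two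
  values at one sign.
\<close>

lemma sign_separation:
  fixes a :: "'i set \<Rightarrow> 'b::field_char_0"
  assumes "finite S" and "\<And>\<epsilon>. (\<forall>j. \<epsilon> j = 1 \<or> \<epsilon> j = - 1) \<Longrightarrow> (\<Sum>I\<in>Pow S. (\<Prod>j\<in>I. \<epsilon> j) * a I) = 0"
    and "I \<subseteq> S"
  shows "a I = 0"
  using assms
proof (induction S arbitrary: a I rule: finite_induct)
  case empty
  show ?case using empty(1)[of "\<lambda>_. 1"] empty(2) by simp
next
  case (insert x S)
  have split: "(\<Sum>I\<in>Pow (insert x S). f I) = (\<Sum>I\<in>Pow S. f I + f (insert x I))" for f :: "'i set \<Rightarrow> 'b"
  proof -
    have "inj_on (insert x) (Pow S)" using insert.hyps by (auto simp: inj_on_def)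
    then show ?thesis
      unfolding Pow_insert using insert.hyps
      by (subst sum.union_disjoint) (auto simp: sum.reindex sum.distrib)
  qed
  have key: "a I + s * a (insert x I) = 0" if s: "s = 1 \<or> s = - 1" and I: "I \<subseteq> S" for s I
  proof (rule insert.IH[where a="\<lambda>I. a I + s * a (insert x I)", OF _ I])
    fix \<epsilon> :: "'i \<Rightarrow> 'b" assume e: "\<forall>j. \<epsilon> j = 1 \<or> \<epsilon> j = - 1"
    let ?e = "\<epsilon>(x := s)"
    have "(\<Sum>I\<in>Pow (insert x S). (\<Prod>j\<in>I. ?e j) * a I) = 0" using insert.prems(1)[of ?e] e s by auto
    moreover have "(\<Prod>j\<in>I. ?e j) * a I + (\<Prod>j\<in>insert x I. ?e j) * a (insert x I) =
        (\<Prod>j\<in>I. \<epsilon> j) * (a I + s * a (insert x I))" if "I \<in> Pow S" for I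
    proof -
      have x: "x \<notin> I" "finite I" using that insert.hyps by (auto intro: finite_subset)
      have "(\<Prod>j\<in>I. ?e j) = (\<Prod>j\<in>I. \<epsilon> j)" by (rule prod.cong) (use x in auto)
      then show ?thesis using x by (simp add: algebra_simps)
    qed
    ultimately show "(\<Sum>I\<in>Pow S. (\<Prod>j\<in>I. \<epsilon> j) * (a I + s * a (insert x I))) = 0"
      unfolding split by (subst sum.cong[OF refl, symmetric]) assumption+
  qed
  have both: "a J = 0" "a (insert x J) = 0" if "J \<subseteq> S" for J
  proof -
    have p: "a J + a (insert x J) = 0" and m: "a J - a (insert x J) = 0" using key[OF _ that, of 1] key[OF _ that, of "-1"] by auto
    have "2 * a J = (a J + a (insert x J)) + (a J - a (insert x J))" by simp
    then show "a J = 0" unfolding p m by simp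
    then show "a (insert x J) = 0" using p by simp
  qed
  show ?case
  proof (cases "x \<in> I")
    case True
    then have "I = insert x (I - {x})" "I - {x} \<subseteq> S" using insert.prems by auto
    then show ?thesis using both by metis
  next
    case False
    then have "I \<subseteq> S" using insert.prems(2) by auto
    then show ?thesis by (rule both(1))
  qed
qed

section \<open>Descent of fixed elements\<close>

definition kspan :: "'a::field set \<Rightarrow> 'a set \<Rightarrow> 'a set" where
  "kspan K M = {\<Sum>l\<in>M. c l * l |c. \<forall>l\<in>M. c l \<in> K}"

definition kindep :: "'a::field set \<Rightarrow> 'a set \<Rightarrow> bool" where
  "kindep K M \<longleftrightarrow> (\<forall>c. (\<forall>l\<in>M. c l \<in> K) \<longrightarrow> (\<Sum>l\<in>M. c l * l) = 0 \<longrightarrow> (\<forall>l\<in>M. c l = 0))"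

lemma kindepD:
  assumes "kindep K M" "\<And>l. l \<in> M \<Longrightarrow> c l \<in> K" "(\<Sum>l\<in>M. c l * l) = 0" "l \<in> M"
  shows "c l = 0"
  using assms(1)[unfolded kindep_def, rule_format, of c] assms(2-4) by simp

lemma kspanI: "(\<And>l. l \<in> M \<Longrightarrow> c l \<in> K) \<Longrightarrow> (\<Sum>l\<in>M. c l * l) \<in> kspan K M"
  unfolding kspan_def by blast

lemma kspanE:
  assumes "x \<in> kspan K M" obtains c where "\<And>l. l \<in> M \<Longrightarrow> c l \<in> K" "x = (\<Sum>l\<in>M. c l * l)"
  using assms unfolding kspan_def by blast

lemma kspan_closed:
  assumes K: "subring_set K"
  shows kspan_0: "0 \<in> kspan K M"
    and kspan_add: "x \<in> kspan K M \<Longrightarrow> y \<in> kspan K M \<Longrightarrow> x + y \<in> kspan K M"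
    and kspan_diff: "x \<in> kspan K M \<Longrightarrow> y \<in> kspan K M \<Longrightarrow> x - y \<in> kspan K M"
    and kspan_scale: "a \<in> K \<Longrightarrow> x \<in> kspan K M \<Longrightarrow> a * x \<in> kspan K M"
proof -
  show "0 \<in> kspan K M" using kspanI[of M "\<lambda>_. 0" K] subring_zero[OF K] by simp
  show "x + y \<in> kspan K M" if xy: "x \<in> kspan K M" "y \<in> kspan K M"
  proof -
    obtain c where c: "\<And>l. l \<in> M \<Longrightarrow> c l \<in> K" "x = (\<Sum>l\<in>M. c l * l)" using xy(1) by (rule kspanE) blast
    obtain d where d: "\<And>l. l \<in> M \<Longrightarrow> d l \<in> K" "y = (\<Sum>l\<in>M. d l * l)" using xy(2) by (rule kspanE) blast
    have "(\<Sum>l\<in>M. (c l + d l) * l) \<in> kspan K M" by (rule kspanI) (use c d subring_add[OF K] in blast)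
    then show ?thesis using c d by (simp add: algebra_simps sum.distrib)
  qed
  show "x - y \<in> kspan K M" if xy: "x \<in> kspan K M" "y \<in> kspan K M"
  proof -
    obtain c where c: "\<And>l. l \<in> M \<Longrightarrow> c l \<in> K" "x = (\<Sum>l\<in>M. c l * l)" using xy(1) by (rule kspanE) blast
    obtain d where d: "\<And>l. l \<in> M \<Longrightarrow> d l \<in> K" "y = (\<Sum>l\<in>M. d l * l)" using xy(2) by (rule kspanE) blast
    have "(\<Sum>l\<in>M. (c l - d l) * l) \<in> kspan K M" by (rule kspanI) (use c d subring_diff[OF K] in blast)
    then show ?thesis using c d by (simp add: left_diff_distrib sum_subtractf)
  qed
  show "a * x \<in> kspan K M" if ax: "a \<in> K" "x \<in> kspan K M"
  proof -
    obtain c where c: "\<And>l. l \<in> M \<Longrightarrow> c l \<in> K" "x = (\<Sum>l\<in>M. c l * l)" using ax(2) by (rule kspanE) blast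
    have "(\<Sum>l\<in>M. (a * c l) * l) \<in> kspan K M" by (rule kspanI) (use c ax subring_mult[OF K] in blast)
    then show ?thesis using c by (simp add: sum_distrib_left mult_ac)
  qed
qed

lemma kspan_sum:
  assumes K: "subring_set K" and "\<And>i. i \<in> I \<Longrightarrow> f i \<in> kspan K M" shows "sum f I \<in> kspan K M"
  using assms(2) by (induction I rule: infinite_finite_induct) (auto intro: kspan_closed[OF K])

lemma kspan_gen:
  assumes K: "subring_set K" and M: "finite M" "l \<in> M" shows "l \<in> kspan K M"
proof -
  have "(\<Sum>u\<in>M. (if u = l then 1 else 0) * u) \<in> kspan K M"
    by (rule kspanI) (auto intro: subring_one[OF K] subring_zero[OF K])
  also have "(\<Sum>u\<in>M. (if u = l then 1 else 0) * u) = (\<Sum>u\<in>M. if u = l then l else 0)"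
    by (rule sum.cong) auto
  also have "\<dots> = l" using M by simp
  finally show ?thesis .
qed

lemma kspan_subsetI:
  assumes K: "subring_set K" and "\<And>l. l \<in> M \<Longrightarrow> l \<in> kspan K M'" shows "kspan K M \<subseteq> kspan K M'"
proof
  fix x assume "x \<in> kspan K M"
  then obtain c where c: "\<And>l. l \<in> M \<Longrightarrow> c l \<in> K" "x = (\<Sum>l\<in>M. c l * l)" by (rule kspanE) blast
  show "x \<in> kspan K M'" unfolding c(2) by (intro kspan_sum[OF K] kspan_scale[OF K] c(1) assms(2))
qed

lemma kspan_mono:
  assumes K: "subring_set K" and "finite M'" "M \<subseteq> M'" shows "kspan K M \<subseteq> kspan K M'"
  using assms by (intro kspan_subsetI[OF K] kspan_gen[OF K]) auto

lemma kspan_basis: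
  assumes K: "subfield_set K" and M: "finite M"
  obtains M' where "M' \<subseteq> M" "kindep K M'" "kspan K M \<subseteq> kspan K M'"
  using M
proof (induction M arbitrary: thesis rule: finite_psubset_induct)
  case (psubset M)
  note R = subfield_subring[OF K]
  show ?case
  proof (cases "kindep K M")
    case True
    show ?thesis by (rule psubset.prems[OF _ True]) auto
  next
    case False
    then obtain c l where c: "\<And>l. l \<in> M \<Longrightarrow> c l \<in> K" "(\<Sum>l\<in>M. c l * l) = 0" "l \<in> M" "c l \<noteq> 0"
      unfolding kindep_def by blast
    let ?M = "M - {l}"
    have "c l * l + (\<Sum>u\<in>?M. c u * u) = 0" using c(2) psubset.hyps c(3) by (simp add: sum.remove)
    then have "l = (\<Sum>u\<in>?M. c u * u) * (- (1 / c l))" using c(4) by (simp add: field_simps add_eq_0_iff)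
    also have "\<dots> = (\<Sum>u\<in>?M. (- (c u / c l)) * u)"
      unfolding sum_distrib_right by (rule sum.cong) simp_all
    finally have "l = (\<Sum>u\<in>?M. (- (c u / c l)) * u)" .
    also have "\<dots> \<in> kspan K ?M"
      by (rule kspanI) (use c in \<open>auto intro!: subring_minus[OF R] subfield_divide[OF K]\<close>)
    finally have l: "l \<in> kspan K ?M" .
    have "u \<in> kspan K ?M" if "u \<in> M" for u
      using l kspan_gen[OF R, of ?M u] psubset.hyps that by (cases "u = l") auto
    then have sub: "kspan K M \<subseteq> kspan K ?M" by (rule kspan_subsetI[OF R])
    obtain M' where "M' \<subseteq> ?M" "kindep K M'" "kspan K ?M \<subseteq> kspan K M'"
      using psubset.IH[of ?M] c(3) by blast
    then show ?thesis using psubset.prems[of M'] sub by blast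
  qed
qed

lemma gen_ring_kspan:
  assumes K: "subring_set K" and x: "x \<in> gen_ring (K \<union> Y)"
  obtains M where "finite M" "M \<subseteq> gen_ring Y" "x \<in> kspan K M"
proof -
  have one: "a \<in> kspan K {1}" if "a \<in> K" for a using kspan_scale[OF K that kspan_gen[OF K, of "{1}" 1]] by simp
  have "\<exists>M. finite M \<and> M \<subseteq> gen_ring Y \<and> x \<in> kspan K M" using x
  proof induction
    case gen_ring_one
    show ?case using one[OF subring_one[OF K]] by (intro exI[of _ "{1}"]) (auto intro: gen_ring.gen_ring_one)
  next
    case (gen_ring_incl x)
    show ?case
    proof (cases "x \<in> K")
      case True
      then show ?thesis using one by (intro exI[of _ "{1}"]) (auto intro: gen_ring.gen_ring_one)
    next
      case False
      then have "x \<in> Y" using gen_ring_incl by simp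
      then show ?thesis using kspan_gen[OF K, of "{x}" x] by (intro exI[of _ "{x}"]) (auto intro: gen_ring.gen_ring_incl)
    qed
  next
    case (gen_ring_diff x y)
    then obtain M N where "finite M" "M \<subseteq> gen_ring Y" "x \<in> kspan K M" "finite N" "N \<subseteq> gen_ring Y" "y \<in> kspan K N" by blast
    then show ?case using kspan_mono[OF K, of "M \<union> N" M] kspan_mono[OF K, of "M \<union> N" N]
      by (intro exI[of _ "M \<union> N"]) (auto intro!: kspan_diff[OF K])
  next
    case (gen_ring_mult x y)
    then obtain M N where MN: "finite M" "M \<subseteq> gen_ring Y" "x \<in> kspan K M" "finite N" "N \<subseteq> gen_ring Y" "y \<in> kspan K N" by blast
    define P where "P = (\<lambda>(u, v). u * v) ` (M \<times> N)"
    have P: "finite P" "P \<subseteq> gen_ring Y" using MN by (auto simp: P_def intro!: gen_ring.gen_ring_mult)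
    obtain c where c: "\<And>l. l \<in> M \<Longrightarrow> c l \<in> K" "x = (\<Sum>l\<in>M. c l * l)" using MN(3) by (rule kspanE) blast
    obtain d where d: "\<And>l. l \<in> N \<Longrightarrow> d l \<in> K" "y = (\<Sum>l\<in>N. d l * l)" using MN(6) by (rule kspanE) blast
    have "x * y = (\<Sum>u\<in>M. \<Sum>v\<in>N. (c u * d v) * (u * v))"
      unfolding c(2) d(2) sum_product by (intro sum.cong refl) (simp add: mult_ac)
    also have "\<dots> \<in> kspan K P"
      by (intro kspan_sum[OF K] kspan_scale[OF K] subring_mult[OF K] c d kspan_gen[OF K P(1)])
        (auto simp: P_def)
    finally show ?case using P by blast
  qed
  then show ?thesis using that by blast
qed

text \<open>
  Artin's argument. Choose a nonzero element of \<open>D\<close> with the fewest coefficients in the basis \<open>M\<close> and scale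
  one coefficient to 1. Its difference with its image under \<open>g\<close> lies in \<open>D\<close> and has fewer coefficients,
  hence is zero.
\<close>

lemma fixed_in_stable_subspace:
  assumes K: "subfield_set K" and g: "\<And>g. g \<in> \<Gamma> \<Longrightarrow> hom_on UNIV g" "\<And>g a. g \<in> \<Gamma> \<Longrightarrow> a \<in> K \<Longrightarrow> g a \<in> K"
    and M: "finite M" "kindep K M" and fixM: "\<And>g l. g \<in> \<Gamma> \<Longrightarrow> l \<in> M \<Longrightarrow> g l = l"
    and D: "D \<subseteq> kspan K M" "\<And>x y. x \<in> D \<Longrightarrow> y \<in> D \<Longrightarrow> x - y \<in> D" "\<And>a x. a \<in> K \<Longrightarrow> x \<in> D \<Longrightarrow> a * x \<in> D"
      "\<And>g x. g \<in> \<Gamma> \<Longrightarrow> x \<in> D \<Longrightarrow> g x \<in> D"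
    and x: "x \<in> D" "x \<noteq> 0"
  obtains d where "d \<in> D" "d \<noteq> 0" "\<And>g. g \<in> \<Gamma> \<Longrightarrow> g d = d"
proof -
  note R = subfield_subring[OF K]
  define good where "good = (\<lambda>c. (\<forall>l\<in>M. c l \<in> K) \<and> (\<Sum>l\<in>M. c l * l) \<in> D \<and> (\<exists>l\<in>M. c l \<noteq> 0))"
  let ?s = "\<lambda>c. card {l \<in> M. c l \<noteq> 0}"
  obtain c0 where "\<And>l. l \<in> M \<Longrightarrow> c0 l \<in> K" "x = (\<Sum>l\<in>M. c0 l * l)" using D(1) x(1) by (auto elim: kspanE)
  moreover have "\<exists>l\<in>M. c0 l \<noteq> 0"
  proof (rule ccontr)
    assume "\<not> ?thesis"
    then have "(\<Sum>l\<in>M. c0 l * l) = 0" by (intro sum.neutral) auto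
    with calculation x(2) show False by simp
  qed
  ultimately have "good c0" using x(1) unfolding good_def by blast
  then obtain c where c: "good c" and least: "\<And>d. good d \<Longrightarrow> ?s c \<le> ?s d"
    using ex_has_least_nat[of good c0 ?s] by blast
  obtain l0 where l0: "l0 \<in> M" "c l0 \<noteq> 0" using c by (auto simp: good_def)
  define e where "e = (\<lambda>l. c l / c l0)"
  have cK: "\<And>l. l \<in> M \<Longrightarrow> c l \<in> K" using c by (auto simp: good_def)
  have eK: "e l \<in> K" if "l \<in> M" for l unfolding e_def using subfield_divide[OF K cK[OF that] cK[OF l0(1)]] .
  define d where "d = (\<Sum>l\<in>M. e l * l)"
  have "d = (1 / c l0) * (\<Sum>l\<in>M. c l * l)" by (simp add: d_def e_def sum_distrib_left)
  moreover have "1 / c l0 \<in> K" by (rule subfield_divide[OF K subring_one[OF R] cK[OF l0(1)]])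
  from D(3)[OF this] c have "(1 / c l0) * (\<Sum>l\<in>M. c l * l) \<in> D" unfolding good_def by blast
  ultimately have dD: "d \<in> D" by (simp only:)
  have "d \<noteq> 0"
  proof
    assume "d = 0"
    then have "e l0 = 0" using kindepD[OF M(2) eK _ l0(1)] by (simp add: d_def)
    then show False using l0 by (simp add: e_def)
  qed
  moreover have "g d = d" if G: "g \<in> \<Gamma>" for g
  proof -
    note h = g(1)[OF G]
    have "g d = (\<Sum>l\<in>M. g (e l * l))" unfolding d_def by (rule hom_on_sum[OF h]) simp
    also have "\<dots> = (\<Sum>l\<in>M. g (e l) * l)"
      by (rule sum.cong[OF refl]) (simp add: hom_on_mult[OF h] fixM[OF G])
    finally have gd: "g d = (\<Sum>l\<in>M. g (e l) * l)" .
    \<comment> \<open>The coefficients of \<open>g d - d\<close>; the one at \<open>l0\<close> cancels because \<open>e l0 = 1\<close>.\<close>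
    define f where "f = (\<lambda>l. g (e l) - e l)"
    have fd: "(\<Sum>l\<in>M. f l * l) = g d - d"
      unfolding gd by (simp add: d_def f_def left_diff_distrib sum_subtractf)
    have "\<not> good f"
    proof
      assume "good f"
      then have "?s c \<le> ?s f" by (rule least)
      moreover have "{l \<in> M. f l \<noteq> 0} \<subset> {l \<in> M. c l \<noteq> 0}"
      proof
        show "{l \<in> M. f l \<noteq> 0} \<subseteq> {l \<in> M. c l \<noteq> 0}"
          by (auto simp: f_def e_def hom_on_zero[OF h])
        have "f l0 = 0" using l0 by (simp add: f_def e_def hom_on_one[OF h])
        then show "{l \<in> M. f l \<noteq> 0} \<noteq> {l \<in> M. c l \<noteq> 0}" using l0 by blast
      qed
      then have "?s f < ?s c" using M(1) by (intro psubset_card_mono) auto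
      ultimately show False by simp
    qed
    moreover have "(\<Sum>l\<in>M. f l * l) \<in> D" unfolding fd by (rule D(2)[OF D(4)[OF G dD] dD])
    moreover have "\<forall>l\<in>M. f l \<in> K" using subring_diff[OF R g(2)[OF G eK] eK] by (simp add: f_def)
    ultimately have "\<forall>l\<in>M. f l = 0" by (auto simp: good_def)
    then have "(\<Sum>l\<in>M. f l * l) = 0" by (intro sum.neutral) auto
    then show ?thesis using fd by simp
  qed
  ultimately show ?thesis using that dD by blast
qed

lemma kindep_coeff_eq:
  assumes K: "subring_set K" and M: "kindep K M" and "\<And>l. l \<in> M \<Longrightarrow> c l \<in> K" "\<And>l. l \<in> M \<Longrightarrow> d l \<in> K"
    and "(\<Sum>l\<in>M. c l * l) = (\<Sum>l\<in>M. d l * l)" and "l \<in> M"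
  shows "c l = d l"
proof -
  have "(\<Sum>l\<in>M. (c l - d l) * l) = 0" using assms(5) by (simp add: left_diff_distrib sum_subtractf)
  then have "c l - d l = 0"
    by (rule kindepD[OF M, of "\<lambda>l. c l - d l", rotated]) (use assms subring_diff[OF K] in auto)
  then show ?thesis by simp
qed

text \<open>
  The denominators \<open>d\<close> for which all \<open>d * f j\<close> are combinations of \<open>M\<close> over \<open>K\<close> form a \<open>K\<close>-space. It is
  stable under \<open>\<Gamma>\<close> because \<open>\<Gamma>\<close> mixes the \<open>f j\<close> linearly over \<open>K\<close>, so it contains a nonzero fixed
  element. This plays the role of Hilbert's Theorem 90 for the general linear group.
\<close>

lemma common_fixed_denominator:
  fixes K :: "'a::field set"
  assumes K: "subfield_set K" and g: "\<And>g. g \<in> \<Gamma> \<Longrightarrow> hom_on UNIV g" "\<And>g a. g \<in> \<Gamma> \<Longrightarrow> a \<in> K \<Longrightarrow> g a \<in> K"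
    and Y: "\<And>g y. g \<in> \<Gamma> \<Longrightarrow> y \<in> Y \<Longrightarrow> g y = y"
    and J: "finite J" "\<And>j. j \<in> J \<Longrightarrow> f j \<in> gen_subfield (K \<union> Y)"
    and span: "\<And>g j. g \<in> \<Gamma> \<Longrightarrow> j \<in> J \<Longrightarrow> \<exists>c. (\<forall>i\<in>J. c i \<in> K) \<and> f j = (\<Sum>i\<in>J. c i * g (f i))"
  obtains b M where "finite M" "M \<subseteq> gen_ring Y" "kindep K M" "b \<noteq> 0" "b \<in> kspan K M"
    "\<And>g. g \<in> \<Gamma> \<Longrightarrow> g b = b" "\<And>j. j \<in> J \<Longrightarrow> b * f j \<in> kspan K M"
proof -
  note R = subfield_subring[OF K]
  let ?R = "gen_ring (K \<union> Y)"
  have "\<exists>b. b \<in> ?R \<and> b \<noteq> 0 \<and> (\<forall>j\<in>J. b * f j \<in> ?R)" using J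
  proof (induction J rule: finite_induct)
    case empty
    show ?case by (rule exI[of _ 1]) (auto intro: gen_ring_one)
  next
    case (insert j J)
    then obtain b where b: "b \<in> ?R" "b \<noteq> 0" "\<forall>j\<in>J. b * f j \<in> ?R" by auto
    obtain u v where uv: "u \<in> ?R" "v \<in> ?R" "v \<noteq> 0" "f j = u / v"
      using insert.prems[of j] by (auto elim: gen_subfield_quotient)
    have "b * v * f i \<in> ?R" if "i \<in> insert j J" for i
    proof (cases "i = j")
      case True
      then have "b * v * f i = b * u" using uv by simp
      then show ?thesis using gen_ring_mult[OF b(1) uv(1)] by (simp only:)
    next
      case False
      then have "b * f i \<in> ?R" using b(3) that by simp
      from gen_ring_mult[OF uv(2) this] show ?thesis by (simp add: mult_ac)
    qed
    moreover have "b * v \<in> ?R" by (rule gen_ring_mult[OF b(1) uv(2)])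
    ultimately show ?case using b(2) uv(3) by (intro exI[of _ "b * v"]) simp
  qed
  then obtain b0 where b0: "b0 \<in> ?R" "b0 \<noteq> 0" "\<And>j. j \<in> J \<Longrightarrow> b0 * f j \<in> ?R" by blast
  have "\<exists>M. finite M \<and> M \<subseteq> gen_ring Y \<and> T \<subseteq> kspan K M" if "finite T" "T \<subseteq> ?R" for T
    using that
  proof (induction T rule: finite_induct)
    case (insert t T)
    then obtain M where M: "finite M" "M \<subseteq> gen_ring Y" "T \<subseteq> kspan K M" by auto
    obtain N where N: "finite N" "N \<subseteq> gen_ring Y" "t \<in> kspan K N"
      using gen_ring_kspan[OF R, of t Y] insert.prems by auto
    show ?case using M N kspan_mono[OF R, of "M \<union> N" M] kspan_mono[OF R, of "M \<union> N" N]
      by (intro exI[of _ "M \<union> N"]) auto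
  qed auto
  from this[of "insert b0 ((\<lambda>j. b0 * f j) ` J)"] obtain M0 where M0: "finite M0" "M0 \<subseteq> gen_ring Y"
    "insert b0 ((\<lambda>j. b0 * f j) ` J) \<subseteq> kspan K M0" using b0 J(1) by auto
  \<comment> \<open>Finitely many products of elements of \<open>Y\<close> suffice to express one denominator and the numerators;
    linear independence over \<open>K\<close> can be achieved by discarding some of them.\<close>
  obtain M where M: "M \<subseteq> M0" "kindep K M" "kspan K M0 \<subseteq> kspan K M" using kspan_basis[OF K M0(1)] by blast
  have fM: "finite M" "M \<subseteq> gen_ring Y" using M M0 by (auto intro: finite_subset)
  have fixY: "g l = l" if "g \<in> \<Gamma>" "l \<in> gen_ring Y" for g l
    using that(2) by induction (simp_all add: Y[OF that(1)] hom_onD[OF g(1)[OF that(1)]])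
  have fixM: "g l = l" if "g \<in> \<Gamma>" "l \<in> M" for g l using fixY[OF that(1)] fM(2) that(2) by blast
  have gspan: "g x \<in> kspan K M" if G: "g \<in> \<Gamma>" and x: "x \<in> kspan K M" for g x
  proof -
    obtain c where c: "\<And>l. l \<in> M \<Longrightarrow> c l \<in> K" "x = (\<Sum>l\<in>M. c l * l)" using x by (rule kspanE) blast
    have "g x = (\<Sum>l\<in>M. g (c l) * l)"
      unfolding c(2) using fixM[OF G] by (simp add: hom_on_sum[OF g(1)[OF G]] hom_on_mult[OF g(1)[OF G]])
    also have "\<dots> \<in> kspan K M" by (rule kspanI) (rule g(2)[OF G c(1)])
    finally show ?thesis .
  qed
  \<comment> \<open>The space of possible denominators.\<close>
  define D where "D = {d \<in> kspan K M. \<forall>j\<in>J. d * f j \<in> kspan K M}"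
  have b0D: "b0 \<in> D" using M0(3) M(3) by (auto simp: D_def)
  have gD: "g d \<in> D" if G: "g \<in> \<Gamma>" and d: "d \<in> D" for g d
  proof -
    have "g d * f j \<in> kspan K M" if j: "j \<in> J" for j
    proof -
      obtain c where c: "\<forall>i\<in>J. c i \<in> K" "f j = (\<Sum>i\<in>J. c i * g (f i))" using span[OF G j] by blast
      have "g d * f j = (\<Sum>i\<in>J. c i * g (d * f i))"
        unfolding c(2) by (simp add: sum_distrib_left hom_on_mult[OF g(1)[OF G]] mult_ac)
      also have "\<dots> \<in> kspan K M"
      proof (intro kspan_sum[OF R] kspan_scale[OF R])
        fix i assume i: "i \<in> J"
        show "c i \<in> K" using c(1) i by blast
        show "g (d * f i) \<in> kspan K M" by (rule gspan[OF G]) (use d i in \<open>simp add: D_def\<close>)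
      qed
      finally show ?thesis .
    qed
    then show ?thesis using d gspan[OF G] by (simp add: D_def)
  qed
  obtain b where "b \<in> D" "b \<noteq> 0" "\<And>g. g \<in> \<Gamma> \<Longrightarrow> g b = b"
  proof (rule fixed_in_stable_subspace[where K=K and \<Gamma>=\<Gamma> and M=M and D=D and x=b0,
        OF K _ _ fM(1) M(2) _ _ _ _ _ b0D b0(2)])
    show "D \<subseteq> kspan K M" by (auto simp: D_def)
    show "x - y \<in> D" if "x \<in> D" "y \<in> D" for x y
      using that by (auto simp: D_def left_diff_distrib intro: kspan_diff[OF R])
    show "a * x \<in> D" if "a \<in> K" "x \<in> D" for a x
      using that by (auto simp: D_def mult.assoc intro: kspan_scale[OF R])
    show "hom_on UNIV h" if "h \<in> \<Gamma>" for h by (rule g(1)[OF that])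
    show "h a \<in> K" if "h \<in> \<Gamma>" "a \<in> K" for h a by (rule g(2)[OF that])
    show "h l = l" if "h \<in> \<Gamma>" "l \<in> M" for h l by (rule fixM[OF that])
    show "h x \<in> D" if "h \<in> \<Gamma>" "x \<in> D" for h x by (rule gD[OF that])
    fix d assume "d \<in> D" "d \<noteq> 0" and fd: "\<And>g. g \<in> \<Gamma> \<Longrightarrow> g d = d"
    then show thesis by (intro that[of d]) (assumption | rule fd)+
  qed
  then show ?thesis using that[OF fM M(2)] by (auto simp: D_def)
qed

text \<open>
  A fixed \<open>f\<close> has a fixed denominator, and hence a fixed numerator. The coefficients of a fixed
  combination of linearly independent fixed elements are fixed themselves.
\<close>

theorem fixed_field_descent:
  fixes K :: "'a::field set"
  assumes K: "subfield_set K" and g: "\<And>g. g \<in> \<Gamma> \<Longrightarrow> hom_on UNIV g" "\<And>g a. g \<in> \<Gamma> \<Longrightarrow> a \<in> K \<Longrightarrow> g a \<in> K"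
    and Y: "\<And>g y. g \<in> \<Gamma> \<Longrightarrow> y \<in> Y \<Longrightarrow> g y = y"
    and f: "f \<in> gen_subfield (K \<union> Y)" "\<And>g. g \<in> \<Gamma> \<Longrightarrow> g f = f"
  shows "f \<in> gen_subfield ({a \<in> K. \<forall>g\<in>\<Gamma>. g a = a} \<union> Y)"
proof -
  note R = subfield_subring[OF K]
  let ?K0 = "{a \<in> K. \<forall>g\<in>\<Gamma>. g a = a}"
  note F = subfield_gen_subfield[of "?K0 \<union> Y"]
  obtain b M where M: "finite M" "M \<subseteq> gen_ring Y" "kindep K M" and b: "b \<noteq> 0" "b \<in> kspan K M"
    "\<And>g. g \<in> \<Gamma> \<Longrightarrow> g b = b" "\<And>j. j \<in> {()} \<Longrightarrow> b * f \<in> kspan K M"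
  proof (rule common_fixed_denominator[where f="\<lambda>_. f" and J="{()}" and K=K and Y=Y and \<Gamma>=\<Gamma>, OF K])
    show "\<exists>c. (\<forall>i\<in>{()}. c i \<in> K) \<and> f = (\<Sum>i\<in>{()}. c i * g f)" if "g \<in> \<Gamma>" for g
      using f(2)[OF that] subring_one[OF R] by (intro exI[of _ "\<lambda>_. 1"]) simp
    show "hom_on UNIV h" if "h \<in> \<Gamma>" for h by (rule g(1)[OF that])
    show "h a \<in> K" if "h \<in> \<Gamma>" "a \<in> K" for h a by (rule g(2)[OF that])
    show "h y = y" if "h \<in> \<Gamma>" "y \<in> Y" for h y by (rule Y[OF that])
    show "finite {()}" by simp
    show "f \<in> gen_subfield (K \<union> Y)" by (rule f(1))
    fix b M assume "finite M" "M \<subseteq> gen_ring Y" "kindep K M" "b \<noteq> 0" "b \<in> kspan K M"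
      and fb: "\<And>g. g \<in> \<Gamma> \<Longrightarrow> g b = b" and bf: "\<And>j. j \<in> {()} \<Longrightarrow> b * f \<in> kspan K M"
    then show thesis by (intro that[of M b]) (assumption | rule fb | rule bf)+
  qed
  have fixM: "g l = l" if "g \<in> \<Gamma>" "l \<in> M" for g l
  proof -
    have "l \<in> gen_ring Y" using M(2) that(2) by blast
    then show ?thesis by induction (simp_all add: Y[OF that(1)] hom_onD[OF g(1)[OF that(1)]])
  qed
  have "gen_ring Y \<subseteq> gen_subfield (?K0 \<union> Y)"
    using gen_ring_subset_gen_subfield[of Y] gen_subfield_mono[of Y "?K0 \<union> Y"] by blast
  then have MF: "M \<subseteq> gen_subfield (?K0 \<union> Y)" using M(2) by blast
  have K0F: "?K0 \<subseteq> gen_subfield (?K0 \<union> Y)" using gen_subfield_incl[of "?K0 \<union> Y"] by blast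
  \<comment> \<open>Comparison of coefficients in \<open>g x = x\<close>.\<close>
  have key: "x \<in> gen_subfield (?K0 \<union> Y)" if x: "x \<in> kspan K M" "\<And>g. g \<in> \<Gamma> \<Longrightarrow> g x = x" for x
  proof -
    obtain c where c: "\<And>l. l \<in> M \<Longrightarrow> c l \<in> K" "x = (\<Sum>l\<in>M. c l * l)" using x(1) by (rule kspanE) blast
    have "g (c l) = c l" if G: "g \<in> \<Gamma>" and l: "l \<in> M" for g l
    proof (rule kindep_coeff_eq[OF R M(3) _ c(1) _ l])
      show "g (c l) \<in> K" if "l \<in> M" for l using g(2)[OF G c(1)[OF that]] .
      have "g x = (\<Sum>l\<in>M. g (c l) * l)"
        unfolding c(2) using fixM[OF G] by (simp add: hom_on_sum[OF g(1)[OF G]] hom_on_mult[OF g(1)[OF G]])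
      then show "(\<Sum>l\<in>M. g (c l) * l) = (\<Sum>l\<in>M. c l * l)" using x(2)[OF G] c(2) by simp
    qed
    then have "c l \<in> gen_subfield (?K0 \<union> Y)" if "l \<in> M" for l using c(1)[OF that] that K0F by blast
    then show ?thesis unfolding c(2) using MF
      by (intro subring_sum[OF subfield_subring[OF F]] subring_mult[OF subfield_subring[OF F]]) auto
  qed
  have "b \<in> gen_subfield (?K0 \<union> Y)" by (rule key[OF b(2)]) (rule b(3))
  moreover have "b * f \<in> gen_subfield (?K0 \<union> Y)"
  proof (rule key)
    show "b * f \<in> kspan K M" using b(4) by simp
    show "g (b * f) = b * f" if "g \<in> \<Gamma>" for g
      using hom_on_mult[OF g(1)[OF that], of b f] b(3)[OF that] f(2)[OF that] by simp
  qed
  ultimately have "b * f / b \<in> gen_subfield (?K0 \<union> Y)" by (rule subfield_divide[OF F, rotated])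
  then show ?thesis using b(1) by simp
qed

section \<open>The Galois-fixed elements of the algebraic closure\<close>

lemma to_ac_hom: "hom_on UNIV to_ac"
  by (simp add: hom_on_def subring_UNIV)

lemma algebraic_over_base:
  fixes y :: "'k::field alg_closure"
  obtains Q where "poly_over (range to_ac) Q" "Q \<noteq> 0" "poly Q y = 0"
proof -
  obtain p :: "'k poly" where p: "p \<noteq> 0" "poly (map_poly to_ac p) y = 0" by (rule alg_closure_algebraic)
  have "map_poly to_ac p \<noteq> 0" using p(1) by (simp add: map_poly_eq_0_iff)
  moreover have "poly_over (range to_ac) (map_poly to_ac p)" by (simp add: poly_over_def coeff_map_poly)
  ultimately show ?thesis using that p by blast
qed

text \<open>
  Zorn's lemma on graphs of partial homomorphisms. A maximal one is defined everywhere, since an element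
  \<open>y\<close> outside its domain is algebraic and can be sent to a root of the image of its minimal polynomial.
  The domains are subrings rather than subfields; injectivity follows from \<open>norm_multiple\<close>.
\<close>

lemma hom_extend_algebraic:
  fixes f :: "'k::field_char_0 alg_closure \<Rightarrow> 'k alg_closure"
  assumes f: "hom_on A f" and A: "range to_ac \<subseteq> A" and fk: "\<And>c. f (to_ac c) = to_ac c"
  obtains \<sigma> where "hom_on UNIV \<sigma>" "\<And>a. a \<in> A \<Longrightarrow> \<sigma> a = f a"
proof -
  define G0 where "G0 = (\<lambda>a. (a, f a)) ` A"
  define \<F> where "\<F> = {G :: ('k alg_closure \<times> 'k alg_closure) set. G0 \<subseteq> G \<and> single_valued G \<and>
     (\<forall>a b c d. (a, b) \<in> G \<longrightarrow> (c, d) \<in> G \<longrightarrow> (a - c, b - d) \<in> G \<and> (a * c, b * d) \<in> G)}"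
  have graph: "(\<lambda>a. (a, h a)) ` B \<in> \<F>" if h: "hom_on B h" and "A \<subseteq> B" "\<And>a. a \<in> A \<Longrightarrow> h a = f a" for B h
  proof -
    note B = hom_on_subring[OF h]
    have "G0 \<subseteq> (\<lambda>a. (a, h a)) ` B" unfolding G0_def using that by (auto simp: image_iff)
    moreover have "single_valued ((\<lambda>a. (a, h a)) ` B)" by (auto simp: single_valued_def)
    ultimately show ?thesis unfolding \<F>_def
      using hom_on_diff[OF h] hom_on_mult[OF h] subring_diff[OF B] subring_mult[OF B] by auto
  qed
  have "\<exists>G\<in>\<F>. \<forall>H\<in>\<F>. G \<subseteq> H \<longrightarrow> H = G"
  proof (rule subset_Zorn_nonempty)
    show "\<F> \<noteq> {}" using graph[OF f] by auto
    fix \<C> assume ne: "\<C> \<noteq> {}" and ch: "subset.chain \<F> \<C>"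
    have sub: "\<C> \<subseteq> \<F>" and tot: "\<And>G H. G \<in> \<C> \<Longrightarrow> H \<in> \<C> \<Longrightarrow> G \<subseteq> H \<or> H \<subseteq> G"
      using ch by (auto simp: subset_chain_def)
    have two: "\<exists>G\<in>\<C>. p \<in> G \<and> q \<in> G" if pq: "p \<in> \<Union>\<C>" "q \<in> \<Union>\<C>" for p q
    proof -
      obtain G H where "G \<in> \<C>" "p \<in> G" "H \<in> \<C>" "q \<in> H" using pq by blast
      with tot[of G H] show ?thesis by blast
    qed
    show "\<Union>\<C> \<in> \<F>" unfolding \<F>_def
    proof (intro CollectI conjI allI impI)
      obtain G where "G \<in> \<C>" using ne by blast
      moreover from this sub have "G0 \<subseteq> G" by (auto simp: \<F>_def)
      ultimately show "G0 \<subseteq> \<Union>\<C>" by blast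
      show "single_valued (\<Union>\<C>)"
      proof (rule single_valuedI)
        fix x y z assume "(x, y) \<in> \<Union>\<C>" "(x, z) \<in> \<Union>\<C>"
        from two[OF this] obtain G where "G \<in> \<C>" "(x, y) \<in> G" "(x, z) \<in> G" by blast
        with sub show "y = z" by (auto simp: \<F>_def dest: single_valuedD)
      qed
      fix a b c d assume "(a, b) \<in> \<Union>\<C>" "(c, d) \<in> \<Union>\<C>"
      from two[OF this] obtain G where G: "G \<in> \<C>" "(a, b) \<in> G" "(c, d) \<in> G" by blast
      with sub have "(a - c, b - d) \<in> G \<and> (a * c, b * d) \<in> G" unfolding \<F>_def by blast
      with G show "(a - c, b - d) \<in> \<Union>\<C>" "(a * c, b * d) \<in> \<Union>\<C>" by blast+
    qed
  qed
  then obtain G where G: "G \<in> \<F>" and max: "\<And>H. H \<in> \<F> \<Longrightarrow> G \<subseteq> H \<Longrightarrow> H = G" by blast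
  define B where "B = Domain G"
  define s where "s = (\<lambda>a. THE b. (a, b) \<in> G)"
  have sv: "single_valued G" and G0: "G0 \<subseteq> G"
    and cl: "\<And>a b c d. (a, b) \<in> G \<Longrightarrow> (c, d) \<in> G \<Longrightarrow> (a - c, b - d) \<in> G \<and> (a * c, b * d) \<in> G"
    using G by (auto simp: \<F>_def)
  have s: "s a = b" if "(a, b) \<in> G" for a b
    unfolding s_def using that sv by (auto dest: single_valuedD)
  have sG: "(a, s a) \<in> G" if "a \<in> B" for a using that s by (auto simp: B_def)
  have AB: "A \<subseteq> B" using G0 by (auto simp: B_def G0_def)
  have sf: "s a = f a" if "a \<in> A" for a using that G0 by (intro s) (auto simp: G0_def)
  note AA = hom_on_subring[OF f]
  have Bs: "subring_set B" unfolding subring_set_def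
  proof (intro conjI ballI)
    show "1 \<in> B" using AB subring_one[OF AA] by blast
    fix x y assume "x \<in> B" "y \<in> B"
    from cl[OF sG[OF this(1)] sG[OF this(2)]] show "x - y \<in> B" "x * y \<in> B"
      unfolding B_def by blast+
  qed
  have neg: "(- a, - b) \<in> G" if "(a, b) \<in> G" for a b
    using cl[OF _ that, of 0 0] G0 subring_zero[OF AA] hom_on_zero[OF f] by (auto simp: G0_def image_iff)
  have hs: "hom_on B s" unfolding hom_on_def
  proof (intro conjI ballI Bs)
    show "s 1 = 1" using sf[OF subring_one[OF AA]] hom_on_one[OF f] by simp
    fix x y assume xy: "x \<in> B" "y \<in> B"
    have "(x - - y, s x - - s y) \<in> G" using cl[OF sG[OF xy(1)] neg[OF sG[OF xy(2)]]] by blast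
    then show "s (x + y) = s x + s y" by (intro s) simp
    show "s (x * y) = s x * s y" by (intro s) (use cl[OF sG[OF xy(1)] sG[OF xy(2)]] in blast)
  qed
  have kB: "range to_ac \<subseteq> B" using A AB by blast
  have k: "subring_set (range (to_ac :: 'k \<Rightarrow> _))"
    using hom_inverse_const(2)[OF to_ac_hom] by (rule hom_on_subring)
  have sk: "s (to_ac c) = to_ac c" for c
  proof -
    have "to_ac c \<in> A" using A by blast
    then show ?thesis using sf fk by simp
  qed
  \<comment> \<open>A multiple of \<open>a\<close> in \<open>B\<close> is a nonzero element of \<open>k\<close>, and \<open>s\<close> does not move it.\<close>
  have inj: "s a \<noteq> 0" if a: "a \<in> B" "a \<noteq> 0" for a
  proof -
    obtain Q where "poly_over (range to_ac) Q" "Q \<noteq> 0" "poly Q a = 0" by (rule algebraic_over_base)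
    then obtain P where P: "min_poly (range to_ac) a P" by (rule min_poly_exists)
    obtain e where e: "e \<in> adjoin (range to_ac) a" "a * e \<in> range to_ac" "a * e \<noteq> 0"
      by (rule norm_multiple[OF k P adjoin_gen[OF k] a(2)])
    have "e \<in> B" using e(1) poly_in_subring[OF Bs _ a(1)] poly_over_sub[OF _ kB] by (auto simp: adjoin_def)
    then have "s a * s e = s (a * e)" using hom_on_mult[OF hs a(1)] by simp
    also have "\<dots> \<noteq> 0" using e sk by auto
    finally show ?thesis by auto
  qed
  have "y \<in> B" for y
  proof -
    obtain Q where Q: "poly_over (range to_ac) Q" "Q \<noteq> 0" "poly Q y = 0" by (rule algebraic_over_base)
    obtain P where P: "min_poly B y P" using min_poly_exists[OF poly_over_sub[OF Q(1) kB] Q(2,3)] .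
    have Po: "poly_over B P" "P \<noteq> 0" using P by (auto simp: min_poly_def)
    have lc: "s (Polynomial.lead_coeff P) \<noteq> 0" using Po by (intro inj) (auto simp: poly_over_def)
    then have "Polynomial.coeff (map_poly s P) (Polynomial.degree P) \<noteq> 0"
      by (simp add: coeff_map_poly hom_on_zero[OF hs])
    then have "Polynomial.degree P \<le> Polynomial.degree (map_poly s P)" by (rule le_degree)
    with min_poly_degree_pos[OF P] obtain x where x: "poly (map_poly s P) x = 0"
      using alg_closed_imp_poly_has_root[of "map_poly s P"] by auto
    obtain g where g: "hom_on (adjoin B y) g" "\<And>a. a \<in> B \<Longrightarrow> g a = s a"
      using hom_extend_root[OF hs P lc x] by blast
    have BA: "B \<subseteq> adjoin B y" using adjoin_base[OF Bs] by blast
    let ?H = "(\<lambda>a. (a, g a)) ` adjoin B y"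
    have "?H \<in> \<F>" by (rule graph[OF g(1)]) (use AB BA g(2) sf in auto)
    moreover have "G \<subseteq> ?H"
    proof
      fix p assume p: "p \<in> G"
      then obtain a b where ab: "p = (a, b)" "(a, b) \<in> G" by (cases p) auto
      then have "a \<in> B" "s a = b" using s by (auto simp: B_def)
      then show "p \<in> ?H" using ab(1) g(2) BA by (auto simp: image_iff)
    qed
    ultimately have "?H = G" by (rule max)
    then have "adjoin B y \<subseteq> B" by (auto simp: B_def)
    then show ?thesis using adjoin_gen[OF Bs] by blast
  qed
  then have "B = UNIV" by blast
  with hs sf show ?thesis using that by blast
qed

text \<open>
  Only surjectivity is at stake: an injective endomorphism over \<open>k\<close> permutes the finitely many roots of
  each polynomial over \<open>k\<close>.
\<close>

lemma absolute_galoisI: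
  fixes \<sigma> :: "'k::field_char_0 alg_closure \<Rightarrow> 'k alg_closure"
  assumes s: "hom_on UNIV \<sigma>" and k: "\<And>c. \<sigma> (to_ac c) = to_ac c"
  shows "\<sigma> \<in> absolute_galois"
proof -
  note inj = hom_UNIV_inj[OF s]
  have "y \<in> range \<sigma>" for y
  proof -
    obtain Q where Q: "poly_over (range to_ac) Q" "Q \<noteq> 0" "poly Q y = 0" by (rule algebraic_over_base)
    let ?R = "{x. poly Q x = 0}"
    have "map_poly \<sigma> Q = Q"
    proof (rule poly_eqI)
      fix i
      have "Polynomial.coeff Q i \<in> range to_ac" using Q(1) by (simp add: poly_over_def)
      then show "Polynomial.coeff (map_poly \<sigma> Q) i = Polynomial.coeff Q i"
        using k by (auto simp: coeff_map_poly hom_on_zero[OF s])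
    qed
    then have "poly Q (\<sigma> x) = \<sigma> (poly Q x)" for x
      using poly_map_poly_hom[OF s, of Q x] by (simp add: poly_over_def)
    then have "\<sigma> ` ?R \<subseteq> ?R" by (auto simp: hom_on_zero[OF s])
    moreover have "finite ?R" by (rule poly_roots_finite[OF Q(2)])
    ultimately have "\<sigma> ` ?R = ?R" using inj by (intro endo_inj_surj) (auto intro: inj_on_subset)
    with Q(3) show ?thesis by blast
  qed
  then have "bij \<sigma>" using inj by (auto simp: bij_def)
  then show ?thesis using k hom_on_add[OF s] hom_on_mult[OF s] by (auto simp: absolute_galois_def)
qed

text \<open>
  An element outside \<open>k\<close> has two conjugates by \<open>two_extensions\<close>, and each conjugation extends to an
  automorphism of the algebraic closure; so the element cannot be fixed.
\<close>

theorem galois_fixed: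
  fixes c :: "'k::field_char_0 alg_closure"
  assumes "\<And>\<sigma>. \<sigma> \<in> absolute_galois \<Longrightarrow> \<sigma> c = c"
  shows "c \<in> range to_ac"
proof (rule ccontr)
  assume c: "c \<notin> range to_ac"
  let ?k = "range (to_ac :: 'k \<Rightarrow> _)"
  have k: "subring_set ?k" using hom_inverse_const(2)[OF to_ac_hom] by (rule hom_on_subring)
  have y: "c * q \<noteq> p" if pq: "p \<in> ?k" "q \<in> ?k" "q \<noteq> 0" for p q
  proof
    assume e: "c * q = p"
    obtain a b where "p = to_ac a" "q = to_ac b" using pq by blast
    with e pq have "c = to_ac (a / b)" by (simp add: field_simps)
    with c show False by blast
  qed
  have char0: "(of_nat j :: 'k alg_closure) \<noteq> 0" if "j > 0" for j using that by simp
  obtain a where a: "a \<in> ?k" "a \<noteq> 0" and two: "\<And>f :: 'k alg_closure \<Rightarrow> 'k alg_closure.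
      hom_on ?k f \<Longrightarrow> f a \<noteq> 0 \<Longrightarrow>
       \<exists>g h. hom_on (adjoin ?k c) g \<and> hom_on (adjoin ?k c) h \<and> (\<forall>x\<in>?k. g x = f x \<and> h x = f x) \<and>
         g 1 \<noteq> 0 \<and> h 1 \<noteq> 0 \<and> g c \<noteq> h c"
    using two_extensions[OF k y char0 subring_one[OF subring_adjoin[OF k]] one_neq_zero, where 'b="'k alg_closure"]
    by blast
  have "hom_on ?k id" using k by (simp add: hom_on_def)
  from two[OF this] a obtain g h where gh: "hom_on (adjoin ?k c) g" "hom_on (adjoin ?k c) h"
    "\<forall>x\<in>?k. g x = x \<and> h x = x" "g c \<noteq> h c" by auto
  have sub: "?k \<subseteq> adjoin ?k c" using adjoin_base[OF k] by blast
  have fix1: "f c = c" if f: "hom_on (adjoin ?k c) f" "\<forall>x\<in>?k. f x = x" for f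
  proof -
    obtain \<sigma> where s: "hom_on UNIV \<sigma>" "\<And>a. a \<in> adjoin ?k c \<Longrightarrow> \<sigma> a = f a"
      using hom_extend_algebraic[OF f(1) sub] f(2) by blast
    have "\<sigma> (to_ac u) = to_ac u" for u
    proof -
      have "to_ac u \<in> adjoin ?k c" using sub by blast
      then show ?thesis using s(2) f(2) by simp
    qed
    then have "\<sigma> \<in> absolute_galois" by (rule absolute_galoisI[OF s(1)])
    with assms have "\<sigma> c = c" by blast
    then show ?thesis using s(2)[OF adjoin_gen[OF k]] by simp
  qed
  show False using fix1[OF gh(1)] fix1[OF gh(2)] gh(3,4) by auto
qed

text \<open>
  The dollar sign denotes entries of vectors from here on.
\<close>

no_notation fps_nth (infixl \<open>$\<close> 75)

section \<open>The orthogonal group as a matrix group\<close>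

lemma quadratic_sum_split:
  fixes f :: "nat \<Rightarrow> nat \<Rightarrow> 'a::comm_ring_1"
  shows "(\<Sum>i<n. \<Sum>j<n. f i j) = (\<Sum>i<n. f i i) + (\<Sum>j<n. \<Sum>i<j. f i j + f j i)"
proof (induction n)
  case (Suc n)
  have "(\<Sum>i<Suc n. \<Sum>j<Suc n. f i j) = (\<Sum>i<n. \<Sum>j<n. f i j) + (\<Sum>i<n. f i n) + (\<Sum>j<n. f n j) + f n n"
    by (simp add: sum.distrib algebra_simps)
  then show ?case using Suc by (simp add: sum.distrib algebra_simps)
qed simp

locale orthogonal_form =
  fixes q :: "'k::field_char_0 vec \<Rightarrow> 'k" and n :: nat
  assumes quadratic: "quadratic_form n q" and nondegenerate: "nondegenerate_form n q"
begin

definition gram :: "'k mat" where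
  "gram = mat n n (\<lambda>(i, j). polar_form q (unit_vec n i) (unit_vec n j) / 2)"

definition Q :: "'k alg_closure mat" where "Q = map_mat to_ac gram"

lemma gram_carrier [simp]: "gram \<in> carrier_mat n n" and Q_carrier [simp]: "Q \<in> carrier_mat n n"
  by (simp_all add: gram_def Q_def)

lemma Q_one [simp]: "1\<^sub>m n * Q = Q" "Q * 1\<^sub>m n = Q"
  using left_mult_one_mat[OF Q_carrier] right_mult_one_mat[OF Q_carrier] by auto

lemma polar_sym:
  "v \<in> carrier_vec n \<Longrightarrow> w \<in> carrier_vec n \<Longrightarrow> polar_form q v w = polar_form q w v"
  by (simp add: polar_form_def comm_add_vec[of v n w])

lemma gram_sym: "i < n \<Longrightarrow> j < n \<Longrightarrow> gram $$ (i, j) = gram $$ (j, i)"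
  by (simp add: gram_def polar_sym)

lemma Q_sym: "i < n \<Longrightarrow> j < n \<Longrightarrow> Q $$ (i, j) = Q $$ (j, i)"
  using gram_sym gram_carrier by (simp add: Q_def carrier_matD[OF gram_carrier])

lemma polar_left_add: "u \<in> carrier_vec n \<Longrightarrow> v \<in> carrier_vec n \<Longrightarrow> w \<in> carrier_vec n \<Longrightarrow>
    polar_form q (u + v) w = polar_form q u w + polar_form q v w"
  and polar_left_smult: "v \<in> carrier_vec n \<Longrightarrow> w \<in> carrier_vec n \<Longrightarrow>
    polar_form q (c \<cdot>\<^sub>v v) w = c * polar_form q v w"
  and q_smult: "v \<in> carrier_vec n \<Longrightarrow> q (c \<cdot>\<^sub>v v) = c\<^sup>2 * q v"
  using quadratic unfolding quadratic_form_def by blast+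

lemma q_polar:
  assumes v: "v \<in> carrier_vec n" shows "q v = polar_form q v v / 2"
proof -
  have "v + v = 2 \<cdot>\<^sub>v v" using v by (intro eq_vecI) auto
  then have "polar_form q v v = 4 * q v - q v - q v"
    unfolding polar_form_def using q_smult[OF v, of 2] by simp
  then show ?thesis by simp
qed

lemma polar_expand:
  assumes v: "v \<in> carrier_vec n" and w: "w \<in> carrier_vec n"
  shows "polar_form q v w = (\<Sum>i<n. v $ i * polar_form q (unit_vec n i) w)"
proof -
  let ?p = "\<lambda>k. vec n (\<lambda>i. if i < k then v $ i else 0)"
  have "polar_form q (?p k) w = (\<Sum>i<k. v $ i * polar_form q (unit_vec n i) w)" if "k \<le> n" for k
    using that
  proof (induction k)
    case 0
    have "?p 0 = 0 \<cdot>\<^sub>v 0\<^sub>v n" by (intro eq_vecI) auto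
    then show ?case using polar_left_smult[OF zero_carrier_vec w, of 0] by simp
  next
    case (Suc k)
    have "?p (Suc k) = ?p k + v $ k \<cdot>\<^sub>v unit_vec n k"
      using Suc.prems by (intro eq_vecI) (auto simp: unit_vec_def less_Suc_eq)
    then have "polar_form q (?p (Suc k)) w = polar_form q (?p k) w + polar_form q (v $ k \<cdot>\<^sub>v unit_vec n k) w"
      using polar_left_add[of "?p k" "v $ k \<cdot>\<^sub>v unit_vec n k" w] w by simp
    then show ?case using Suc w by (simp add: polar_left_smult)
  qed
  from this[of n] have "polar_form q (?p n) w = (\<Sum>i<n. v $ i * polar_form q (unit_vec n i) w)" by simp
  moreover have "?p n = v" using v by (intro eq_vecI) auto
  ultimately show ?thesis by simp
qed

lemma det_gram: "det gram \<noteq> 0"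
proof (rule mat_kernel_trivial[OF gram_carrier])
  fix v :: "'k vec" assume v: "v \<in> carrier_vec n" and z: "gram *\<^sub>v v = 0\<^sub>v n"
  have "polar_form q (unit_vec n i) v = 0" if i: "i < n" for i
  proof -
    have "polar_form q (unit_vec n i) v = polar_form q v (unit_vec n i)" by (rule polar_sym) (use v in auto)
    also have "\<dots> = (\<Sum>j<n. v $ j * polar_form q (unit_vec n j) (unit_vec n i))" by (rule polar_expand) (use v in auto)
    also have "\<dots> = (\<Sum>j<n. 2 * (gram $$ (i, j) * v $ j))"
      by (rule sum.cong) (use i in \<open>simp_all add: gram_def polar_sym\<close>)
    also have "\<dots> = 2 * (gram *\<^sub>v v) $ i"
      unfolding mult_mat_vec_index_sum[OF gram_carrier v i] by (simp add: sum_distrib_left)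
    also have "\<dots> = 0" using z i by simp
    finally show ?thesis .
  qed
  then have "polar_form q v w = 0" if "w \<in> carrier_vec n" for w
    using polar_expand[OF that v] polar_sym[OF v that] by simp
  with nondegenerate v show "v = 0\<^sub>v n" by (auto simp: nondegenerate_form_def)
qed

lemma to_ac_mat_hom: "comm_ring_hom (to_ac :: 'k \<Rightarrow> _)"
  by unfold_locales auto

lemma det_Q: "det Q \<noteq> 0"
proof -
  interpret comm_ring_hom "to_ac :: 'k \<Rightarrow> _" by (rule to_ac_mat_hom)
  show ?thesis unfolding Q_def using det_gram by (simp add: hom_det)
qed

lemma form_closure_bilinear:
  assumes v: "v \<in> carrier_vec n"
  shows "form_closure n q v = (\<Sum>i<n. \<Sum>j<n. v $ i * Q $$ (i, j) * v $ j)"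
proof -
  have d: "to_ac (q (unit_vec n i)) * (v $ i)\<^sup>2 = v $ i * Q $$ (i, i) * v $ i" if "i < n" for i
    using that by (simp add: Q_def gram_def q_polar[of "unit_vec n i"] power2_eq_square)
  have o: "to_ac (polar_form q (unit_vec n i) (unit_vec n j)) * v $ i * v $ j =
      v $ i * Q $$ (i, j) * v $ j + v $ j * Q $$ (j, i) * v $ i" if "i < j" "j < n" for i j
  proof -
    have "Q $$ (j, i) = Q $$ (i, j)" using that Q_sym by simp
    moreover have "to_ac (polar_form q (unit_vec n i) (unit_vec n j)) = 2 * Q $$ (i, j)"
      using that by (simp add: Q_def gram_def)
    ultimately show ?thesis by (simp add: algebra_simps)
  qed
  show ?thesis unfolding quadratic_sum_split form_closure_def using d o by simp
qed

abbreviation "Oq \<equiv> {A \<in> carrier_mat n n. transpose_mat A * Q * A = Q}"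

lemma transpose_Q: "transpose_mat Q = Q"
  by (rule eq_matI) (use Q_sym in \<open>auto simp: carrier_matD[OF Q_carrier]\<close>)

lemma gram_product_index:
  assumes A: "A \<in> carrier_mat n n" and S: "S \<in> carrier_mat n n" and ij: "i < n" "j < n"
  shows "(transpose_mat A * S * A) $$ (i, j) = (\<Sum>k<n. \<Sum>l<n. A $$ (k, i) * S $$ (k, l) * A $$ (l, j))"
proof -
  have T: "transpose_mat A \<in> carrier_mat n n" using A by simp
  have "(transpose_mat A * S * A) $$ (i, j) = (\<Sum>l<n. (\<Sum>k<n. A $$ (k, i) * S $$ (k, l)) * A $$ (l, j))"
    unfolding index_mult_mat_sum[OF mult_carrier_mat[OF T S] A ij]
    by (intro sum.cong refl) (use index_mult_mat_sum[OF T S ij(1)] A ij in simp)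
  also have "\<dots> = (\<Sum>k<n. \<Sum>l<n. A $$ (k, i) * S $$ (k, l) * A $$ (l, j))"
    unfolding sum_distrib_right by (rule sum.swap)
  finally show ?thesis .
qed

lemma form_closure_mult:
  assumes A: "A \<in> carrier_mat n n" and v: "v \<in> carrier_vec n"
  shows "form_closure n q (A *\<^sub>v v) = (\<Sum>i<n. \<Sum>j<n. v $ i * (transpose_mat A * Q * A) $$ (i, j) * v $ j)"
proof -
  have "(A *\<^sub>v v) \<in> carrier_vec n" using A v by simp
  then have "form_closure n q (A *\<^sub>v v) = (\<Sum>k<n. \<Sum>l<n. (\<Sum>i<n. A $$ (k, i) * v $ i) * Q $$ (k, l) * (\<Sum>j<n. A $$ (l, j) * v $ j))"
    by (simp add: form_closure_bilinear mult_mat_vec_index_sum[OF A v])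
  also have "\<dots> = (\<Sum>k<n. \<Sum>l<n. \<Sum>i<n. \<Sum>j<n. v $ i * (A $$ (k, i) * Q $$ (k, l) * A $$ (l, j)) * v $ j)"
    by (simp add: sum_distrib_left sum_distrib_right mult_ac)
  also have "\<dots> = (\<Sum>i<n. \<Sum>j<n. \<Sum>k<n. \<Sum>l<n. v $ i * (A $$ (k, i) * Q $$ (k, l) * A $$ (l, j)) * v $ j)"
  proof -
    have "(\<Sum>k<n. \<Sum>l<n. \<Sum>i<n. \<Sum>j<n. F k l i j) = (\<Sum>i<n. \<Sum>j<n. \<Sum>k<n. \<Sum>l<n. F k l i j)"
      for F :: "nat \<Rightarrow> nat \<Rightarrow> nat \<Rightarrow> nat \<Rightarrow> 'k alg_closure"
    proof -
      have "(\<Sum>k<n. \<Sum>l<n. \<Sum>i<n. \<Sum>j<n. F k l i j) = (\<Sum>k<n. \<Sum>i<n. \<Sum>l<n. \<Sum>j<n. F k l i j)"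
        by (rule sum.cong[OF refl], rule sum.swap)
      also have "\<dots> = (\<Sum>i<n. \<Sum>k<n. \<Sum>l<n. \<Sum>j<n. F k l i j)" by (rule sum.swap)
      also have "\<dots> = (\<Sum>i<n. \<Sum>k<n. \<Sum>j<n. \<Sum>l<n. F k l i j)"
        by (rule sum.cong[OF refl], rule sum.cong[OF refl], rule sum.swap)
      also have "\<dots> = (\<Sum>i<n. \<Sum>j<n. \<Sum>k<n. \<Sum>l<n. F k l i j)"
        by (rule sum.cong[OF refl], rule sum.swap)
      finally show ?thesis .
    qed
    then show ?thesis .
  qed
  also have "\<dots> = (\<Sum>i<n. \<Sum>j<n. v $ i * (transpose_mat A * Q * A) $$ (i, j) * v $ j)"
    by (intro sum.cong refl) (simp add: gram_product_index[OF A Q_carrier] sum_distrib_left sum_distrib_right)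
  finally show ?thesis .
qed

text \<open>
  Polarization: unit vectors give the diagonal, sums of two unit vectors the other entries.
\<close>

lemma symmetric_form_determined:
  fixes S T :: "'k alg_closure mat"
  assumes S: "\<And>i j. i < n \<Longrightarrow> j < n \<Longrightarrow> S $$ (i, j) = S $$ (j, i)" "\<And>i j. i < n \<Longrightarrow> j < n \<Longrightarrow> T $$ (i, j) = T $$ (j, i)"
    and e: "\<And>v. v \<in> carrier_vec n \<Longrightarrow> (\<Sum>i<n. \<Sum>j<n. v $ i * S $$ (i, j) * v $ j) = (\<Sum>i<n. \<Sum>j<n. v $ i * T $$ (i, j) * v $ j)"
    and ij: "i < n" "j < n"
  shows "S $$ (i, j) = T $$ (i, j)"
proof -
  have one: "(\<Sum>k<n. \<Sum>l<n. (if k = i then 1 else 0) * M k l * (if l = j then 1 else 0)) = M i j"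
    if "i < n" "j < n" for i j and M :: "nat \<Rightarrow> nat \<Rightarrow> 'k alg_closure"
  proof -
    have "(\<Sum>k<n. \<Sum>l<n. (if k = i then 1 else 0) * M k l * (if l = j then 1 else 0)) =
        (\<Sum>k<n. (\<Sum>l<n. M k l * (if l = j then 1 else 0)) * (if k = i then 1 else 0))"
      unfolding sum_distrib_right by (intro sum.cong refl) (simp add: mult_ac)
    also have "\<dots> = M i j" using that by (simp only: sum_delta_mult)
    finally show ?thesis .
  qed
  have diag: "S $$ (i, i) = T $$ (i, i)" if i: "i < n" for i
  proof -
    have u: "(\<Sum>k<n. \<Sum>l<n. unit_vec n i $ k * M $$ (k, l) * unit_vec n i $ l) = M $$ (i, i)" for M :: "'k alg_closure mat"
    proof -
      have "(\<Sum>k<n. \<Sum>l<n. unit_vec n i $ k * M $$ (k, l) * unit_vec n i $ l) =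
          (\<Sum>k<n. \<Sum>l<n. (if k = i then 1 else 0) * M $$ (k, l) * (if l = i then 1 else 0))"
        by (intro sum.cong refl) (use i in simp)
      also have "\<dots> = M $$ (i, i)" by (rule one[OF i i])
      finally show ?thesis .
    qed
    show ?thesis using e[of "unit_vec n i"] unfolding u by simp
  qed
  show ?thesis
  proof (cases "i = j")
    case False
    let ?d = "\<lambda>i k. if k = i then 1 else 0 :: 'k alg_closure"
    let ?v = "vec n (\<lambda>k. ?d i k + ?d j k)"
    have x: "(\<Sum>k<n. \<Sum>l<n. ?v $ k * M $$ (k, l) * ?v $ l) = M $$ (i, i) + M $$ (i, j) + M $$ (j, i) + M $$ (j, j)" for M
    proof -
      have "(\<Sum>k<n. \<Sum>l<n. ?v $ k * M $$ (k, l) * ?v $ l) =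
          (\<Sum>k<n. \<Sum>l<n. ?d i k * M $$ (k, l) * ?d i l + ?d i k * M $$ (k, l) * ?d j l +
             ?d j k * M $$ (k, l) * ?d i l + ?d j k * M $$ (k, l) * ?d j l)"
        by (intro sum.cong refl) (simp add: algebra_simps)
      then show ?thesis using ij one[of _ _ "\<lambda>k l. M $$ (k, l)"] by (simp only: sum.distrib)
    qed
    have "S $$ (i, i) + S $$ (i, j) + S $$ (j, i) + S $$ (j, j) = T $$ (i, i) + T $$ (i, j) + T $$ (j, i) + T $$ (j, j)"
      using e[of ?v] unfolding x by simp
    then have "2 * S $$ (i, j) = 2 * T $$ (i, j)" using diag[OF ij(1)] diag[OF ij(2)] S(1)[OF ij] S(2)[OF ij] by simp
    then show ?thesis by simp
  qed (use diag ij in simp)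
qed

lemma Oq_det:
  assumes "g \<in> Oq" shows "det g * det g = 1"
proof -
  have g: "g \<in> carrier_mat n n" "transpose_mat g * Q * g = Q" using assms by auto
  have T: "transpose_mat g \<in> carrier_mat n n" using g by simp
  have "det (transpose_mat g * Q * g) = det g * det Q * det g"
    by (simp add: det_mult[OF mult_carrier_mat[OF T Q_carrier] g(1)] det_mult[OF T Q_carrier] det_transpose[OF g(1)])
  then have "det Q = det g * det Q * det g" using g(2) by simp
  then have "det Q * (det g * det g) = det Q * 1" by (simp add: mult_ac)
  then show ?thesis using det_Q by simp
qed

lemma GL_carrier: "A \<in> carrier (GL k) \<longleftrightarrow> A \<in> carrier_mat k k \<and> (\<exists>B\<in>carrier_mat k k. A * B = 1\<^sub>m k \<and> B * A = 1\<^sub>m k)"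
  by (auto simp: GL_def units_of_def Units_def ring_mat_def)

lemma carrier_orthogonal: "carrier (orthogonal_group n q) = Oq"
proof -
  have "A \<in> carrier (orthogonal_group n q) \<longleftrightarrow> A \<in> Oq" for A
  proof -
  have c: "A \<in> carrier (orthogonal_group n q) \<longleftrightarrow> A \<in> carrier (GL n) \<and>
      (\<forall>v\<in>carrier_vec n. form_closure n q (A *\<^sub>v v) = form_closure n q v)"
    by (simp add: orthogonal_group_def)
  show "A \<in> carrier (orthogonal_group n q) \<longleftrightarrow> A \<in> Oq"
  proof
    assume "A \<in> carrier (orthogonal_group n q)"
    then have A: "A \<in> carrier_mat n n" and f: "\<And>v. v \<in> carrier_vec n \<Longrightarrow> form_closure n q (A *\<^sub>v v) = form_closure n q v"
      unfolding c GL_carrier by auto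
    have "transpose_mat A * Q * A = Q"
    proof (rule eq_matI)
      fix i j assume "i < dim_row Q" "j < dim_col Q"
      then have ij: "i < n" "j < n" using carrier_matD[OF Q_carrier] by auto
      show "(transpose_mat A * Q * A) $$ (i, j) = Q $$ (i, j)"
      proof (rule symmetric_form_determined[OF _ Q_sym _ ij])
        show "(transpose_mat A * Q * A) $$ (i, j) = (transpose_mat A * Q * A) $$ (j, i)" if "i < n" "j < n" for i j
          unfolding gram_product_index[OF A Q_carrier that] gram_product_index[OF A Q_carrier that(2,1)]
          by (subst sum.swap) (intro sum.cong refl, simp add: Q_sym mult_ac)
        show "(\<Sum>i<n. \<Sum>j<n. v $ i * (transpose_mat A * Q * A) $$ (i, j) * v $ j) = (\<Sum>i<n. \<Sum>j<n. v $ i * Q $$ (i, j) * v $ j)"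
          if "v \<in> carrier_vec n" for v
          using f[OF that] form_closure_mult[OF A that] form_closure_bilinear[OF that] by simp
      qed
    qed (use A carrier_matD[OF Q_carrier] in auto)
    with A show "A \<in> Oq" by simp
  next
    assume A: "A \<in> Oq"
    have "det A \<noteq> 0" using Oq_det[OF A] by auto
    then have "A \<in> carrier (GL n)" unfolding GL_carrier using A mat_inverse_exists[of A n] by blast
    moreover have "form_closure n q (A *\<^sub>v v) = form_closure n q v" if "v \<in> carrier_vec n" for v
      using A that by (simp add: form_closure_mult form_closure_bilinear)
    ultimately show "A \<in> carrier (orthogonal_group n q)" unfolding c by blast
  qed
  qed
  then show ?thesis by blast
qed

lemma orthogonal_simps [simp]:
  "x \<otimes>\<^bsub>orthogonal_group n q\<^esub> y = x * y" "\<one>\<^bsub>orthogonal_group n q\<^esub> = 1\<^sub>m n"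
  by (simp_all add: orthogonal_group_def GL_def units_of_def ring_mat_def)

lemma Oq_one: "1\<^sub>m n \<in> Oq"
  using left_mult_one_mat[OF Q_carrier] right_mult_one_mat[OF Q_carrier] by simp

lemma Oq_mult: assumes "g \<in> Oq" "h \<in> Oq" shows "g * h \<in> Oq"
proof -
  have g: "g \<in> carrier_mat n n" "transpose_mat g * Q * g = Q" and h: "h \<in> carrier_mat n n" "transpose_mat h * Q * h = Q"
    using assms by auto
  have T: "transpose_mat g \<in> carrier_mat n n" "transpose_mat h \<in> carrier_mat n n" using g h by auto
  have "transpose_mat (g * h) * Q * (g * h) = transpose_mat h * (transpose_mat g * Q * g) * h"
    using g(1) h(1) T by (simp add: transpose_mult[OF g(1) h(1)] assoc_mult_mat[of _ n n _ n _ n] mult_carrier_mat[of _ n n _ n])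
  then show ?thesis using g h by simp
qed

lemma Oq_inverse:
  assumes "g \<in> Oq" obtains h where "h \<in> Oq" "g * h = 1\<^sub>m n" "h * g = 1\<^sub>m n"
proof -
  have g: "g \<in> carrier_mat n n" "transpose_mat g * Q * g = Q" using assms by auto
  have "det g \<noteq> 0" using Oq_det[OF assms] by auto
  then obtain h where h: "h \<in> carrier_mat n n" "g * h = 1\<^sub>m n" "h * g = 1\<^sub>m n"
    using mat_inverse_exists[OF g(1)] by blast
  have T: "transpose_mat g \<in> carrier_mat n n" "transpose_mat h \<in> carrier_mat n n" using g h by auto
  have ht: "transpose_mat h * transpose_mat g = 1\<^sub>m n" using transpose_mult[OF g(1) h(1)] h(2) by simp
  have "transpose_mat h * Q * h = transpose_mat h * (transpose_mat g * Q * g) * h" using g(2) by simp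
  also have "\<dots> = (transpose_mat h * transpose_mat g) * Q * (g * h)"
    using g(1) h(1) T by (simp add: assoc_mult_mat[of _ n n _ n _ n] mult_carrier_mat[of _ n n _ n])
  also have "\<dots> = Q" using ht h by simp
  finally have "h \<in> Oq" using h by simp
  with h that show ?thesis by blast
qed

lemma mat_inverse_unique:
  fixes g h h' :: "'x::field mat"
  assumes "g \<in> carrier_mat k k" "h \<in> carrier_mat k k" "h' \<in> carrier_mat k k" "h * g = 1\<^sub>m k" "g * h' = 1\<^sub>m k"
  shows "h = h'"
proof -
  have "h * (g * h') = h * g * h'" by (rule assoc_mult_mat[symmetric, OF assms(2,1,3)])
  then show ?thesis
    unfolding assms(4,5) using left_mult_one_mat[OF assms(3)] right_mult_one_mat[OF assms(2)] by simp
qed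

lemma inv_orthogonal:
  assumes g: "g \<in> Oq" and h: "h \<in> Oq" "g * h = 1\<^sub>m n" "h * g = 1\<^sub>m n"
  shows "inv\<^bsub>orthogonal_group n q\<^esub> g = h"
  unfolding m_inv_def
proof (rule the_equality)
  show "h \<in> carrier (orthogonal_group n q) \<and> g \<otimes>\<^bsub>orthogonal_group n q\<^esub> h = \<one>\<^bsub>orthogonal_group n q\<^esub> \<and>
      h \<otimes>\<^bsub>orthogonal_group n q\<^esub> g = \<one>\<^bsub>orthogonal_group n q\<^esub>"
    using h by (simp add: carrier_orthogonal)
  fix y assume "y \<in> carrier (orthogonal_group n q) \<and> g \<otimes>\<^bsub>orthogonal_group n q\<^esub> y = \<one>\<^bsub>orthogonal_group n q\<^esub> \<and>
      y \<otimes>\<^bsub>orthogonal_group n q\<^esub> g = \<one>\<^bsub>orthogonal_group n q\<^esub>"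
  then show "y = h" using g h mat_inverse_unique[of g n y h] by (simp add: carrier_orthogonal)
qed

text \<open>
  Two invertible matrices with the same Gram matrix differ by an element of the orthogonal group: the
  orbits of \<open>O(q)\<close> on invertible matrices are the fibres of \<open>w \<mapsto> w\<^sup>T Q w\<close>.
\<close>

lemma Oq_quotient:
  assumes w: "w \<in> carrier_mat n n" and wi: "wi \<in> carrier_mat n n" "w * wi = 1\<^sub>m n" "wi * w = 1\<^sub>m n"
    and w': "w' \<in> carrier_mat n n"
    and e: "transpose_mat w' * Q * w' = transpose_mat w * Q * w"
  shows "w' * wi \<in> Oq" "w' * wi * w = w'"
proof -
  let ?T = transpose_mat
  have T: "?T w \<in> carrier_mat n n" "?T w' \<in> carrier_mat n n" "?T wi \<in> carrier_mat n n" using w w' wi by auto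
  have wt: "?T wi * ?T w = 1\<^sub>m n" using transpose_mult[OF w wi(1)] wi(2) by simp
  have "?T (w' * wi) * Q * (w' * wi) = ?T wi * (?T w' * Q * w') * wi"
    using w' wi(1) T by (simp add: transpose_mult[OF w' wi(1)] assoc_mult_mat[of _ n n _ n _ n] mult_carrier_mat[of _ n n _ n])
  also have "\<dots> = (?T wi * ?T w) * Q * (w * wi)"
    unfolding e using w wi(1) T by (simp add: assoc_mult_mat[of _ n n _ n _ n] mult_carrier_mat[of _ n n _ n])
  also have "\<dots> = Q" using wt wi by simp
  finally show "w' * wi \<in> Oq" using w' wi by simp
  show "w' * wi * w = w'" using assoc_mult_mat[OF w' wi(1) w] wi w' by simp
qed

text \<open>
  The inverse of an orthogonal matrix is polynomial in its entries, so no denominators arise below.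
\<close>

lemma Oq_inverse_formula:
  assumes Qi: "Qi \<in> carrier_mat n n" "Qi * Q = 1\<^sub>m n" and g: "g \<in> Oq" and h: "h \<in> Oq" "g * h = 1\<^sub>m n"
  shows "h = Qi * transpose_mat g * Q"
proof -
  have gc: "g \<in> carrier_mat n n" "transpose_mat g * Q * g = Q" "transpose_mat g \<in> carrier_mat n n" using g by auto
  have hc: "h \<in> carrier_mat n n" using h by simp
  have "Qi * transpose_mat g * Q * g = Qi * (transpose_mat g * Q * g)"
    using Qi(1) gc(1,3) by (simp add: assoc_mult_mat[of _ n n _ n _ n] mult_carrier_mat[of _ n n _ n])
  then have "Qi * transpose_mat g * Q * g = 1\<^sub>m n" using gc(2) Qi(2) by simp
  from mat_inverse_unique[OF gc(1) mult_carrier_mat[OF mult_carrier_mat[OF Qi(1) gc(3)] Q_carrier] hc this h(2)]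
  show ?thesis by (rule HOL.sym)
qed

end

section \<open>Sign characters and equivariant rows\<close>

text \<open>
  A point with coordinates \<open>u i j\<close> and \<open>\<eta> j\<close>, for polynomials with variables in \<open>nat \<times> nat\<close>: row
  indices from \<open>n\<close> on stand for an additional row that holds \<open>\<eta>\<close>.
\<close>

definition pt :: "nat \<Rightarrow> 'a::zero mat \<Rightarrow> (nat \<Rightarrow> 'a) \<Rightarrow> nat \<times> nat \<Rightarrow> 'a" where
  "pt n u \<eta> ij = (if snd ij < n then if fst ij < n then u $$ ij else \<eta> (snd ij) else 0)"

text \<open>
  Functions of \<open>u\<close> and \<open>\<tau>\<close> that are polynomial over \<open>k\<close>, arranged by the parity of the exponent of each
  \<open>\<tau> j\<close>: only the squares \<open>\<tau> j\<^sup>2\<close> enter the coefficients.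
\<close>

definition sign_rep ::
    "nat \<Rightarrow> ('k::field_char_0 alg_closure mat \<Rightarrow> (nat \<Rightarrow> 'k alg_closure) \<Rightarrow> 'k alg_closure) \<Rightarrow> bool" where
  "sign_rep n f \<longleftrightarrow> (\<exists>P :: nat set \<Rightarrow> (nat \<times> nat, 'k) mpol. \<forall>u \<tau>.
     f u \<tau> = (\<Sum>I\<in>Pow {..<n}. (\<Prod>j\<in>I. \<tau> j) * mpol_eval to_ac (pt n u (\<lambda>j. (\<tau> j)\<^sup>2)) (P I)))"

lemma eval_to_ac_hom: "hom_on UNIV (mpol_eval (to_ac :: 'k::field_char_0 \<Rightarrow> _) x)"
  by (rule hom_mpol_eval[OF to_ac_hom])

lemma sign_rep_term:
  assumes "I0 \<subseteq> {..<n}"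
  shows "sign_rep n (\<lambda>u \<tau>. (\<Prod>j\<in>I0. \<tau> j) * mpol_eval to_ac (pt n u (\<lambda>j. (\<tau> j)\<^sup>2)) p)"
  unfolding sign_rep_def
proof (intro exI[of _ "\<lambda>I. if I = I0 then p else 0"] allI)
  fix u :: "'a alg_closure mat" and \<tau>
  let ?e = "mpol_eval to_ac (pt n u (\<lambda>j. (\<tau> j)\<^sup>2))"
  have "(\<Sum>I\<in>Pow {..<n}. (\<Prod>j\<in>I. \<tau> j) * ?e (if I = I0 then p else 0)) =
      (\<Sum>I\<in>Pow {..<n}. if I = I0 then (\<Prod>j\<in>I0. \<tau> j) * ?e p else 0)"
    by (intro sum.cong refl) (simp add: hom_on_zero[OF eval_to_ac_hom])
  also have "\<dots> = (\<Prod>j\<in>I0. \<tau> j) * ?e p"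
    using assms by (simp add: sum.delta finite_Pow_iff)
  finally show "(\<Prod>j\<in>I0. \<tau> j) * ?e p = (\<Sum>I\<in>Pow {..<n}. (\<Prod>j\<in>I. \<tau> j) * ?e (if I = I0 then p else 0))" by simp
qed

lemma sign_rep_add:
  assumes "sign_rep n f" "sign_rep n g" shows "sign_rep n (\<lambda>u \<tau>. f u \<tau> + g u \<tau>)"
proof -
  obtain P R where P: "\<And>u \<tau>. f u \<tau> = (\<Sum>I\<in>Pow {..<n}. (\<Prod>j\<in>I. \<tau> j) * mpol_eval to_ac (pt n u (\<lambda>j. (\<tau> j)\<^sup>2)) (P I))"
    and R: "\<And>u \<tau>. g u \<tau> = (\<Sum>I\<in>Pow {..<n}. (\<Prod>j\<in>I. \<tau> j) * mpol_eval to_ac (pt n u (\<lambda>j. (\<tau> j)\<^sup>2)) (R I))"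
    using assms unfolding sign_rep_def by blast
  show ?thesis unfolding sign_rep_def
    by (intro exI[of _ "\<lambda>I. P I + R I"])
      (simp add: P R hom_on_add[OF eval_to_ac_hom] distrib_left sum.distrib)
qed

lemma sign_rep_const: "sign_rep n (\<lambda>u \<tau>. to_ac c)"
  using sign_rep_term[of "{}" n "mpol_const c"] by (simp add: mpol_eval_const)

lemma sign_rep_entry: "i < n \<Longrightarrow> j < n \<Longrightarrow> sign_rep n (\<lambda>u \<tau>. u $$ (i, j))"
  using sign_rep_term[of "{}" n "mpol_var (i, j)"] by (simp add: mpol_eval_var[OF to_ac_hom] pt_def)

lemma sign_rep_tau: "j < n \<Longrightarrow> sign_rep n (\<lambda>u \<tau>. \<tau> j)"
  using sign_rep_term[of "{j}" n 1] by (simp add: hom_on_one[OF eval_to_ac_hom])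

lemma sign_rep_sum:
  assumes "\<And>i. i \<in> S \<Longrightarrow> sign_rep n (f i)" shows "sign_rep n (\<lambda>u \<tau>. \<Sum>i\<in>S. f i u \<tau>)"
  using assms
proof (induction S rule: infinite_finite_induct)
  case (insert i S)
  then show ?case using sign_rep_add[of n "f i" "\<lambda>u \<tau>. \<Sum>i\<in>S. f i u \<tau>"] by simp
qed (use sign_rep_const[of n 0] in simp_all)

text \<open>
  Parities add: for sets \<open>I\<close> and \<open>J\<close> the product of the monomials is the monomial of the
  symmetric difference times the squares for \<open>I \<inter> J\<close>.
\<close>

lemma sign_rep_mult:
  fixes f g :: "'k::field_char_0 alg_closure mat \<Rightarrow> (nat \<Rightarrow> 'k alg_closure) \<Rightarrow> 'k alg_closure"
  assumes "sign_rep n f" "sign_rep n g" shows "sign_rep n (\<lambda>u \<tau>. f u \<tau> * g u \<tau>)"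
proof -
  let ?e = "\<lambda>u \<tau>. mpol_eval to_ac (pt n u (\<lambda>j. (\<tau> j :: 'k alg_closure)\<^sup>2))"
  obtain P R where P: "\<And>u \<tau>. f u \<tau> = (\<Sum>I\<in>Pow {..<n}. (\<Prod>j\<in>I. \<tau> j) * ?e u \<tau> (P I))"
    and R: "\<And>u \<tau>. g u \<tau> = (\<Sum>I\<in>Pow {..<n}. (\<Prod>j\<in>I. \<tau> j) * ?e u \<tau> (R I))"
    using assms unfolding sign_rep_def by blast
  define T where "T = (\<lambda>I J. (\<Prod>j\<in>I \<inter> J. mpol_var (n, j)) * (P I * R J))"
  have t: "(\<Prod>j\<in>I. \<tau> j) * ?e u \<tau> (P I) * ((\<Prod>j\<in>J. \<tau> j) * ?e u \<tau> (R J)) =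
      (\<Prod>j\<in>(I - J) \<union> (J - I). \<tau> j) * ?e u \<tau> (T I J)"
    if IJ: "I \<in> Pow {..<n}" "J \<in> Pow {..<n}" for I J u \<tau>
  proof -
    have fin: "finite I" "finite J" using IJ by (auto intro: finite_subset)
    have i: "(\<Prod>j\<in>I. \<tau> j) = (\<Prod>j\<in>I - J. \<tau> j) * (\<Prod>j\<in>I \<inter> J. \<tau> j)"
      using prod.Int_Diff[OF fin(1), of \<tau> J] by (simp add: mult_ac)
    have j: "(\<Prod>j\<in>J. \<tau> j) = (\<Prod>j\<in>J - I. \<tau> j) * (\<Prod>j\<in>I \<inter> J. \<tau> j)"
      using prod.Int_Diff[OF fin(2), of \<tau> I] by (simp add: mult_ac Int_commute)
    have u: "(\<Prod>j\<in>(I - J) \<union> (J - I). \<tau> j) = (\<Prod>j\<in>I - J. \<tau> j) * (\<Prod>j\<in>J - I. \<tau> j)"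
      by (rule prod.union_disjoint) (use fin in auto)
    have "?e u \<tau> (\<Prod>j\<in>I \<inter> J. mpol_var (n, j)) = (\<Prod>j\<in>I \<inter> J. (\<tau> j)\<^sup>2)"
      unfolding hom_on_prod[OF eval_to_ac_hom, simplified]
      by (rule prod.cong) (use IJ in \<open>auto simp: mpol_eval_var[OF to_ac_hom] pt_def\<close>)
    then have "?e u \<tau> (T I J) = (\<Prod>j\<in>I \<inter> J. \<tau> j) * (\<Prod>j\<in>I \<inter> J. \<tau> j) * (?e u \<tau> (P I) * ?e u \<tau> (R J))"
      unfolding T_def by (simp add: hom_on_mult[OF eval_to_ac_hom] power2_eq_square prod.distrib)
    then show ?thesis unfolding i j u by (simp add: mult_ac)
  qed
  have "(\<lambda>u \<tau>. f u \<tau> * g u \<tau>) = (\<lambda>u \<tau>. \<Sum>I\<in>Pow {..<n}. \<Sum>J\<in>Pow {..<n}. (\<Prod>j\<in>(I - J) \<union> (J - I). \<tau> j) * ?e u \<tau> (T I J))"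
    unfolding P R sum_product by (intro ext sum.cong refl t)
  moreover have "sign_rep n (\<lambda>u \<tau>. \<Sum>I\<in>Pow {..<n}. \<Sum>J\<in>Pow {..<n}. (\<Prod>j\<in>(I - J) \<union> (J - I). \<tau> j) * ?e u \<tau> (T I J))"
    by (intro sign_rep_sum sign_rep_term) auto
  ultimately show ?thesis by simp
qed

lemma sign_rep_prod:
  assumes "\<And>i. i \<in> S \<Longrightarrow> sign_rep n (f i)" shows "sign_rep n (\<lambda>u \<tau>. \<Prod>i\<in>S. f i u \<tau>)"
  using assms
proof (induction S rule: infinite_finite_induct)
  case (insert i S)
  then show ?case using sign_rep_mult[of n "f i" "\<lambda>u \<tau>. \<Prod>i\<in>S. f i u \<tau>"] by simp
qed (use sign_rep_const[of n 1] in simp_all)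

lemma sign_rep_power: "sign_rep n f \<Longrightarrow> sign_rep n (\<lambda>u \<tau>. f u \<tau> ^ k)"
  using sign_rep_prod[of "{..<k}" n "\<lambda>_. f"] by simp

lemma sign_rep_eval:
  assumes "\<And>v. v \<in> mpol_vars p \<Longrightarrow> sign_rep n (x v)" shows "sign_rep n (\<lambda>u \<tau>. mpol_eval to_ac (\<lambda>v. x v u \<tau>) p)"
  unfolding mpol_eval_def
  by (intro sign_rep_sum sign_rep_mult sign_rep_const sign_rep_prod sign_rep_power assms)
    (auto simp: mpol_vars_def)

locale orthogonal_action = orthogonal_form q n
  for q :: "'k::field_char_0 vec \<Rightarrow> 'k" and n :: nat +
  fixes m :: nat and \<rho> :: "'k alg_closure mat \<Rightarrow> 'k alg_closure mat"
  assumes action: "linear_action (orthogonal_group n q) n m \<rho>"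
begin

lemma rho_GL: "g \<in> Oq \<Longrightarrow> \<rho> g \<in> carrier (GL m)"
  using action by (auto simp: linear_action_def hom_def carrier_orthogonal)

lemma rho_carrier: "g \<in> Oq \<Longrightarrow> \<rho> g \<in> carrier_mat m m"
  using rho_GL GL_carrier by blast

lemma rho_mult: "g \<in> Oq \<Longrightarrow> h \<in> Oq \<Longrightarrow> \<rho> (g * h) = \<rho> g * \<rho> h"
  using action unfolding linear_action_def hom_def carrier_orthogonal
  by (auto simp: GL_def units_of_def ring_mat_def)

lemma rho_one: "\<rho> (1\<^sub>m n) = 1\<^sub>m m"
proof -
  note o = rho_carrier[OF Oq_one]
  have "\<rho> (1\<^sub>m n) = \<rho> (1\<^sub>m n) * \<rho> (1\<^sub>m n)" using rho_mult[OF Oq_one Oq_one] by simp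
  moreover obtain B where B: "B \<in> carrier_mat m m" "B * \<rho> (1\<^sub>m n) = 1\<^sub>m m"
    using rho_GL[OF Oq_one] unfolding GL_carrier by blast
  ultimately have "B * \<rho> (1\<^sub>m n) = B * \<rho> (1\<^sub>m n) * \<rho> (1\<^sub>m n)"
    using assoc_mult_mat[OF B(1) o o] by simp
  then show ?thesis unfolding B(2) using left_mult_one_mat[OF o] by simp
qed

lemma rho_inverse:
  assumes "g \<in> Oq" "h \<in> Oq" "g * h = 1\<^sub>m n" shows "\<rho> g * \<rho> h = 1\<^sub>m m"
  using rho_mult[OF assms(1,2)] assms(3) rho_one by simp

text \<open>
  On the orthogonal group \<open>det g = \<plusminus>1\<close>, so the denominators of regular functions can be moved to the
  numerator.
\<close>

lemma rho_polynomial: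
  obtains p :: "nat \<Rightarrow> nat \<Rightarrow> (nat \<times> nat, 'k) mpol" and N where
    "\<And>i c. i < m \<Longrightarrow> c < m \<Longrightarrow> mpol_vars (p i c) \<subseteq> {..<n} \<times> {..<n}"
    "\<And>i c g. i < m \<Longrightarrow> c < m \<Longrightarrow> g \<in> Oq \<Longrightarrow>
       \<rho> g $$ (i, c) = mpol_eval to_ac (\<lambda>ij. g $$ ij) (p i c) * det g ^ N i c"
proof -
  define good where "good = (\<lambda>i c pN. mpol_vars (fst pN :: (nat \<times> nat, 'k) mpol) \<subseteq> {..<n} \<times> {..<n} \<and>
      (\<forall>g\<in>Oq. \<rho> g $$ (i, c) = mpol_eval to_ac (\<lambda>ij. g $$ ij) (fst pN) / det g ^ (snd pN)))"
  define pN where "pN = (\<lambda>i c. SOME pN. good i c pN)"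
  have pN: "good i c (pN i c)" if ic: "i < m" "c < m" for i c
  proof -
    have "regular_on (orthogonal_group n q) n (\<lambda>g. \<rho> g $$ (i, c))"
      using action ic unfolding linear_action_def by blast
    then obtain p :: "(nat \<times> nat, 'k) mpol" and N where "mpol_vars p \<subseteq> {..<n} \<times> {..<n}"
      "\<forall>g\<in>Oq. \<rho> g $$ (i, c) = mpol_eval to_ac (\<lambda>ij. g $$ ij) p / det g ^ N"
      unfolding regular_on_def carrier_orthogonal by blast
    then have "good i c (p, N)" by (simp add: good_def)
    then show ?thesis unfolding pN_def by (rule someI)
  qed
  have i: "x / det g ^ k = x * det g ^ k" if g: "g \<in> Oq" for g k x
  proof -
    have "det g ^ k * det g ^ k = 1" using Oq_det[OF g] by (simp add: power_mult_distrib[symmetric])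
    then have "inverse (det g ^ k) = det g ^ k" by (rule inverse_unique)
    then show ?thesis by (simp only: divide_inverse)
  qed
  show ?thesis
  proof (rule that[of "\<lambda>i c. fst (pN i c)" "\<lambda>i c. snd (pN i c)"])
    fix i c assume ic: "i < m" "c < m"
    show "mpol_vars (fst (pN i c)) \<subseteq> {..<n} \<times> {..<n}" using pN[OF ic] unfolding good_def by blast
    fix g assume g: "g \<in> Oq"
    show "\<rho> g $$ (i, c) = mpol_eval to_ac (\<lambda>ij. g $$ ij) (fst (pN i c)) * det g ^ snd (pN i c)"
      using pN[OF ic] g unfolding good_def i[OF g, symmetric] by blast
  qed
qed

text \<open>
  Matrices with orthogonal columns. The number \<open>\<eta> j\<close> is the factor whose square root rescales column
  \<open>j\<close> to norm \<open>a j\<close>, where \<open>a\<close> will be a diagonal form of \<open>Q\<close> over \<open>k\<close>.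
\<close>

definition good_point :: "(nat \<Rightarrow> 'k) \<Rightarrow> 'k alg_closure mat \<Rightarrow> (nat \<Rightarrow> 'k alg_closure) \<Rightarrow> bool" where
  "good_point a u \<eta> \<longleftrightarrow> u \<in> carrier_mat n n \<and> (\<forall>j<n. \<eta> j \<noteq> 0) \<and>
     transpose_mat u * Q * u = diag_mat_of n (\<lambda>j. to_ac (a j) / \<eta> j)"

lemma good_point_mult:
  assumes g: "g \<in> Oq" and u: "good_point a u \<eta>" shows "good_point a (g * u) \<eta>"
proof -
  have gc: "g \<in> carrier_mat n n" "transpose_mat g * Q * g = Q" "transpose_mat g \<in> carrier_mat n n"
    and uc: "u \<in> carrier_mat n n" "transpose_mat u \<in> carrier_mat n n" using g u by (auto simp: good_point_def)
  have "transpose_mat (g * u) * Q * (g * u) = transpose_mat u * (transpose_mat g * Q * g) * u"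
    using gc(1,3) uc by (simp add: transpose_mult[OF gc(1) uc(1)] assoc_mult_mat[of _ n n _ n _ n] mult_carrier_mat[of _ n n _ n])
  then show ?thesis using u gc uc by (simp add: good_point_def)
qed

text \<open>
  If \<open>u\<close> has orthogonal columns and \<open>\<tau> j\<^sup>2 = \<eta> j\<close>, then \<open>frame u \<tau> = u \<cdot> diag(\<tau>) \<cdot> B\<close> lies in
  \<open>O(q)\<close>, and \<open>frame (g u) \<tau> = g \<cdot> frame u \<tau>\<close>. Hence the rows of \<open>\<rho> (frame u \<tau>)\<^sup>-\<^sup>1\<close> are multiplied
  on the right by \<open>\<rho> g\<^sup>-\<^sup>1\<close> when \<open>u\<close> moves to \<open>g u\<close>. Their entries are polynomial in \<open>u\<close> and \<open>\<tau>\<close>. The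
  part \<open>P I\<close> with odd exponents exactly at the \<open>\<tau> j\<close> for \<open>j\<close> in \<open>I\<close> depends on \<open>u\<close> and \<open>\<eta>\<close> only
  and transforms in the same way, because the identity holds for all choices of the signs of the
  \<open>\<tau> j\<close>. Together the parts recombine to an invertible matrix, which gives the last property.
\<close>

lemma equivariant_rows:
  obtains a :: "nat \<Rightarrow> 'k" and P :: "nat set \<Rightarrow> nat \<Rightarrow> nat \<Rightarrow> (nat \<times> nat, 'k) mpol" where
    "\<And>j. j < n \<Longrightarrow> a j \<noteq> 0"
    "\<And>u \<eta> g h I i c. good_point a u \<eta> \<Longrightarrow> g \<in> Oq \<Longrightarrow> h \<in> Oq \<Longrightarrow> g * h = 1\<^sub>m n \<Longrightarrow> I \<subseteq> {..<n} \<Longrightarrow> i < m \<Longrightarrow> c < m \<Longrightarrow>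
       mpol_eval to_ac (pt n (g * u) \<eta>) (P I i c) =
       (\<Sum>e<m. mpol_eval to_ac (pt n u \<eta>) (P I i e) * \<rho> h $$ (e, c))"
    "\<And>u \<eta> x. good_point a u \<eta> \<Longrightarrow>
       (\<And>I i. I \<subseteq> {..<n} \<Longrightarrow> i < m \<Longrightarrow> (\<Sum>c<m. mpol_eval to_ac (pt n u \<eta>) (P I i c) * x c) = 0) \<Longrightarrow>
       (\<forall>c<m. x c = 0)"
proof -
  interpret ac: comm_ring_hom "to_ac :: 'k \<Rightarrow> _" by (rule to_ac_mat_hom)
  let ?T = transpose_mat
  note assoc = assoc_mult_mat[of _ n n _ n _ n] mult_carrier_mat[of _ n n _ n]
  have U: "subfield_set (UNIV :: 'k set)" by (simp add: subfield_set_def subring_UNIV)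
  obtain Ak a where Ak: "Ak \<in> carrier_mat n n" "det Ak \<noteq> 0" and a: "\<And>i. i < n \<Longrightarrow> a i \<noteq> 0"
    and diag: "?T Ak * gram * Ak = diag_mat_of n a"
    by (rule diagonalize_symmetric[OF U _ gram_carrier _ gram_sym det_gram]) auto
  obtain Bk where Bk: "Bk \<in> carrier_mat n n" "Ak * Bk = 1\<^sub>m n" "Bk * Ak = 1\<^sub>m n"
    using mat_inverse_exists[OF Ak] by blast
  obtain Qk where Qk: "Qk \<in> carrier_mat n n" "gram * Qk = 1\<^sub>m n" "Qk * gram = 1\<^sub>m n"
    using mat_inverse_exists[OF gram_carrier det_gram] by blast
  define B where "B = map_mat to_ac Bk"
  define Qi where "Qi = map_mat to_ac Qk"
  have BQ: "B \<in> carrier_mat n n" "Qi \<in> carrier_mat n n" using Bk Qk by (auto simp: B_def Qi_def)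
  have QiQ: "Qi * Q = 1\<^sub>m n"
    unfolding Qi_def Q_def by (simp only: ac.mat_hom_mult[OF Qk(1) gram_carrier, symmetric] Qk(3) ac.mat_hom_one)
  have Bdiag: "?T B * diag_mat_of n (\<lambda>j. to_ac (a j)) * B = Q"
  proof -
    have T: "?T Ak \<in> carrier_mat n n" "?T Bk \<in> carrier_mat n n" using Ak Bk by auto
    have tb: "?T Bk * ?T Ak = 1\<^sub>m n" using transpose_mult[OF Ak(1) Bk(1)] Bk(2) by simp
    have "?T Bk * diag_mat_of n a * Bk = (?T Bk * ?T Ak) * gram * (Ak * Bk)"
      unfolding diag[symmetric] using T Ak(1) Bk(1) by (simp add: assoc)
    also have "\<dots> = gram" unfolding tb Bk(2) using left_mult_one_mat[OF gram_carrier] right_mult_one_mat[OF gram_carrier] by simp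
    finally have e: "?T Bk * diag_mat_of n a * Bk = gram" .
    have "map_mat to_ac (?T Bk * diag_mat_of n a * Bk) =
        map_mat to_ac (?T Bk) * map_mat to_ac (diag_mat_of n a) * map_mat to_ac Bk"
      using ac.mat_hom_mult[OF mult_carrier_mat[OF T(2) diag_mat_of_carrier] Bk(1)]
        ac.mat_hom_mult[OF T(2) diag_mat_of_carrier] by simp
    moreover have "map_mat to_ac (?T Bk) = ?T B" unfolding B_def by (rule eq_matI) auto
    moreover have "map_mat to_ac (diag_mat_of n a) = diag_mat_of n (\<lambda>j. to_ac (a j))"
      by (rule eq_matI) (auto simp: diag_mat_of_def)
    ultimately show ?thesis using e by (simp add: Q_def B_def)
  qed
  \<comment> \<open>The matrix \<open>B\<close> is defined over \<open>k\<close> and satisfies \<open>B\<^sup>T diag(a) B = Q\<close>.\<close>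
  define frame where "frame = (\<lambda>u \<tau>. u * diag_mat_of n \<tau> * B)"
  define finv where "finv = (\<lambda>u \<tau>. Qi * ?T (frame u \<tau>) * Q)"
  have frame_c: "frame u \<tau> \<in> carrier_mat n n" if "u \<in> carrier_mat n n" for u \<tau>
    unfolding frame_def by (rule mult_carrier_mat[OF mult_carrier_mat[OF that diag_mat_of_carrier] BQ(1)])
  have frame_Oq: "frame u \<tau> \<in> Oq" if g: "good_point a u \<eta>" and t: "\<And>j. j < n \<Longrightarrow> (\<tau> j)\<^sup>2 = \<eta> j" for u \<tau> \<eta>
  proof -
    have u: "u \<in> carrier_mat n n" "?T u * Q * u = diag_mat_of n (\<lambda>j. to_ac (a j) / \<eta> j)" "\<And>j. j < n \<Longrightarrow> \<eta> j \<noteq> 0"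
      using g by (auto simp: good_point_def)
    have T: "?T u \<in> carrier_mat n n" "?T B \<in> carrier_mat n n" using u BQ by auto
    let ?D = "diag_mat_of n \<tau>"
    have "?T (frame u \<tau>) = ?T B * (?D * ?T u)"
      unfolding frame_def transpose_mult[OF mult_carrier_mat[OF u(1) diag_mat_of_carrier] BQ(1)]
        transpose_mult[OF u(1) diag_mat_of_carrier] diag_mat_of_transpose ..
    then have "?T (frame u \<tau>) * Q * frame u \<tau> = ?T B * (?D * (?T u * Q * u) * ?D) * B"
      unfolding frame_def using T u(1) BQ(1) by (simp add: assoc)
    also have "?D * (?T u * Q * u) * ?D = diag_mat_of n (\<lambda>j. to_ac (a j))"
    proof -
      have "\<tau> j * (to_ac (a j) / \<eta> j) * \<tau> j = to_ac (a j)" if "j < n" for j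
        using u(3)[OF that] t[OF that] by (simp add: power2_eq_square field_simps)
      then show ?thesis unfolding u(2) diag_mat_of_mult
        by (intro eq_matI) (auto simp: diag_mat_of_def)
    qed
    finally show ?thesis using Bdiag frame_c[OF u(1)] by simp
  qed
  obtain p :: "nat \<Rightarrow> nat \<Rightarrow> (nat \<times> nat, 'k) mpol" and N where
    pv: "\<And>i c. i < m \<Longrightarrow> c < m \<Longrightarrow> mpol_vars (p i c) \<subseteq> {..<n} \<times> {..<n}" and
    p: "\<And>i c g. i < m \<Longrightarrow> c < m \<Longrightarrow> g \<in> Oq \<Longrightarrow>
       \<rho> g $$ (i, c) = mpol_eval to_ac (\<lambda>ij. g $$ ij) (p i c) * det g ^ N i c"
    by (rule rho_polynomial) blast
  \<comment> \<open>The entries of the inverse of \<open>frame u \<tau>\<close>, written as explicit sums in order to exhibit them as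
    polynomials in \<open>u\<close> and \<open>\<tau>\<close>.\<close>
  define F where "F = (\<lambda>u \<tau> (i, j). \<Sum>k<n. \<Sum>l<n. Qi $$ (i, k) * (\<Sum>r<n. u $$ (l, r) * \<tau> r * B $$ (r, k)) * Q $$ (l, j))"
  have finv_index: "finv u \<tau> $$ ij = F u \<tau> ij" if u: "u \<in> carrier_mat n n" and lt: "fst ij < n" "snd ij < n" for u \<tau> ij
  proof -
    obtain i j where ij: "ij = (i, j)" "i < n" "j < n" using lt by (cases ij) auto
    have fr: "frame u \<tau> $$ (l, k) = (\<Sum>r<n. u $$ (l, r) * \<tau> r * B $$ (r, k))" if "l < n" "k < n" for l k
    proof -
      have "(u * diag_mat_of n \<tau>) $$ (l, r) = u $$ (l, r) * \<tau> r" if "r < n" for r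
        unfolding index_mult_mat_sum[OF u diag_mat_of_carrier \<open>l < n\<close> that]
        using that by (simp add: diag_mat_of_index if_distrib cong: if_cong)
      then show ?thesis unfolding frame_def
        index_mult_mat_sum[OF mult_carrier_mat[OF u diag_mat_of_carrier] BQ(1) that] by simp
    qed
    have T: "?T (frame u \<tau>) \<in> carrier_mat n n" using frame_c[OF u] by simp
    have "finv u \<tau> $$ (i, j) = (\<Sum>l<n. (\<Sum>k<n. Qi $$ (i, k) * frame u \<tau> $$ (l, k)) * Q $$ (l, j))"
      unfolding finv_def index_mult_mat_sum[OF mult_carrier_mat[OF BQ(2) T] Q_carrier ij(2,3)]
      by (intro sum.cong refl) (use index_mult_mat_sum[OF BQ(2) T ij(2)] carrier_matD[OF frame_c[OF u]] in simp)
    also have "\<dots> = F u \<tau> (i, j)"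
      unfolding F_def sum_distrib_right by (subst sum.swap) (simp add: fr)
    finally show ?thesis using ij by simp
  qed
  define detF where "detF = (\<lambda>u \<tau>. \<Sum>\<pi> | \<pi> permutes {0..<n}. signof \<pi> * (\<Prod>i = 0..<n. F u \<tau> (i, \<pi> i)))"
  have det_index: "det (finv u \<tau>) = detF u \<tau>" if u: "u \<in> carrier_mat n n" for u \<tau>
  proof -
    have c: "finv u \<tau> \<in> carrier_mat n n" unfolding finv_def using frame_c[OF u] BQ by (simp add: assoc)
    have "finv u \<tau> $$ (i, \<pi> i) = F u \<tau> (i, \<pi> i)" if "\<pi> permutes {0..<n}" "i \<in> {0..<n}" for \<pi> i
      using finv_index[OF u, of "(i, \<pi> i)"] permutes_in_image[OF that(1), of i] that(2) by simp
    then show ?thesis unfolding det_def'[OF c] detF_def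
      by (intro sum.cong refl arg_cong2[where f="(*)"] prod.cong) auto
  qed
  have Fv: "F u \<tau> ij = F u \<tau> (fst ij, snd ij)" for u \<tau> ij by simp
  have srF: "sign_rep n (\<lambda>u \<tau>. F u \<tau> ij)" if "fst ij < n" "snd ij < n" for ij
  proof -
    obtain i j where ij: "ij = (i, j)" by (cases ij) auto
    have cQ: "sign_rep n (\<lambda>u \<tau>. Qi $$ (i, k))" if "i < n" "k < n" for i k
      using sign_rep_const[of n "Qk $$ (i, k)"] that Qk(1) by (simp add: Qi_def)
    have cB: "sign_rep n (\<lambda>u \<tau>. B $$ (i, k))" if "i < n" "k < n" for i k
      using sign_rep_const[of n "Bk $$ (i, k)"] that Bk(1) by (simp add: B_def)
    have cG: "sign_rep n (\<lambda>u \<tau>. Q $$ (i, k))" if "i < n" "k < n" for i k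
      using sign_rep_const[of n "gram $$ (i, k)"] that carrier_matD[OF gram_carrier] by (simp add: Q_def)
    show ?thesis unfolding F_def ij prod.case
      using that ij by (intro sign_rep_sum sign_rep_mult cQ cB cG sign_rep_entry sign_rep_tau) auto
  qed
  have srdet: "sign_rep n detF"
  proof -
    have sg: "sign_rep n (\<lambda>u \<tau>. signof \<pi> :: 'k alg_closure)" for \<pi> :: "nat \<Rightarrow> nat"
      using sign_rep_const[of n "1 :: 'k"] sign_rep_const[of n "- 1 :: 'k"] by (simp add: sign_def)
    show ?thesis unfolding detF_def
    proof (intro sign_rep_sum sign_rep_mult sg sign_rep_prod)
      fix \<pi> i assume "\<pi> \<in> {\<pi>. \<pi> permutes {0..<n}}" "i \<in> {0..<n}"
      then have "i < n" "\<pi> i < n" using permutes_in_image[of \<pi> "{0..<n}" i] by auto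
      then show "sign_rep n (\<lambda>u \<tau>. F u \<tau> (i, \<pi> i))" by (intro srF) auto
    qed
  qed
  \<comment> \<open>The parts of the entry \<open>(i, c)\<close> of \<open>\<rho> (frame u \<tau>)\<^sup>-\<^sup>1\<close>, one for each parity pattern.\<close>
  define goodR where "goodR = (\<lambda>i c (R :: nat set \<Rightarrow> (nat \<times> nat, 'k) mpol). \<forall>u \<tau>.
      mpol_eval to_ac (\<lambda>ij. F u \<tau> ij) (p i c) * detF u \<tau> ^ N i c =
      (\<Sum>I\<in>Pow {..<n}. (\<Prod>j\<in>I. \<tau> j) * mpol_eval to_ac (pt n u (\<lambda>j. (\<tau> j)\<^sup>2)) (R I)))"
  define R where "R = (\<lambda>i c. SOME R. goodR i c R)"
  have "goodR i c (R i c)" if ic: "i < m" "c < m" for i c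
  proof -
    have "sign_rep n (\<lambda>u \<tau>. mpol_eval to_ac (\<lambda>ij. F u \<tau> ij) (p i c) * detF u \<tau> ^ N i c)"
      using pv[OF ic] by (intro sign_rep_mult sign_rep_eval srF sign_rep_power srdet) auto
    then have "\<exists>R. goodR i c R" unfolding sign_rep_def goodR_def by blast
    then show ?thesis unfolding R_def by (rule someI_ex)
  qed
  then have R: "mpol_eval to_ac (\<lambda>ij. F u \<tau> ij) (p i c) * detF u \<tau> ^ N i c =
      (\<Sum>I\<in>Pow {..<n}. (\<Prod>j\<in>I. \<tau> j) * mpol_eval to_ac (pt n u (\<lambda>j. (\<tau> j)\<^sup>2)) (R i c I))"
    if "i < m" "c < m" for i c u \<tau>
    using that unfolding goodR_def by blast
  have pt_cong: "pt n u \<eta> = pt n u \<eta>'" if "\<And>j. j < n \<Longrightarrow> \<eta> j = \<eta>' j" for u :: "'k alg_closure mat" and \<eta> \<eta>'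
    using that by (auto simp: pt_def fun_eq_iff)
  have key: "\<rho> h $$ (i, c) = (\<Sum>I\<in>Pow {..<n}. (\<Prod>j\<in>I. \<tau> j) * mpol_eval to_ac (pt n u \<eta>) (R i c I))"
    if g: "good_point a u \<eta>" and t: "\<And>j. j < n \<Longrightarrow> (\<tau> j)\<^sup>2 = \<eta> j" and ic: "i < m" "c < m"
      and h: "h \<in> Oq" "frame u \<tau> * h = 1\<^sub>m n" for u \<eta> \<tau> i c h
  proof -
    have u: "u \<in> carrier_mat n n" using g by (simp add: good_point_def)
    have hf: "h = finv u \<tau>"
      unfolding finv_def by (rule Oq_inverse_formula[OF BQ(2) QiQ frame_Oq[OF g t] h])
    have "mpol_eval to_ac (\<lambda>ij. h $$ ij) (p i c) = mpol_eval to_ac (\<lambda>ij. F u \<tau> ij) (p i c)"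
      unfolding hf using pv[OF ic] finv_index[OF u] by (intro mpol_eval_cong) auto
    then have "\<rho> h $$ (i, c) = mpol_eval to_ac (\<lambda>ij. F u \<tau> ij) (p i c) * detF u \<tau> ^ N i c"
      using p[OF ic h(1)] det_index[OF u] hf by simp
    moreover have "pt n u (\<lambda>j. (\<tau> j)\<^sup>2) = pt n u \<eta>" by (rule pt_cong) (rule t)
    ultimately show ?thesis unfolding R[OF ic] by simp
  qed
  have root: "\<exists>\<tau> :: nat \<Rightarrow> 'k alg_closure. \<forall>j. (\<tau> j)\<^sup>2 = \<eta> j" for \<eta>
    by (rule choice) (use nth_root_exists[of 2] in auto)
  show ?thesis
  proof (rule that[of a "\<lambda>I i c. R i c I"])
    show "a j \<noteq> 0" if "j < n" for j using a[OF that] .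
  next
    fix u \<eta> g h I i c
    assume gp: "good_point a u \<eta>" and g: "g \<in> Oq" and h: "h \<in> Oq" "g * h = 1\<^sub>m n" and I: "I \<subseteq> {..<n}" and ic: "i < m" "c < m"
    obtain \<tau> :: "nat \<Rightarrow> 'k alg_closure" where \<tau>: "\<And>j. (\<tau> j)\<^sup>2 = \<eta> j" using root by blast
    have u: "u \<in> carrier_mat n n" and \<eta>: "\<And>j. j < n \<Longrightarrow> \<eta> j \<noteq> 0" using gp by (auto simp: good_point_def)
    let ?e = "\<lambda>I. mpol_eval to_ac (pt n (g * u) \<eta>) (R i c I) - (\<Sum>e<m. mpol_eval to_ac (pt n u \<eta>) (R i e I) * \<rho> h $$ (e, c))"
    \<comment> \<open>The equivariance of the whole row for the square roots \<open>\<epsilon> j * \<tau> j\<close>.\<close>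
    have z: "(\<Sum>I\<in>Pow {..<n}. (\<Prod>j\<in>I. \<epsilon> j) * ((\<Prod>j\<in>I. \<tau> j) * ?e I)) = 0"
      if e: "\<forall>j. \<epsilon> j = 1 \<or> \<epsilon> j = - 1" for \<epsilon> :: "nat \<Rightarrow> 'k alg_closure"
    proof -
      let ?t = "\<lambda>j. \<epsilon> j * \<tau> j"
      have t: "(?t j)\<^sup>2 = \<eta> j" for j using e[rule_format, of j] \<tau> by (auto simp: power_mult_distrib)
      have fu: "frame u ?t \<in> Oq" by (rule frame_Oq[OF gp t])
      obtain f where f: "f \<in> Oq" "frame u ?t * f = 1\<^sub>m n" "f * frame u ?t = 1\<^sub>m n" using Oq_inverse[OF fu] by blast
      have fg: "frame (g * u) ?t = g * frame u ?t"
        unfolding frame_def using g u BQ by (simp add: assoc)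
      have fh: "f * h \<in> Oq" by (rule Oq_mult[OF f(1) h(1)])
      have "frame (g * u) ?t * (f * h) = g * (frame u ?t * f) * h"
        unfolding fg using g h(1) f(1) frame_c[OF u] by (simp add: assoc)
      have one: "frame (g * u) ?t * (f * h) = 1\<^sub>m n"
      proof -
        have "g \<in> carrier_mat n n" using g by simp
        then have "g * 1\<^sub>m n = g" by (rule right_mult_one_mat)
        with \<open>frame (g * u) ?t * (f * h) = g * (frame u ?t * f) * h\<close> show ?thesis by (simp only: f(2) h(2))
      qed
      have "\<rho> (f * h) $$ (i, c) = (\<Sum>I\<in>Pow {..<n}. (\<Prod>j\<in>I. ?t j) * mpol_eval to_ac (pt n (g * u) \<eta>) (R i c I))"
        by (rule key[OF good_point_mult[OF g gp] t ic fh one])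
      moreover have "\<rho> (f * h) $$ (i, c) = (\<Sum>e<m. \<rho> f $$ (i, e) * \<rho> h $$ (e, c))"
        unfolding rho_mult[OF f(1) h(1)] by (rule index_mult_mat_sum[OF rho_carrier[OF f(1)] rho_carrier[OF h(1)] ic])
      moreover have "\<rho> f $$ (i, e) = (\<Sum>I\<in>Pow {..<n}. (\<Prod>j\<in>I. ?t j) * mpol_eval to_ac (pt n u \<eta>) (R i e I))" if "e < m" for e
        by (rule key[OF gp t ic(1) that f(1,2)])
      ultimately have "(\<Sum>I\<in>Pow {..<n}. (\<Prod>j\<in>I. ?t j) * mpol_eval to_ac (pt n (g * u) \<eta>) (R i c I)) =
          (\<Sum>e<m. (\<Sum>I\<in>Pow {..<n}. (\<Prod>j\<in>I. ?t j) * mpol_eval to_ac (pt n u \<eta>) (R i e I)) * \<rho> h $$ (e, c))" by simp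
      also have "\<dots> = (\<Sum>I\<in>Pow {..<n}. (\<Prod>j\<in>I. ?t j) * (\<Sum>e<m. mpol_eval to_ac (pt n u \<eta>) (R i e I) * \<rho> h $$ (e, c)))"
        unfolding sum_distrib_right sum_distrib_left by (subst sum.swap) (simp add: mult_ac)
      finally have "(\<Sum>I\<in>Pow {..<n}. (\<Prod>j\<in>I. ?t j) * ?e I) = 0"
        by (simp add: right_diff_distrib sum_subtractf)
      then show ?thesis by (simp add: prod.distrib mult.assoc)
    qed
    have "(\<Prod>j\<in>I. \<tau> j) * ?e I = 0"
      by (rule sign_separation[where S="{..<n}" and a="\<lambda>I. (\<Prod>j\<in>I. \<tau> j) * ?e I", OF finite_lessThan _ I]) (rule z)
    moreover have "(\<Prod>j\<in>I. \<tau> j) \<noteq> 0"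
    proof -
      have "\<tau> j \<noteq> 0" if "j \<in> I" for j using \<tau>[of j] \<eta>[of j] that I by auto
      then show ?thesis using I by (simp add: prod_zero_iff finite_subset)
    qed
    ultimately show "mpol_eval to_ac (pt n (g * u) \<eta>) (R i c I) =
       (\<Sum>e<m. mpol_eval to_ac (pt n u \<eta>) (R i e I) * \<rho> h $$ (e, c))" by simp
  next
    fix u \<eta> and x :: "nat \<Rightarrow> 'k alg_closure"
    assume gp: "good_point a u \<eta>"
      and z: "\<And>I i. I \<subseteq> {..<n} \<Longrightarrow> i < m \<Longrightarrow> (\<Sum>c<m. mpol_eval to_ac (pt n u \<eta>) (R i c I) * x c) = 0"
    obtain \<tau> :: "nat \<Rightarrow> 'k alg_closure" where \<tau>: "\<And>j. (\<tau> j)\<^sup>2 = \<eta> j" using root by blast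
    have fu: "frame u \<tau> \<in> Oq" by (rule frame_Oq[OF gp \<tau>])
    obtain f where f: "f \<in> Oq" "frame u \<tau> * f = 1\<^sub>m n" "f * frame u \<tau> = 1\<^sub>m n" using Oq_inverse[OF fu] by blast
    define v where "v = vec m x"
    have v: "v \<in> carrier_vec m" by (simp add: v_def)
    have "\<rho> f *\<^sub>v v = 0\<^sub>v m"
    proof (rule eq_vecI)
      fix i assume "i < dim_vec (0\<^sub>v m :: 'k alg_closure vec)"
      then have i: "i < m" by simp
      have "(\<rho> f *\<^sub>v v) $ i = (\<Sum>c<m. (\<Sum>I\<in>Pow {..<n}. (\<Prod>j\<in>I. \<tau> j) * mpol_eval to_ac (pt n u \<eta>) (R i c I)) * x c)"
        unfolding mult_mat_vec_index_sum[OF rho_carrier[OF f(1)] v i]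
        by (intro sum.cong refl) (use key[OF gp \<tau> i _ f(1,2)] in \<open>simp add: v_def\<close>)
      also have "\<dots> = (\<Sum>I\<in>Pow {..<n}. (\<Prod>j\<in>I. \<tau> j) * (\<Sum>c<m. mpol_eval to_ac (pt n u \<eta>) (R i c I) * x c))"
        unfolding sum_distrib_right sum_distrib_left by (subst sum.swap) (simp add: mult_ac)
      also have "\<dots> = 0" by (intro sum.neutral) (use z i in auto)
      finally show "(\<rho> f *\<^sub>v v) $ i = 0\<^sub>v m $ i" using i by simp
    qed (use rho_carrier[OF f(1)] in auto)
    then have "\<rho> (frame u \<tau>) *\<^sub>v (\<rho> f *\<^sub>v v) = 0\<^sub>v m"
      using rho_carrier[OF fu] by (intro eq_vecI) auto
    then have "v = 0\<^sub>v m"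
      using assoc_mult_mat_vec[OF rho_carrier[OF fu] rho_carrier[OF f(1)] v] rho_inverse[OF fu f(1,2)] v by simp
    then have "v $ c = 0" if "c < m" for c using that by simp
    then show "\<forall>c<m. x c = 0" by (simp add: v_def)
  qed
qed

end

section \<open>The group acting on vectors and generic matrices\<close>

lemma map_mat_hom_on:
  assumes f: "hom_on A f" and M: "M \<in> carrier_mat r k" "L \<in> carrier_mat k c"
    and e: "\<And>i j. i < r \<Longrightarrow> j < k \<Longrightarrow> M $$ (i, j) \<in> A" "\<And>i j. i < k \<Longrightarrow> j < c \<Longrightarrow> L $$ (i, j) \<in> A"
  shows map_mat_hom_mult: "map_mat f (M * L) = map_mat f M * map_mat f L"
    and mat_mult_entries: "\<And>i j. i < r \<Longrightarrow> j < c \<Longrightarrow> (M * L) $$ (i, j) \<in> A"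
proof -
  note A = hom_on_subring[OF f]
  show mem: "(M * L) $$ (i, j) \<in> A" if "i < r" "j < c" for i j
    unfolding index_mult_mat_sum[OF M that] using e that by (intro subring_sum[OF A] subring_mult[OF A]) auto
  have MM: "map_mat f M \<in> carrier_mat r k" "map_mat f L \<in> carrier_mat k c" using M by auto
  show "map_mat f (M * L) = map_mat f M * map_mat f L"
  proof (rule eq_matI)
    fix i j assume "i < dim_row (map_mat f M * map_mat f L)" "j < dim_col (map_mat f M * map_mat f L)"
    then have ij: "i < r" "j < c" using M by auto
    have "map_mat f (M * L) $$ (i, j) = f (\<Sum>l<k. M $$ (i, l) * L $$ (l, j))"
      using ij M index_mult_mat_sum[OF M ij] by simp
    also have "\<dots> = (\<Sum>l<k. f (M $$ (i, l)) * f (L $$ (l, j)))"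
    proof -
      have "f (\<Sum>l<k. M $$ (i, l) * L $$ (l, j)) = (\<Sum>l<k. f (M $$ (i, l) * L $$ (l, j)))"
        by (rule hom_on_sum[OF f]) (use e ij in \<open>auto intro: subring_mult[OF A]\<close>)
      then show ?thesis using e ij by (simp add: hom_on_mult[OF f])
    qed
    also have "\<dots> = (map_mat f M * map_mat f L) $$ (i, j)"
      unfolding index_mult_mat_sum[OF MM ij] using ij M by simp
    finally show "map_mat f (M * L) $$ (i, j) = (map_mat f M * map_mat f L) $$ (i, j)" .
  qed (use M in auto)
qed

lemma map_mat_transpose: "map_mat f (transpose_mat M) = transpose_mat (map_mat f M)"
  by (rule eq_matI) auto

lemma map_mat_one_on: "hom_on A f \<Longrightarrow> map_mat f (1\<^sub>m k) = 1\<^sub>m k"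
  by (rule eq_matI) (auto simp: hom_on_one hom_on_zero)

lemma inverse_sum:
  assumes M: "M \<in> carrier_mat k k" "L \<in> carrier_mat k k" "M * L = 1\<^sub>m k" and i: "i < k"
  shows "(\<Sum>l<k. M $$ (i, l) * (\<Sum>r<k. L $$ (l, r) * x r)) = (x i :: 'a::comm_ring_1)"
proof -
  have "(\<Sum>l<k. M $$ (i, l) * (\<Sum>r<k. L $$ (l, r) * x r)) = (\<Sum>r<k. (\<Sum>l<k. M $$ (i, l) * L $$ (l, r)) * x r)"
    unfolding sum_distrib_left sum_distrib_right by (subst sum.swap) (simp add: mult_ac)
  also have "\<dots> = (\<Sum>r<k. (M * L) $$ (i, r) * x r)"
    by (intro sum.cong refl) (use index_mult_mat_sum[OF M(1,2) i] in simp)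
  also have "\<dots> = (\<Sum>r<k. if r = i then x i else 0)"
    unfolding M(3) by (intro sum.cong refl) (use i in auto)
  finally show ?thesis using i by simp
qed

text \<open>
  The rows of \<open>equivariant_rows\<close> are fixed, so that they can be evaluated at the generic matrix.
\<close>

locale orthogonal_rows = orthogonal_action q n m \<rho>
  for q :: "'k::field_char_0 vec \<Rightarrow> 'k" and n m :: nat and \<rho> :: "'k alg_closure mat \<Rightarrow> 'k alg_closure mat" +
  fixes a :: "nat \<Rightarrow> 'k" and P :: "nat set \<Rightarrow> nat \<Rightarrow> nat \<Rightarrow> (nat \<times> nat, 'k) mpol"
  assumes a_nonzero: "\<And>j. j < n \<Longrightarrow> a j \<noteq> 0"
    and P_equivariant: "\<And>u \<eta> g h I i c. good_point a u \<eta> \<Longrightarrow> g \<in> Oq \<Longrightarrow> h \<in> Oq \<Longrightarrow> g * h = 1\<^sub>m n \<Longrightarrow>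
       I \<subseteq> {..<n} \<Longrightarrow> i < m \<Longrightarrow> c < m \<Longrightarrow>
       mpol_eval to_ac (pt n (g * u) \<eta>) (P I i c) =
       (\<Sum>e<m. mpol_eval to_ac (pt n u \<eta>) (P I i e) * \<rho> h $$ (e, c))"
    and P_kernel: "\<And>u \<eta> x. good_point a u \<eta> \<Longrightarrow>
       (\<And>I i. I \<subseteq> {..<n} \<Longrightarrow> i < m \<Longrightarrow> (\<Sum>c<m. mpol_eval to_ac (pt n u \<eta>) (P I i c) * x c) = 0) \<Longrightarrow>
       (\<forall>c<m. x c = 0)"
begin

text \<open>
  The variables with index below \<open>m\<close> are the coordinates of the generic vector of \<open>V\<close>; those from \<open>m\<close>
  to \<open>N\<close> are the entries of the generic matrix \<open>wm\<close>, row by row; \<open>sm\<close> is its Gram matrix.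
\<close>

definition N :: nat where "N = m + n * n"

definition wm :: "'k alg_closure ratfun mat" where "wm = mat n n (\<lambda>(i, j). rf_var (m + i * n + j))"
definition QO :: "'k alg_closure ratfun mat" where "QO = map_mat rf_const Q"
definition sm :: "'k alg_closure ratfun mat" where "sm = transpose_mat wm * QO * wm"

lemma carriers [simp]: "wm \<in> carrier_mat n n" "QO \<in> carrier_mat n n" "sm \<in> carrier_mat n n"
proof -
  show w: "wm \<in> carrier_mat n n" by (auto simp: wm_def)
  show Q: "QO \<in> carrier_mat n n" unfolding QO_def using Q_carrier by simp
  have "transpose_mat wm \<in> carrier_mat n n" using w by simp
  then show "sm \<in> carrier_mat n n" unfolding sm_def by (intro mult_carrier_mat[OF mult_carrier_mat[OF _ Q] w(1)])
qed

lemma frame_index_less: "i < n \<Longrightarrow> j < n \<Longrightarrow> m + i * n + j < N"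
proof -
  assume "i < n" "j < n"
  moreover from this have "Suc i * n \<le> n * n" by (intro mult_le_mono1) simp
  ultimately have "i * n + j < i * n + n" "i * n + n \<le> n * n" by auto
  then show "m + i * n + j < N" by (simp add: N_def)
qed

lemma wm_index: "i < n \<Longrightarrow> j < n \<Longrightarrow> wm $$ (i, j) = rf_var (m + i * n + j)"
  by (simp add: wm_def)

lemma two_nonzero: "(2 :: 'k alg_closure ratfun) \<noteq> 0"
proof
  assume z: "(2 :: 'k alg_closure ratfun) = 0"
  have "rf_const (1 + 1 :: 'k alg_closure) = rf_const 1 + rf_const 1"
    by (rule hom_on_add[OF hom_rf_const]) auto
  then have "rf_const (1 + 1 :: 'k alg_closure) = 1 + 1" by (simp only: hom_on_one[OF hom_rf_const])
  then have "rf_const (2 :: 'k alg_closure) = 0" using z by simp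
  then show False by (simp add: hom_UNIV_eq_0[OF hom_rf_const])
qed

definition sub_poly :: "'k alg_closure mat \<Rightarrow> nat \<Rightarrow> (nat, 'k alg_closure) mpol" where
  "sub_poly g i = (if i < m then \<Sum>l<m. mpol_const (\<rho> g $$ (i, l)) * mpol_var l
     else if i < N then \<Sum>l<n. mpol_const (g $$ ((i - m) div n, l)) * mpol_var (m + l * n + (i - m) mod n)
     else mpol_var i)"

text \<open>
  The substitution \<open>x \<mapsto> \<rho>(g) x\<close>, \<open>w \<mapsto> g w\<close>. It is the action of \<open>g\<^sup>-\<^sup>1\<close> on functions, which has the
  same fixed elements as the action of the group and avoids inverses in the formulas.
\<close>

definition sub :: "'k alg_closure mat \<Rightarrow> 'k alg_closure ratfun \<Rightarrow> 'k alg_closure ratfun" where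
  "sub g = rf_hom rf_const (\<lambda>i. Fraction_Field.Fract (sub_poly g i) 1)"

lemma frame_index_bounds:
  assumes "m \<le> i" "i < N"
  shows "(i - m) div n < n" "(i - m) mod n < n" "m + ((i - m) div n) * n + (i - m) mod n = i"
proof -
  have n: "n > 0" using assms by (auto simp: N_def intro!: Nat.gr0I)
  show "(i - m) mod n < n" using n by simp
  show "m + ((i - m) div n) * n + (i - m) mod n = i" using assms by simp
  have "i - m < n * n" using assms by (simp add: N_def less_diff_conv2)
  then show "(i - m) div n < n" using n by (simp add: less_mult_imp_div_less)
qed

lemma id_hom: "hom_on UNIV (\<lambda>b. b)"
  by (simp add: hom_on_def subring_UNIV)

lemma sub_poly_eval:
  "mpol_eval (\<lambda>b. b) y (sub_poly g i) = (if i < m then \<Sum>l<m. \<rho> g $$ (i, l) * y l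
     else if i < N then \<Sum>l<n. g $$ ((i - m) div n, l) * y (m + l * n + (i - m) mod n)
     else y i)"
  unfolding sub_poly_def
  by (simp add: hom_on_sum[OF hom_mpol_eval[OF id_hom]] hom_on_mult[OF hom_mpol_eval[OF id_hom]]
      mpol_eval_const mpol_eval_var[OF id_hom])

lemma sub_inj:
  assumes g: "g \<in> Oq" and z: "mpol_eval rf_const (\<lambda>i. Fraction_Field.Fract (sub_poly g i) 1) p = 0"
  shows "p = 0"
proof -
  obtain h where h: "h \<in> Oq" "g * h = 1\<^sub>m n" "h * g = 1\<^sub>m n" using Oq_inverse[OF g] by blast
  have gh: "g \<in> carrier_mat n n" "h \<in> carrier_mat n n" using g h by auto
  show ?thesis
  proof (rule mpol_eval_inj_points[OF id_hom _ _ z])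
    show "Fraction_Field.Fract (sub_poly g i) 1 = Fraction_Field.Fract (sub_poly g i) 1" for i ..
    fix x :: "nat \<Rightarrow> 'k alg_closure"
    define y where "y = (\<lambda>i. if i < m then \<Sum>l<m. \<rho> h $$ (i, l) * x l
     else if i < N then \<Sum>l<n. h $$ ((i - m) div n, l) * x (m + l * n + (i - m) mod n) else x i)"
    have "mpol_eval (\<lambda>b. b) y (sub_poly g i) = x i" for i
    proof -
      consider "i < m" | "m \<le> i" "i < N" | "N \<le> i" by linarith
      then show ?thesis
      proof cases
        case 1
        then show ?thesis unfolding sub_poly_eval
          using inverse_sum[OF rho_carrier[OF g] rho_carrier[OF h(1)] rho_inverse[OF g h(1,2)] 1] by (simp add: y_def)
      next
        case 2
        note b = frame_index_bounds[OF 2]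
        have "y (m + l * n + (i - m) mod n) = (\<Sum>r<n. h $$ (l, r) * x (m + r * n + (i - m) mod n))" if l: "l < n" for l
          using frame_index_less[OF l b(2)] b(2) by (simp add: y_def div_mult_self3 add.commute)
        then have "(\<Sum>l<n. g $$ ((i - m) div n, l) * y (m + l * n + (i - m) mod n)) = x (m + ((i - m) div n) * n + (i - m) mod n)"
          using inverse_sum[OF gh h(2) b(1), of "\<lambda>r. x (m + r * n + (i - m) mod n)"] by simp
        then show ?thesis unfolding sub_poly_eval using 2 b(3) by simp
      next
        case 3
        then show ?thesis unfolding sub_poly_eval by (simp add: y_def N_def)
      qed
    qed
    then show "\<exists>y. \<forall>i. mpol_eval (\<lambda>b. b) y (sub_poly g i) = x i" by blast
  qed
qed

lemma sub_facts:
  assumes g: "g \<in> Oq"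
  shows sub_hom: "hom_on UNIV (sub g)" and sub_const: "sub g (rf_const c) = rf_const c"
    and sub_var: "sub g (rf_var i) = Fraction_Field.Fract (sub_poly g i) 1"
  unfolding sub_def using rf_hom[OF hom_rf_const sub_inj[OF g]] by blast+

lemma Fract_sum_const_var:
  "Fraction_Field.Fract (\<Sum>l\<in>I. mpol_const (b l) * mpol_var (e l)) 1 = (\<Sum>l\<in>I. rf_const (b l) * rf_var (e l))"
  by (simp add: hom_on_sum[OF hom_Fract] rf_const_def rf_var_def)

lemma sub_v: "g \<in> Oq \<Longrightarrow> i < m \<Longrightarrow> sub g (rf_var i) = (\<Sum>l<m. rf_const (\<rho> g $$ (i, l)) * rf_var l)"
  by (simp add: sub_var sub_poly_def Fract_sum_const_var)

lemma sub_wm: assumes g: "g \<in> Oq" shows "map_mat (sub g) wm = map_mat rf_const g * wm"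
proof (rule eq_matI)
  have gc: "g \<in> carrier_mat n n" using g by simp
  have r: "map_mat rf_const g \<in> carrier_mat n n" using g by simp
  fix i j assume "i < dim_row (map_mat rf_const g * wm)" "j < dim_col (map_mat rf_const g * wm)"
  then have ij: "i < n" "j < n" using gc by (auto simp: wm_def)
  have "sub g (rf_var (m + i * n + j)) = (\<Sum>l<n. rf_const (g $$ (i, l)) * rf_var (m + l * n + j))"
    using frame_index_less[OF ij] ij by (simp add: sub_var[OF g] sub_poly_def Fract_sum_const_var)
  then show "map_mat (sub g) wm $$ (i, j) = (map_mat rf_const g * wm) $$ (i, j)"
    unfolding index_mult_mat_sum[OF r carriers(1) ij] using ij gc by (simp add: wm_def)
qed (use g in \<open>auto simp: wm_def\<close>)

text \<open>
  Invariance under \<open>G\<close> and under Galois is treated as one condition.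
\<close>

definition \<Gamma> :: "('k alg_closure ratfun \<Rightarrow> 'k alg_closure ratfun) set" where
  "\<Gamma> = sub ` Oq \<union> galois_act ` absolute_galois"

lemma galois_hom: "\<sigma> \<in> absolute_galois \<Longrightarrow> hom_on UNIV \<sigma>"
proof -
  assume s: "\<sigma> \<in> absolute_galois"
  then have "\<sigma> 1 = 1" unfolding absolute_galois_def by (metis (mono_tags, lifting) mem_Collect_eq to_ac_1)
  with s show ?thesis by (auto simp: absolute_galois_def hom_on_def subring_UNIV)
qed

lemma Gamma_hom: "\<gamma> \<in> \<Gamma> \<Longrightarrow> hom_on UNIV \<gamma>"
  by (auto simp: \<Gamma>_def intro: sub_hom galois_act_hom(1) galois_hom)

lemma Gamma_cases [consumes 1, case_names sub galois]:
  assumes "\<gamma> \<in> \<Gamma>"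
  obtains g where "g \<in> Oq" "\<gamma> = sub g" | \<sigma> where "\<sigma> \<in> absolute_galois" "\<gamma> = galois_act \<sigma>"
  using assms by (auto simp: \<Gamma>_def)

lemma galois_wm: "\<sigma> \<in> absolute_galois \<Longrightarrow> map_mat (galois_act \<sigma>) wm = wm"
  by (rule eq_matI) (auto simp: wm_def galois_act_hom(3)[OF galois_hom])

lemma Gamma_base: assumes "\<gamma> \<in> \<Gamma>" shows "\<gamma> (rf_const (to_ac c)) = rf_const (to_ac c)"
  using assms
proof (cases rule: Gamma_cases)
  case (sub g) then show ?thesis using sub_const by simp
next
  case (galois \<sigma>)
  then have "\<sigma> (to_ac c) = to_ac c" by (simp add: absolute_galois_def)
  then show ?thesis using galois by (simp add: galois_act_hom(2)[OF galois_hom])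
qed

lemma Gamma_QO: assumes "\<gamma> \<in> \<Gamma>" shows "map_mat \<gamma> QO = QO"
  by (rule eq_matI) (auto simp: QO_def Q_def Gamma_base[OF assms] carrier_matD[OF gram_carrier])

lemma hom_UNIV_mat_mult: "hom_on UNIV \<gamma> \<Longrightarrow> M \<in> carrier_mat r k \<Longrightarrow> L \<in> carrier_mat k c \<Longrightarrow>
    map_mat \<gamma> (M * L) = map_mat \<gamma> M * map_mat \<gamma> L"
  by (rule map_mat_hom_mult) auto

lemma Gamma_sm: assumes G: "\<gamma> \<in> \<Gamma>" shows "map_mat \<gamma> sm = sm"
proof -
  note h = Gamma_hom[OF G]
  have T: "transpose_mat wm \<in> carrier_mat n n" by simp
  have e: "map_mat \<gamma> sm = transpose_mat (map_mat \<gamma> wm) * QO * map_mat \<gamma> wm"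
    unfolding sm_def using hom_UNIV_mat_mult[OF h mult_carrier_mat[OF T carriers(2)] carriers(1)]
      hom_UNIV_mat_mult[OF h T carriers(2)] Gamma_QO[OF G] by (simp add: map_mat_transpose)
  show ?thesis using G
  proof (cases rule: Gamma_cases)
    case (galois \<sigma>)
    then show ?thesis using e galois_wm by (simp add: sm_def)
  next
    case (sub g)
    let ?g = "map_mat rf_const g :: 'k alg_closure ratfun mat"
    have gc: "g \<in> carrier_mat n n" "transpose_mat g * Q * g = Q" using sub by auto
    have gT: "transpose_mat g \<in> carrier_mat n n" using gc by simp
    have c: "?g \<in> carrier_mat n n" "transpose_mat ?g \<in> carrier_mat n n" using gc by auto
    have gQ: "transpose_mat ?g * QO * ?g = QO"
    proof -
      have "map_mat rf_const (transpose_mat g * Q * g) = transpose_mat ?g * QO * ?g"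
        using hom_UNIV_mat_mult[OF hom_rf_const mult_carrier_mat[OF gT Q_carrier] gc(1)]
          hom_UNIV_mat_mult[OF hom_rf_const gT Q_carrier] by (simp add: map_mat_transpose QO_def)
      then show ?thesis using gc(2) by (simp add: QO_def)
    qed
    have "map_mat \<gamma> sm = transpose_mat (?g * wm) * QO * (?g * wm)" using e sub sub_wm by simp
    also have "\<dots> = transpose_mat wm * (transpose_mat ?g * QO * ?g) * wm"
      using c T by (simp add: transpose_mult[OF c(1) carriers(1)] assoc_mult_mat[of _ n n _ n _ n] mult_carrier_mat[of _ n n _ n])
    finally show ?thesis unfolding gQ sm_def .
  qed
qed

lemma Gamma_sm_index:
  assumes "\<gamma> \<in> \<Gamma>" "i < n" "j < n" shows "\<gamma> (sm $$ (i, j)) = sm $$ (i, j)"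
proof -
  have "map_mat \<gamma> sm $$ (i, j) = \<gamma> (sm $$ (i, j))"
    using assms carrier_matD[OF carriers(3)] by simp
  then show ?thesis by (simp add: Gamma_sm[OF assms(1)])
qed

lemma mat_eval_hom: "comm_ring_hom (mpol_eval (\<lambda>b :: 'k alg_closure. b) y)"
  by unfold_locales
    (simp_all add: hom_on_add[OF hom_mpol_eval[OF id_hom]] hom_on_mult[OF hom_mpol_eval[OF id_hom]]
      hom_on_one[OF hom_mpol_eval[OF id_hom]] hom_on_zero[OF hom_mpol_eval[OF id_hom]])

text \<open>
  The determinant is evaluated at the identity matrix.
\<close>

lemma det_wm: "det wm \<noteq> 0"
proof
  assume z: "det wm = 0"
  let ?F = "\<lambda>p :: (nat, 'k alg_closure) mpol. Fraction_Field.Fract p 1"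
  define wp :: "(nat, 'k alg_closure) mpol mat" where "wp = mat n n (\<lambda>(i, j). mpol_var (m + i * n + j))"
  have F: "comm_ring_hom ?F" by unfold_locales (simp_all add: One_fract_def Zero_fract_def)
  have "wm = map_mat ?F wp" by (rule eq_matI) (auto simp: wm_def wp_def rf_var_def)
  then have "?F (det wp) = 0" using z comm_ring_hom.hom_det[OF F, of wp] by simp
  then have d: "det wp = 0" by (simp add: Zero_fract_def Fraction_Field.eq_fract)
  define y :: "nat \<Rightarrow> 'k alg_closure" where "y = (\<lambda>i. if (i - m) div n = (i - m) mod n then 1 else 0)"
  let ?e = "mpol_eval (\<lambda>b :: 'k alg_closure. b) y"
  have "map_mat ?e wp = 1\<^sub>m n"
    by (rule eq_matI) (auto simp: wp_def mpol_eval_var[OF id_hom] y_def)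
  then have "?e (det wp) = 1" using comm_ring_hom.hom_det[OF mat_eval_hom, of y wp] by simp
  then show False using d by (simp add: hom_on_zero[OF hom_mpol_eval[OF id_hom]])
qed

lemma det_sm: "det sm \<noteq> 0"
proof -
  have T: "transpose_mat wm \<in> carrier_mat n n" by simp
  interpret c: comm_ring_hom "rf_const :: 'k alg_closure \<Rightarrow> _"
    by unfold_locales (simp_all add: hom_onD[OF hom_rf_const])
  have "det QO = rf_const (det Q)" unfolding QO_def by (rule c.hom_det)
  then have "det QO \<noteq> 0" using det_Q by (simp add: hom_UNIV_eq_0[OF hom_rf_const])
  then show ?thesis unfolding sm_def
    using det_wm by (simp add: det_mult[OF mult_carrier_mat[OF T carriers(2)] carriers(1)]
        det_mult[OF T carriers(2)] det_transpose[OF carriers(1)])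
qed

lemma sm_sym: assumes ij: "i < n" "j < n" shows "sm $$ (i, j) = sm $$ (j, i)"
proof -
  have T: "transpose_mat wm \<in> carrier_mat n n" by simp
  have TQ: "transpose_mat QO = QO" unfolding QO_def map_mat_transpose[symmetric] transpose_Q ..
  have "transpose_mat sm = transpose_mat wm * (QO * wm)"
    unfolding sm_def transpose_mult[OF mult_carrier_mat[OF T carriers(2)] carriers(1)]
      transpose_mult[OF T carriers(2)] TQ by simp
  also have "\<dots> = sm" unfolding sm_def using assoc_mult_mat[OF T carriers(2) carriers(1)] by simp
  finally have "transpose_mat sm $$ (j, i) = sm $$ (j, i)" by simp
  then show ?thesis using ij carrier_matD[OF carriers(3)] by simp
qed

definition s_entries :: "'k alg_closure ratfun set" where
  "s_entries = {sm $$ (i, j) |i j. i < n \<and> j < n}"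

definition s_field :: "'k alg_closure ratfun set" where
  "s_field = gen_subfield (base_field \<union> s_entries)"

lemma Gamma_s_field: assumes G: "\<gamma> \<in> \<Gamma>" and x: "x \<in> s_field" shows "\<gamma> x = x"
proof -
  have "\<gamma> x = (\<lambda>b. b) x"
  proof (rule hom_gen_subfield_cong[OF Gamma_hom[OF G] id_hom _ x[unfolded s_field_def]])
    fix y assume "y \<in> base_field \<union> s_entries"
    then consider c where "y = rf_const (to_ac c)" | i j where "i < n" "j < n" "y = sm $$ (i, j)"
      by (auto simp: s_entries_def base_field_def)
    then show "\<gamma> y = y"
      by cases (simp_all add: Gamma_sm_index[OF G] Gamma_base[OF G])
  qed
  then show ?thesis by simp
qed

text \<open>
  Gram-Schmidt for the generic matrix. Its coefficients are rational functions of the invariants \<open>sm\<close>.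
\<close>

lemma s_diagonal:
  obtains B d where "B \<in> carrier_mat n n" "\<And>i j. i < n \<Longrightarrow> j < n \<Longrightarrow> B $$ (i, j) \<in> s_field"
    "\<And>i. i < n \<Longrightarrow> d i \<in> s_field \<and> d i \<noteq> 0" "transpose_mat B * sm * B = diag_mat_of n d"
proof -
  have F: "subfield_set s_field" unfolding s_field_def by (rule subfield_gen_subfield)
  have "sm $$ (i, j) \<in> s_entries" if "i < n" "j < n" for i j
    using that by (auto simp: s_entries_def)
  then have sF: "sm $$ (i, j) \<in> s_field" if "i < n" "j < n" for i j
    using gen_subfield_incl[of "base_field \<union> s_entries"] that by (auto simp: s_field_def)
  obtain B d where "B \<in> carrier_mat n n" "\<And>i j. i < n \<Longrightarrow> j < n \<Longrightarrow> B $$ (i, j) \<in> s_field"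
    "\<And>i. i < n \<Longrightarrow> d i \<in> s_field \<and> d i \<noteq> 0" "transpose_mat B * sm * B = diag_mat_of n d"
    by (rule diagonalize_symmetric[OF F two_nonzero carriers(3) sF sm_sym det_sm]) auto
  then show ?thesis by (rule that)
qed

definition K :: "'k alg_closure ratfun set" where "K = function_field m"

lemma K_subfield: "subfield_set K"
  unfolding K_def function_field_def by (rule subfield_gen_subfield)

lemma K_const: "rf_const c \<in> K" and K_var: "i < m \<Longrightarrow> rf_var i \<in> K"
  using gen_subfield_incl[of "range rf_const \<union> rf_var ` {..<m}"] by (auto simp: K_def function_field_def)

lemma Gamma_gen_subfield:
  assumes G: "\<gamma> \<in> \<Gamma>" and F: "subfield_set F" and T: "\<And>x. x \<in> T \<Longrightarrow> \<gamma> x \<in> F" and x: "x \<in> gen_subfield T"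
  shows "\<gamma> x \<in> F"
proof -
  have "\<gamma> x \<in> gen_subfield (\<gamma> ` T)" using hom_image_gen_subfield[OF Gamma_hom[OF G]] x by blast
  moreover have "gen_subfield (\<gamma> ` T) \<subseteq> F" by (rule gen_subfield_least[OF F]) (use T in blast)
  ultimately show ?thesis by blast
qed

lemma Gamma_K: assumes G: "\<gamma> \<in> \<Gamma>" and x: "x \<in> K" shows "\<gamma> x \<in> K"
proof (rule Gamma_gen_subfield[OF G K_subfield _ x[unfolded K_def function_field_def]])
  note R = subfield_subring[OF K_subfield]
  fix y :: "'k alg_closure ratfun" assume "y \<in> range rf_const \<union> rf_var ` {..<m}"
  then consider c where "y = rf_const c" | i where "i < m" "y = rf_var i" by blast
  then show "\<gamma> y \<in> K"
  proof cases
    case 1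
    show ?thesis using G
    proof (cases rule: Gamma_cases)
      case (sub g) then show ?thesis using 1 sub_const K_const by simp
    next
      case (galois \<sigma>) then show ?thesis using 1 K_const by (simp add: galois_act_hom(2)[OF galois_hom])
    qed
  next
    case 2
    show ?thesis using G
    proof (cases rule: Gamma_cases)
      case (sub g)
      then show ?thesis using 2 sub_v[OF sub(1) 2(1)] K_const K_var
        by (auto intro!: subring_sum[OF R] subring_mult[OF R])
    next
      case (galois \<sigma>) then show ?thesis using 2 K_var by (simp add: galois_act_hom(3)[OF galois_hom])
    qed
  qed
qed

text \<open>
  Both sides are field homomorphisms on \<open>K\<close> that agree on constants and variables.
\<close>

lemma ratfun_act_eq_sub:
  assumes g: "g \<in> Oq" and h: "h \<in> Oq" "g * h = 1\<^sub>m n" "h * g = 1\<^sub>m n" and f: "f \<in> K"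
  shows "ratfun_act (orthogonal_group n q) m \<rho> g f = sub h f"
proof -
  let ?A = "\<rho> h"
  let ?xp = "\<lambda>i. if i < m then \<Sum>j<m. mpol_const (?A $$ (i, j)) * mpol_var j else mpol_var i :: (nat, 'k alg_closure) mpol"
  have subst: "mpol_linear_subst m ?A = mpol_eval mpol_const ?xp" by (simp add: mpol_linear_subst_def)
  have hs: "hom_on UNIV (mpol_linear_subst m ?A)" unfolding subst by (rule hom_mpol_eval[OF hom_mpol_const])
  have ev: "mpol_eval (\<lambda>b. b) y (?xp i) = (if i < m then \<Sum>l<m. ?A $$ (i, l) * y l else y i)" for y i
    by (simp add: hom_on_sum[OF hom_mpol_eval[OF id_hom]] hom_on_mult[OF hom_mpol_eval[OF id_hom]]
      mpol_eval_const mpol_eval_var[OF id_hom])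
  have inj: "p = 0" if z: "mpol_linear_subst m ?A p = 0" for p
  proof (rule mpol_eval_inj_points[OF id_hom])
    show "Fraction_Field.Fract (?xp i) 1 = Fraction_Field.Fract (?xp i) 1" for i ..
    show "\<exists>y. \<forall>i. mpol_eval (\<lambda>b. b) y (?xp i) = x i" for x
    proof (intro exI allI)
      fix i
      show "mpol_eval (\<lambda>b. b) (\<lambda>i. if i < m then \<Sum>l<m. \<rho> g $$ (i, l) * x l else x i) (?xp i) = x i"
        unfolding ev using inverse_sum[OF rho_carrier[OF h(1)] rho_carrier[OF g] rho_inverse[OF h(1) g h(3)]] by simp
    qed
    have "mpol_eval rf_const (\<lambda>i. Fraction_Field.Fract (?xp i) 1) p = Fraction_Field.Fract (mpol_eval mpol_const ?xp p) 1"
      using hom_on_mpol_eval(1)[OF hom_Fract, of p mpol_const ?xp] by (simp add: rf_const_eq)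
    then show "mpol_eval rf_const (\<lambda>i. Fraction_Field.Fract (?xp i) 1) p = 0"
      using z unfolding subst by (simp add: Zero_fract_def)
  qed
  have r: "ratfun_act (orthogonal_group n q) m \<rho> g = fract_lift (\<lambda>b. Fraction_Field.Fract (mpol_linear_subst m ?A b) 1)"
    unfolding ratfun_act_def inv_orthogonal[OF g h] by (rule fract_map_eq_lift[OF hs inj])
  have hF: "hom_on UNIV (\<lambda>b. Fraction_Field.Fract (mpol_linear_subst m ?A b) 1)"
    using hom_on_comp[OF hs hom_Fract] by (simp add: comp_def)
  have iF: "b = 0" if "Fraction_Field.Fract (mpol_linear_subst m ?A b) 1 = 0" for b
    using that inj by (auto simp: Zero_fract_def Fraction_Field.eq_fract)
  have hr: "hom_on UNIV (ratfun_act (orthogonal_group n q) m \<rho> g)" unfolding r by (rule hom_fract_lift[OF hF iF])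
  have val: "ratfun_act (orthogonal_group n q) m \<rho> g (Fraction_Field.Fract b 1) = Fraction_Field.Fract (mpol_linear_subst m ?A b) 1" for b
    unfolding r using fract_lift_Fract[OF hF iF, of 1 b] by (simp add: hom_on_one[OF hs] One_fract_def[symmetric])
  show ?thesis
  proof (rule hom_gen_subfield_cong[OF hr sub_hom[OF h(1)] _ f[unfolded K_def function_field_def]])
    fix y :: "'k alg_closure ratfun" assume "y \<in> range rf_const \<union> rf_var ` {..<m}"
    then consider c where "y = rf_const c" | i where "i < m" "y = rf_var i" by blast
    then show "ratfun_act (orthogonal_group n q) m \<rho> g y = sub h y"
    proof cases
      case 1
      have "mpol_linear_subst m ?A (mpol_const c) = mpol_const c"
        unfolding subst by (simp add: mpol_eval_const hom_on_zero[OF hom_mpol_const])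
      then show ?thesis unfolding 1 sub_const[OF h(1)] using val[of "mpol_const c"] by (simp add: rf_const_def)
    next
      case 2
      have "mpol_linear_subst m ?A (mpol_var i) = ?xp i"
        unfolding subst by (rule mpol_eval_var[OF hom_mpol_const])
      then show ?thesis unfolding 2(2) sub_v[OF h(1) 2(1)] using val[of "mpol_var i"] 2(1)
        by (simp add: rf_var_def[of i] Fract_sum_const_var)
    qed
  qed
qed

lemma invariant_field_eq: "invariant_field (orthogonal_group n q) m \<rho> = {f \<in> K. \<forall>\<gamma>\<in>\<Gamma>. \<gamma> f = f}"
proof (rule Set.set_eqI)
  fix f
  have "(\<forall>g\<in>Oq. ratfun_act (orthogonal_group n q) m \<rho> g f = f) \<longleftrightarrow> (\<forall>g\<in>Oq. sub g f = f)" if f: "f \<in> K"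
  proof
    assume l: "\<forall>g\<in>Oq. ratfun_act (orthogonal_group n q) m \<rho> g f = f"
    show "\<forall>g\<in>Oq. sub g f = f"
    proof
      fix g assume g: "g \<in> Oq"
      obtain h where h: "h \<in> Oq" "g * h = 1\<^sub>m n" "h * g = 1\<^sub>m n" using Oq_inverse[OF g] by blast
      show "sub g f = f" using ratfun_act_eq_sub[OF h(1) g h(3,2) f] l h(1) by simp
    qed
  next
    assume r: "\<forall>g\<in>Oq. sub g f = f"
    show "\<forall>g\<in>Oq. ratfun_act (orthogonal_group n q) m \<rho> g f = f"
    proof
      fix g assume g: "g \<in> Oq"
      obtain h where h: "h \<in> Oq" "g * h = 1\<^sub>m n" "h * g = 1\<^sub>m n" using Oq_inverse[OF g] by blast
      show "ratfun_act (orthogonal_group n q) m \<rho> g f = f" using ratfun_act_eq_sub[OF g h f] r h(1) by simp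
    qed
  qed
  then show "f \<in> invariant_field (orthogonal_group n q) m \<rho> \<longleftrightarrow> f \<in> {f \<in> K. \<forall>\<gamma>\<in>\<Gamma>. \<gamma> f = f}"
    unfolding invariant_field_def geom_invariant_field_def carrier_orthogonal K_def \<Gamma>_def by blast
qed

end

section \<open>Generators of the invariants of vectors and matrices\<close>

lemma pt_hom:
  assumes "f 0 = 0" "u \<in> carrier_mat n n" shows "f (pt n u \<eta> v) = pt n (map_mat f u) (\<lambda>j. f (\<eta> j)) v"
  using assms by (cases v) (auto simp: pt_def)

lemma sum_assoc:
  fixes A :: "nat \<Rightarrow> 'a::comm_ring_1"
  shows "(\<Sum>c<k. (\<Sum>e<m. A e * H e c) * x c) = (\<Sum>e<m. A e * (\<Sum>c<k. H e c * x c))"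
  unfolding sum_distrib_right sum_distrib_left by (subst sum.swap) (simp add: mult.assoc)

text \<open>
  The matrix \<open>B\<close> and the norms \<open>d\<close> of \<open>s_diagonal\<close>; the matrix \<open>wm * B\<close> has orthogonal columns.
\<close>

locale generic_frame = orthogonal_rows q n m \<rho> a P
  for q :: "'k::field_char_0 vec \<Rightarrow> 'k" and n m :: nat and \<rho> :: "'k alg_closure mat \<Rightarrow> 'k alg_closure mat"
    and a :: "nat \<Rightarrow> 'k" and P :: "nat set \<Rightarrow> nat \<Rightarrow> nat \<Rightarrow> (nat \<times> nat, 'k) mpol" +
  fixes B :: "'k alg_closure ratfun mat" and d :: "nat \<Rightarrow> 'k alg_closure ratfun" and wi :: "'k alg_closure ratfun mat"
  assumes B_carrier [simp]: "B \<in> carrier_mat n n" and B_field: "\<And>i j. i < n \<Longrightarrow> j < n \<Longrightarrow> B $$ (i, j) \<in> s_field"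
    and d_field: "\<And>i. i < n \<Longrightarrow> d i \<in> s_field \<and> d i \<noteq> 0"
    and B_diag: "transpose_mat B * sm * B = diag_mat_of n d"
    and wi: "wi \<in> carrier_mat n n" "wm * wi = 1\<^sub>m n" "wi * wm = 1\<^sub>m n"
begin

definition um :: "'k alg_closure ratfun mat" where "um = wm * B"

definition eta :: "nat \<Rightarrow> 'k alg_closure ratfun" where "eta j = rf_const (to_ac (a j)) / d j"

definition row :: "nat set \<Rightarrow> nat \<Rightarrow> nat \<Rightarrow> 'k alg_closure ratfun" where
  "row I i c = mpol_eval (\<lambda>b. rf_const (to_ac b)) (pt n um eta) (P I i c)"

text \<open>
  The functions that have to be regular at the points under consideration. The inverses are included
  so that at each such point the matrix is invertible and the \<open>eta j\<close> are nonzero.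
\<close>

definition core :: "'k alg_closure ratfun set" where
  "core = rf_var ` {..<N} \<union> (\<lambda>(i, j). B $$ (i, j)) ` ({..<n} \<times> {..<n}) \<union>
     (\<lambda>(i, j). wi $$ (i, j)) ` ({..<n} \<times> {..<n}) \<union> eta ` {..<n} \<union> (\<lambda>j. inverse (eta j)) ` {..<n}"

definition coord_ring :: "'k alg_closure ratfun set \<Rightarrow> 'k alg_closure ratfun set" where
  "coord_ring T = gen_ring (range rf_const \<union> (core \<union> T))"

text \<open>
  Points of the affine variety with coordinate ring \<open>coord_ring T\<close> over the algebraically closed field. The
  additional functions \<open>T\<close> vary from one argument to the next.
\<close>

definition point_of :: "'k alg_closure ratfun set \<Rightarrow> ('k alg_closure ratfun \<Rightarrow> 'k alg_closure) \<Rightarrow> bool" where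
  "point_of T \<phi> \<longleftrightarrow> hom_on (coord_ring T) \<phi> \<and> (\<forall>c. \<phi> (rf_const c) = c)"

lemma finite_core: "finite core"
  by (simp add: core_def)

lemma um_carrier [simp]: "um \<in> carrier_mat n n"
  unfolding um_def by (rule mult_carrier_mat[OF carriers(1) B_carrier])

lemma eta_field: "j < n \<Longrightarrow> eta j \<in> s_field" and eta_nonzero: "j < n \<Longrightarrow> eta j \<noteq> 0"
proof -
  have F: "subfield_set s_field" unfolding s_field_def by (rule subfield_gen_subfield)
  have "rf_const (to_ac (a j)) \<in> s_field"
    using gen_subfield_incl[of "base_field \<union> s_entries"] by (auto simp: s_field_def base_field_def)
  then show "j < n \<Longrightarrow> eta j \<in> s_field" unfolding eta_def using d_field by (intro subfield_divide[OF F]) auto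
  show "j < n \<Longrightarrow> eta j \<noteq> 0" using a_nonzero[of j] d_field[of j]
    by (simp add: eta_def hom_UNIV_eq_0[OF hom_rf_const])
qed

lemma coord_ring_subring: "subring_set (coord_ring T)"
  unfolding coord_ring_def by (rule subring_gen_ring)

lemma coord_ring_incl: "x \<in> core \<Longrightarrow> x \<in> coord_ring T" "x \<in> T \<Longrightarrow> x \<in> coord_ring T" "rf_const c \<in> coord_ring T"
  unfolding coord_ring_def by (auto intro: gen_ring_incl)

lemma coord_ring_entries:
  shows "i < n \<Longrightarrow> j < n \<Longrightarrow> wm $$ (i, j) \<in> coord_ring T"
    and "i < m \<Longrightarrow> rf_var i \<in> coord_ring T"
    and "i < N \<Longrightarrow> rf_var i \<in> coord_ring T"
    and "i < n \<Longrightarrow> j < n \<Longrightarrow> B $$ (i, j) \<in> coord_ring T"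
    and "i < n \<Longrightarrow> j < n \<Longrightarrow> wi $$ (i, j) \<in> coord_ring T"
    and "j < n \<Longrightarrow> eta j \<in> coord_ring T"
    and "j < n \<Longrightarrow> inverse (eta j) \<in> coord_ring T"
    and "i < n \<Longrightarrow> j < n \<Longrightarrow> QO $$ (i, j) \<in> coord_ring T"
proof -
  show v: "rf_var i \<in> coord_ring T" if "i < N" for i by (rule coord_ring_incl(1)) (use that in \<open>auto simp: core_def\<close>)
  show "i < n \<Longrightarrow> j < n \<Longrightarrow> wm $$ (i, j) \<in> coord_ring T" using frame_index_less by (simp add: wm_index v)
  show "i < m \<Longrightarrow> rf_var i \<in> coord_ring T" by (rule v) (simp add: N_def)
  show "i < n \<Longrightarrow> j < n \<Longrightarrow> B $$ (i, j) \<in> coord_ring T"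
    by (rule coord_ring_incl(1)) (force simp: core_def)
  show "i < n \<Longrightarrow> j < n \<Longrightarrow> wi $$ (i, j) \<in> coord_ring T"
    by (rule coord_ring_incl(1)) (force simp: core_def)
  show "j < n \<Longrightarrow> eta j \<in> coord_ring T" by (rule coord_ring_incl(1)) (simp add: core_def)
  show "j < n \<Longrightarrow> inverse (eta j) \<in> coord_ring T" by (rule coord_ring_incl(1)) (simp add: core_def)
  show "i < n \<Longrightarrow> j < n \<Longrightarrow> QO $$ (i, j) \<in> coord_ring T"
    using carrier_matD[OF Q_carrier] by (simp add: QO_def coord_ring_incl(3))
qed

lemma coord_ring_um: "i < n \<Longrightarrow> j < n \<Longrightarrow> um $$ (i, j) \<in> coord_ring T"
  unfolding um_def index_mult_mat_sum[OF carriers(1) B_carrier]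
  by (intro subring_sum[OF coord_ring_subring] subring_mult[OF coord_ring_subring] coord_ring_entries) auto

lemma coord_ring_pt:
  assumes "\<And>i j. i < n \<Longrightarrow> j < n \<Longrightarrow> u $$ (i, j) \<in> coord_ring T" shows "pt n u eta v \<in> coord_ring T"
  using assms by (cases v) (auto simp: pt_def coord_ring_entries subring_zero[OF coord_ring_subring])

lemma coord_ring_eval:
  assumes "\<And>i j. i < n \<Longrightarrow> j < n \<Longrightarrow> u $$ (i, j) \<in> coord_ring T"
  shows "mpol_eval (\<lambda>b. rf_const (to_ac b)) (pt n u eta) p \<in> coord_ring T"
  by (rule mpol_eval_mem[OF coord_ring_subring]) (use coord_ring_incl(3) coord_ring_pt[OF assms] in auto)

lemma coord_ring_gmult:
  assumes g: "g \<in> carrier_mat n n" and ij: "i < n" "j < n"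
  shows "(map_mat rf_const g * um) $$ (i, j) \<in> coord_ring T"
proof -
  have c: "map_mat rf_const g \<in> carrier_mat n n" using g by simp
  show ?thesis
    unfolding index_mult_mat_sum[OF c um_carrier ij]
    using g ij by (intro subring_sum[OF coord_ring_subring] subring_mult[OF coord_ring_subring] coord_ring_um)
      (auto simp: coord_ring_incl(3))
qed

lemma coord_ring_row: "row I i c \<in> coord_ring T"
  unfolding row_def by (rule coord_ring_eval) (rule coord_ring_um)

lemma specialize:
  assumes "finite T" "x \<in> coord_ring T" "x \<noteq> 0"
  obtains \<phi> where "point_of T \<phi>" "\<phi> x \<noteq> 0"
  using specialization[OF hom_rf_const, of "core \<union> T" x] assms finite_core
  unfolding coord_ring_def point_of_def by blast

context
  fixes T \<phi> assumes pt: "point_of T \<phi>"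
begin

lemma point_hom: "hom_on (coord_ring T) \<phi>" and point_const: "\<phi> (rf_const c) = c"
  using pt by (auto simp: point_of_def)

lemma point_QO: "map_mat \<phi> QO = Q"
  by (rule eq_matI) (auto simp: QO_def point_const)

lemma point_sm: "map_mat \<phi> sm = transpose_mat (map_mat \<phi> wm) * Q * map_mat \<phi> wm"
proof -
  have T: "transpose_mat wm \<in> carrier_mat n n" by simp
  have t: "transpose_mat wm $$ (i, j) \<in> coord_ring T" if "i < n" "j < n" for i j
    using that coord_ring_entries(1)[of j i T] carrier_matD[OF carriers(1)] by simp
  have tq: "(transpose_mat wm * QO) $$ (i, j) \<in> coord_ring T" if "i < n" "j < n" for i j
    using mat_mult_entries[OF point_hom T carriers(2) t coord_ring_entries(8)] that by blast
  show ?thesis unfolding sm_def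
    using map_mat_hom_mult[OF point_hom mult_carrier_mat[OF T carriers(2)] carriers(1) tq coord_ring_entries(1)]
      map_mat_hom_mult[OF point_hom T carriers(2) t coord_ring_entries(8)]
    by (simp add: map_mat_transpose point_QO)
qed

lemma point_um: "map_mat \<phi> um = map_mat \<phi> wm * map_mat \<phi> B"
  unfolding um_def
  by (rule map_mat_hom_mult[OF point_hom carriers(1) B_carrier coord_ring_entries(1,4)])

lemma point_wi: "map_mat \<phi> wm * map_mat \<phi> wi = 1\<^sub>m n" "map_mat \<phi> wi * map_mat \<phi> wm = 1\<^sub>m n"
  using map_mat_hom_mult[OF point_hom carriers(1) wi(1) coord_ring_entries(1,5)]
    map_mat_hom_mult[OF point_hom wi(1) carriers(1) coord_ring_entries(5,1)] wi(2,3) map_mat_one_on[OF point_hom]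
  by simp_all

lemma point_eta: assumes j: "j < n" shows "\<phi> (eta j) \<noteq> 0"
proof
  assume z: "\<phi> (eta j) = 0"
  have "\<phi> (eta j * inverse (eta j)) = \<phi> (eta j) * \<phi> (inverse (eta j))"
    by (rule hom_on_mult[OF point_hom]) (use j coord_ring_entries in auto)
  then show False using z eta_nonzero[OF j] hom_on_one[OF point_hom] by simp
qed

text \<open>
  Each point lies over a matrix to which the equivariance of the rows applies.
\<close>

lemma point_good: "good_point a (map_mat \<phi> um) (\<lambda>j. \<phi> (eta j))"
proof -
  have Tw: "transpose_mat wm \<in> carrier_mat n n" "transpose_mat B \<in> carrier_mat n n" by simp_all
  have "transpose_mat um * QO * um = transpose_mat B * sm * B"
    unfolding um_def sm_def transpose_mult[OF carriers(1) B_carrier]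
    using Tw by (simp add: assoc_mult_mat[of _ n n _ n _ n] mult_carrier_mat[of _ n n _ n])
  then have e: "transpose_mat um * QO * um = diag_mat_of n d" using B_diag by simp
  have T: "transpose_mat um \<in> carrier_mat n n" by simp
  have t: "transpose_mat um $$ (i, j) \<in> coord_ring T" if "i < n" "j < n" for i j
    using that coord_ring_um[of j i T] carrier_matD[OF um_carrier] by simp
  have tq: "(transpose_mat um * QO) $$ (i, j) \<in> coord_ring T" if "i < n" "j < n" for i j
    using mat_mult_entries[OF point_hom T carriers(2) t coord_ring_entries(8)] that by blast
  have "map_mat \<phi> (transpose_mat um * QO * um) = transpose_mat (map_mat \<phi> um) * Q * map_mat \<phi> um"
    using map_mat_hom_mult[OF point_hom mult_carrier_mat[OF T carriers(2)] um_carrier tq coord_ring_um]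
      map_mat_hom_mult[OF point_hom T carriers(2) t coord_ring_entries(8)]
    by (simp add: map_mat_transpose point_QO)
  moreover have "map_mat \<phi> (diag_mat_of n d) = diag_mat_of n (\<lambda>j. to_ac (a j) / \<phi> (eta j))"
  proof (rule eq_matI)
    fix i j assume "i < dim_row (diag_mat_of n (\<lambda>j. to_ac (a j) / \<phi> (eta j)))"
      "j < dim_col (diag_mat_of n (\<lambda>j. to_ac (a j) / \<phi> (eta j)))"
    then have ij: "i < n" "j < n" by (auto simp: diag_mat_of_def)
    have "\<phi> (d i) = to_ac (a i) / \<phi> (eta i)"
    proof -
      have di: "d i \<noteq> 0" "d i * eta i = rf_const (to_ac (a i))" using d_field[OF ij(1)] by (auto simp: eta_def)
      have "d i = rf_const (to_ac (a i)) * inverse (eta i)" using di eta_nonzero[OF ij(1)] by (simp add: field_simps)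
      moreover have "rf_const (to_ac (a i)) * inverse (eta i) \<in> coord_ring T"
        by (intro subring_mult[OF coord_ring_subring] coord_ring_incl(3) coord_ring_entries(7) ij)
      ultimately have "d i \<in> coord_ring T" by simp
      then have "\<phi> (d i * eta i) = \<phi> (d i) * \<phi> (eta i)"
        using hom_on_mult[OF point_hom] coord_ring_entries(6)[OF ij(1)] by blast
      then show ?thesis using di(2) point_eta[OF ij(1)] by (simp add: point_const field_simps)
    qed
    then show "map_mat \<phi> (diag_mat_of n d) $$ (i, j) = diag_mat_of n (\<lambda>j. to_ac (a j) / \<phi> (eta j)) $$ (i, j)"
      using ij by (auto simp: diag_mat_of_def hom_on_zero[OF point_hom])
  qed (auto simp: diag_mat_of_def)
  ultimately show ?thesis using e point_eta by (simp add: good_point_def)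
qed

lemma point_eval:
  assumes u: "u \<in> carrier_mat n n" "\<And>i j. i < n \<Longrightarrow> j < n \<Longrightarrow> u $$ (i, j) \<in> coord_ring T"
  shows "\<phi> (mpol_eval (\<lambda>b. rf_const (to_ac b)) (pt n u eta) p) =
    mpol_eval to_ac (pt n (map_mat \<phi> u) (\<lambda>j. \<phi> (eta j))) p"
proof -
  have "\<phi> (mpol_eval (\<lambda>b. rf_const (to_ac b)) (pt n u eta) p) =
      mpol_eval (\<lambda>b. \<phi> (rf_const (to_ac b))) (\<lambda>v. \<phi> (pt n u eta v)) p"
    by (rule hom_on_mpol_eval[OF point_hom]) (use coord_ring_incl(3) coord_ring_pt[OF u(2)] in auto)
  then show ?thesis using pt_hom[of \<phi>, OF hom_on_zero[OF point_hom] u(1)] by (simp add: point_const)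
qed

lemma point_row: "\<phi> (row I i c) = mpol_eval to_ac (pt n (map_mat \<phi> um) (\<lambda>j. \<phi> (eta j))) (P I i c)"
  unfolding row_def by (rule point_eval[OF um_carrier coord_ring_um])

lemma point_gmult:
  assumes g: "g \<in> carrier_mat n n"
  shows "map_mat \<phi> (map_mat rf_const g * um) = g * map_mat \<phi> um"
proof -
  have c: "map_mat rf_const g \<in> carrier_mat n n" using g by simp
  have e: "map_mat rf_const g $$ (i, j) \<in> coord_ring T" if "i < n" "j < n" for i j
    using that g by (simp add: coord_ring_incl(3))
  have "map_mat \<phi> (map_mat rf_const g) = g" by (rule eq_matI) (auto simp: point_const)
  then show "map_mat \<phi> (map_mat rf_const g * um) = g * map_mat \<phi> um"
    using map_mat_hom_mult[OF point_hom c um_carrier e coord_ring_um] by simp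
qed

end

text \<open>
  An identity of rational functions that holds at all points: a nonzero difference would be nonzero at
  some point by \<open>specialize\<close>.
\<close>

lemma sub_row:
  assumes g: "g \<in> Oq" and h: "h \<in> Oq" "g * h = 1\<^sub>m n" and I: "I \<subseteq> {..<n}" and ic: "i < m" "c < m"
  shows "sub g (row I i c) = (\<Sum>e<m. row I i e * rf_const (\<rho> h $$ (e, c)))"
proof (rule ccontr)
  assume ne: "\<not> ?thesis"
  have gc: "g \<in> carrier_mat n n" using g by simp
  let ?gu = "map_mat rf_const g * um"
  have gu: "?gu \<in> carrier_mat n n" using mult_carrier_mat[of "map_mat rf_const g" n n um n] gc by simp
  have "map_mat (sub g) um = map_mat (sub g) wm * map_mat (sub g) B"
    unfolding um_def by (rule hom_UNIV_mat_mult[OF sub_hom[OF g] carriers(1) B_carrier])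
  moreover have "map_mat (sub g) B = B"
    by (rule eq_matI) (use g in \<open>auto simp: \<Gamma>_def intro!: Gamma_s_field[of "sub g"] B_field\<close>,
      use carrier_matD[OF B_carrier] in auto)
  ultimately have su: "map_mat (sub g) um = ?gu"
    unfolding sub_wm[OF g] um_def using gc by (simp add: assoc_mult_mat[of _ n n _ n _ n])
  have se: "sub g (eta j) = eta j" if "j < n" for j
    using g that by (auto simp: \<Gamma>_def intro!: Gamma_s_field eta_field)
  have "sub g (row I i c) = mpol_eval (\<lambda>b. sub g (rf_const (to_ac b))) (\<lambda>v. sub g (pt n um eta v)) (P I i c)"
    unfolding row_def by (rule hom_on_mpol_eval[OF sub_hom[OF g]]) auto
  also have "(\<lambda>v. sub g (pt n um eta v)) = pt n ?gu eta"
    by (rule ext) (use se in \<open>simp add: pt_hom[of "sub g", OF hom_on_zero[OF sub_hom[OF g]] um_carrier] su, simp add: pt_def\<close>)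
  also have "(\<lambda>b. sub g (rf_const (to_ac b))) = (\<lambda>b. rf_const (to_ac b))" using sub_const[OF g] by simp
  finally have sr: "sub g (row I i c) = mpol_eval (\<lambda>b. rf_const (to_ac b)) (pt n ?gu eta) (P I i c)" .
  let ?x = "sub g (row I i c) - (\<Sum>e<m. row I i e * rf_const (\<rho> h $$ (e, c)))"
  note R = coord_ring_subring[of "{}"]
  have subR: "sub g (row I i c) \<in> coord_ring {}"
    unfolding sr by (intro coord_ring_eval coord_ring_gmult gc)
  have sumR: "(\<Sum>e<m. row I i e * rf_const (\<rho> h $$ (e, c))) \<in> coord_ring {}"
    by (intro subring_sum[OF R] subring_mult[OF R] coord_ring_row coord_ring_incl(3))
  have xR: "?x \<in> coord_ring {}" by (rule subring_diff[OF R subR sumR])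
  obtain \<phi> where phi: "point_of {} \<phi>" "\<phi> ?x \<noteq> 0"
    using specialize[of "{}" ?x] xR ne by auto
  note h\<phi> = point_hom[OF phi(1)] and good = point_good[OF phi(1)]
  let ?u = "map_mat \<phi> um" and ?\<eta> = "\<lambda>j. \<phi> (eta j)"
  have "\<phi> (sub g (row I i c)) = mpol_eval to_ac (pt n (g * ?u) ?\<eta>) (P I i c)"
    using point_eval[OF phi(1) gu coord_ring_gmult[OF gc], of "P I i c"] by (simp only: sr point_gmult[OF phi(1) gc])
  moreover have "\<phi> (\<Sum>e<m. row I i e * rf_const (\<rho> h $$ (e, c))) =
      (\<Sum>e<m. mpol_eval to_ac (pt n ?u ?\<eta>) (P I i e) * \<rho> h $$ (e, c))"
  proof -
    have "\<phi> (\<Sum>e<m. row I i e * rf_const (\<rho> h $$ (e, c))) = (\<Sum>e<m. \<phi> (row I i e * rf_const (\<rho> h $$ (e, c))))"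
      by (rule hom_on_sum[OF h\<phi>]) (intro subring_mult[OF R] coord_ring_row coord_ring_incl(3))
    also have "\<dots> = (\<Sum>e<m. \<phi> (row I i e) * \<rho> h $$ (e, c))"
      by (intro sum.cong refl)
        (simp add: hom_on_mult[OF h\<phi> coord_ring_row coord_ring_incl(3)] point_const[OF phi(1)])
    finally show ?thesis by (simp only: point_row[OF phi(1)])
  qed
  moreover have "\<phi> ?x = \<phi> (sub g (row I i c)) - \<phi> (\<Sum>e<m. row I i e * rf_const (\<rho> h $$ (e, c)))"
    by (rule hom_on_diff[OF h\<phi> subR sumR])
  ultimately have "\<phi> ?x = 0" using P_equivariant[OF good g h I ic] by simp
  with phi(2) show False by simp
qed

lemma galois_row:
  assumes s: "\<sigma> \<in> absolute_galois" shows "galois_act \<sigma> (row I i c) = row I i c"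
proof -
  have G: "galois_act \<sigma> \<in> \<Gamma>" using s by (auto simp: \<Gamma>_def)
  note h = Gamma_hom[OF G]
  have "map_mat (galois_act \<sigma>) um = map_mat (galois_act \<sigma>) wm * map_mat (galois_act \<sigma>) B"
    unfolding um_def by (rule hom_UNIV_mat_mult[OF h carriers(1) B_carrier])
  moreover have "map_mat (galois_act \<sigma>) B = B"
    by (rule eq_matI) (use Gamma_s_field[OF G B_field] carrier_matD[OF B_carrier] in auto)
  ultimately have su: "map_mat (galois_act \<sigma>) um = um" by (simp add: galois_wm[OF s] um_def)
  have "galois_act \<sigma> (row I i c) =
      mpol_eval (\<lambda>b. galois_act \<sigma> (rf_const (to_ac b))) (\<lambda>v. galois_act \<sigma> (pt n um eta v)) (P I i c)"
    unfolding row_def by (rule hom_on_mpol_eval[OF h]) auto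
  also have "(\<lambda>v. galois_act \<sigma> (pt n um eta v)) = pt n um eta"
    by (rule ext, subst pt_hom[of "galois_act \<sigma>", OF hom_on_zero[OF h] um_carrier])
      (use Gamma_s_field[OF G eta_field] in \<open>simp add: su pt_def\<close>)
  finally show ?thesis using Gamma_base[OF G] by (simp add: row_def)
qed

definition z_inv :: "nat set \<Rightarrow> nat \<Rightarrow> 'k alg_closure ratfun" where
  "z_inv I i = (\<Sum>c<m. row I i c * rf_var c)"

lemma Gamma_z_inv:
  assumes G: "\<gamma> \<in> \<Gamma>" and I: "I \<subseteq> {..<n}" and i: "i < m" shows "\<gamma> (z_inv I i) = z_inv I i"
  using G
proof (cases rule: Gamma_cases)
  case (galois \<sigma>)
  then show ?thesis unfolding z_inv_def
    by (simp add: hom_on_sum[OF galois_act_hom(1)[OF galois_hom]] hom_on_mult[OF galois_act_hom(1)[OF galois_hom]]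
        galois_row galois_act_hom(3)[OF galois_hom])
next
  case (sub g)
  obtain h where h: "h \<in> Oq" "g * h = 1\<^sub>m n" "h * g = 1\<^sub>m n" using Oq_inverse[OF sub(1)] by blast
  note s = sub_hom[OF sub(1)]
  have M: "map_mat rf_const (\<rho> h) \<in> carrier_mat m m" "map_mat rf_const (\<rho> g) \<in> carrier_mat m m"
    using rho_carrier[OF h(1)] rho_carrier[OF sub(1)] by auto
  have "map_mat rf_const (\<rho> h) * map_mat rf_const (\<rho> g) = (1\<^sub>m m :: 'k alg_closure ratfun mat)"
    using hom_UNIV_mat_mult[OF hom_rf_const rho_carrier[OF h(1)] rho_carrier[OF sub(1)]]
      rho_inverse[OF h(1) sub(1) h(3)] map_mat_one_on[OF hom_rf_const] by metis
  note inv = inverse_sum[OF M this]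
  have "\<gamma> (z_inv I i) = (\<Sum>c<m. sub g (row I i c) * sub g (rf_var c))"
    unfolding z_inv_def sub(2) by (simp add: hom_on_sum[OF s] hom_on_mult[OF s])
  also have "\<dots> = (\<Sum>c<m. (\<Sum>e<m. row I i e * rf_const (\<rho> h $$ (e, c))) * (\<Sum>l<m. rf_const (\<rho> g $$ (c, l)) * rf_var l))"
    by (intro sum.cong refl) (simp add: sub_row[OF sub(1) h(1,2) I i] sub_v[OF sub(1)])
  also have "\<dots> = (\<Sum>e<m. row I i e * (\<Sum>c<m. rf_const (\<rho> h $$ (e, c)) * (\<Sum>l<m. rf_const (\<rho> g $$ (c, l)) * rf_var l)))"
    by (rule sum_assoc)
  also have "\<dots> = (\<Sum>e<m. row I i e * rf_var e)"
  proof (intro sum.cong refl arg_cong2[where f="(*)"])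
    fix e assume "e \<in> {..<m}"
    then have e: "e < m" by simp
    show "(\<Sum>c<m. rf_const (\<rho> h $$ (e, c)) * (\<Sum>l<m. rf_const (\<rho> g $$ (c, l)) * rf_var l)) = rf_var e"
      using inv[OF e, of rf_var] e rho_carrier[OF h(1)] rho_carrier[OF sub(1)] by simp
  qed
  finally show ?thesis by (simp add: z_inv_def)
qed

text \<open>
  At every point the rows have trivial common kernel. A kernel vector over the function field can be
  specialized to a point where one of its coordinates does not vanish.
\<close>

lemma rows_selection:
  obtains f where "\<And>r. r < m \<Longrightarrow> f r \<in> Pow {..<n} \<times> {..<m}"
    "det (mat m m (\<lambda>(r, c). row (fst (f r)) (snd (f r)) c)) \<noteq> 0"
proof -
  have k: "\<forall>c<m. x c = 0" if z: "\<And>e. e \<in> Pow {..<n} \<times> {..<m} \<Longrightarrow> (\<Sum>c<m. row (fst e) (snd e) c * x c) = 0" for x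
  proof (rule ccontr)
    assume "\<not> ?thesis"
    then obtain c0 where c0: "c0 < m" "x c0 \<noteq> 0" by blast
    let ?T = "x ` {..<m}"
    have x: "x c \<in> coord_ring ?T" if "c < m" for c by (rule coord_ring_incl(2)) (use that in auto)
    obtain \<phi> where phi: "point_of ?T \<phi>" "\<phi> (x c0) \<noteq> 0"
      using specialize[of ?T "x c0"] x[OF c0(1)] c0(2) by auto
    note h\<phi> = point_hom[OF phi(1)] and R = coord_ring_subring[of ?T]
    have "(\<Sum>c<m. mpol_eval to_ac (pt n (map_mat \<phi> um) (\<lambda>j. \<phi> (eta j))) (P I i c) * \<phi> (x c)) = 0"
      if "I \<subseteq> {..<n}" "i < m" for I i
    proof -
      have "\<phi> (\<Sum>c<m. row I i c * x c) = (\<Sum>c<m. \<phi> (row I i c * x c))"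
        by (rule hom_on_sum[OF h\<phi>]) (use x in \<open>auto intro!: subring_mult[OF R] coord_ring_row\<close>)
      also have "\<dots> = (\<Sum>c<m. \<phi> (row I i c) * \<phi> (x c))"
        by (intro sum.cong refl) (use x in \<open>simp add: hom_on_mult[OF h\<phi> coord_ring_row]\<close>)
      finally show ?thesis using z[of "(I, i)"] that hom_on_zero[OF h\<phi>] by (simp add: point_row[OF phi(1)])
    qed
    from P_kernel[OF point_good[OF phi(1)], of "\<lambda>c. \<phi> (x c)", OF this] c0(1) phi(2) show False by simp
  qed
  show ?thesis
    by (rule select_rows[where R="\<lambda>e. row (fst e) (snd e)" and E="Pow {..<n} \<times> {..<m}", OF k]) (use that in auto)
qed

end

text \<open>
  A choice of \<open>m\<close> of the invariant linear forms that are linearly independent; \<open>Zi\<close> recovers the vector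
  from their values.
\<close>

locale selected_frame = generic_frame q n m \<rho> a P B d wi
  for q :: "'k::field_char_0 vec \<Rightarrow> 'k" and n m :: nat and \<rho> :: "'k alg_closure mat \<Rightarrow> 'k alg_closure mat"
    and a :: "nat \<Rightarrow> 'k" and P :: "nat set \<Rightarrow> nat \<Rightarrow> nat \<Rightarrow> (nat \<times> nat, 'k) mpol"
    and B :: "'k alg_closure ratfun mat" and d :: "nat \<Rightarrow> 'k alg_closure ratfun" and wi :: "'k alg_closure ratfun mat" +
  fixes f :: "nat \<Rightarrow> nat set \<times> nat" and Zi :: "'k alg_closure ratfun mat"
  assumes f: "\<And>r. r < m \<Longrightarrow> f r \<in> Pow {..<n} \<times> {..<m}"
    and Zi: "Zi \<in> carrier_mat m m" "mat m m (\<lambda>(r, c). row (fst (f r)) (snd (f r)) c) * Zi = 1\<^sub>m m"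
      "Zi * mat m m (\<lambda>(r, c). row (fst (f r)) (snd (f r)) c) = 1\<^sub>m m"
begin

definition Z :: "'k alg_closure ratfun mat" where "Z = mat m m (\<lambda>(r, c). row (fst (f r)) (snd (f r)) c)"

definition z :: "nat \<Rightarrow> 'k alg_closure ratfun" where "z r = z_inv (fst (f r)) (snd (f r))"

text \<open>
  The generators of the field of invariants of vectors and matrices.
\<close>

definition Y :: "'k alg_closure ratfun set" where "Y = s_entries \<union> z ` {..<m}"

lemma Z_carrier [simp]: "Z \<in> carrier_mat m m"
  by (simp add: Z_def)

lemma Gamma_Y: assumes G: "\<gamma> \<in> \<Gamma>" and y: "y \<in> Y" shows "\<gamma> y = y"
proof -
  consider i j where "i < n" "j < n" "y = sm $$ (i, j)" | r where "r < m" "y = z r"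
    using y by (auto simp: Y_def s_entries_def)
  then show ?thesis
  proof cases
    case 1 then show ?thesis using Gamma_sm_index[OF G] by simp
  next
    case 2
    then show ?thesis using f[OF 2(1)] Gamma_z_inv[OF G, of "fst (f r)" "snd (f r)"] by (auto simp: z_def)
  qed
qed

definition Zi_entries :: "'k alg_closure ratfun set" where
  "Zi_entries = (\<lambda>(i, j). Zi $$ (i, j)) ` ({..<m} \<times> {..<m})"

lemma coord_ring_Zi: "Zi_entries \<subseteq> T \<Longrightarrow> i < m \<Longrightarrow> j < m \<Longrightarrow> Zi $$ (i, j) \<in> coord_ring T"
  by (rule coord_ring_incl(2)) (force simp: Zi_entries_def)

lemma coord_ring_Z: "i < m \<Longrightarrow> j < m \<Longrightarrow> Z $$ (i, j) \<in> coord_ring T"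
  by (simp add: Z_def coord_ring_row)

lemma z_sum: "r < m \<Longrightarrow> z r = (\<Sum>c<m. Z $$ (r, c) * rf_var c)"
  by (simp add: z_def z_inv_def Z_def)

lemma coord_ring_z: "r < m \<Longrightarrow> z r \<in> coord_ring T"
  unfolding z_sum by (intro subring_sum[OF coord_ring_subring] subring_mult[OF coord_ring_subring])
    (auto intro: coord_ring_Z coord_ring_entries(2))

lemma point_z:
  assumes phi: "point_of T \<phi>" and r: "r < m"
  shows "\<phi> (z r) = (\<Sum>c<m. \<phi> (Z $$ (r, c)) * \<phi> (rf_var c))"
proof -
  note h = point_hom[OF phi]
  have "\<phi> (z r) = (\<Sum>c<m. \<phi> (Z $$ (r, c) * rf_var c))"
    unfolding z_sum[OF r]
    by (rule hom_on_sum[OF h]) (use r in \<open>auto intro!: subring_mult[OF coord_ring_subring] coord_ring_Z coord_ring_entries(2)\<close>)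
  also have "\<dots> = (\<Sum>c<m. \<phi> (Z $$ (r, c)) * \<phi> (rf_var c))"
    using r by (intro sum.cong refl hom_on_mult[OF h] coord_ring_Z coord_ring_entries(2)) auto
  finally show ?thesis .
qed

lemma point_Zi:
  assumes phi: "point_of T \<phi>" and T: "Zi_entries \<subseteq> T"
  shows "map_mat \<phi> Zi * map_mat \<phi> Z = 1\<^sub>m m" "map_mat \<phi> Z * map_mat \<phi> Zi = 1\<^sub>m m"
  using map_mat_hom_mult[OF point_hom[OF phi] Zi(1) Z_carrier coord_ring_Zi[OF T] coord_ring_Z]
    map_mat_hom_mult[OF point_hom[OF phi] Z_carrier Zi(1) coord_ring_Z coord_ring_Zi[OF T]]
    Zi(2,3) map_mat_one_on[OF point_hom[OF phi]] by (simp_all add: Z_def)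

text \<open>
  Two points with the same invariants lie in one orbit. The Gram matrices determine \<open>g\<close> from the matrix
  part. The equivariant rows then make the values of the \<open>z r\<close> linear equations for the vector part, and these
  have a unique solution. Agreement on \<open>B\<close> and \<open>eta\<close> is required separately: they are rational in the
  invariants, but a point need not be defined on the denominators.
\<close>

lemma orbit:
  assumes phi: "point_of T \<phi>" and psi: "point_of T \<psi>" and T: "Zi_entries \<subseteq> T"
    and eqY: "\<And>y. y \<in> Y \<Longrightarrow> \<phi> y = \<psi> y"
    and eqB: "\<And>i j. i < n \<Longrightarrow> j < n \<Longrightarrow> \<phi> (B $$ (i, j)) = \<psi> (B $$ (i, j))"
    and eqe: "\<And>j. j < n \<Longrightarrow> \<phi> (eta j) = \<psi> (eta j)"
  obtains g where "g \<in> Oq" "map_mat \<psi> wm = g * map_mat \<phi> wm"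
    "\<And>i. i < m \<Longrightarrow> \<psi> (rf_var i) = (\<Sum>l<m. \<rho> g $$ (i, l) * \<phi> (rf_var l))"
proof -
  let ?w = "map_mat \<phi> wm" and ?w' = "map_mat \<psi> wm" and ?wi = "map_mat \<phi> wi"
  have c: "?w \<in> carrier_mat n n" "?w' \<in> carrier_mat n n" "?wi \<in> carrier_mat n n" using wi(1) by auto
  have "map_mat \<phi> sm = map_mat \<psi> sm"
    by (rule eq_matI) (use eqY carrier_matD[OF carriers(3)] in \<open>auto simp: Y_def s_entries_def\<close>)
  then have e: "transpose_mat ?w' * Q * ?w' = transpose_mat ?w * Q * ?w"
    using point_sm[OF phi] point_sm[OF psi] by simp
  define g where "g = ?w' * ?wi"
  have g: "g \<in> Oq" "g * ?w = ?w'"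
    unfolding g_def using Oq_quotient[OF c(1,3) point_wi[OF phi] c(2) e] by blast+
  obtain h where h: "h \<in> Oq" "g * h = 1\<^sub>m n" "h * g = 1\<^sub>m n" using Oq_inverse[OF g(1)] by blast
  have gc: "g \<in> carrier_mat n n" using g by simp
  have "map_mat \<phi> B = map_mat \<psi> B" by (rule eq_matI) (use eqB carrier_matD[OF B_carrier] in auto)
  moreover have "map_mat \<phi> B \<in> carrier_mat n n" using B_carrier by simp
  ultimately have u: "map_mat \<psi> um = g * map_mat \<phi> um"
    unfolding point_um[OF phi] point_um[OF psi] using g(2) assoc_mult_mat[OF gc c(1), of "map_mat \<phi> B" n] by simp
  have ptc: "pt n u (\<lambda>j. \<psi> (eta j)) = pt n u (\<lambda>j. \<phi> (eta j))" for u :: "'k alg_closure mat"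
    using eqe by (auto simp: pt_def fun_eq_iff)
  have Z': "\<psi> (Z $$ (r, c)) = (\<Sum>e<m. \<phi> (Z $$ (r, e)) * \<rho> h $$ (e, c))" if rc: "r < m" "c < m" for r c
  proof -
    have fr: "fst (f r) \<subseteq> {..<n}" "snd (f r) < m" using f[OF rc(1)] by auto
    have "\<psi> (Z $$ (r, c)) = mpol_eval to_ac (pt n (g * map_mat \<phi> um) (\<lambda>j. \<phi> (eta j))) (P (fst (f r)) (snd (f r)) c)"
      using rc by (simp add: Z_def point_row[OF psi] u ptc)
    also have "\<dots> = (\<Sum>e<m. mpol_eval to_ac (pt n (map_mat \<phi> um) (\<lambda>j. \<phi> (eta j))) (P (fst (f r)) (snd (f r)) e) * \<rho> h $$ (e, c))"
      by (rule P_equivariant[OF point_good[OF phi] g(1) h(1,2) fr rc(2)])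
    also have "\<dots> = (\<Sum>e<m. \<phi> (Z $$ (r, e)) * \<rho> h $$ (e, c))"
      using rc by (simp add: Z_def point_row[OF phi])
    finally show ?thesis .
  qed
  \<comment> \<open>The vector part of \<open>\<psi>\<close> moved back by \<open>g\<^sup>-\<^sup>1\<close>; it satisfies the same equations as that of \<open>\<phi>\<close>.\<close>
  define v where "v = (\<lambda>e. \<Sum>c<m. \<rho> h $$ (e, c) * \<psi> (rf_var c))"
  have zz: "(\<Sum>c<m. \<phi> (Z $$ (r, c)) * \<phi> (rf_var c)) = (\<Sum>e<m. \<phi> (Z $$ (r, e)) * v e)" if r: "r < m" for r
  proof -
    have "(\<Sum>c<m. \<phi> (Z $$ (r, c)) * \<phi> (rf_var c)) = \<psi> (z r)"
      using point_z[OF phi r] eqY[of "z r"] r by (simp add: Y_def)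
    also have "\<dots> = (\<Sum>c<m. (\<Sum>e<m. \<phi> (Z $$ (r, e)) * \<rho> h $$ (e, c)) * \<psi> (rf_var c))"
      unfolding point_z[OF psi r] using Z' r by (intro sum.cong refl) simp
    also have "\<dots> = (\<Sum>e<m. \<phi> (Z $$ (r, e)) * v e)"
      unfolding v_def by (rule sum_assoc)
    finally show ?thesis .
  qed
  have ZZ: "map_mat \<phi> Zi \<in> carrier_mat m m" "map_mat \<phi> Z \<in> carrier_mat m m" using Zi(1) by auto
  have cancel: "x e = y e" if "e < m" and xy: "\<And>r. r < m \<Longrightarrow> (\<Sum>c<m. \<phi> (Z $$ (r, c)) * x c) = (\<Sum>c<m. \<phi> (Z $$ (r, c)) * y c)"
    for e and x y :: "nat \<Rightarrow> 'k alg_closure"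
  proof -
    have "(\<Sum>l<m. map_mat \<phi> Zi $$ (e, l) * (\<Sum>r<m. map_mat \<phi> Z $$ (l, r) * x r)) =
        (\<Sum>l<m. map_mat \<phi> Zi $$ (e, l) * (\<Sum>r<m. map_mat \<phi> Z $$ (l, r) * y r))"
      using xy carrier_matD[OF Z_carrier] by (intro sum.cong refl) simp
    then show ?thesis unfolding inverse_sum[OF ZZ point_Zi(1)[OF phi T] that(1)] .
  qed
  have ve: "\<phi> (rf_var e) = v e" if e: "e < m" for e
    by (rule cancel[OF e, of "\<lambda>c. \<phi> (rf_var c)"]) (rule zz)
  show ?thesis
  proof (rule that[OF g(1) g(2)[symmetric]])
    fix i assume i: "i < m"
    have "(\<Sum>l<m. \<rho> g $$ (i, l) * \<phi> (rf_var l)) = (\<Sum>l<m. \<rho> g $$ (i, l) * v l)"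
      using ve by (intro sum.cong refl) simp
    also have "\<dots> = \<psi> (rf_var i)"
      unfolding v_def by (rule inverse_sum[OF rho_carrier[OF g(1)] rho_carrier[OF h(1)] rho_inverse[OF g(1) h(1,2)] i])
    finally show "\<psi> (rf_var i) = (\<Sum>l<m. \<rho> g $$ (i, l) * \<phi> (rf_var l))" by simp
  qed
qed

definition base_coords :: "'k alg_closure ratfun set" where
  "base_coords = Y \<union> (\<lambda>(i, j). B $$ (i, j)) ` ({..<n} \<times> {..<n}) \<union> eta ` {..<n}"

lemma finite_Y: "finite Y"
proof -
  have "s_entries = (\<lambda>(i, j). sm $$ (i, j)) ` ({..<n} \<times> {..<n})" by (auto simp: s_entries_def)
  then show ?thesis by (simp add: Y_def)
qed

lemma base_coords_field:
  assumes "range rf_const \<subseteq> L" "Y \<subseteq> L" "subfield_set L" shows "gen_subfield (range rf_const \<union> base_coords) \<subseteq> L"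
proof (rule gen_subfield_least[OF assms(3)])
  have "base_field \<union> s_entries \<subseteq> L" using assms(1,2) by (auto simp: base_field_def Y_def)
  then have "s_field \<subseteq> L" unfolding s_field_def by (rule gen_subfield_least[OF assms(3)])
  then show "range rf_const \<union> base_coords \<subseteq> L"
    using assms(1,2) B_field eta_field by (auto simp: base_coords_def)
qed

lemma coord_ring_sm: assumes ij: "i < n" "j < n" shows "sm $$ (i, j) \<in> coord_ring T"
proof -
  have h: "hom_on (coord_ring T) (\<lambda>b. b)" using coord_ring_subring by (simp add: hom_on_def)
  have Tw: "transpose_mat wm \<in> carrier_mat n n" by simp
  have t: "transpose_mat wm $$ (i, j) \<in> coord_ring T" if "i < n" "j < n" for i j
    using that coord_ring_entries(1)[of j i T] carrier_matD[OF carriers(1)] by simp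
  have tq: "(transpose_mat wm * QO) $$ (i, j) \<in> coord_ring T" if "i < n" "j < n" for i j
    using mat_mult_entries[OF h Tw carriers(2) t coord_ring_entries(8)] that by blast
  show ?thesis unfolding sm_def
    using mat_mult_entries[OF h mult_carrier_mat[OF Tw carriers(2)] carriers(1) tq coord_ring_entries(1)] ij by blast
qed

lemma base_coords_ring: "x \<in> base_coords \<Longrightarrow> x \<in> coord_ring T"
  by (auto simp: base_coords_def Y_def s_entries_def coord_ring_sm coord_ring_z coord_ring_entries)

text \<open>
  Separating specializations for \<open>y\<close>, taken to agree also on the functions that \<open>orbit\<close> needs;
  those are rational over \<open>Y\<close>, so \<open>y\<close> remains outside the field that they generate.
\<close>

lemma coord_separation:
  assumes y: "y \<in> T" and T: "finite T" "Zi_entries \<subseteq> T" and W: "W \<subseteq> T" "finite W"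
    and not: "y \<notin> gen_subfield (range rf_const \<union> (Y \<union> W))"
  obtains \<phi> \<psi> g where "point_of T \<phi>" "point_of T \<psi>" "\<phi> y \<noteq> \<psi> y" "g \<in> Oq"
    "map_mat \<psi> wm = g * map_mat \<phi> wm"
    "\<And>i. i < m \<Longrightarrow> \<psi> (rf_var i) = (\<Sum>l<m. \<rho> g $$ (i, l) * \<phi> (rf_var l))"
    "\<And>x. x \<in> W \<Longrightarrow> \<phi> x = \<psi> x"
proof -
  let ?D = "base_coords \<union> W"
  let ?S = "(core \<union> T) \<union> ?D"
  have fin: "finite ?S" using finite_core T W finite_Y by (simp add: base_coords_def)
  have eq: "gen_ring (range rf_const \<union> ?S) = coord_ring T"
  proof
    show "coord_ring T \<subseteq> gen_ring (range rf_const \<union> ?S)" unfolding coord_ring_def by (rule gen_ring_mono) auto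
    show "gen_ring (range rf_const \<union> ?S) \<subseteq> coord_ring T"
    proof (rule gen_ring_least[OF coord_ring_subring], rule subsetI)
      fix x assume "x \<in> range rf_const \<union> ?S"
      then consider c where "x = rf_const c" | "x \<in> core" | "x \<in> T" | "x \<in> base_coords"
        using W(1) by blast
      then show "x \<in> coord_ring T" by cases (simp_all add: base_coords_ring coord_ring_incl)
    qed
  qed
  have "gen_subfield (range rf_const \<union> ?D) \<subseteq> gen_subfield (range rf_const \<union> (Y \<union> W))"
  proof (rule gen_subfield_least[OF subfield_gen_subfield])
    let ?L = "gen_subfield (range rf_const \<union> (Y \<union> W))"
    have L: "range rf_const \<union> (Y \<union> W) \<subseteq> ?L" by (rule gen_subfield_incl)
    have cL: "range rf_const \<subseteq> ?L" and YL: "Y \<subseteq> ?L" and WL: "W \<subseteq> ?L" using L by simp_all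
    have "range rf_const \<union> base_coords \<subseteq> ?L"
      by (rule subset_trans[OF gen_subfield_incl base_coords_field[OF cL YL subfield_gen_subfield]])
    then show "range rf_const \<union> ?D \<subseteq> ?L" using WL by simp
  qed
  with not have ny: "y \<notin> gen_subfield (range rf_const \<union> ?D)" by blast
  have yS: "y \<in> ?S" using y by blast
  have S0: "?D \<subseteq> ?S" by blast
  obtain \<phi> \<psi> where hom: "hom_on (gen_ring (range rf_const \<union> ?S)) \<phi>" "hom_on (gen_ring (range rf_const \<union> ?S)) \<psi>"
    and cst: "\<And>x. \<phi> (rf_const x) = x" "\<And>x. \<psi> (rf_const x) = x"
    and agree: "\<And>x. x \<in> ?D \<Longrightarrow> \<phi> x = \<psi> x" and ne: "\<phi> y \<noteq> \<psi> y"
  proof (rule separating_specializations[OF hom_rf_const fin S0 yS ny])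
    fix \<phi> \<psi>
    assume "hom_on (gen_ring (range rf_const \<union> ?S)) \<phi>" "hom_on (gen_ring (range rf_const \<union> ?S)) \<psi>"
      "\<And>x. \<phi> (rf_const x) = x" "\<And>x. \<psi> (rf_const x) = x"
      "\<And>x. x \<in> ?D \<Longrightarrow> \<phi> x = \<psi> x" "\<phi> y \<noteq> \<psi> y"
    then show thesis by (rule that)
  qed
  have pts: "point_of T \<phi>" "point_of T \<psi>" using hom cst by (simp_all add: eq point_of_def)
  have aB: "\<phi> (B $$ (i, j)) = \<psi> (B $$ (i, j))" if "i < n" "j < n" for i j
  proof (rule agree, rule UnI1)
    have "(\<lambda>(i, j). B $$ (i, j)) (i, j) \<in> (\<lambda>(i, j). B $$ (i, j)) ` ({..<n} \<times> {..<n})"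
      by (rule imageI) (use that in simp)
    then show "B $$ (i, j) \<in> base_coords" by (simp add: base_coords_def)
  qed
  have ae: "\<phi> (eta j) = \<psi> (eta j)" if "j < n" for j
    by (rule agree) (use that in \<open>simp add: base_coords_def\<close>)
  have aY: "\<phi> x = \<psi> x" if "x \<in> Y" for x
    by (rule agree) (use that in \<open>simp add: base_coords_def\<close>)
  have aW: "\<phi> x = \<psi> x" if "x \<in> W" for x by (rule agree) (use that in simp)
  obtain g where g: "g \<in> Oq" "map_mat \<psi> wm = g * map_mat \<phi> wm"
    and v: "\<And>i. i < m \<Longrightarrow> \<psi> (rf_var i) = (\<Sum>l<m. \<rho> g $$ (i, l) * \<phi> (rf_var l))"
    using orbit[OF pts T(2) aY aB ae] by blast
  show ?thesis by (rule that[OF pts ne g v aW])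
qed

text \<open>
  An invariant function takes the same value at two points of one orbit. It therefore cannot be separated
  from \<open>Y\<close>. The inverse of its denominator \<open>b\<close> is adjoined to the ring so that the value is a quotient of values.
\<close>

lemma geometric_invariants:
  assumes x: "x \<in> function_field N" and inv: "\<And>g. g \<in> Oq \<Longrightarrow> sub g x = x"
  shows "x \<in> gen_subfield (range rf_const \<union> Y)"
proof (rule ccontr)
  assume not: "\<not> ?thesis"
  let ?V = "range rf_const \<union> rf_var ` {..<N} :: 'k alg_closure ratfun set"
  obtain a b where ab: "a \<in> gen_ring ?V" "b \<in> gen_ring ?V" "b \<noteq> 0" "x = a / b"
    using x unfolding function_field_def by (rule gen_subfield_quotient)
  let ?T = "Zi_entries \<union> {x, inverse b}"
  have fT: "finite ?T" by (simp add: Zi_entries_def)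
  have not': "x \<notin> gen_subfield (range rf_const \<union> (Y \<union> {}))" using not by simp
  obtain \<phi> \<psi> g where p: "point_of ?T \<phi>" "point_of ?T \<psi>" "\<phi> x \<noteq> \<psi> x" and g: "g \<in> Oq"
    and w: "map_mat \<psi> wm = g * map_mat \<phi> wm"
    and v: "\<And>i. i < m \<Longrightarrow> \<psi> (rf_var i) = (\<Sum>l<m. \<rho> g $$ (i, l) * \<phi> (rf_var l))"
    by (rule coord_separation[OF _ fT _ _ _ not']) auto
  note R = coord_ring_subring[of ?T] and h = point_hom[OF p(1)] "point_hom"[OF p(2)] and s = sub_hom[OF g]
  have VR: "gen_ring ?V \<subseteq> coord_ring ?T"
    by (rule gen_ring_least[OF R]) (use coord_ring_incl(3) coord_ring_entries(3) in auto)
  have subvar: "sub g (rf_var i) \<in> gen_ring ?V \<and> \<phi> (sub g (rf_var i)) = \<psi> (rf_var i)" if i: "i < N" for i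
  proof -
    note G = subring_gen_ring[of ?V]
    have vV: "rf_var j \<in> gen_ring ?V" if "j < N" for j by (rule gen_ring_incl) (use that in auto)
    have cV: "rf_const c \<in> gen_ring ?V" for c by (rule gen_ring_incl) auto
    have eval: "\<phi> (\<Sum>l<k. rf_const (c l) * rf_var (e l)) = (\<Sum>l<k. c l * \<phi> (rf_var (e l)))"
      and mem: "(\<Sum>l<k. rf_const (c l) * rf_var (e l)) \<in> gen_ring ?V"
      if e: "\<And>l. l < k \<Longrightarrow> e l < N" for k :: nat and c :: "nat \<Rightarrow> 'k alg_closure" and e
    proof -
      have m: "rf_const (c l) * rf_var (e l) \<in> gen_ring ?V" if "l < k" for l
        by (intro subring_mult[OF G] cV vV e that)
      then show "(\<Sum>l<k. rf_const (c l) * rf_var (e l)) \<in> gen_ring ?V" by (intro subring_sum[OF G]) auto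
      have "\<phi> (\<Sum>l<k. rf_const (c l) * rf_var (e l)) = (\<Sum>l<k. \<phi> (rf_const (c l) * rf_var (e l)))"
        by (rule hom_on_sum[OF h(1)]) (use m VR in auto)
      also have "\<dots> = (\<Sum>l<k. c l * \<phi> (rf_var (e l)))"
      proof (rule sum.cong[OF refl])
        fix l assume "l \<in> {..<k}"
        then have "rf_var (e l) \<in> coord_ring ?T" using coord_ring_entries(3) e by simp
        then show "\<phi> (rf_const (c l) * rf_var (e l)) = c l * \<phi> (rf_var (e l))"
          using hom_on_mult[OF h(1) coord_ring_incl(3)] point_const[OF p(1)] by simp
      qed
      finally show "\<phi> (\<Sum>l<k. rf_const (c l) * rf_var (e l)) = (\<Sum>l<k. c l * \<phi> (rf_var (e l)))" .
    qed
    show ?thesis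
    proof (cases "i < m")
      case True
      have l: "l < N" if "l < m" for l using that by (simp add: N_def)
      show ?thesis using eval[of m "\<lambda>l. l" "\<lambda>l. \<rho> g $$ (i, l)", OF l] mem[of m "\<lambda>l. l" "\<lambda>l. \<rho> g $$ (i, l)", OF l]
          v[OF True] sub_v[OF g True] by simp
    next
      case False
      then have mi: "m \<le> i" by simp
      note b = frame_index_bounds[OF mi i]
      let ?i = "(i - m) div n" and ?j = "(i - m) mod n"
      have l: "m + l * n + ?j < N" if "l < n" for l using frame_index_less[OF that b(2)] .
      have gc: "g \<in> carrier_mat n n" using g by simp
      have wc: "map_mat \<phi> wm \<in> carrier_mat n n" by simp
      have "sub g (rf_var i) = (\<Sum>l<n. rf_const (g $$ (?i, l)) * rf_var (m + l * n + ?j))"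
        using False i by (simp add: sub_var[OF g] sub_poly_def Fract_sum_const_var)
      moreover have "\<psi> (rf_var i) = (\<Sum>l<n. g $$ (?i, l) * \<phi> (rf_var (m + l * n + ?j)))"
      proof -
        have "\<psi> (rf_var i) = map_mat \<psi> wm $$ (?i, ?j)" using b by (simp add: wm_def)
        also have "\<dots> = (\<Sum>l<n. g $$ (?i, l) * map_mat \<phi> wm $$ (l, ?j))"
          unfolding w by (rule index_mult_mat_sum[OF gc wc b(1,2)])
        also have "\<dots> = (\<Sum>l<n. g $$ (?i, l) * \<phi> (rf_var (m + l * n + ?j)))"
          using b by (intro sum.cong refl) (simp add: wm_def)
        finally show ?thesis .
      qed
      ultimately show ?thesis
        using eval[of n "\<lambda>l. m + l * n + ?j" "\<lambda>l. g $$ (?i, l)", OF l] mem[of n "\<lambda>l. m + l * n + ?j" "\<lambda>l. g $$ (?i, l)", OF l]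
        by simp
    qed
  qed
  have sV: "sub g y \<in> gen_ring ?V" if "y \<in> gen_ring ?V" for y
    by (rule gen_ring_image[OF hom_on_subset[OF s subring_gen_ring] subring_gen_ring _ that])
      (use subvar sub_const[OF g] in \<open>auto intro: gen_ring_incl\<close>)
  have comp: "\<phi> (sub g y) = \<psi> y" if y: "y \<in> gen_ring ?V" for y
  proof -
    have 1: "hom_on (gen_ring ?V) (\<phi> \<circ> sub g)"
      by (rule hom_on_comp[OF hom_on_subset[OF s subring_gen_ring] h(1)]) (use sV VR in auto)
    have 2: "hom_on (gen_ring ?V) \<psi>" by (rule hom_on_subset[OF h(2) subring_gen_ring VR])
    have "(\<phi> \<circ> sub g) y = \<psi> y"
      by (rule gen_ring_cong_hom[OF 1 2 _ y])
        (use subvar sub_const[OF g] point_const[OF p(1)] point_const[OF p(2)] in auto)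
    then show ?thesis by simp
  qed
  have xT: "x \<in> coord_ring ?T" "inverse b \<in> coord_ring ?T" by (rule coord_ring_incl(2), simp)+
  have bT: "b \<in> coord_ring ?T" "a \<in> coord_ring ?T" using ab VR by auto
  have bx: "b * x = a" using ab by simp
  have "sub g b * x = sub g a"
    using hom_on_mult[OF s, of b x] inv[OF g] bx by simp
  then have "\<phi> (sub g b * x) = \<phi> (sub g a)" by simp
  then have "\<psi> b * \<phi> x = \<psi> a"
    using hom_on_mult[OF h(1) _ xT(1), of "sub g b"] sV[OF ab(2)] VR comp[OF ab(1)] comp[OF ab(2)] by auto
  moreover have "\<psi> b * \<psi> x = \<psi> a" using hom_on_mult[OF h(2) bT(1) xT(1)] bx by simp
  moreover have "\<psi> b \<noteq> 0"
  proof
    assume "\<psi> b = 0"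
    then have "\<psi> (b * inverse b) = 0" using hom_on_mult[OF h(2) bT(1) xT(2)] by simp
    then show False using ab(3) hom_on_one[OF h(2)] by simp
  qed
  ultimately have "\<psi> b * \<phi> x = \<psi> b * \<psi> x" "\<psi> b \<noteq> 0" by simp_all
  then show False using p(3) by simp
qed

text \<open>
  Suppose that an entry of \<open>w\<close> takes two values at points with the same vector \<open>x\<close> and the same
  invariants. The group element that connects the points stabilizes \<open>x\<close>. If \<open>x\<close> lies in the open set
  where stabilizers are trivial, the points coincide. The function \<open>pv\<close> is a defining function of this open
  set, and its inverse is adjoined to the ring.
\<close>

lemma frame_generated:
  assumes free: "almost_free (orthogonal_group n q) m \<rho>" and ij: "i < n" "j < n"
  shows "wm $$ (i, j) \<in> gen_subfield (K \<union> Y)"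
proof (rule ccontr)
  assume not: "\<not> ?thesis"
  obtain U where U: "k_open m U" "U \<noteq> {}" "\<And>x. x \<in> U \<Longrightarrow> stabilizer (orthogonal_group n q) (\<lambda>g v. \<rho> g *\<^sub>v v) x = {\<one>\<^bsub>orthogonal_group n q\<^esub>}"
    using free unfolding almost_free_def by blast
  obtain S :: "(nat, 'k) mpol set" where S: "\<And>p. p \<in> S \<Longrightarrow> mpol_vars p \<subseteq> {..<m}"
    "U = {x \<in> carrier_vec m. \<exists>p\<in>S. mpol_eval to_ac (\<lambda>i. x $ i) p \<noteq> 0}" using U(1) unfolding k_open_def by blast
  obtain p x0 where p: "p \<in> S" "mpol_eval to_ac (\<lambda>i. x0 $ i) p \<noteq> 0" using U(2) S(2) by blast
  define pv where "pv = mpol_eval (\<lambda>b. rf_const (to_ac b)) rf_var p"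
  have hc: "hom_on UNIV (\<lambda>b. mpol_const (to_ac b))"
    using hom_on_comp[OF to_ac_hom hom_mpol_const] by (simp add: comp_def)
  have "pv \<noteq> 0"
  proof
    assume z: "pv = 0"
    have "pv = Fraction_Field.Fract (mpol_eval (\<lambda>b. mpol_const (to_ac b)) mpol_var p) 1"
      unfolding pv_def using hom_on_mpol_eval(1)[OF hom_Fract, of p "\<lambda>b. mpol_const (to_ac b)" mpol_var]
      by (simp add: rf_const_def rf_var_def[abs_def])
    then have "mpol_eval (\<lambda>b. mpol_const (to_ac b)) mpol_var p = (0 :: (nat, 'k alg_closure) mpol)"
      using z by (simp add: Zero_fract_def Fraction_Field.eq_fract)
    then have "mpol_eval (\<lambda>b. b) (\<lambda>i. x0 $ i) (mpol_eval (\<lambda>b. mpol_const (to_ac b)) mpol_var p) = 0"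
      by (simp add: hom_on_zero[OF hom_mpol_eval[OF id_hom]])
    then show False using p(2)
      by (simp add: mpol_eval_comp[OF id_hom] mpol_eval_const mpol_eval_var[OF id_hom])
  qed
  let ?W = "rf_var ` {..<m} :: 'k alg_closure ratfun set"
  let ?T = "Zi_entries \<union> {wm $$ (i, j), inverse pv} \<union> ?W"
  have fT: "finite ?T" by (simp add: Zi_entries_def)
  have "gen_subfield (range rf_const \<union> (Y \<union> ?W)) \<subseteq> gen_subfield (K \<union> Y)"
    by (rule gen_subfield_mono) (use K_const K_var in auto)
  with not have not': "wm $$ (i, j) \<notin> gen_subfield (range rf_const \<union> (Y \<union> ?W))" by blast
  obtain \<phi> \<psi> g where pt: "point_of ?T \<phi>" "point_of ?T \<psi>" "\<phi> (wm $$ (i, j)) \<noteq> \<psi> (wm $$ (i, j))" and g: "g \<in> Oq"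
    and w: "map_mat \<psi> wm = g * map_mat \<phi> wm"
    and v: "\<And>i. i < m \<Longrightarrow> \<psi> (rf_var i) = (\<Sum>l<m. \<rho> g $$ (i, l) * \<phi> (rf_var l))"
    and agree: "\<And>x. x \<in> ?W \<Longrightarrow> \<phi> x = \<psi> x"
    by (rule coord_separation[OF _ fT _ _ _ not']) auto
  note h = point_hom[OF pt(1)] and R = coord_ring_subring[of ?T]
  have "mpol_eval (\<lambda>b. rf_const (to_ac b)) rf_var p \<in> coord_ring ?T"
    by (rule mpol_eval_mem[OF R]) (use S(1)[OF p(1)] coord_ring_incl(3) coord_ring_entries(2) in auto)
  then have pvR: "pv \<in> coord_ring ?T" by (simp only: pv_def[symmetric])
  have ipv: "inverse pv \<in> coord_ring ?T" by (rule coord_ring_incl(2)) simp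
  define x where "x = vec m (\<lambda>i. \<phi> (rf_var i))"
  have "\<phi> pv = mpol_eval to_ac (\<lambda>i. x $ i) p"
  proof -
    have "\<phi> pv = mpol_eval (\<lambda>b. \<phi> (rf_const (to_ac b))) (\<lambda>v. \<phi> (rf_var v)) p"
      unfolding pv_def by (rule hom_on_mpol_eval[OF h])
        (use S(1)[OF p(1)] coord_ring_incl(3) coord_ring_entries(2) in auto)
    also have "\<dots> = mpol_eval to_ac (\<lambda>i. x $ i) p"
      by (rule mpol_eval_cong) (use S(1)[OF p(1)] in \<open>auto simp: x_def point_const[OF pt(1)]\<close>)
    finally show ?thesis .
  qed
  moreover have "\<phi> pv \<noteq> 0"
  proof
    assume "\<phi> pv = 0"
    then have "\<phi> (pv * inverse pv) = 0" using hom_on_mult[OF h pvR ipv] by simp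
    then show False using \<open>pv \<noteq> 0\<close> hom_on_one[OF h] by simp
  qed
  ultimately have xU: "x \<in> U" unfolding S(2) using p(1) by (auto simp: x_def)
  have "\<rho> g *\<^sub>v x = x"
  proof (rule eq_vecI)
    fix i assume "i < dim_vec x"
    then have i: "i < m" by (simp add: x_def)
    have "(\<rho> g *\<^sub>v x) $ i = (\<Sum>l<m. \<rho> g $$ (i, l) * \<phi> (rf_var l))"
      using mult_mat_vec_index_sum[OF rho_carrier[OF g], of x i] i by (simp add: x_def)
    also have "\<dots> = x $ i" using v[OF i] agree[of "rf_var i"] i by (simp add: x_def)
    finally show "(\<rho> g *\<^sub>v x) $ i = x $ i" .
  qed (use rho_carrier[OF g] in \<open>auto simp: x_def\<close>)
  then have "g \<in> stabilizer (orthogonal_group n q) (\<lambda>g v. \<rho> g *\<^sub>v v) x"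
    using g by (simp add: stabilizer_def carrier_orthogonal)
  then have "g = 1\<^sub>m n" using U(3)[OF xU] by simp
  then have "map_mat \<psi> wm = map_mat \<phi> wm" using w left_mult_one_mat[of "map_mat \<phi> wm" n n] by simp
  then have "map_mat \<psi> wm $$ (i, j) = map_mat \<phi> wm $$ (i, j)" by simp
  then show False using pt(3) ij carrier_matD[OF carriers(1)] by simp
qed

end

section \<open>Frames defined over the function field of the representation\<close>

context selected_frame
begin

definition kY :: "'k alg_closure ratfun set" where "kY = gen_subfield (base_field \<union> Y)"

text \<open>
  Functions of the generic matrix alone; translations of the vector leave them unchanged.
\<close>

definition frame_field :: "'k alg_closure ratfun set" where
  "frame_field = gen_subfield (range rf_const \<union> rf_var ` {m..<N})"

lemma frame_field_subfield: "subfield_set frame_field"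
  unfolding frame_field_def by (rule subfield_gen_subfield)

lemma frame_field_wm: "i < n \<Longrightarrow> j < n \<Longrightarrow> wm $$ (i, j) \<in> frame_field"
  using frame_index_less gen_subfield_incl[of "range rf_const \<union> rf_var ` {m..<N}"]
  by (auto simp: frame_field_def wm_index)

lemma frame_field_const: "rf_const c \<in> frame_field"
  using gen_subfield_incl[of "range rf_const \<union> rf_var ` {m..<N}"] by (auto simp: frame_field_def)

lemma frame_field_sm: assumes ij: "i < n" "j < n" shows "sm $$ (i, j) \<in> frame_field"
proof -
  note R = subfield_subring[OF frame_field_subfield]
  have "QO $$ (k, l) \<in> frame_field" if "k < n" "l < n" for k l
    using that carrier_matD[OF Q_carrier] by (simp add: QO_def frame_field_const)
  then show ?thesis unfolding sm_def gram_product_index[OF carriers(1) carriers(2) ij]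
    using ij by (intro subring_sum[OF R] subring_mult[OF R]) (auto intro: frame_field_wm)
qed

lemma frame_field_s: "s_field \<subseteq> frame_field"
  unfolding s_field_def
  by (rule gen_subfield_least[OF frame_field_subfield])
    (auto simp: base_field_def s_entries_def frame_field_const frame_field_sm)

lemma frame_field_um: assumes ij: "i < n" "j < n" shows "um $$ (i, j) \<in> frame_field"
proof -
  note R = subfield_subring[OF frame_field_subfield]
  have "B $$ (k, l) \<in> frame_field" if "k < n" "l < n" for k l using B_field[OF that] frame_field_s by blast
  then show ?thesis unfolding um_def index_mult_mat_sum[OF carriers(1) B_carrier ij]
    using ij by (intro subring_sum[OF R] subring_mult[OF R]) (auto intro: frame_field_wm)
qed

lemma frame_field_row: "row I i c \<in> frame_field"
proof -
  note R = subfield_subring[OF frame_field_subfield]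
  have e: "eta j \<in> frame_field" if "j < n" for j using eta_field[OF that] frame_field_s by blast
  have "pt n um eta v \<in> frame_field" for v
    by (cases v) (auto simp: pt_def frame_field_um e subring_zero[OF R])
  then show ?thesis unfolding row_def by (intro mpol_eval_mem[OF R] frame_field_const)
qed

lemma frame_field_Z: "i < m \<Longrightarrow> j < m \<Longrightarrow> Z $$ (i, j) \<in> frame_field"
  by (simp add: Z_def frame_field_row)

lemma frame_field_N: "frame_field \<subseteq> function_field N"
  unfolding frame_field_def function_field_def by (rule gen_subfield_mono) auto

lemma function_field_N_subfield: "subfield_set (function_field N)"
  unfolding function_field_def by (rule subfield_gen_subfield)

lemma Y_function_field: "Y \<subseteq> function_field N"
proof -
  note R = subfield_subring[OF function_field_N_subfield]
  have v: "rf_var c \<in> function_field N" if "c < m" for c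
    using gen_subfield_incl[of "range rf_const \<union> rf_var ` {..<N}"] that by (auto simp: function_field_def N_def)
  have "z r \<in> function_field N" if "r < m" for r
    unfolding z_sum[OF that] using that v frame_field_Z frame_field_N
    by (intro subring_sum[OF R] subring_mult[OF R]) auto
  then show ?thesis using frame_field_sm frame_field_N by (auto simp: Y_def s_entries_def)
qed

lemma const_subfield: "subfield_set (range (rf_const :: 'k alg_closure \<Rightarrow> _))"
proof -
  have "subring_set (range (rf_const :: 'k alg_closure \<Rightarrow> _))"
    by (rule hom_on_subring[OF hom_inverse_const(2)[OF hom_rf_const]])
  then show ?thesis
    by (auto simp: subfield_set_def hom_UNIV_inverse[OF hom_rf_const, symmetric])
qed

lemma Gamma_const: "\<gamma> \<in> \<Gamma> \<Longrightarrow> c \<in> range rf_const \<Longrightarrow> \<gamma> c \<in> range rf_const"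
  by (auto simp: \<Gamma>_def sub_const galois_act_hom(2)[OF galois_hom])

text \<open>
  Invariance under \<open>G\<close> gives a rational expression with coefficients in the algebraic closure, and
  invariance under Galois moves the coefficients to \<open>k\<close>.
\<close>

lemma invariants_in_kY:
  assumes x: "x \<in> function_field N" "\<And>\<gamma>. \<gamma> \<in> \<Gamma> \<Longrightarrow> \<gamma> x = x" shows "x \<in> kY"
proof -
  have geo: "x \<in> gen_subfield (range rf_const \<union> Y)"
    by (rule geometric_invariants[OF x(1)]) (rule x(2), simp add: \<Gamma>_def)
  have "x \<in> gen_subfield ({c \<in> range rf_const. \<forall>\<gamma>\<in>\<Gamma>. \<gamma> c = c} \<union> Y)"
  proof (rule fixed_field_descent[where \<Gamma>=\<Gamma> and K="range rf_const" and Y=Y, OF const_subfield])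
    show "hom_on UNIV \<gamma>" if "\<gamma> \<in> \<Gamma>" for \<gamma> using Gamma_hom that .
    show "\<gamma> c \<in> range rf_const" if "\<gamma> \<in> \<Gamma>" "c \<in> range rf_const" for \<gamma> c using Gamma_const that .
    show "\<gamma> y = y" if "\<gamma> \<in> \<Gamma>" "y \<in> Y" for \<gamma> y using Gamma_Y that .
    show "x \<in> gen_subfield (range rf_const \<union> Y)" by (rule geo)
    show "\<gamma> x = x" if "\<gamma> \<in> \<Gamma>" for \<gamma> using x(2) that .
  qed
  moreover have "{c \<in> range rf_const. \<forall>\<gamma>\<in>\<Gamma>. \<gamma> c = c} \<subseteq> base_field"
  proof
    fix c assume c: "c \<in> {c \<in> range rf_const. \<forall>\<gamma>\<in>\<Gamma>. \<gamma> c = c}"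
    then obtain u where u: "c = rf_const u" by blast
    have "\<sigma> u = u" if s: "\<sigma> \<in> absolute_galois" for \<sigma>
    proof -
      have "galois_act \<sigma> c = c" using c s by (simp add: \<Gamma>_def)
      then have "rf_const (\<sigma> u) = rf_const u" unfolding u galois_act_hom(2)[OF galois_hom[OF s]] .
      then show ?thesis by (rule injD[OF hom_UNIV_inj[OF hom_rf_const]])
    qed
    then have "u \<in> range to_ac" by (rule galois_fixed)
    then show "c \<in> base_field" using u by (auto simp: base_field_def)
  qed
  ultimately show ?thesis unfolding kY_def using gen_subfield_mono[of _ "base_field \<union> Y"] by blast
qed

subsection \<open>Equivariant frames\<close>

text \<open>
  The entries of \<open>w\<close> span a \<open>\<Gamma>\<close>-stable space over \<open>K\<close>, so there is a fixed \<open>b\<close> such that each \<open>b * w i j\<close> is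
  a combination of linearly independent fixed elements \<open>l\<close> in \<open>M\<close> with coefficients \<open>C i j l\<close> in \<open>K\<close>. For fixed \<open>j\<close> and \<open>l\<close>, the
  vector of the \<open>C i j l\<close> transforms like a column of \<open>w\<close>. These vectors span because \<open>b * w\<close> is
  invertible, and \<open>n\<close> independent ones are the columns of \<open>F\<close>.
\<close>

lemma equivariant_frame:
  assumes free: "almost_free (orthogonal_group n q) m \<rho>"
  obtains F where "F \<in> carrier_mat n n" "\<And>i j. i < n \<Longrightarrow> j < n \<Longrightarrow> F $$ (i, j) \<in> K" "det F \<noteq> 0"
    "\<And>g. g \<in> Oq \<Longrightarrow> map_mat (sub g) F = map_mat rf_const g * F"
    "\<And>\<sigma>. \<sigma> \<in> absolute_galois \<Longrightarrow> map_mat (galois_act \<sigma>) F = F"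
proof -
  note R = subfield_subring[OF K_subfield]
  let ?J = "{..<n} \<times> {..<n}" and ?f = "\<lambda>(i, j). wm $$ (i, j)"
  have wmvar: "wm $$ (i, j) = rf_var (m + i * n + j)" if "i < n" "j < n" for i j using wm_index that .
  have sub_w: "sub g (wm $$ (i, j)) = (\<Sum>l<n. rf_const (g $$ (i, l)) * wm $$ (l, j))"
    if g: "g \<in> Oq" and ij: "i < n" "j < n" for g i j
  proof -
    have gc: "map_mat rf_const g \<in> carrier_mat n n" "g \<in> carrier_mat n n" using g by auto
    have "sub g (wm $$ (i, j)) = map_mat (sub g) wm $$ (i, j)" using ij carrier_matD[OF carriers(1)] by simp
    also have "\<dots> = (\<Sum>l<n. rf_const (g $$ (i, l)) * wm $$ (l, j))"
      unfolding sub_wm[OF g] index_mult_mat_sum[OF gc(1) carriers(1) ij] using ij gc(2) by simp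
    finally show ?thesis .
  qed
  have gal_w: "galois_act \<sigma> (wm $$ (i, j)) = wm $$ (i, j)" if "\<sigma> \<in> absolute_galois" "i < n" "j < n" for \<sigma> i j
    using that by (simp add: wmvar galois_act_hom(3)[OF galois_hom])
  have "\<exists>b M. finite M \<and> M \<subseteq> gen_ring Y \<and> kindep K M \<and> b \<noteq> 0 \<and> (\<forall>\<gamma>\<in>\<Gamma>. \<gamma> b = b) \<and> (\<forall>e\<in>?J. b * ?f e \<in> kspan K M)"
  proof (rule common_fixed_denominator[where K=K and \<Gamma>=\<Gamma> and Y=Y and J="?J" and f="?f", OF K_subfield])
    show "hom_on UNIV \<gamma>" if "\<gamma> \<in> \<Gamma>" for \<gamma> using Gamma_hom that .
    show "\<gamma> x \<in> K" if "\<gamma> \<in> \<Gamma>" "x \<in> K" for \<gamma> x using Gamma_K that .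
    show "\<gamma> y = y" if "\<gamma> \<in> \<Gamma>" "y \<in> Y" for \<gamma> y using Gamma_Y that .
    show "finite ?J" by simp
    show "?f e \<in> gen_subfield (K \<union> Y)" if "e \<in> ?J" for e using frame_generated[OF free] that by auto
    show "\<exists>c. (\<forall>i\<in>?J. c i \<in> K) \<and> ?f e = (\<Sum>i\<in>?J. c i * \<gamma> (?f i))" if G: "\<gamma> \<in> \<Gamma>" and e: "e \<in> ?J" for \<gamma> e
    proof -
      obtain i j where ij: "e = (i, j)" "i < n" "j < n" using e by auto
      show ?thesis using G
      proof (cases rule: Gamma_cases)
        case (galois \<sigma>)
        have "(\<Sum>u\<in>?J. (if u = (i, j) then 1 else 0) * \<gamma> (?f u)) = (\<Sum>u\<in>?J. if u = (i, j) then \<gamma> (?f (i, j)) else 0)"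
          by (intro sum.cong) auto
        also have "\<dots> = wm $$ (i, j)" using ij gal_w[OF galois(1)] galois(2) by simp
        finally show ?thesis unfolding ij(1)
          by (intro exI[of _ "\<lambda>u. if u = (i, j) then 1 else 0"]) (auto intro: subring_one[OF R] subring_zero[OF R])
      next
        case (sub g)
        obtain h where h: "h \<in> Oq" "g * h = 1\<^sub>m n" "h * g = 1\<^sub>m n" using Oq_inverse[OF sub(1)] by blast
        let ?h = "map_mat rf_const h" and ?g = "map_mat rf_const g"
        have c: "?h \<in> carrier_mat n n" "?g \<in> carrier_mat n n" "h \<in> carrier_mat n n" "g \<in> carrier_mat n n" using h sub by auto
        have hg: "?h * ?g = (1\<^sub>m n :: 'k alg_closure ratfun mat)"
        proof -
          have "?h * ?g = (map_mat rf_const (h * g) :: 'k alg_closure ratfun mat)"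
            by (rule hom_UNIV_mat_mult[OF hom_rf_const c(3,4), symmetric])
          also have "\<dots> = 1\<^sub>m n" unfolding h(3) by (rule map_mat_one_on[OF hom_rf_const])
          finally show ?thesis .
        qed
        \<comment> \<open>The entries of \<open>w\<close> are recovered from those of \<open>g w\<close> by the inverse \<open>h\<close> of \<open>g\<close>.\<close>
        have "wm $$ (i, j) = (\<Sum>l<n. ?h $$ (i, l) * (\<Sum>r<n. ?g $$ (l, r) * wm $$ (r, j)))"
          using inverse_sum[OF c(1,2) hg ij(2), of "\<lambda>r. wm $$ (r, j)"] by simp
        also have "\<dots> = (\<Sum>l<n. rf_const (h $$ (i, l)) * \<gamma> (wm $$ (l, j)))"
          using ij c(3,4) by (intro sum.cong refl) (simp add: sub(2) sub_w[OF sub(1)])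
        also have "\<dots> = (\<Sum>l<n. \<Sum>b<n. if b = j then rf_const (h $$ (i, l)) * \<gamma> (wm $$ (l, b)) else 0)"
          using ij by simp
        also have "\<dots> = (\<Sum>l<n. \<Sum>b<n. (if b = j then rf_const (h $$ (i, l)) else 0) * \<gamma> (wm $$ (l, b)))"
          by (intro sum.cong refl) auto
        also have "\<dots> = (\<Sum>u\<in>?J. (if snd u = j then rf_const (h $$ (i, fst u)) else 0) * \<gamma> (?f u))"
          by (simp add: sum.cartesian_product case_prod_beta)
        finally show ?thesis unfolding ij(1) prod.case
          by (intro exI[of _ "\<lambda>u. if snd u = j then rf_const (h $$ (i, fst u)) else 0"])
            (auto intro: K_const subring_zero[OF R])
      qed
    qed
    fix b M assume 1: "finite M" "M \<subseteq> gen_ring Y" "kindep K M" "b \<noteq> 0" "b \<in> kspan K M"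
      and 2: "\<And>\<gamma>. \<gamma> \<in> \<Gamma> \<Longrightarrow> \<gamma> b = b" and 3: "\<And>e. e \<in> ?J \<Longrightarrow> b * ?f e \<in> kspan K M"
    have "\<forall>\<gamma>\<in>\<Gamma>. \<gamma> b = b" by (rule ballI) (rule 2)
    moreover have "\<forall>e\<in>?J. b * ?f e \<in> kspan K M" by (rule ballI) (rule 3)
    ultimately show ?thesis using 1 by (intro exI[of _ b] exI[of _ M]) simp
  qed
  then obtain b M where M: "finite M" "M \<subseteq> gen_ring Y" "kindep K M" and b: "b \<noteq> 0" "\<forall>\<gamma>\<in>\<Gamma>. \<gamma> b = b"
    "\<forall>e\<in>?J. b * ?f e \<in> kspan K M" by blast
  have fixM: "\<gamma> l = l" if G: "\<gamma> \<in> \<Gamma>" and l: "l \<in> M" for \<gamma> l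
  proof -
    have "l \<in> gen_ring Y" using M(2) l by blast
    then show ?thesis by induction (simp_all add: Gamma_Y[OF G] hom_onD[OF Gamma_hom[OF G]])
  qed
  define C where "C = (\<lambda>i j. SOME c. (\<forall>l\<in>M. c l \<in> K) \<and> b * wm $$ (i, j) = (\<Sum>l\<in>M. c l * l))"
  have C: "(\<forall>l\<in>M. C i j l \<in> K) \<and> b * wm $$ (i, j) = (\<Sum>l\<in>M. C i j l * l)" if ij: "i < n" "j < n" for i j
  proof -
    have "b * wm $$ (i, j) \<in> kspan K M" using b(3) ij by auto
    then obtain c where "\<And>l. l \<in> M \<Longrightarrow> c l \<in> K" "b * wm $$ (i, j) = (\<Sum>l\<in>M. c l * l)" by (rule kspanE) blast
    then have "\<exists>c. (\<forall>l\<in>M. c l \<in> K) \<and> b * wm $$ (i, j) = (\<Sum>l\<in>M. c l * l)" by blast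
    then show ?thesis unfolding C_def by (rule someI_ex)
  qed
  have imC: "\<gamma> (b * wm $$ (i, j)) = (\<Sum>l\<in>M. \<gamma> (C i j l) * l)" if G: "\<gamma> \<in> \<Gamma>" and ij: "i < n" "j < n" for \<gamma> i j
  proof -
    have "\<gamma> (b * wm $$ (i, j)) = (\<Sum>l\<in>M. \<gamma> (C i j l * l))"
      using C[OF ij] hom_on_sum[OF Gamma_hom[OF G], of M "\<lambda>l. C i j l * l"] by simp
    also have "\<dots> = (\<Sum>l\<in>M. \<gamma> (C i j l) * l)"
      by (rule sum.cong[OF refl]) (simp add: hom_on_mult[OF Gamma_hom[OF G]] fixM[OF G])
    finally show ?thesis .
  qed
  have sub_C: "sub g (C i j l) = (\<Sum>r<n. rf_const (g $$ (i, r)) * C r j l)"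
    if g: "g \<in> Oq" and ij: "i < n" "j < n" and l: "l \<in> M" for g i j l
  proof (rule kindep_coeff_eq[OF R M(3) _ _ _ l])
    have G: "sub g \<in> \<Gamma>" using g by (simp add: \<Gamma>_def)
    show "sub g (C i j l) \<in> K" if "l \<in> M" for l using C[OF ij] Gamma_K[OF G] that by blast
    show "(\<Sum>r<n. rf_const (g $$ (i, r)) * C r j l) \<in> K" if "l \<in> M" for l
      by (intro subring_sum[OF R] subring_mult[OF R] K_const) (use C ij(2) that in auto)
    have "(\<Sum>l\<in>M. sub g (C i j l) * l) = sub g b * sub g (wm $$ (i, j))"
      unfolding imC[OF G ij, symmetric] by (simp add: hom_on_mult[OF sub_hom[OF g]])
    also have "\<dots> = (\<Sum>r<n. rf_const (g $$ (i, r)) * (b * wm $$ (r, j)))"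
      unfolding bspec[OF b(2) G] sub_w[OF g ij] sum_distrib_left by (simp add: mult_ac)
    also have "\<dots> = (\<Sum>r<n. rf_const (g $$ (i, r)) * (\<Sum>l\<in>M. C r j l * l))"
      using C ij(2) by (intro sum.cong refl) simp
    also have "\<dots> = (\<Sum>l\<in>M. (\<Sum>r<n. rf_const (g $$ (i, r)) * C r j l) * l)"
      unfolding sum_distrib_left sum_distrib_right by (subst sum.swap) (simp add: mult.assoc)
    finally show "(\<Sum>l\<in>M. sub g (C i j l) * l) = (\<Sum>l\<in>M. (\<Sum>r<n. rf_const (g $$ (i, r)) * C r j l) * l)" .
  qed
  have gal_C: "galois_act \<sigma> (C i j l) = C i j l"
    if s: "\<sigma> \<in> absolute_galois" and ij: "i < n" "j < n" and l: "l \<in> M" for \<sigma> i j l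
  proof (rule kindep_coeff_eq[OF R M(3) _ _ _ l])
    have G: "galois_act \<sigma> \<in> \<Gamma>" using s by (simp add: \<Gamma>_def)
    show "galois_act \<sigma> (C i j l) \<in> K" if "l \<in> M" for l using C[OF ij] Gamma_K[OF G] that by blast
    show "C i j l \<in> K" if "l \<in> M" for l using C[OF ij] that by blast
    have "(\<Sum>l\<in>M. galois_act \<sigma> (C i j l) * l) = galois_act \<sigma> b * galois_act \<sigma> (wm $$ (i, j))"
      unfolding imC[OF G ij, symmetric] by (simp add: hom_on_mult[OF Gamma_hom[OF G]])
    also have "\<dots> = b * wm $$ (i, j)" unfolding bspec[OF b(2) G] gal_w[OF s ij] ..
    finally show "(\<Sum>l\<in>M. galois_act \<sigma> (C i j l) * l) = (\<Sum>l\<in>M. C i j l * l)" using C[OF ij] by simp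
  qed
  have ker: "\<forall>i<n. c i = 0"
    if k: "\<And>e. e \<in> {..<n} \<times> M \<Longrightarrow> (\<Sum>i<n. C i (fst e) (snd e) * c i) = 0" for c
  proof -
    define v where "v = vec n c"
    have v: "v \<in> carrier_vec n" by (simp add: v_def)
    have T: "transpose_mat wm \<in> carrier_mat n n" by simp
    have "transpose_mat wm *\<^sub>v v = 0\<^sub>v n"
    proof (rule eq_vecI)
      fix j assume "j < dim_vec (0\<^sub>v n :: 'k alg_closure ratfun vec)"
      then have j: "j < n" by simp
      have "b * (transpose_mat wm *\<^sub>v v) $ j = (\<Sum>i<n. (b * wm $$ (i, j)) * c i)"
        unfolding mult_mat_vec_index_sum[OF T v j] sum_distrib_left
        using j carrier_matD[OF carriers(1)] by (intro sum.cong refl) (simp add: v_def mult.assoc)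
      also have "\<dots> = (\<Sum>i<n. (\<Sum>l\<in>M. C i j l * l) * c i)" using C j by (intro sum.cong refl) simp
      also have "\<dots> = (\<Sum>l\<in>M. (\<Sum>i<n. C i j l * c i) * l)"
        unfolding sum_distrib_right by (subst sum.swap) (simp add: mult_ac)
      also have "\<dots> = 0" using k[of "(j, _)"] j by (intro sum.neutral) auto
      finally show "(transpose_mat wm *\<^sub>v v) $ j = 0\<^sub>v n $ j" using b(1) j by simp
    qed (use carrier_matD[OF carriers(1)] in simp)
    moreover have "det (transpose_mat wm) \<noteq> 0" using det_wm det_transpose[OF carriers(1)] by simp
    ultimately have "v = 0\<^sub>v n" using det_0_iff_vec_prod_zero_field[OF T] v by blast
    then have "v $ i = 0" if "i < n" for i using that by simp
    then show ?thesis by (simp add: v_def)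
  qed
  obtain e where e: "\<And>r. r < n \<Longrightarrow> e r \<in> {..<n} \<times> M"
    and det: "det (mat n n (\<lambda>(r, i). C i (fst (e r)) (snd (e r)))) \<noteq> 0"
    by (rule select_rows[where R="\<lambda>e i. C i (fst e) (snd e)" and E="{..<n} \<times> M", OF ker]) blast+
  have er: "fst (e r) < n" "snd (e r) \<in> M" if "r < n" for r using e[OF that] by auto
  define F where "F = mat n n (\<lambda>(i, r). C i (fst (e r)) (snd (e r)))"
  have F: "F \<in> carrier_mat n n" by (simp add: F_def)
  have "transpose_mat F = mat n n (\<lambda>(r, i). C i (fst (e r)) (snd (e r)))" by (rule eq_matI) (auto simp: F_def)
  then have dF: "det F \<noteq> 0" using det det_transpose[OF F] by simp
  show ?thesis
  proof (rule that[OF F _ dF])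
    show "F $$ (i, j) \<in> K" if "i < n" "j < n" for i j using C er that by (simp add: F_def)
    show "map_mat (sub g) F = map_mat rf_const g * F" if g: "g \<in> Oq" for g
    proof (rule eq_matI)
      have gc: "map_mat rf_const g \<in> carrier_mat n n" "g \<in> carrier_mat n n" using g by auto
      fix i j assume "i < dim_row (map_mat rf_const g * F)" "j < dim_col (map_mat rf_const g * F)"
      then have ij: "i < n" "j < n" using gc F by auto
      show "map_mat (sub g) F $$ (i, j) = (map_mat rf_const g * F) $$ (i, j)"
        unfolding index_mult_mat_sum[OF gc(1) F ij] using ij gc(2) by (simp add: F_def sub_C[OF g _ er(1) er(2)])
    qed (use F g in auto)
    show "map_mat (galois_act \<sigma>) F = F" if s: "\<sigma> \<in> absolute_galois" for \<sigma>
      by (rule eq_matI) (auto simp: F_def gal_C[OF s _ er(1) er(2)])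
  qed
qed

subsection \<open>Algebraic independence of the invariants\<close>

definition shift_poly :: "(nat \<Rightarrow> 'k alg_closure) \<Rightarrow> nat \<Rightarrow> (nat, 'k alg_closure) mpol" where
  "shift_poly t i = (if i < m then mpol_var i + mpol_const (t i) else mpol_var i)"

text \<open>
  Translation of the generic vector by \<open>t\<close>. It makes the values of the \<open>z r\<close> at a point arbitrary
  without moving the matrix part.
\<close>

definition shift :: "(nat \<Rightarrow> 'k alg_closure) \<Rightarrow> 'k alg_closure ratfun \<Rightarrow> 'k alg_closure ratfun" where
  "shift t = rf_hom rf_const (\<lambda>i. Fraction_Field.Fract (shift_poly t i) 1)"

lemma shift_facts:
  shows shift_hom: "hom_on UNIV (shift t)" and shift_const: "shift t (rf_const c) = rf_const c"
    and shift_var: "shift t (rf_var i) = (if i < m then rf_var i + rf_const (t i) else rf_var i)"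
proof -
  have inj: "p = 0" if z: "mpol_eval rf_const (\<lambda>i. Fraction_Field.Fract (shift_poly t i) 1) p = 0" for p
  proof (rule mpol_eval_inj_points[OF id_hom _ _ z])
    show "Fraction_Field.Fract (shift_poly t i) 1 = Fraction_Field.Fract (shift_poly t i) 1" for i ..
    show "\<exists>y. \<forall>i. mpol_eval (\<lambda>b. b) y (shift_poly t i) = x i" for x
      by (rule exI[of _ "\<lambda>i. if i < m then x i - t i else x i"])
        (simp add: shift_poly_def hom_on_add[OF hom_mpol_eval[OF id_hom]] mpol_eval_const mpol_eval_var[OF id_hom])
  qed
  show "hom_on UNIV (shift t)" "shift t (rf_const c) = rf_const c"
    unfolding shift_def using rf_hom[OF hom_rf_const inj] by blast+
  have "shift t (rf_var i) = Fraction_Field.Fract (shift_poly t i) 1"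
    unfolding shift_def using rf_hom[OF hom_rf_const inj] by blast
  then show "shift t (rf_var i) = (if i < m then rf_var i + rf_const (t i) else rf_var i)"
    by (simp add: shift_poly_def rf_var_def rf_const_def)
qed

lemma shift_frame_field: assumes x: "x \<in> frame_field" shows "shift t x = x"
proof -
  have "shift t x = (\<lambda>b. b) x"
    by (rule hom_gen_subfield_cong[OF shift_hom id_hom _ x[unfolded frame_field_def]])
      (auto simp: shift_const shift_var)
  then show ?thesis by simp
qed

text \<open>
  The entries of the Gram matrix as polynomials, which can be evaluated at any matrix over the constants.
\<close>

definition s_poly :: "nat \<Rightarrow> nat \<Rightarrow> (nat, 'k alg_closure) mpol" where
  "s_poly i j = (\<Sum>k<n. \<Sum>l<n. mpol_var (m + k * n + i) * mpol_const (Q $$ (k, l)) * mpol_var (m + l * n + j))"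

lemma s_poly_Fract: assumes ij: "i < n" "j < n" shows "Fraction_Field.Fract (s_poly i j) 1 = sm $$ (i, j)"
proof -
  have "sm $$ (i, j) = (\<Sum>k<n. \<Sum>l<n. rf_var (m + k * n + i) * rf_const (Q $$ (k, l)) * rf_var (m + l * n + j))"
    unfolding sm_def gram_product_index[OF carriers(1) carriers(2) ij]
    using ij carrier_matD[OF Q_carrier] by (intro sum.cong refl) (simp add: wm_index QO_def)
  then show ?thesis
    by (simp add: s_poly_def hom_on_sum[OF hom_Fract] rf_var_def rf_const_def)
qed

lemma s_poly_eval:
  assumes W: "W \<in> carrier_mat n n" and ij: "i < n" "j < n"
  shows "mpol_eval (\<lambda>b. b) (\<lambda>e. W $$ ((e - m) div n, (e - m) mod n)) (s_poly i j) = (transpose_mat W * Q * W) $$ (i, j)"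
  unfolding gram_product_index[OF W Q_carrier ij] s_poly_def
  using ij by (simp add: hom_on_sum[OF hom_mpol_eval[OF id_hom]] hom_on_mult[OF hom_mpol_eval[OF id_hom]]
      mpol_eval_const mpol_eval_var[OF id_hom])

lemma gram_surjective:
  fixes S :: "'k alg_closure mat"
  assumes S: "S \<in> carrier_mat n n" "\<And>i j. i < n \<Longrightarrow> j < n \<Longrightarrow> S $$ (i, j) = S $$ (j, i)" "det S \<noteq> 0"
  obtains W where "W \<in> carrier_mat n n" "transpose_mat W * Q * W = S"
proof -
  obtain A where A: "A \<in> carrier_mat n n" "Q = transpose_mat A * A" by (rule symmetric_square[OF Q_carrier Q_sym det_Q])
  obtain L where L: "L \<in> carrier_mat n n" "S = transpose_mat L * L" by (rule symmetric_square[OF S])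
  have AT: "transpose_mat A \<in> carrier_mat n n" "transpose_mat L \<in> carrier_mat n n" using A L by auto
  have "det A \<noteq> 0" using det_Q det_mult[OF AT(1) A(1)] A(2) by auto
  then obtain Ai where Ai: "Ai \<in> carrier_mat n n" "A * Ai = 1\<^sub>m n" using mat_inverse_exists[OF A(1)] by blast
  have AiT: "transpose_mat Ai \<in> carrier_mat n n" using Ai by simp
  have at: "transpose_mat Ai * transpose_mat A = 1\<^sub>m n" using transpose_mult[OF A(1) Ai(1)] Ai(2) by simp
  have "transpose_mat (Ai * L) * Q * (Ai * L) = transpose_mat L * ((transpose_mat Ai * transpose_mat A) * ((A * Ai) * L))"
    unfolding A(2) transpose_mult[OF Ai(1) L(1)]
    using AT AiT A(1) Ai(1) L(1) by (simp add: assoc_mult_mat[of _ n n _ n _ n] mult_carrier_mat[of _ n n _ n])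
  also have "\<dots> = S" unfolding at Ai(2) L(2) using left_mult_one_mat[OF L(1)] by simp
  finally show ?thesis using that[of "Ai * L"] Ai L by simp
qed

lemma s_diagonal_distinct: assumes "i < n" "j < n" "i \<noteq> j" "k < n" shows "sm $$ (i, j) \<noteq> sm $$ (k, k)"
proof
  assume "sm $$ (i, j) = sm $$ (k, k)"
  then have "Fraction_Field.Fract (s_poly i j) 1 = Fraction_Field.Fract (s_poly k k) 1"
    using assms by (simp add: s_poly_Fract)
  then have e: "s_poly i j = s_poly k k" by (simp add: Fraction_Field.eq_fract)
  obtain W where W: "W \<in> carrier_mat n n" "transpose_mat W * Q * W = 1\<^sub>m n"
    by (rule gram_surjective[of "1\<^sub>m n"]) auto
  show False using s_poly_eval[OF W(1), of i j] s_poly_eval[OF W(1), of k k] assms e by (simp add: W(2))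
qed

text \<open>
  The map given by the invariants reaches enough values. If \<open>a\<close> is a point with
  \<open>p(a) \<noteq> 0\<close>, then the \<open>z r\<close> can be given the values prescribed by \<open>a\<close> by a translation,
  which leaves a relation \<open>pw\<close> between the entries of the Gram matrix. Every invertible symmetric
  matrix is a Gram matrix. The symmetric matrix \<open>S\<close> prescribed by \<open>a\<close> may be singular, but \<open>S + t\<close> is
  invertible for all but finitely many \<open>t\<close>, so \<open>p\<close> vanishes along this line and hence at \<open>a\<close>. The entries
  \<open>s i j\<close> and \<open>s j i\<close> coincide, so the variables of the relation correspond to elements of \<open>Y\<close>
  rather than to indices.
\<close>

theorem Y_independent:
  fixes p :: "('v, 'c::zero) mpol" and h :: "'c \<Rightarrow> 'k alg_closure"
  assumes h: "\<And>a. a \<in> Poly_Mapping.range p \<Longrightarrow> h a \<noteq> 0"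
    and x: "inj_on x (mpol_vars p)" "x ` mpol_vars p \<subseteq> Y"
    and zero: "mpol_eval (\<lambda>a. rf_const (h a)) x p = 0"
  shows "p = 0"
proof (rule ccontr)
  assume "p \<noteq> 0"
  then obtain a where a: "mpol_eval h a p \<noteq> 0" using mpol_nonvanishing[of p h] h by blast
  let ?V = "mpol_vars p"
  \<comment> \<open>The value prescribed by \<open>a\<close> for an element of \<open>Y\<close> that occurs in the relation.\<close>
  define a' where "a' = (\<lambda>y. a (inv_into ?V x y))"
  have a': "a' (x v) = a v" if "v \<in> ?V" for v unfolding a'_def using inv_into_f_f[OF x(1) that] by simp
  define sp :: "'k alg_closure ratfun \<Rightarrow> (nat, 'k alg_closure) mpol"
    where "sp = (\<lambda>y. SOME P. Fraction_Field.Fract P 1 = y)"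
  have sp: "sp (sm $$ (i, j)) = s_poly i j" if "i < n" "j < n" for i j
  proof -
    have "Fraction_Field.Fract (sp (sm $$ (i, j))) 1 = sm $$ (i, j)"
      unfolding sp_def by (rule someI[of _ "s_poly i j"]) (rule s_poly_Fract[OF that])
    then have "Fraction_Field.Fract (sp (sm $$ (i, j))) 1 = Fraction_Field.Fract (s_poly i j) 1"
      unfolding s_poly_Fract[OF that] .
    then show ?thesis by (simp add: Fraction_Field.eq_fract)
  qed
  have spF: "Fraction_Field.Fract (sp y) 1 = y" if "y \<in> s_entries" for y
    using that sp s_poly_Fract by (auto simp: s_entries_def)
  let ?xp = "\<lambda>v. if x v \<in> s_entries then sp (x v) else mpol_const (a v)"
  \<comment> \<open>The relation after the values of \<open>a\<close> are inserted for the \<open>z r\<close>.\<close>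
  define pw where "pw = mpol_eval (\<lambda>c. mpol_const (h c)) ?xp p"
  have "pw = 0"
  proof (rule ccontr)
    assume "pw \<noteq> 0"
    define e where "e = mpol_eval (\<lambda>c. rf_const (h c)) (\<lambda>v. if x v \<in> s_entries then x v else rf_const (a v)) p"
    have "Fraction_Field.Fract pw 1 = mpol_eval (\<lambda>c. Fraction_Field.Fract (mpol_const (h c)) 1) (\<lambda>v. Fraction_Field.Fract (?xp v) 1) p"
      unfolding pw_def by (rule hom_on_mpol_eval[OF hom_Fract]) auto
    also have "\<dots> = e" unfolding e_def
      by (rule mpol_eval_cong) (auto simp: rf_const_def spF)
    finally have "e \<noteq> 0" using \<open>pw \<noteq> 0\<close> by (auto simp: Zero_fract_def Fraction_Field.eq_fract)
    note R = coord_ring_subring[of Zi_entries]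
    have sR: "y \<in> coord_ring Zi_entries" if "y \<in> s_entries" for y using that coord_ring_sm by (auto simp: s_entries_def)
    have eR: "e \<in> coord_ring Zi_entries" unfolding e_def
      by (rule mpol_eval_mem[OF R]) (auto intro: sR coord_ring_incl(3))
    obtain \<phi> where phi: "point_of Zi_entries \<phi>" "\<phi> e \<noteq> 0"
      using specialize[OF _ eR \<open>e \<noteq> 0\<close>] by (auto simp: Zi_entries_def)
    note hp = point_hom[OF phi(1)]
    have "\<phi> e = mpol_eval (\<lambda>c. \<phi> (rf_const (h c))) (\<lambda>v. \<phi> (if x v \<in> s_entries then x v else rf_const (a v))) p"
      unfolding e_def by (rule hom_on_mpol_eval[OF hp]) (auto intro: sR coord_ring_incl(3))
    also have "\<dots> = mpol_eval h (\<lambda>v. if x v \<in> s_entries then \<phi> (x v) else a v) p"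
      by (rule mpol_eval_cong) (simp_all add: point_const[OF phi(1)])
    finally have ne: "mpol_eval h (\<lambda>v. if x v \<in> s_entries then \<phi> (x v) else a v) p \<noteq> 0" using phi(2) by simp
    let ?Zi = "map_mat \<phi> Zi" and ?Z = "map_mat \<phi> Z"
    have ZZ: "?Zi \<in> carrier_mat m m" "?Z \<in> carrier_mat m m" using Zi(1) by auto
    define v1 where "v1 = (\<lambda>c. \<Sum>r<m. ?Zi $$ (c, r) * a' (z r))"
    \<comment> \<open>The translation that moves the vector of the point \<open>\<phi>\<close> to the solution \<open>v1\<close> of \<open>z = a'\<close>.\<close>
    define t where "t = (\<lambda>c. v1 c - \<phi> (rf_var c))"
    have shz: "shift t (z r) \<in> coord_ring Zi_entries \<and> \<phi> (shift t (z r)) = a' (z r)" if r: "r < m" for r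
    proof -
      have ZR: "Z $$ (r, c) \<in> coord_ring Zi_entries" if "c < m" for c by (rule coord_ring_Z[OF r that])
      have vR: "rf_var c + rf_const (t c) \<in> coord_ring Zi_entries" if "c < m" for c
        by (intro subring_add[OF R] coord_ring_entries(2) that coord_ring_incl(3))
      have s: "shift t (z r) = (\<Sum>c<m. Z $$ (r, c) * (rf_var c + rf_const (t c)))"
      proof -
        have "shift t (z r) = (\<Sum>c<m. shift t (Z $$ (r, c) * rf_var c))"
          unfolding z_sum[OF r] by (rule hom_on_sum[OF shift_hom]) simp
        also have "\<dots> = (\<Sum>c<m. Z $$ (r, c) * (rf_var c + rf_const (t c)))"
        proof (rule sum.cong[OF refl])
          fix c assume "c \<in> {..<m}"
          then have c: "c < m" by simp
          have "shift t (Z $$ (r, c)) = Z $$ (r, c)" by (rule shift_frame_field[OF frame_field_Z[OF r c]])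
          moreover have "shift t (rf_var c) = rf_var c + rf_const (t c)" using c by (simp add: shift_var)
          ultimately show "shift t (Z $$ (r, c) * rf_var c) = Z $$ (r, c) * (rf_var c + rf_const (t c))"
            using hom_on_mult[OF shift_hom, of "Z $$ (r, c)" "rf_var c" t] by simp
        qed
        finally show ?thesis .
      qed
      have 1: "shift t (z r) \<in> coord_ring Zi_entries" unfolding s
        by (intro subring_sum[OF R] subring_mult[OF R]) (use ZR vR in auto)
      have "\<phi> (shift t (z r)) = (\<Sum>c<m. \<phi> (Z $$ (r, c) * (rf_var c + rf_const (t c))))"
        unfolding s by (rule hom_on_sum[OF hp]) (use ZR vR in \<open>auto intro: subring_mult[OF R]\<close>)
      also have "\<dots> = (\<Sum>c<m. ?Z $$ (r, c) * v1 c)"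
      proof (rule sum.cong[OF refl])
        fix c assume "c \<in> {..<m}"
        then have c: "c < m" by simp
        have "\<phi> (rf_var c + rf_const (t c)) = v1 c"
          using hom_on_add[OF hp coord_ring_entries(2)[OF c] coord_ring_incl(3)] by (simp add: point_const[OF phi(1)] t_def)
        then show "\<phi> (Z $$ (r, c) * (rf_var c + rf_const (t c))) = ?Z $$ (r, c) * v1 c"
          using hom_on_mult[OF hp ZR[OF c] vR[OF c]] r c carrier_matD[OF Z_carrier] by simp
      qed
      also have "\<dots> = a' (z r)" unfolding v1_def by (rule inverse_sum[OF ZZ(2,1) point_Zi(2)[OF phi(1) subset_refl] r])
      finally show ?thesis using 1 by simp
    qed
    have xs: "shift t (x v) \<in> coord_ring Zi_entries \<and> \<phi> (shift t (x v)) = (if x v \<in> s_entries then \<phi> (x v) else a v)"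
      if v: "v \<in> ?V" for v
    proof (cases "x v \<in> s_entries")
      case True
      then have "shift t (x v) = x v" using frame_field_sm by (auto simp: s_entries_def intro: shift_frame_field)
      then show ?thesis using True sR by simp
    next
      case False
      then obtain r where "r < m" "x v = z r" using x(2) v by (auto simp: Y_def)
      then show ?thesis using shz a'[OF v] False by auto
    qed
    have "0 = \<phi> (shift t (mpol_eval (\<lambda>c. rf_const (h c)) x p))"
      unfolding zero by (simp add: hom_on_zero[OF shift_hom] hom_on_zero[OF hp])
    also have "shift t (mpol_eval (\<lambda>c. rf_const (h c)) x p) = mpol_eval (\<lambda>c. shift t (rf_const (h c))) (\<lambda>v. shift t (x v)) p"
      by (rule hom_on_mpol_eval[OF shift_hom]) auto
    also have "\<phi> \<dots> = mpol_eval (\<lambda>c. \<phi> (shift t (rf_const (h c)))) (\<lambda>v. \<phi> (shift t (x v))) p"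
      by (rule hom_on_mpol_eval[OF hp]) (use xs in \<open>auto simp: shift_const coord_ring_incl(3)\<close>)
    also have "\<dots> = mpol_eval h (\<lambda>v. if x v \<in> s_entries then \<phi> (x v) else a v) p"
      by (rule mpol_eval_cong) (use xs in \<open>auto simp: shift_const point_const[OF phi(1)]\<close>)
    finally show False using ne by simp
  qed
  \<comment> \<open>The direction of the line \<open>S + t\<close>. It is a function on \<open>Y\<close>, which is possible since diagonal entries
    differ from the other ones.\<close>
  define del where "del = (\<lambda>y. if \<exists>i<n. y = sm $$ (i, i) then 1 else 0 :: 'k alg_closure)"
  have del: "del (sm $$ (i, j)) = (if i = j then 1 else 0)" if "i < n" "j < n" for i j
    using s_diagonal_distinct[OF that] that by (auto simp: del_def)
  define S where "S = mat n n (\<lambda>(i, j). a' (sm $$ (i, j)))"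
  have S: "S \<in> carrier_mat n n" "- S \<in> carrier_mat n n" by (auto simp: S_def)
  define ch where "ch = char_poly (- S)"
  have "ch \<noteq> 0" using degree_monic_char_poly[OF S(2)] unfolding ch_def by auto
  define rp where "rp = mpol_eval (\<lambda>c. [:h c:]) (\<lambda>v. if x v \<in> s_entries then [:a v, del (x v):] else [:a v:]) p"
  have poly_hom: "hom_on UNIV (\<lambda>p :: 'k alg_closure poly. poly p t)" for t by (simp add: hom_on_def subring_UNIV)
  have prp: "poly rp t = mpol_eval h (\<lambda>v. if x v \<in> s_entries then a v + t * del (x v) else a v) p" for t
  proof -
    have "poly rp t = mpol_eval (\<lambda>c. poly [:h c:] t) (\<lambda>v. poly (if x v \<in> s_entries then [:a v, del (x v):] else [:a v:]) t) p"
      unfolding rp_def by (rule hom_on_mpol_eval[OF poly_hom]) auto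
    also have "\<dots> = mpol_eval h (\<lambda>v. if x v \<in> s_entries then a v + t * del (x v) else a v) p"
      by (rule mpol_eval_cong) auto
    finally show ?thesis .
  qed
  have van: "poly rp t = 0" if t: "poly ch t \<noteq> 0" for t
  proof -
    define St where "St = mat n n (\<lambda>(i, j). a' (sm $$ (i, j)) + (if i = j then t else 0))"
    have St: "St \<in> carrier_mat n n" by (simp add: St_def)
    have ph: "comm_ring_hom (\<lambda>p :: 'k alg_closure poly. poly p t)" by unfold_locales auto
    have "poly ch t = det (map_mat (\<lambda>p. poly p t) (char_poly_matrix (- S)))"
      unfolding ch_def char_poly_def using comm_ring_hom.hom_det[OF ph] by simp
    also have "map_mat (\<lambda>p. poly p t) (char_poly_matrix (- S)) = St"
      by (rule eq_matI) (auto simp: char_poly_matrix_def St_def S_def)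
    finally have "det St \<noteq> 0" using t by simp
    moreover have "St $$ (i, j) = St $$ (j, i)" if "i < n" "j < n" for i j using that sm_sym by (auto simp: St_def)
    ultimately obtain W where W: "W \<in> carrier_mat n n" "transpose_mat W * Q * W = St"
      using gram_surjective[OF St] by blast
    let ?y = "\<lambda>e. W $$ ((e - m) div n, (e - m) mod n)"
    have "0 = mpol_eval (\<lambda>b. b) ?y pw" using \<open>pw = 0\<close> by (simp add: hom_on_zero[OF hom_mpol_eval[OF id_hom]])
    also have "\<dots> = mpol_eval (\<lambda>c. mpol_eval (\<lambda>b. b) ?y (mpol_const (h c))) (\<lambda>v. mpol_eval (\<lambda>b. b) ?y (?xp v)) p"
      unfolding pw_def by (rule hom_on_mpol_eval[OF hom_mpol_eval[OF id_hom]]) auto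
    also have "\<dots> = mpol_eval h (\<lambda>v. if x v \<in> s_entries then a v + t * del (x v) else a v) p"
    proof (rule mpol_eval_cong)
      show "mpol_eval (\<lambda>b. b) ?y (mpol_const (h c)) = h c" for c by (simp add: mpol_eval_const)
      fix v assume v: "v \<in> ?V"
      show "mpol_eval (\<lambda>b. b) ?y (?xp v) = (if x v \<in> s_entries then a v + t * del (x v) else a v)"
      proof (cases "x v \<in> s_entries")
        case True
        then obtain i j where ij: "i < n" "j < n" "x v = sm $$ (i, j)" by (auto simp: s_entries_def)
        have "mpol_eval (\<lambda>b. b) ?y (sp (x v)) = St $$ (i, j)"
          using s_poly_eval[OF W(1) ij(1,2)] ij sp[OF ij(1,2)] W(2) by simp
        also have "\<dots> = a v + t * del (x v)" using ij del[OF ij(1,2)] a'[OF v] by (simp add: St_def)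
        finally show ?thesis using True by simp
      qed (simp add: mpol_eval_const)
    qed
    finally show ?thesis using prp by simp
  qed
  have "rp = 0"
  proof (rule ccontr)
    assume "rp \<noteq> 0"
    then have "rp * ch \<noteq> 0" using \<open>ch \<noteq> 0\<close> by simp
    then obtain t where "poly (rp * ch) t \<noteq> 0" using poly_nonroots_infinite[of "rp * ch" "{}"] by blast
    then show False using van[of t] by simp
  qed
  then have "poly rp 0 = 0" by simp
  then have "mpol_eval h (\<lambda>v. if x v \<in> s_entries then a v + 0 * del (x v) else a v) p = 0" unfolding prp .
  then have "mpol_eval h a p = 0" by (simp cong: if_cong)
  with a show False by simp
qed

end

section \<open>Transfer to a purely transcendental extension\<close>

lemma mat_left_cancel:
  fixes A :: "'a::comm_ring_1 mat"
  assumes A: "A \<in> carrier_mat k k" "L \<in> carrier_mat k k" "L * A = 1\<^sub>m k"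
    and M: "M \<in> carrier_mat k c" "M' \<in> carrier_mat k c" "A * M = A * M'"
  shows "M = M'"
proof -
  have "L * A * M = L * A * M'" unfolding assoc_mult_mat[OF A(2,1) M(1)] assoc_mult_mat[OF A(2,1) M(2)] M(3) ..
  then show ?thesis unfolding A(3) left_mult_one_mat[OF M(1)] left_mult_one_mat[OF M(2)] .
qed

locale framed_representation = selected_frame q n m \<rho> a P B d wi f Zi
  for q :: "'k::field_char_0 vec \<Rightarrow> 'k" and n m :: nat and \<rho> :: "'k alg_closure mat \<Rightarrow> 'k alg_closure mat"
    and a :: "nat \<Rightarrow> 'k" and P :: "nat set \<Rightarrow> nat \<Rightarrow> nat \<Rightarrow> (nat \<times> nat, 'k) mpol"
    and B :: "'k alg_closure ratfun mat" and d :: "nat \<Rightarrow> 'k alg_closure ratfun" and wi :: "'k alg_closure ratfun mat"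
    and f :: "nat \<Rightarrow> nat set \<times> nat" and Zi :: "'k alg_closure ratfun mat" +
  fixes F Fi :: "'k alg_closure ratfun mat"
  assumes F_carrier [simp]: "F \<in> carrier_mat n n" and F_K: "\<And>i j. i < n \<Longrightarrow> j < n \<Longrightarrow> F $$ (i, j) \<in> K"
    and F_sub: "\<And>g. g \<in> Oq \<Longrightarrow> map_mat (sub g) F = map_mat rf_const g * F"
    and F_galois: "\<And>\<sigma>. \<sigma> \<in> absolute_galois \<Longrightarrow> map_mat (galois_act \<sigma>) F = F"
    and Fi: "Fi \<in> carrier_mat n n" "F * Fi = 1\<^sub>m n" "Fi * F = 1\<^sub>m n"
begin

definition ym :: "'k alg_closure ratfun mat" where "ym = Fi * wm"

definition y_entries :: "'k alg_closure ratfun set" where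
  "y_entries = {ym $$ (i, j) |i j. i < n \<and> j < n}"

definition K0 :: "'k alg_closure ratfun set" where "K0 = {f \<in> K. \<forall>\<gamma>\<in>\<Gamma>. \<gamma> f = f}"

lemma ym_carrier [simp]: "ym \<in> carrier_mat n n"
  unfolding ym_def by (rule mult_carrier_mat[OF Fi(1) carriers(1)])

lemma F_ym: "F * ym = wm"
  unfolding ym_def assoc_mult_mat[OF F_carrier Fi(1) carriers(1), symmetric] Fi(2)
  by (rule left_mult_one_mat[OF carriers(1)])

text \<open>
  For \<open>g\<close> in \<open>G\<close>, both \<open>F\<close> and \<open>w\<close> are multiplied by \<open>g\<close>, which cancels in \<open>F\<^sup>-\<^sup>1 w\<close>.
\<close>

lemma Gamma_ym: assumes G: "\<gamma> \<in> \<Gamma>" shows "map_mat \<gamma> ym = ym"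
  using G
proof (cases rule: Gamma_cases)
  case (galois \<sigma>)
  show ?thesis
  proof (rule mat_left_cancel[where c=n, OF F_carrier Fi(1,3)])
    have "map_mat \<gamma> F * map_mat \<gamma> ym = map_mat \<gamma> wm"
      unfolding F_ym[symmetric] by (rule hom_UNIV_mat_mult[OF Gamma_hom[OF G] F_carrier ym_carrier, symmetric])
    then show "F * map_mat \<gamma> ym = F * ym"
      unfolding galois(2) F_galois[OF galois(1)] galois_wm[OF galois(1)] F_ym .
  qed auto
next
  case (sub g)
  obtain h where h: "h \<in> Oq" "g * h = 1\<^sub>m n" "h * g = 1\<^sub>m n" using Oq_inverse[OF sub(1)] by blast
  let ?g = "map_mat rf_const g :: 'k alg_closure ratfun mat" and ?h = "map_mat rf_const h :: 'k alg_closure ratfun mat"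
  have c: "?g \<in> carrier_mat n n" "?h \<in> carrier_mat n n" "g \<in> carrier_mat n n" "h \<in> carrier_mat n n"
    using h(1) sub(1) by auto
  have "?h * ?g = map_mat rf_const (h * g)" by (rule hom_UNIV_mat_mult[OF hom_rf_const c(4,3), symmetric])
  then have hg: "?h * ?g = 1\<^sub>m n" unfolding h(3) map_mat_one_on[OF hom_rf_const] .
  show ?thesis
  proof (rule mat_left_cancel[where c=n, OF F_carrier Fi(1,3)])
    have y: "map_mat \<gamma> ym \<in> carrier_mat n n" by simp
    then show "map_mat \<gamma> ym \<in> carrier_mat n n" .
    show "F * map_mat \<gamma> ym = F * ym"
    proof (rule mat_left_cancel[where c=n, OF c(1,2) hg])
      have "map_mat \<gamma> F * map_mat \<gamma> ym = map_mat \<gamma> wm"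
        unfolding F_ym[symmetric] by (rule hom_UNIV_mat_mult[OF Gamma_hom[OF G] F_carrier ym_carrier, symmetric])
      then have "?g * F * map_mat \<gamma> ym = ?g * wm"
        unfolding sub(2) F_sub[OF sub(1)] sub_wm[OF sub(1)] .
      then show "?g * (F * map_mat \<gamma> ym) = ?g * (F * ym)"
        unfolding F_ym assoc_mult_mat[OF c(1) F_carrier y] .
    qed (rule mult_carrier_mat[OF F_carrier y], rule mult_carrier_mat[OF F_carrier ym_carrier])
  qed simp
qed

lemma Gamma_y_entries: assumes G: "\<gamma> \<in> \<Gamma>" and y: "y \<in> y_entries" shows "\<gamma> y = y"
proof -
  obtain i j where ij: "i < n" "j < n" "y = ym $$ (i, j)" using y by (auto simp: y_entries_def)
  have "\<gamma> (ym $$ (i, j)) = map_mat \<gamma> ym $$ (i, j)" using ij carrier_matD[OF ym_carrier] by simp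
  then show ?thesis unfolding Gamma_ym[OF G] ij(3) .
qed

lemma K_function_field: "K \<subseteq> function_field N"
  unfolding K_def function_field_def by (rule gen_subfield_mono) (auto simp: N_def)

lemma y_entries_function_field: "y_entries \<subseteq> function_field N"
proof
  fix y assume "y \<in> y_entries"
  then obtain i j where ij: "i < n" "j < n" "y = ym $$ (i, j)" by (auto simp: y_entries_def)
  have w: "wm $$ (l, j) \<in> function_field N" if "l < n" for l
    using frame_field_wm[OF that ij(2)] frame_field_N by blast
  have v: "Fi $$ (i, l) \<in> function_field N" if "l < n" for l
    using inverse_in_subfield[OF K_subfield F_carrier F_K Fi(1,3) ij(1) that] K_function_field by blast
  then show "y \<in> function_field N"
    unfolding ij(3) ym_def index_mult_mat_sum[OF Fi(1) carriers(1) ij(1,2)]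
    by (intro subring_sum[OF subfield_subring[OF function_field_N_subfield]]
        subring_mult[OF subfield_subring[OF function_field_N_subfield]] v w) simp_all
qed

lemma function_field_framed: "function_field N \<subseteq> gen_subfield (K \<union> y_entries)"
proof -
  note S = subfield_gen_subfield[of "K \<union> y_entries"] and I = gen_subfield_incl[of "K \<union> y_entries"]
  note R = subfield_subring[OF S]
  have "rf_var i \<in> gen_subfield (K \<union> y_entries)" if i: "i < N" for i
  proof (cases "i < m")
    case True
    then show ?thesis using I K_var by blast
  next
    case False
    then have mi: "m \<le> i" by simp
    note b = frame_index_bounds[OF mi i]
    have y: "ym $$ (l, (i - m) mod n) \<in> gen_subfield (K \<union> y_entries)" if "l < n" for l
      by (rule subsetD[OF I], rule UnI2, unfold y_entries_def) (use that b(2) in blast)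
    have k: "F $$ ((i - m) div n, l) \<in> gen_subfield (K \<union> y_entries)" if "l < n" for l
      using I F_K[OF b(1) that] by blast
    have "rf_var i = (F * ym) $$ ((i - m) div n, (i - m) mod n)" unfolding F_ym using b by (simp add: wm_index)
    also have "\<dots> \<in> gen_subfield (K \<union> y_entries)"
      unfolding index_mult_mat_sum[OF F_carrier ym_carrier b(1,2)]
      by (intro subring_sum[OF R] subring_mult[OF R] k y) simp_all
    finally show ?thesis .
  qed
  moreover have "rf_const c \<in> gen_subfield (K \<union> y_entries)" for c using I K_const by blast
  ultimately have "range rf_const \<union> rf_var ` {..<N} \<subseteq> gen_subfield (K \<union> y_entries)" by blast
  then show ?thesis unfolding function_field_def by (rule gen_subfield_least[OF S])
qed

text \<open>
  The two descriptions of the invariants of vectors and matrices. The entries of \<open>y\<close> are invariant, and the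
  function field of \<open>V \<times> M\<^sub>n\<close> is generated by them over \<open>K\<close>; descent from \<open>K\<close> to its
  fixed field leaves the elements fixed by \<open>\<Gamma>\<close>.
\<close>

lemma invariant_field_adjoin_y: "gen_subfield (K0 \<union> y_entries) = kY"
proof
  show "gen_subfield (K0 \<union> y_entries) \<subseteq> kY"
  proof (rule gen_subfield_least)
    show "subfield_set kY" unfolding kY_def by (rule subfield_gen_subfield)
    show "K0 \<union> y_entries \<subseteq> kY"
    proof
      fix x assume x: "x \<in> K0 \<union> y_entries"
      show "x \<in> kY"
      proof (rule invariants_in_kY)
        show "x \<in> function_field N" using x K_function_field y_entries_function_field by (auto simp: K0_def)
        show "\<gamma> x = x" if G: "\<gamma> \<in> \<Gamma>" for \<gamma> using x
        proof
          assume "x \<in> K0"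
          then show ?thesis using G by (simp add: K0_def)
        qed (rule Gamma_y_entries[OF G])
      qed
    qed
  qed
  show "kY \<subseteq> gen_subfield (K0 \<union> y_entries)" unfolding kY_def
  proof (rule gen_subfield_least[OF subfield_gen_subfield])
    have "base_field \<subseteq> K0" by (auto simp: base_field_def K0_def K_const Gamma_base)
    then have 1: "base_field \<subseteq> gen_subfield (K0 \<union> y_entries)" using gen_subfield_incl by blast
    have "y \<in> gen_subfield (K0 \<union> y_entries)" if y: "y \<in> Y" for y
      unfolding K0_def
    proof (rule fixed_field_descent[where \<Gamma>=\<Gamma> and K=K and Y=y_entries, OF K_subfield])
      show "hom_on UNIV \<gamma>" if "\<gamma> \<in> \<Gamma>" for \<gamma> using Gamma_hom that .
      show "\<gamma> c \<in> K" if "\<gamma> \<in> \<Gamma>" "c \<in> K" for \<gamma> c using Gamma_K that .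
      show "\<gamma> e = e" if "\<gamma> \<in> \<Gamma>" "e \<in> y_entries" for \<gamma> e using Gamma_y_entries that .
      show "y \<in> gen_subfield (K \<union> y_entries)" using y Y_function_field function_field_framed by blast
      show "\<gamma> y = y" if "\<gamma> \<in> \<Gamma>" for \<gamma> using Gamma_Y that y .
    qed
    with 1 show "base_field \<union> Y \<subseteq> gen_subfield (K0 \<union> y_entries)" by blast
  qed
qed

definition psi_poly :: "nat \<Rightarrow> (nat, 'k alg_closure ratfun) mpol" where
  "psi_poly i = (if i < m then mpol_const (rf_var i)
     else if i < N then \<Sum>l<n. mpol_const (F $$ ((i - m) div n, l)) * mpol_var (l * n + (i - m) mod n)
     else mpol_var i)"

text \<open>
  On \<open>K(w)\<close> this is the isomorphism with a rational function field over \<open>K\<close> that sends \<open>y\<close> to the new variables. It is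
  defined on the original variables: elements of \<open>K\<close> become constants and \<open>w = F y\<close> becomes
  \<open>F\<close> times the matrix of the first \<open>n\<^sup>2\<close> new variables.
\<close>

definition Psi :: "'k alg_closure ratfun \<Rightarrow> 'k alg_closure ratfun ratfun" where
  "Psi = rf_hom (\<lambda>c. rf_const (rf_const c)) (\<lambda>i. Fraction_Field.Fract (psi_poly i) 1)"

lemma hom_rf_const_const: "hom_on UNIV (\<lambda>c :: 'k alg_closure. rf_const (rf_const c) :: 'k alg_closure ratfun ratfun)"
  using hom_on_comp[OF hom_rf_const[where 'a="'k alg_closure"] hom_rf_const[where 'a="'k alg_closure ratfun"]] by (simp add: comp_def)

text \<open>
  Replacing the new variables by the entries of \<open>y\<close> turns the substituted elements back into the original
  variables, so they satisfy no relation.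
\<close>

lemma psi_poly_inj:
  assumes "mpol_eval (\<lambda>c :: 'k alg_closure. rf_const (rf_const c)) (\<lambda>i. Fraction_Field.Fract (psi_poly i) 1) p = 0"
  shows "p = 0"
proof (rule mpol_eval_inj[OF hom_rf_const _ _ assms])
  show "Fraction_Field.Fract (psi_poly i) 1 = Fraction_Field.Fract (psi_poly i) 1" for i ..
  fix p :: "(nat, 'k alg_closure) mpol" assume p: "p \<noteq> 0"
  let ?y = "\<lambda>k. if k < n * n then ym $$ (k div n, k mod n) else rf_var k"
  note e = hom_mpol_eval[OF id_hom, of ?y]
  have "mpol_eval (\<lambda>b. b) ?y (psi_poly i) = rf_var i" for i
  proof -
    consider "i < m" | "m \<le> i" "i < N" | "N \<le> i" by linarith
    then show ?thesis
    proof cases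
      case 1
      then show ?thesis by (simp add: psi_poly_def mpol_eval_const)
    next
      case 2
      note b = frame_index_bounds[OF 2]
      let ?i = "(i - m) div n" and ?j = "(i - m) mod n"
      have "?y (l * n + ?j) = ym $$ (l, ?j)" if "l < n" for l
        using frame_index_less[OF that b(2)] b(2) by (simp add: N_def)
      then have "mpol_eval (\<lambda>b. b) ?y (psi_poly i) = (\<Sum>l<n. F $$ (?i, l) * ym $$ (l, ?j))"
        using 2 by (simp add: psi_poly_def hom_on_sum[OF e] hom_on_mult[OF e] mpol_eval_const mpol_eval_var[OF id_hom])
      also have "\<dots> = (F * ym) $$ (?i, ?j)" by (rule index_mult_mat_sum[OF F_carrier ym_carrier b(1,2), symmetric])
      also have "\<dots> = rf_var i" unfolding F_ym using b by (simp add: wm_index)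
      finally show ?thesis .
    next
      case 3
      then show ?thesis by (simp add: psi_poly_def mpol_eval_var[OF id_hom] N_def)
    qed
  qed
  then have "mpol_eval rf_const (\<lambda>i. mpol_eval (\<lambda>b. b) ?y (psi_poly i)) p = Fraction_Field.Fract p 1"
    by (simp add: mpol_eval_rf)
  moreover have "Fraction_Field.Fract p 1 \<noteq> 0" using p by (simp add: Zero_fract_def Fraction_Field.eq_fract)
  ultimately show "\<exists>y. mpol_eval rf_const (\<lambda>i. mpol_eval (\<lambda>b. b) y (psi_poly i)) p \<noteq> 0" by (intro exI[of _ ?y]) simp
qed

lemma Psi_hom: "hom_on UNIV Psi" and Psi_const: "Psi (rf_const c) = rf_const (rf_const c)"
  and Psi_var: "Psi (rf_var i) = Fraction_Field.Fract (psi_poly i) 1"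
  unfolding Psi_def by (rule rf_hom[OF hom_rf_const_const psi_poly_inj], assumption)+

lemma Psi_K: assumes "x \<in> K" shows "Psi x = rf_const x"
  using assms unfolding K_def function_field_def
  by (rule hom_gen_subfield_cong[OF Psi_hom hom_rf_const, rotated])
    (auto simp: Psi_const Psi_var psi_poly_def rf_const_def[of "rf_var _"])

lemma Psi_ym: assumes ij: "i < n" "j < n" shows "Psi (ym $$ (i, j)) = rf_var (i * n + j)"
proof -
  let ?F = "map_mat rf_const F" and ?Fi = "map_mat rf_const Fi"
  define xm :: "'k alg_closure ratfun ratfun mat" where "xm = mat n n (\<lambda>(i, j). rf_var (i * n + j))"
  have c: "?F \<in> carrier_mat n n" "?Fi \<in> carrier_mat n n" "xm \<in> carrier_mat n n" using Fi(1) by (auto simp: xm_def)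
  have "?Fi * ?F = map_mat rf_const (Fi * F)" by (rule hom_UNIV_mat_mult[OF hom_rf_const Fi(1) F_carrier, symmetric])
  then have inv: "?Fi * ?F = 1\<^sub>m n" unfolding Fi(3) map_mat_one_on[OF hom_rf_const] .
  have PF: "map_mat Psi F = ?F"
    by (rule eq_matI) (use carrier_matD[OF F_carrier] F_K in \<open>auto simp: Psi_K\<close>)
  have Pw: "map_mat Psi wm = ?F * xm"
  proof (rule eq_matI)
    fix i j assume "i < dim_row (?F * xm)" "j < dim_col (?F * xm)"
    then have ij: "i < n" "j < n" using c carrier_matD[OF F_carrier] by auto
    have "map_mat Psi wm $$ (i, j) = Psi (rf_var (m + i * n + j))" using ij carrier_matD[OF carriers(1)] by (simp add: wm_index)
    also have "\<dots> = (\<Sum>l<n. rf_const (F $$ (i, l)) * rf_var (l * n + j))"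
      using ij frame_index_less[OF ij] by (simp add: Psi_var psi_poly_def Fract_sum_const_var add.assoc)
    also have "\<dots> = (?F * xm) $$ (i, j)"
      unfolding index_mult_mat_sum[OF c(1,3) ij] using ij carrier_matD[OF F_carrier]
      by (intro sum.cong refl) (simp add: xm_def)
    finally show "map_mat Psi wm $$ (i, j) = (?F * xm) $$ (i, j)" .
  qed (use c carrier_matD[OF F_carrier] carrier_matD[OF carriers(1)] in auto)
  have "map_mat Psi ym = xm"
  proof (rule mat_left_cancel[OF c(1,2) inv _ c(3)])
    show "?F * map_mat Psi ym = ?F * xm"
      unfolding PF[symmetric] hom_UNIV_mat_mult[OF Psi_hom F_carrier ym_carrier, symmetric] F_ym Pw
      unfolding PF ..
  qed simp
  moreover have "map_mat Psi ym $$ (i, j) = Psi (ym $$ (i, j))" using ij carrier_matD[OF ym_carrier] by simp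
  ultimately show ?thesis using ij by (simp add: xm_def)
qed

lemma Psi_y_entries: "Psi ` y_entries = rf_var ` {..<n * n}"
proof
  show "Psi ` y_entries \<subseteq> rf_var ` {..<n * n}"
  proof
    fix x assume "x \<in> Psi ` y_entries"
    then obtain i j where ij: "i < n" "j < n" "x = Psi (ym $$ (i, j))" by (auto simp: y_entries_def)
    have "i * n + j < n * n" using frame_index_less[OF ij(1,2)] by (simp add: N_def)
    then show "x \<in> rf_var ` {..<n * n}" unfolding ij(3) Psi_ym[OF ij(1,2)] by simp
  qed
  show "rf_var ` {..<n * n} \<subseteq> Psi ` y_entries"
  proof
    fix x :: "'k alg_closure ratfun ratfun" assume "x \<in> rf_var ` {..<n * n}"
    then obtain k where k: "k < n * n" "x = rf_var k" by blast
    have mk: "m \<le> m + k" "m + k < N" using k(1) by (auto simp: N_def)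
    have b: "k div n < n" "k mod n < n" "k div n * n + k mod n = k"
      using frame_index_bounds[OF mk] by auto
    have "x = Psi (ym $$ (k div n, k mod n))" unfolding Psi_ym[OF b(1,2)] b(3) k(2) ..
    moreover have "ym $$ (k div n, k mod n) \<in> y_entries" unfolding y_entries_def using b(1,2) by blast
    ultimately show "x \<in> Psi ` y_entries" by blast
  qed
qed

lemma Psi_Y_independent: "alg_independent (rf_const ` base_field) (Psi ` Y)"
  unfolding alg_independent_def
proof (intro allI impI)
  fix p :: "('k alg_closure ratfun ratfun, 'k alg_closure ratfun ratfun) mpol"
  assume c: "Poly_Mapping.range p \<subseteq> rf_const ` base_field" and v: "mpol_vars p \<subseteq> Psi ` Y"
    and z: "mpol_eval (\<lambda>c. c) (\<lambda>b. b) p = 0"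
  let ?c = "\<lambda>c :: 'k alg_closure. rf_const (rf_const c) :: 'k alg_closure ratfun ratfun"
  define h where "h = inv_into UNIV ?c"
  have h: "h (?c u) = u" for u unfolding h_def by (rule inv_f_f[OF hom_UNIV_inj[OF hom_rf_const_const]])
  have ch: "?c (h a) = a" if a: "a \<in> Poly_Mapping.range p" for a
  proof -
    obtain u where "a = ?c u" using c a by (auto simp: base_field_def)
    then show ?thesis by (simp add: h)
  qed
  have Px: "Psi (inv_into UNIV Psi b) = b" if "b \<in> mpol_vars p" for b
    using v that by (auto intro: f_inv_into_f)
  show "p = 0"
  proof (rule Y_independent[where h=h and x="inv_into UNIV Psi"])
    show "h a \<noteq> 0" if a: "a \<in> Poly_Mapping.range p" for a
    proof
      assume "h a = 0"
      then have "a = 0" using ch[OF a] hom_on_zero[OF hom_rf_const_const] by simp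
      then show False using a range_nonzero by blast
    qed
    show "inj_on (inv_into UNIV Psi) (mpol_vars p)" by (rule inj_on_inverseI[of _ Psi]) (rule Px)
    show "inv_into UNIV Psi ` mpol_vars p \<subseteq> Y"
      using v inv_f_f[OF hom_UNIV_inj[OF Psi_hom]] by auto
    have "Psi (mpol_eval (\<lambda>a. rf_const (h a)) (inv_into UNIV Psi) p) =
        mpol_eval (\<lambda>a. Psi (rf_const (h a))) (\<lambda>b. Psi (inv_into UNIV Psi b)) p"
      by (rule hom_on_mpol_eval[OF Psi_hom]) auto
    also have "\<dots> = mpol_eval (\<lambda>c. c) (\<lambda>b. b) p"
      by (rule mpol_eval_cong) (simp_all add: Psi_const ch Px)
    finally show "mpol_eval (\<lambda>a. rf_const (h a)) (inv_into UNIV Psi) p = 0"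
      unfolding z by (simp add: hom_UNIV_eq_0[OF Psi_hom])
  qed
qed

text \<open>
  \<open>Psi\<close> carries \<open>k(s, z) = k(V)\<^sup>G(y)\<close> to the field of rational functions in \<open>n\<^sup>2\<close> variables over \<open>k(V)\<^sup>G\<close>,
  and the images of \<open>s\<close> and \<open>z\<close> form the transcendence basis.
\<close>

theorem stably_pure_K0: "stably_pure base_field K0"
  unfolding stably_pure_def purely_transcendental_def
proof (intro exI conjI)
  show "alg_independent (rf_const ` base_field) (Psi ` Y)" by (rule Psi_Y_independent)
  have k: "rf_const ` K0 = Psi ` K0" by (rule image_cong) (auto simp: K0_def Psi_K)
  have b: "rf_const ` base_field = Psi ` base_field"
    by (rule image_cong) (auto simp: base_field_def Psi_const)
  have "gen_subfield (rf_const ` K0 \<union> rf_var ` {..<n * n}) = Psi ` gen_subfield (K0 \<union> y_entries)"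
    unfolding k Psi_y_entries[symmetric] image_Un[symmetric] by (rule hom_image_gen_subfield[OF Psi_hom, symmetric])
  also have "\<dots> = gen_subfield (Psi ` (base_field \<union> Y))"
    unfolding invariant_field_adjoin_y kY_def by (rule hom_image_gen_subfield[OF Psi_hom])
  finally show "gen_subfield (rf_const ` K0 \<union> rf_var ` {..<n * n}) = gen_subfield (rf_const ` base_field \<union> Psi ` Y)"
    unfolding b image_Un .
qed

end

lemma (in selected_frame) stably_pure_invariant_field:
  assumes "almost_free (orthogonal_group n q) m \<rho>"
  shows "stably_pure base_field (invariant_field (orthogonal_group n q) m \<rho>)"
proof -
  obtain F where F: "F \<in> carrier_mat n n" "\<And>i j. i < n \<Longrightarrow> j < n \<Longrightarrow> F $$ (i, j) \<in> K" "det F \<noteq> 0"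
    "\<And>g. g \<in> Oq \<Longrightarrow> map_mat (sub g) F = map_mat rf_const g * F"
    "\<And>\<sigma>. \<sigma> \<in> absolute_galois \<Longrightarrow> map_mat (galois_act \<sigma>) F = F"
  proof (rule equivariant_frame[OF assms])
    fix F
    assume "F \<in> carrier_mat n n" "\<And>i j. i < n \<Longrightarrow> j < n \<Longrightarrow> F $$ (i, j) \<in> K" "det F \<noteq> 0"
      "\<And>g. g \<in> Oq \<Longrightarrow> map_mat (sub g) F = map_mat rf_const g * F"
      "\<And>\<sigma>. \<sigma> \<in> absolute_galois \<Longrightarrow> map_mat (galois_act \<sigma>) F = F"
    then show thesis by (rule that)
  qed
  obtain Fi where Fi: "Fi \<in> carrier_mat n n" "F * Fi = 1\<^sub>m n" "Fi * F = 1\<^sub>m n" by (rule mat_inverse_exists[OF F(1,3)])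
  interpret framed_representation q n m \<rho> a P B d wi f Zi F Fi
    by unfold_locales (rule F Fi | assumption)+
  show ?thesis unfolding invariant_field_eq K0_def[symmetric] by (rule stably_pure_K0)
qed

theorem proposition4p10:
  fixes q :: "'k::field_char_0 vec \<Rightarrow> 'k"
    and n m :: nat
    and \<rho> :: "'k alg_closure mat \<Rightarrow> 'k alg_closure mat"
  assumes "n \<ge> 2"
    and "quadratic_form n q"
    and "nondegenerate_form n q"
    and "linear_action (orthogonal_group n q) n m \<rho>"
    and "almost_free (orthogonal_group n q) m \<rho>"
  shows "stably_pure base_field (invariant_field (orthogonal_group n q) m \<rho>)"
proof -
  interpret orthogonal_action q n m \<rho> using assms(2-4) by unfold_locales
  obtain a P where "orthogonal_rows q n m \<rho> a P"
  proof (rule equivariant_rows)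
    fix a P
    assume 1: "\<And>j. j < n \<Longrightarrow> a j \<noteq> 0"
      and 2: "\<And>u \<eta> g h I i c. good_point a u \<eta> \<Longrightarrow> g \<in> Oq \<Longrightarrow> h \<in> Oq \<Longrightarrow> g * h = 1\<^sub>m n \<Longrightarrow> I \<subseteq> {..<n} \<Longrightarrow> i < m \<Longrightarrow> c < m \<Longrightarrow>
        mpol_eval to_ac (pt n (g * u) \<eta>) (P I i c) = (\<Sum>e<m. mpol_eval to_ac (pt n u \<eta>) (P I i e) * \<rho> h $$ (e, c))"
      and 3: "\<And>u \<eta> x. good_point a u \<eta> \<Longrightarrow>
        (\<And>I i. I \<subseteq> {..<n} \<Longrightarrow> i < m \<Longrightarrow> (\<Sum>c<m. mpol_eval to_ac (pt n u \<eta>) (P I i c) * x c) = 0) \<Longrightarrow> (\<forall>c<m. x c = 0)"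
    show thesis
      by (rule that[of a P], unfold_locales) (rule 1 2 3 | assumption)+
  qed
  then interpret orthogonal_rows q n m \<rho> a P .
  obtain B d where Bd: "B \<in> carrier_mat n n" "\<And>i j. i < n \<Longrightarrow> j < n \<Longrightarrow> B $$ (i, j) \<in> s_field"
    "\<And>i. i < n \<Longrightarrow> d i \<in> s_field \<and> d i \<noteq> 0" "transpose_mat B * sm * B = diag_mat_of n d"
  proof (rule s_diagonal)
    fix B d
    assume "B \<in> carrier_mat n n" "\<And>i j. i < n \<Longrightarrow> j < n \<Longrightarrow> B $$ (i, j) \<in> s_field"
      "\<And>i. i < n \<Longrightarrow> d i \<in> s_field \<and> d i \<noteq> 0" "transpose_mat B * sm * B = diag_mat_of n d"
    then show thesis by (rule that)
  qed
  obtain wi where wi: "wi \<in> carrier_mat n n" "wm * wi = 1\<^sub>m n" "wi * wm = 1\<^sub>m n"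
    by (rule mat_inverse_exists[OF carriers(1) det_wm])
  interpret generic_frame q n m \<rho> a P B d wi by unfold_locales (rule Bd wi | assumption)+
  obtain f where f: "\<And>r. r < m \<Longrightarrow> f r \<in> Pow {..<n} \<times> {..<m}"
    "det (mat m m (\<lambda>(r, c). row (fst (f r)) (snd (f r)) c)) \<noteq> 0"
  proof (rule rows_selection)
    fix f
    assume "\<And>r. r < m \<Longrightarrow> f r \<in> Pow {..<n} \<times> {..<m}"
      "det (mat m m (\<lambda>(r, c). row (fst (f r)) (snd (f r)) c)) \<noteq> 0"
    then show thesis by (rule that)
  qed
  obtain Zi where Zi: "Zi \<in> carrier_mat m m" "mat m m (\<lambda>(r, c). row (fst (f r)) (snd (f r)) c) * Zi = 1\<^sub>m m"
      "Zi * mat m m (\<lambda>(r, c). row (fst (f r)) (snd (f r)) c) = 1\<^sub>m m"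
    by (rule mat_inverse_exists[OF _ f(2)]) auto
  interpret selected_frame q n m \<rho> a P B d wi f Zi by unfold_locales (rule f Zi | assumption)+
  show ?thesis by (rule stably_pure_invariant_field[OF assms(5)])
qed

end
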